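(* Let $\mathcal{A}$ be a symmetric ribbon fusion category over $\mathbb{C}$ and let $\mathcal{Z}(\mathcal{A})$ be its Drinfeld centre. Then $(\mathcal{Z}(\mathcal{A}),\otimes_s,\mathbb{I}_s)$, where $\otimes_s$ is the symmetric tensor product and $\mathbb{I}_s$ the symmetric unit (with associators, unitors and symmetry induced from $\mathcal A$, all defined in the context), is a symmetric monoidal category.
   Context: **Conventions.** $\mathcal{A}$ is a symmetric ribbon fusion category over $\mathbb{C}$ (semisimple, rigid, finitely many simples, simple unit $\mathbf{1}$), with tensor product $\otimes$ (associators suppressed) and symmetry $s_{x,y}:x\otimes y\to y\otimes x$. $\mathcal{O}(\mathcal{A})$ is a set of representatives of simple objects, $d_i$ is the quantum dimension of $i$, and $D=\sum_{i\in\mathcal{O}(\mathcal{A})}d_i^2$. For an object $x$ with dual $x^*$ one has $\mathrm{ev}_x:x\otimes x^*\to\mathbf 1$ and $\mathrm{coev}_x:\mathbf 1\to x^*\otimes x$ satisfying the snake identities; $\widetilde{\mathrm{coev}}_i:\mathbf 1\to i\otimes i^*$ is the coevaluation obtained using the pivotal structure, so $\mathrm{ev}_i\circ\widetilde{\mathrm{coev}}_i=d_i$. **Drinfeld centre.** Objects of $\mathcal{Z}(\mathcal{A})$ are pairs $z=(a,\beta)$ with $a\in\mathcal{A}$ and $\beta_b:b\otimes a\to a\otimes b$ a natural isomorphism (half-braiding) with $\beta_{b\otimes b'}=(\beta_b\otimes\mathrm{id}_{b'})(\mathrm{id}_b\otimes\beta_{b'})$; morphisms are morphisms of $\mathcal{A}$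 commuting with the half-braidings. $\otimes_c$ is the usual tensor product: underlying object $a\otimes a'$, half-braiding $(\mathrm{id}_a\otimes\beta'_b)(\beta_b\otimes\mathrm{id}_{a'})$. **The idempotent.** For $z=(a,\beta)$, $z'=(a',\beta')$ let $$\Pi_{z,z'}=\sum_{i\in\mathcal{O}(\mathcal{A})}\frac{d_i}{D}(\mathrm{id}_a\otimes\mathrm{ev}_i\otimes\mathrm{id}_{a'})\circ\big((\beta_i\circ s_{a,i})\otimes(s_{a',i^*}\circ\beta'_{i^*})\big)\circ(\mathrm{id}_a\otimes\widetilde{\mathrm{coev}}_i\otimes\mathrm{id}_{a'}).$$ It is an idempotent endomorphism of $z\otimes_c z'$. Let $z\otimes_\Pi z'$ be its image, with inclusion $\iota_{z,z'}:z\otimes_\Pi z'\to z\otimes_c z'$ and projection $p_{z,z'}$, so $p\iota=\mathrm{id}$, $\iota p=\Pi_{z,z'}$. **Symmetric tensor product.** $z\otimes_s z'$ is the underlying object of $z\otimes_\Pi z'$ with half-braiding, for $b\in\mathcal{A}$, $$(p_{z,z'}\otimes\mathrm{id}_b)(\mathrm{id}_a\otimes\beta'_b)(s_{b,a}\otimes\mathrm{id}_{a'})(\mathrm{id}_b\otimes\iota_{z,z'})=(p_{z,z'}\otimes\mathrm{id}_b)(\mathrm{id}_a\otimes s_{b,a'})(\beta_b\otimes\mathrm{id}_{a'})(\mathrm{id}_b\otimes\iota_{z,z'}).$$ On morphisms $f:z\to z'$, $g:y\to y'$: $f\otimes_s g=p_{z',y'}\circ(f\otimes g)\circ\iota_{z,y}$.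 **Symmetric unit.** $\mathbb{I}_s$ is $\bigoplus_{i\in\mathcal{O}(\mathcal{A})}i\otimes i^*$ with half-braiding at $b\in\mathcal{A}$ given by $\sum_{i,j\in\mathcal O(\mathcal A)}\sum_{\phi\in B(b\otimes i,j)}\phi\otimes\phi^\sharp: b\otimes i\otimes i^*\to j\otimes j^*\otimes b$. Here $B(b\otimes i,j)$ is a basis of $\mathcal{A}(b\otimes i,j)$; $\{\phi^t\}\subset\mathcal{A}(j,b\otimes i)$ is the dual basis for the composition pairing ($\phi\phi^t=\mathrm{id}_j$, $\psi\phi^t=0$ for other basis elements $\psi$); $\phi^*:i^*\otimes b^*\to j^*$ is the dual of $\phi^t$, namely $\phi^*=(\mathrm{id}_{j^*}\otimes \mathrm{ev}_b(\mathrm{id}_b\otimes\mathrm{ev}_i\otimes\mathrm{id}_{b^*}))(\mathrm{id}_{j^*}\otimes\phi^t\otimes\mathrm{id})(\mathrm{coev}_j\otimes\mathrm{id})$; and $\phi^\sharp=(\phi^*\otimes\mathrm{id}_b)(\mathrm{id}_{i^*}\otimes\mathrm{coev}_b)$. **Structure morphisms.** Associator $(z\otimes_s z')\otimes_s z''\to z\otimes_s(z'\otimes_s z'')$: $p_{z,z'\otimes_s z''}(\mathrm{id}\otimes p_{z',z''})\,\alpha\,(\iota_{z,z'}\otimes\mathrm{id})\,\iota_{z\otimes_s z',z''}$, with $\alpha$ the associator of $\mathcal{A}$. Left unitor $\mathbb{I}_s\otimes_s z\to z$: $\sum_i(\mathrm{ev}_i\otimes\mathrm{id}_a)(\mathrm{id}_i\otimes\beta_{i^*}^{-1}s_{i^*,a})\,\iota$;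 right unitor $z\otimes_s\mathbb{I}_s\to z$: $\sum_i(\mathrm{id}_a\otimes\mathrm{ev}_i)(\beta_i s_{a,i}\otimes\mathrm{id}_{i^*})\,\iota$ (each $i$-term acts on the $i$-th summand of $\mathbb{I}_s$). Symmetry $z\otimes_s z'\to z'\otimes_s z$: $p_{z',z}\,s_{a,a'}\,\iota_{z,z'}$. *)

theory Defs
  imports Complex_Main "HOL-Library.FuncSet" "HOL-Algebra.Algebraic_Closure_Type"
begin

section \<open>Categories\<close>

record ('o, 'm) category_data =
  Obj :: "'o set"
  Arr :: "'m set"
  Dom :: "'m \<Rightarrow> 'o"
  Cod :: "'m \<Rightarrow> 'o"
  Ident :: "'o \<Rightarrow> 'm" (\<open>\<^bold>1\<index>\<close>)
  Comp :: "'m \<Rightarrow> 'm \<Rightarrow> 'm" (infixr \<open>\<cdot>\<index>\<close> 55)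

context
  fixes C :: "('o, 'm, 'x) category_data_scheme" (structure)
begin

definition hom_set :: "'o \<Rightarrow> 'o \<Rightarrow> 'm set" where
  "hom_set x y = {f \<in> Arr C. Dom C f = x \<and> Cod C f = y}"

definition inverse_arrows :: "'m \<Rightarrow> 'm \<Rightarrow> bool" where
  "inverse_arrows f g \<longleftrightarrow> f \<in> Arr C \<and> g \<in> hom_set (Cod C f) (Dom C f) \<and>
     g \<cdot> f = \<^bold>1 (Dom C f) \<and> f \<cdot> g = \<^bold>1 (Cod C f)"

definition iso_arr :: "'m \<Rightarrow> bool" where
  "iso_arr f \<longleftrightarrow> (\<exists>g. inverse_arrows f g)"

definition inv_arr :: "'m \<Rightarrow> 'm" where
  "inv_arr f = (THE g. inverse_arrows f g)"

definition isomorphic :: "'o \<Rightarrow> 'o \<Rightarrow> bool" where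
  "isomorphic x y \<longleftrightarrow> (\<exists>f \<in> hom_set x y. iso_arr f)"

definition mono_arr :: "'m \<Rightarrow> bool" where
  "mono_arr f \<longleftrightarrow> f \<in> Arr C \<and>
     (\<forall>x \<in> Obj C. \<forall>g \<in> hom_set x (Dom C f). \<forall>h \<in> hom_set x (Dom C f). f \<cdot> g = f \<cdot> h \<longrightarrow> g = h)"

definition epi_arr :: "'m \<Rightarrow> bool" where
  "epi_arr f \<longleftrightarrow> f \<in> Arr C \<and>
     (\<forall>x \<in> Obj C. \<forall>g \<in> hom_set (Cod C f) x. \<forall>h \<in> hom_set (Cod C f) x. g \<cdot> f = h \<cdot> f \<longrightarrow> g = h)"

definition zero_object :: "'o \<Rightarrow> bool" where
  "zero_object o' \<longleftrightarrow> o' \<in> Obj C \<and>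
     (\<forall>x \<in> Obj C. (\<exists>!f. f \<in> hom_set x o') \<and> (\<exists>!f. f \<in> hom_set o' x))"

definition simple_object :: "'o \<Rightarrow> bool" where
  "simple_object x \<longleftrightarrow> x \<in> Obj C \<and> \<not> zero_object x \<and>
     (\<forall>f. mono_arr f \<and> Cod C f = x \<longrightarrow> zero_object (Dom C f) \<or> iso_arr f)"

end

notation hom_set (\<open>Hom\<index>\<close>)
notation inv_arr (\<open>Inv\<index>\<close>)

locale category =
  fixes C :: "('o, 'm, 'x) category_data_scheme" (structure)
  assumes dom_in: "f \<in> Arr C \<Longrightarrow> Dom C f \<in> Obj C"
    and cod_in: "f \<in> Arr C \<Longrightarrow> Cod C f \<in> Obj C"
    and ident_in: "x \<in> Obj C \<Longrightarrow> \<^bold>1 x \<in> Hom x x"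
    and comp_in: "\<lbrakk>f \<in> Hom x y; g \<in> Hom y z\<rbrakk> \<Longrightarrow> g \<cdot> f \<in> Hom x z"
    and comp_ident: "f \<in> Hom x y \<Longrightarrow> f \<cdot> \<^bold>1 x = f"
    and ident_comp: "f \<in> Hom x y \<Longrightarrow> \<^bold>1 y \<cdot> f = f"
    and comp_assoc: "\<lbrakk>f \<in> Hom w x; g \<in> Hom x y; h \<in> Hom y z\<rbrakk> \<Longrightarrow> (h \<cdot> g) \<cdot> f = h \<cdot> (g \<cdot> f)"


section \<open>Monoidal and symmetric monoidal categories\<close>

record ('o, 'm) monoidal_data = "('o, 'm) category_data" +
  tensor_obj :: "'o \<Rightarrow> 'o \<Rightarrow> 'o" (infixr \<open>\<boxtimes>\<index>\<close> 70)
  tensor_arr :: "'m \<Rightarrow> 'm \<Rightarrow> 'm" (infixr \<open>\<boxdot>\<index>\<close> 70)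
  unit_obj :: 'o (\<open>\<I>\<index>\<close>)
  associator :: "'o \<Rightarrow> 'o \<Rightarrow> 'o \<Rightarrow> 'm" (\<open>\<a>\<index>\<close>)
  left_unitor :: "'o \<Rightarrow> 'm" (\<open>\<l>\<index>\<close>)
  right_unitor :: "'o \<Rightarrow> 'm" (\<open>\<r>\<index>\<close>)

record ('o, 'm) symmetric_data = "('o, 'm) monoidal_data" +
  symmetry :: "'o \<Rightarrow> 'o \<Rightarrow> 'm" (\<open>\<s>\<index>\<close>)

locale monoidal_category = category C
  for C :: "('o, 'm, 'x) monoidal_data_scheme" (structure) +
  assumes tensor_obj_in: "\<lbrakk>x \<in> Obj C; y \<in> Obj C\<rbrakk> \<Longrightarrow> x \<boxtimes> y \<in> Obj C"
    and unit_in: "\<I> \<in> Obj C"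
    and tensor_arr_in: "\<lbrakk>f \<in> Hom x x'; g \<in> Hom y y'\<rbrakk> \<Longrightarrow> f \<boxdot> g \<in> Hom (x \<boxtimes> y) (x' \<boxtimes> y')"
    and tensor_ident: "\<lbrakk>x \<in> Obj C; y \<in> Obj C\<rbrakk> \<Longrightarrow> \<^bold>1 x \<boxdot> \<^bold>1 y = \<^bold>1 (x \<boxtimes> y)"
    and tensor_comp:
      "\<lbrakk>f \<in> Hom x x'; f' \<in> Hom x' x''; g \<in> Hom y y'; g' \<in> Hom y' y''\<rbrakk>
       \<Longrightarrow> (f' \<cdot> f) \<boxdot> (g' \<cdot> g) = (f' \<boxdot> g') \<cdot> (f \<boxdot> g)"
    and associator_in:
      "\<lbrakk>x \<in> Obj C; y \<in> Obj C; z \<in> Obj C\<rbrakk> \<Longrightarrow> \<a> x y z \<in> Hom ((x \<boxtimes> y) \<boxtimes> z) (x \<boxtimes> (y \<boxtimes> z))"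
    and associator_iso: "\<lbrakk>x \<in> Obj C; y \<in> Obj C; z \<in> Obj C\<rbrakk> \<Longrightarrow> iso_arr C (\<a> x y z)"
    and associator_natural:
      "\<lbrakk>f \<in> Hom x x'; g \<in> Hom y y'; h \<in> Hom z z'\<rbrakk>
       \<Longrightarrow> \<a> x' y' z' \<cdot> ((f \<boxdot> g) \<boxdot> h) = (f \<boxdot> (g \<boxdot> h)) \<cdot> \<a> x y z"
    and left_unitor_in: "x \<in> Obj C \<Longrightarrow> \<l> x \<in> Hom (\<I> \<boxtimes> x) x"
    and left_unitor_iso: "x \<in> Obj C \<Longrightarrow> iso_arr C (\<l> x)"
    and left_unitor_natural: "f \<in> Hom x y \<Longrightarrow> \<l> y \<cdot> (\<^bold>1 \<I> \<boxdot> f) = f \<cdot> \<l> x"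
    and right_unitor_in: "x \<in> Obj C \<Longrightarrow> \<r> x \<in> Hom (x \<boxtimes> \<I>) x"
    and right_unitor_iso: "x \<in> Obj C \<Longrightarrow> iso_arr C (\<r> x)"
    and right_unitor_natural: "f \<in> Hom x y \<Longrightarrow> \<r> y \<cdot> (f \<boxdot> \<^bold>1 \<I>) = f \<cdot> \<r> x"
    and pentagon:
      "\<lbrakk>w \<in> Obj C; x \<in> Obj C; y \<in> Obj C; z \<in> Obj C\<rbrakk>
       \<Longrightarrow> (\<^bold>1 w \<boxdot> \<a> x y z) \<cdot> \<a> w (x \<boxtimes> y) z \<cdot> (\<a> w x y \<boxdot> \<^bold>1 z)
           = \<a> w x (y \<boxtimes> z) \<cdot> \<a> (w \<boxtimes> x) y z"
    and triangle:
      "\<lbrakk>x \<in> Obj C; y \<in> Obj C\<rbrakk> \<Longrightarrow> (\<^bold>1 x \<boxdot> \<l> y) \<cdot> \<a> x \<I> y = \<r> x \<boxdot> \<^bold>1 y"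

locale symmetric_monoidal_category = monoidal_category C
  for C :: "('o, 'm, 'x) symmetric_data_scheme" (structure) +
  assumes symmetry_in: "\<lbrakk>x \<in> Obj C; y \<in> Obj C\<rbrakk> \<Longrightarrow> \<s> x y \<in> Hom (x \<boxtimes> y) (y \<boxtimes> x)"
    and symmetry_natural:
      "\<lbrakk>f \<in> Hom x x'; g \<in> Hom y y'\<rbrakk> \<Longrightarrow> \<s> x' y' \<cdot> (f \<boxdot> g) = (g \<boxdot> f) \<cdot> \<s> x y"
    and symmetry_involutive:
      "\<lbrakk>x \<in> Obj C; y \<in> Obj C\<rbrakk> \<Longrightarrow> \<s> y x \<cdot> \<s> x y = \<^bold>1 (x \<boxtimes> y)"
    and hexagon:
      "\<lbrakk>x \<in> Obj C; y \<in> Obj C; z \<in> Obj C\<rbrakk>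
       \<Longrightarrow> \<a> y z x \<cdot> \<s> x (y \<boxtimes> z) \<cdot> \<a> x y z
           = (\<^bold>1 y \<boxdot> \<s> x z) \<cdot> \<a> y x z \<cdot> (\<s> x y \<boxdot> \<^bold>1 z)"


section \<open>Symmetric ribbon fusion categories over the complex numbers\<close>

record ('o, 'm) ribbon_fusion_data = "('o, 'm) symmetric_data" +
  arr_add :: "'m \<Rightarrow> 'm \<Rightarrow> 'm"
  arr_zero :: "'o \<Rightarrow> 'o \<Rightarrow> 'm"
  arr_scale :: "complex \<Rightarrow> 'm \<Rightarrow> 'm"
  dual_obj :: "'o \<Rightarrow> 'o"
  ev :: "'o \<Rightarrow> 'm"
  coev :: "'o \<Rightarrow> 'm"
  twist :: "'o \<Rightarrow> 'm"

context
  fixes A :: "('o, 'm, 'x) ribbon_fusion_data_scheme" (structure)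
begin

(* The fields mult and one of the module record play no role. *)
definition hom_space :: "'o \<Rightarrow> 'o \<Rightarrow> (complex, 'm) module" where
  "hom_space x y = \<lparr>carrier = Hom x y, monoid.mult = undefined, one = undefined,
     zero = arr_zero A x y, add = arr_add A, module.smult = arr_scale A\<rparr>"

definition hom_basis :: "'o \<Rightarrow> 'o \<Rightarrow> 'm set \<Rightarrow> bool" where
  "hom_basis x y B \<longleftrightarrow> finite B \<and> B \<subseteq> Hom x y \<and>
     (\<forall>f \<in> Hom x y. \<exists>!c. c \<in> extensional B \<and>
        f = (\<Oplus>\<^bsub>hom_space x y\<^esub> \<phi> \<in> B. c \<phi> \<odot>\<^bsub>hom_space x y\<^esub> \<phi>))"

definition direct_sum :: "'k set \<Rightarrow> ('k \<Rightarrow> 'o) \<Rightarrow> 'o \<Rightarrow> ('k \<Rightarrow> 'm) \<Rightarrow> ('k \<Rightarrow> 'm) \<Rightarrow> bool" where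
  "direct_sum K Y S u v \<longleftrightarrow> finite K \<and> S \<in> Obj A \<and>
     (\<forall>k \<in> K. Y k \<in> Obj A \<and> u k \<in> Hom (Y k) S \<and> v k \<in> Hom S (Y k)) \<and>
     (\<forall>k \<in> K. \<forall>l \<in> K. v k \<cdot> u l = (if k = l then \<^bold>1 (Y k) else arr_zero A (Y l) (Y k))) \<and>
     (\<Oplus>\<^bsub>hom_space S S\<^esub> k \<in> K. u k \<cdot> v k) = \<^bold>1 S"

definition is_kernel :: "'m \<Rightarrow> 'm \<Rightarrow> bool" where
  "is_kernel k f \<longleftrightarrow> f \<in> Arr A \<and> k \<in> Hom (Dom A k) (Dom A f) \<and>
     f \<cdot> k = arr_zero A (Dom A k) (Cod A f) \<and>
     (\<forall>x \<in> Obj A. \<forall>g \<in> Hom x (Dom A f). f \<cdot> g = arr_zero A x (Cod A f) \<longrightarrow>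
        (\<exists>!h. h \<in> Hom x (Dom A k) \<and> k \<cdot> h = g))"

definition is_cokernel :: "'m \<Rightarrow> 'm \<Rightarrow> bool" where
  "is_cokernel q f \<longleftrightarrow> f \<in> Arr A \<and> q \<in> Hom (Cod A f) (Cod A q) \<and>
     q \<cdot> f = arr_zero A (Dom A f) (Cod A q) \<and>
     (\<forall>x \<in> Obj A. \<forall>g \<in> Hom (Cod A f) x. g \<cdot> f = arr_zero A (Dom A f) x \<longrightarrow>
        (\<exists>!h. h \<in> Hom (Cod A q) x \<and> h \<cdot> q = g))"

(* f^* : y^* --> x^* for f : x --> y *)
definition dual_arr :: "'m \<Rightarrow> 'm" where
  "dual_arr f = (let x = Dom A f; y = Cod A f; x' = dual_obj A x; y' = dual_obj A y in
     \<r> x' \<cdot> (\<^bold>1 x' \<boxdot> ev A y) \<cdot> (\<^bold>1 x' \<boxdot> (f \<boxdot> \<^bold>1 y')) \<cdot> \<a> x' x y' \<cdot> (coev A x \<boxdot> \<^bold>1 y') \<cdot> Inv (\<l> y'))"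

(* The pivotal structure of a ribbon category: the Drinfeld isomorphism x --> x^{**}
   composed with the twist. *)
definition drinfeld_iso :: "'o \<Rightarrow> 'm" where
  "drinfeld_iso x = (let x' = dual_obj A x; x'' = dual_obj A x' in
     \<r> x'' \<cdot> (\<^bold>1 x'' \<boxdot> ev A x) \<cdot> (\<^bold>1 x'' \<boxdot> \<s> x' x) \<cdot> \<a> x'' x' x \<cdot> (coev A x' \<boxdot> \<^bold>1 x) \<cdot> Inv (\<l> x))"

definition pivotal :: "'o \<Rightarrow> 'm" where
  "pivotal x = drinfeld_iso x \<cdot> twist A x"

definition coev_tilde :: "'o \<Rightarrow> 'm" where
  "coev_tilde x = (Inv (pivotal x) \<boxdot> \<^bold>1 (dual_obj A x)) \<cdot> coev A (dual_obj A x)"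

definition qdim :: "'o \<Rightarrow> complex" where
  "qdim x = (THE d. ev A x \<cdot> coev_tilde x = d \<odot>\<^bsub>hom_space \<I> \<I>\<^esub> \<^bold>1 \<I>)"

definition simple_representatives :: "'o set \<Rightarrow> bool" where
  "simple_representatives R \<longleftrightarrow> (\<forall>i \<in> R. simple_object A i) \<and>
     (\<forall>x. simple_object A x \<longrightarrow> (\<exists>!i. i \<in> R \<and> isomorphic A x i))"

end

locale linear_category = category A
  for A :: "('o, 'm, 'x) ribbon_fusion_data_scheme" (structure) +
  assumes hom_module:
      "\<lbrakk>x \<in> Obj A; y \<in> Obj A\<rbrakk> \<Longrightarrow> module (ring_of_type_algebra :: complex ring) (hom_space A x y)"
    and comp_add_left:
      "\<lbrakk>f \<in> Hom x y; g \<in> Hom y z; h \<in> Hom y z\<rbrakk>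
       \<Longrightarrow> (g \<oplus>\<^bsub>hom_space A y z\<^esub> h) \<cdot> f = (g \<cdot> f) \<oplus>\<^bsub>hom_space A x z\<^esub> (h \<cdot> f)"
    and comp_add_right:
      "\<lbrakk>f \<in> Hom x y; g \<in> Hom x y; h \<in> Hom y z\<rbrakk>
       \<Longrightarrow> h \<cdot> (f \<oplus>\<^bsub>hom_space A x y\<^esub> g) = (h \<cdot> f) \<oplus>\<^bsub>hom_space A x z\<^esub> (h \<cdot> g)"
    and comp_scale_left:
      "\<lbrakk>f \<in> Hom x y; g \<in> Hom y z\<rbrakk>
       \<Longrightarrow> (c \<odot>\<^bsub>hom_space A y z\<^esub> g) \<cdot> f = c \<odot>\<^bsub>hom_space A x z\<^esub> (g \<cdot> f)"
    and comp_scale_right: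
      "\<lbrakk>f \<in> Hom x y; g \<in> Hom y z\<rbrakk>
       \<Longrightarrow> g \<cdot> (c \<odot>\<^bsub>hom_space A x y\<^esub> f) = c \<odot>\<^bsub>hom_space A x z\<^esub> (g \<cdot> f)"

locale abelian_linear_category = linear_category A
  for A :: "('o, 'm, 'x) ribbon_fusion_data_scheme" (structure) +
  assumes zero_object_exists: "\<exists>x. zero_object A x"
    and binary_direct_sum_exists:
      "\<lbrakk>x \<in> Obj A; y \<in> Obj A\<rbrakk> \<Longrightarrow> \<exists>S u v. direct_sum A UNIV (\<lambda>k::bool. if k then x else y) S u v"
    and kernel_exists: "f \<in> Arr A \<Longrightarrow> \<exists>k. is_kernel A k f"
    and cokernel_exists: "f \<in> Arr A \<Longrightarrow> \<exists>q. is_cokernel A q f"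
    and mono_is_kernel: "mono_arr A f \<Longrightarrow> \<exists>g. is_kernel A f g"
    and epi_is_cokernel: "epi_arr A f \<Longrightarrow> \<exists>g. is_cokernel A f g"

locale semisimple_category = abelian_linear_category A
  for A :: "('o, 'm, 'x) ribbon_fusion_data_scheme" (structure) +
  assumes hom_finite_dim: "\<lbrakk>x \<in> Obj A; y \<in> Obj A\<rbrakk> \<Longrightarrow> \<exists>B. hom_basis A x y B"
    and semisimple:
      "x \<in> Obj A \<Longrightarrow>
       \<exists>(n::nat) Y u v. (\<forall>k<n. simple_object A (Y k)) \<and> direct_sum A {..<n} Y x u v"

(* A duality on one side suffices for rigidity here, since the braiding turns it into a
   duality on the other side. *)
locale rigid_symmetric_category = symmetric_monoidal_category A
  for A :: "('o, 'm, 'x) ribbon_fusion_data_scheme" (structure) +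
  assumes dual_in: "x \<in> Obj A \<Longrightarrow> dual_obj A x \<in> Obj A"
    and ev_in: "x \<in> Obj A \<Longrightarrow> ev A x \<in> Hom (x \<boxtimes> dual_obj A x) \<I>"
    and coev_in: "x \<in> Obj A \<Longrightarrow> coev A x \<in> Hom \<I> (dual_obj A x \<boxtimes> x)"
    and snake_obj:
      "x \<in> Obj A \<Longrightarrow>
       \<l> x \<cdot> (ev A x \<boxdot> \<^bold>1 x) \<cdot> Inv (\<a> x (dual_obj A x) x) \<cdot> (\<^bold>1 x \<boxdot> coev A x) \<cdot> Inv (\<r> x) = \<^bold>1 x"
    and snake_dual:
      "x \<in> Obj A \<Longrightarrow>
       \<r> (dual_obj A x) \<cdot> (\<^bold>1 (dual_obj A x) \<boxdot> ev A x) \<cdot> \<a> (dual_obj A x) x (dual_obj A x)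
         \<cdot> (coev A x \<boxdot> \<^bold>1 (dual_obj A x)) \<cdot> Inv (\<l> (dual_obj A x)) = \<^bold>1 (dual_obj A x)"

locale ribbon_symmetric_category = rigid_symmetric_category A
  for A :: "('o, 'm, 'x) ribbon_fusion_data_scheme" (structure) +
  assumes twist_in: "x \<in> Obj A \<Longrightarrow> twist A x \<in> Hom x x"
    and twist_iso: "x \<in> Obj A \<Longrightarrow> iso_arr A (twist A x)"
    and twist_natural: "f \<in> Hom x y \<Longrightarrow> twist A y \<cdot> f = f \<cdot> twist A x"
    and twist_tensor:
      "\<lbrakk>x \<in> Obj A; y \<in> Obj A\<rbrakk> \<Longrightarrow> twist A (x \<boxtimes> y) = \<s> y x \<cdot> \<s> x y \<cdot> (twist A x \<boxdot> twist A y)"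
    and twist_dual: "x \<in> Obj A \<Longrightarrow> twist A (dual_obj A x) = dual_arr A (twist A x)"

locale symmetric_ribbon_fusion_category = semisimple_category A + ribbon_symmetric_category A
  for A :: "('o, 'm, 'x) ribbon_fusion_data_scheme" (structure) +
  assumes tensor_add_left:
      "\<lbrakk>f \<in> Hom x x'; g \<in> Hom x x'; h \<in> Hom y y'\<rbrakk>
       \<Longrightarrow> (f \<oplus>\<^bsub>hom_space A x x'\<^esub> g) \<boxdot> h
           = (f \<boxdot> h) \<oplus>\<^bsub>hom_space A (x \<boxtimes> y) (x' \<boxtimes> y')\<^esub> (g \<boxdot> h)"
    and tensor_add_right:
      "\<lbrakk>f \<in> Hom x x'; g \<in> Hom y y'; h \<in> Hom y y'\<rbrakk>
       \<Longrightarrow> f \<boxdot> (g \<oplus>\<^bsub>hom_space A y y'\<^esub> h)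
           = (f \<boxdot> g) \<oplus>\<^bsub>hom_space A (x \<boxtimes> y) (x' \<boxtimes> y')\<^esub> (f \<boxdot> h)"
    and tensor_scale_left:
      "\<lbrakk>f \<in> Hom x x'; g \<in> Hom y y'\<rbrakk>
       \<Longrightarrow> (c \<odot>\<^bsub>hom_space A x x'\<^esub> f) \<boxdot> g = c \<odot>\<^bsub>hom_space A (x \<boxtimes> y) (x' \<boxtimes> y')\<^esub> (f \<boxdot> g)"
    and tensor_scale_right:
      "\<lbrakk>f \<in> Hom x x'; g \<in> Hom y y'\<rbrakk>
       \<Longrightarrow> f \<boxdot> (c \<odot>\<^bsub>hom_space A y y'\<^esub> g) = c \<odot>\<^bsub>hom_space A (x \<boxtimes> y) (x' \<boxtimes> y')\<^esub> (f \<boxdot> g)"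
    and finitely_many_simples:
      "\<exists>R. finite R \<and> (\<forall>x. simple_object A x \<longrightarrow> (\<exists>i \<in> R. isomorphic A x i))"
    and unit_simple: "simple_object A \<I>"


section \<open>The Drinfeld centre\<close>

type_synonym ('o, 'm) centre_obj = "'o \<times> ('o \<Rightarrow> 'm)"

(* An arrow of the centre is an arrow of the base category tagged with its source and
   target, since one base arrow can lie between several pairs of half-braidings. *)
type_synonym ('o, 'm) centre_arr = "('o, 'm) centre_obj \<times> 'm \<times> ('o, 'm) centre_obj"

context
  fixes A :: "('o, 'm, 'x) ribbon_fusion_data_scheme" (structure)
begin

definition half_braiding :: "'o \<Rightarrow> ('o \<Rightarrow> 'm) \<Rightarrow> bool" where
  "half_braiding a \<beta> \<longleftrightarrow> \<beta> \<in> extensional (Obj A) \<and>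
     (\<forall>b \<in> Obj A. \<beta> b \<in> Hom (b \<boxtimes> a) (a \<boxtimes> b) \<and> iso_arr A (\<beta> b)) \<and>
     (\<forall>f \<in> Arr A. \<beta> (Cod A f) \<cdot> (f \<boxdot> \<^bold>1 a) = (\<^bold>1 a \<boxdot> f) \<cdot> \<beta> (Dom A f)) \<and>
     (\<forall>b \<in> Obj A. \<forall>b' \<in> Obj A.
        \<beta> (b \<boxtimes> b') = \<a> a b b' \<cdot> (\<beta> b \<boxdot> \<^bold>1 b') \<cdot> Inv (\<a> b a b') \<cdot> (\<^bold>1 b \<boxdot> \<beta> b') \<cdot> \<a> b b' a)"

definition drinfeld_centre :: "(('o, 'm) centre_obj, ('o, 'm) centre_arr) category_data" where
  "drinfeld_centre =
     (let Z = {(a, \<beta>). a \<in> Obj A \<and> half_braiding a \<beta>} in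
      \<lparr>Obj = Z,
       Arr = {((a, \<beta>), f, (a', \<beta>')) | a \<beta> f a' \<beta>'. (a, \<beta>) \<in> Z \<and> (a', \<beta>') \<in> Z \<and> f \<in> Hom a a' \<and>
                (\<forall>b \<in> Obj A. (f \<boxdot> \<^bold>1 b) \<cdot> \<beta> b = \<beta>' b \<cdot> (\<^bold>1 b \<boxdot> f))},
       Dom = (\<lambda>(z, f, z'). z),
       Cod = (\<lambda>(z, f, z'). z'),
       Ident = (\<lambda>z. (z, \<^bold>1 (fst z), z)),
       Comp = (\<lambda>(y, g, y') (z, f, z'). (z, g \<cdot> f, y'))\<rparr>)"

definition centre_tensor :: "('o, 'm) centre_obj \<Rightarrow> ('o, 'm) centre_obj \<Rightarrow> ('o, 'm) centre_obj" where
  "centre_tensor = (\<lambda>(a, \<beta>) (a', \<beta>').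
     (a \<boxtimes> a',
      \<lambda>b \<in> Obj A. Inv (\<a> a a' b) \<cdot> (\<^bold>1 a \<boxdot> \<beta>' b) \<cdot> \<a> a b a' \<cdot> (\<beta> b \<boxdot> \<^bold>1 a') \<cdot> Inv (\<a> b a a')))"


section \<open>The symmetric tensor product\<close>

definition rebracket :: "'o \<Rightarrow> 'o \<Rightarrow> 'o \<Rightarrow> 'o \<Rightarrow> 'm" where
  "rebracket a i i' a' = \<a> (a \<boxtimes> i) i' a' \<cdot> (Inv (\<a> a i i') \<boxdot> \<^bold>1 a')"

(* R is a set of representatives of the simple objects. *)
definition Pi_idem :: "'o set \<Rightarrow> ('o, 'm) centre_obj \<Rightarrow> ('o, 'm) centre_obj \<Rightarrow> 'm" where
  "Pi_idem R = (\<lambda>(a, \<beta>) (a', \<beta>').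
     \<Oplus>\<^bsub>hom_space A (a \<boxtimes> a') (a \<boxtimes> a')\<^esub> i \<in> R.
       (qdim A i / (\<Sum>j\<in>R. (qdim A j)\<^sup>2)) \<odot>\<^bsub>hom_space A (a \<boxtimes> a') (a \<boxtimes> a')\<^esub>
       ((\<r> a \<boxdot> \<^bold>1 a') \<cdot> ((\<^bold>1 a \<boxdot> ev A i) \<boxdot> \<^bold>1 a') \<cdot> Inv (rebracket a i (dual_obj A i) a')
        \<cdot> ((\<beta> i \<cdot> \<s> a i) \<boxdot> (\<s> a' (dual_obj A i) \<cdot> \<beta>' (dual_obj A i)))
        \<cdot> rebracket a i (dual_obj A i) a' \<cdot> ((\<^bold>1 a \<boxdot> coev_tilde A i) \<boxdot> \<^bold>1 a')
        \<cdot> (Inv (\<r> a) \<boxdot> \<^bold>1 a')))"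

(* phi^t, for phi in a basis B of Hom x j with j simple *)
definition dual_vector :: "'o \<Rightarrow> 'o \<Rightarrow> 'm set \<Rightarrow> 'm \<Rightarrow> 'm" where
  "dual_vector x j B \<phi> =
     (THE t. t \<in> Hom j x \<and> (\<forall>\<psi> \<in> B. \<psi> \<cdot> t = (if \<psi> = \<phi> then \<^bold>1 j else arr_zero A j j)))"

(* The dual i^* (x) b^* --> j^* of an arrow t : j --> b (x) i *)
definition tensor_dual :: "'o \<Rightarrow> 'o \<Rightarrow> 'o \<Rightarrow> 'm \<Rightarrow> 'm" where
  "tensor_dual b i j t = (let i' = dual_obj A i; b' = dual_obj A b; j' = dual_obj A j in
     \<r> j'
     \<cdot> (\<^bold>1 j' \<boxdot> (ev A b \<cdot> (\<^bold>1 b \<boxdot> \<l> b') \<cdot> (\<^bold>1 b \<boxdot> (ev A i \<boxdot> \<^bold>1 b')) \<cdot> (\<^bold>1 b \<boxdot> Inv (\<a> i i' b'))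
                \<cdot> \<a> b i (i' \<boxtimes> b')))
     \<cdot> (\<^bold>1 j' \<boxdot> (t \<boxdot> \<^bold>1 (i' \<boxtimes> b'))) \<cdot> \<a> j' j (i' \<boxtimes> b')
     \<cdot> (coev A j \<boxdot> \<^bold>1 (i' \<boxtimes> b')) \<cdot> Inv (\<l> (i' \<boxtimes> b')))"

(* phi^sharp : i^* --> j^* (x) b, for phi in a basis B of Hom (b (x) i) j *)
definition sharp :: "'o \<Rightarrow> 'o \<Rightarrow> 'o \<Rightarrow> 'm set \<Rightarrow> 'm \<Rightarrow> 'm" where
  "sharp b i j B \<phi> = (let i' = dual_obj A i; b' = dual_obj A b in
     (tensor_dual b i j (dual_vector (b \<boxtimes> i) j B \<phi>) \<boxdot> \<^bold>1 b) \<cdot> Inv (\<a> i' b' b)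
     \<cdot> (\<^bold>1 i' \<boxdot> coev A b) \<cdot> Inv (\<r> i'))"

end

(* The choices entering the construction: representatives of the simple objects, bases of the
   spaces Hom (b (x) i) j, the direct sum of the objects i (x) i^*, and images of the
   idempotents. *)
record ('o, 'm) symmetric_choice =
  simples :: "'o set"
  basis :: "'o \<Rightarrow> 'o \<Rightarrow> 'o \<Rightarrow> 'm set"
  sum_obj :: 'o
  sum_inj :: "'o \<Rightarrow> 'm"
  sum_prj :: "'o \<Rightarrow> 'm"
  Pi_image :: "('o, 'm) centre_obj \<Rightarrow> ('o, 'm) centre_obj \<Rightarrow> ('o, 'm) centre_obj"
  Pi_incl :: "('o, 'm) centre_obj \<Rightarrow> ('o, 'm) centre_obj \<Rightarrow> 'm"
  Pi_proj :: "('o, 'm) centre_obj \<Rightarrow> ('o, 'm) centre_obj \<Rightarrow> 'm"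

context
  fixes A :: "('o, 'm, 'x) ribbon_fusion_data_scheme" (structure)
    and T :: "('o, 'm) symmetric_choice"
begin

definition valid_choice :: bool where
  "valid_choice \<longleftrightarrow>
     simple_representatives A (simples T) \<and>
     (\<forall>b \<in> Obj A. \<forall>i \<in> simples T. \<forall>j \<in> simples T. hom_basis A (b \<boxtimes> i) j (basis T b i j)) \<and>
     direct_sum A (simples T) (\<lambda>i. i \<boxtimes> dual_obj A i) (sum_obj T) (sum_inj T) (sum_prj T) \<and>
     (\<forall>z \<in> Obj (drinfeld_centre A). \<forall>z' \<in> Obj (drinfeld_centre A).
        (Pi_image T z z', Pi_incl T z z', centre_tensor A z z') \<in> Arr (drinfeld_centre A) \<and>
        (centre_tensor A z z', Pi_proj T z z', Pi_image T z z') \<in> Arr (drinfeld_centre A) \<and>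
        Pi_proj T z z' \<cdot> Pi_incl T z z' = \<^bold>1 (fst (Pi_image T z z')) \<and>
        Pi_incl T z z' \<cdot> Pi_proj T z z' = Pi_idem A (simples T) z z')"

definition stensor_obj :: "('o, 'm) centre_obj \<Rightarrow> ('o, 'm) centre_obj \<Rightarrow> ('o, 'm) centre_obj" where
  "stensor_obj = (\<lambda>(a, \<beta>) (a', \<beta>').
     let e = fst (Pi_image T (a, \<beta>) (a', \<beta>'));
         \<iota> = Pi_incl T (a, \<beta>) (a', \<beta>'); p = Pi_proj T (a, \<beta>) (a', \<beta>') in
     (e, \<lambda>b \<in> Obj A. (p \<boxdot> \<^bold>1 b) \<cdot> Inv (\<a> a a' b) \<cdot> (\<^bold>1 a \<boxdot> \<beta>' b) \<cdot> \<a> a b a'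
                     \<cdot> (\<s> b a \<boxdot> \<^bold>1 a') \<cdot> Inv (\<a> b a a') \<cdot> (\<^bold>1 b \<boxdot> \<iota>)))"

definition stensor_arr :: "('o, 'm) centre_arr \<Rightarrow> ('o, 'm) centre_arr \<Rightarrow> ('o, 'm) centre_arr" where
  "stensor_arr = (\<lambda>(z, f, z') (y, g, y').
     (stensor_obj z y, Pi_proj T z' y' \<cdot> (f \<boxdot> g) \<cdot> Pi_incl T z y, stensor_obj z' y'))"

definition sunit :: "('o, 'm) centre_obj" where
  "sunit = (let S = sum_obj T in
     (S, \<lambda>b \<in> Obj A.
        \<Oplus>\<^bsub>hom_space A (b \<boxtimes> S) (S \<boxtimes> b)\<^esub> i \<in> simples T.
        \<Oplus>\<^bsub>hom_space A (b \<boxtimes> S) (S \<boxtimes> b)\<^esub> j \<in> simples T.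
        \<Oplus>\<^bsub>hom_space A (b \<boxtimes> S) (S \<boxtimes> b)\<^esub> \<phi> \<in> basis T b i j.
          (sum_inj T j \<boxdot> \<^bold>1 b) \<cdot> Inv (\<a> j (dual_obj A j) b) \<cdot> (\<phi> \<boxdot> sharp A b i j (basis T b i j) \<phi>)
          \<cdot> Inv (\<a> b i (dual_obj A i)) \<cdot> (\<^bold>1 b \<boxdot> sum_prj T i)))"

definition sassociator ::
  "('o, 'm) centre_obj \<Rightarrow> ('o, 'm) centre_obj \<Rightarrow> ('o, 'm) centre_obj \<Rightarrow> ('o, 'm) centre_arr" where
  "sassociator z z' z'' =
     (stensor_obj (stensor_obj z z') z'',
      Pi_proj T z (stensor_obj z' z'') \<cdot> (\<^bold>1 (fst z) \<boxdot> Pi_proj T z' z'') \<cdot> \<a> (fst z) (fst z') (fst z'')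
      \<cdot> (Pi_incl T z z' \<boxdot> \<^bold>1 (fst z'')) \<cdot> Pi_incl T (stensor_obj z z') z'',
      stensor_obj z (stensor_obj z' z''))"

definition sleft_unitor :: "('o, 'm) centre_obj \<Rightarrow> ('o, 'm) centre_arr" where
  "sleft_unitor = (\<lambda>(a, \<beta>).
     (stensor_obj sunit (a, \<beta>),
      (\<Oplus>\<^bsub>hom_space A (sum_obj T \<boxtimes> a) a\<^esub> i \<in> simples T.
         \<l> a \<cdot> (ev A i \<boxdot> \<^bold>1 a) \<cdot> Inv (\<a> i (dual_obj A i) a)
         \<cdot> (\<^bold>1 i \<boxdot> (Inv (\<beta> (dual_obj A i)) \<cdot> \<s> (dual_obj A i) a))
         \<cdot> \<a> i (dual_obj A i) a \<cdot> (sum_prj T i \<boxdot> \<^bold>1 a))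
      \<cdot> Pi_incl T sunit (a, \<beta>),
      (a, \<beta>)))"

definition sright_unitor :: "('o, 'm) centre_obj \<Rightarrow> ('o, 'm) centre_arr" where
  "sright_unitor = (\<lambda>(a, \<beta>).
     (stensor_obj (a, \<beta>) sunit,
      (\<Oplus>\<^bsub>hom_space A (a \<boxtimes> sum_obj T) a\<^esub> i \<in> simples T.
         \<r> a \<cdot> (\<^bold>1 a \<boxdot> ev A i) \<cdot> \<a> a i (dual_obj A i)
         \<cdot> ((\<beta> i \<cdot> \<s> a i) \<boxdot> \<^bold>1 (dual_obj A i))
         \<cdot> Inv (\<a> a i (dual_obj A i)) \<cdot> (\<^bold>1 a \<boxdot> sum_prj T i))
      \<cdot> Pi_incl T (a, \<beta>) sunit,
      (a, \<beta>)))"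

definition ssymmetry :: "('o, 'm) centre_obj \<Rightarrow> ('o, 'm) centre_obj \<Rightarrow> ('o, 'm) centre_arr" where
  "ssymmetry z z' =
     (stensor_obj z z', Pi_proj T z' z \<cdot> \<s> (fst z) (fst z') \<cdot> Pi_incl T z z', stensor_obj z' z)"

definition symmetric_centre :: "(('o, 'm) centre_obj, ('o, 'm) centre_arr) symmetric_data" where
  "symmetric_centre =
     \<lparr>Obj = Obj (drinfeld_centre A), Arr = Arr (drinfeld_centre A),
      Dom = Dom (drinfeld_centre A), Cod = Cod (drinfeld_centre A),
      Ident = Ident (drinfeld_centre A), Comp = Comp (drinfeld_centre A),
      tensor_obj = stensor_obj, tensor_arr = stensor_arr, unit_obj = sunit,
      associator = sassociator, left_unitor = sleft_unitor, right_unitor = sright_unitor,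
      symmetry = ssymmetry\<rparr>"

end

end

theory Submission
  imports Defs
begin

text \<open>Everything takes place inside \<open>A\<close>; the centre only restricts which arrows count.

  An object \<open>x\<close> acts on all others by tensoring on the left, and a half-braiding on \<open>a\<close> amounts to
  isomorphisms \<open>b \<otimes> (a \<otimes> w) \<rightarrow> a \<otimes> (b \<otimes> w)\<close>, natural in the tail \<open>w\<close>. In this right-nested form the
  associators all but disappear from calculations, and since an arrow \<open>f\<close> is determined by the
  arrows \<open>f \<otimes> w\<close> (\<open>eq_by_tail\<close>) nothing is lost.

  For two half-braidings \<open>\<beta>\<close>, \<open>\<beta>'\<close> on \<open>c\<close> let \<open>haar \<beta> \<beta>'\<close> be the average over the simple objects \<open>i\<close>, with
  weights \<open>d_i/D\<close>, of the loops that pass \<open>i\<close> across \<open>c\<close> by the inverse of \<open>\<beta>'\<close> and back by \<open>\<beta>\<close>. Sliding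
  a handle over such a loop (\<open>handle_slide\<close>) shows that it transports \<open>\<beta>'\<close> to \<open>\<beta>\<close> (\<open>haar_conj\<close>).
  If \<open>\<beta>\<close> and \<open>\<beta>'\<close> commute, it is therefore the idempotent whose image is the equalizer of \<open>\<beta>\<close> and \<open>\<beta>'\<close>.
  The division by \<open>D\<close> is legitimate because dimensions are real (\<open>dimn_real\<close>): they are eigenvalues of
  fusion matrices, whose transposes are again fusion matrices, by duality.
  The idempotent \<open>\<Pi>\<close> is the case where \<open>c = a \<otimes> a'\<close> and \<open>\<beta>\<close>, \<open>\<beta>'\<close> braid
  with the first factor through its half-braiding and with the second through the symmetry, or the
  other way round (\<open>Pi_idem_haar\<close>).

  Thus \<open>z \<otimes>\<^sub>s z'\<close> is the largest subobject of \<open>a \<otimes> a'\<close> on which the two half-braidings agree, and an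
  arrow into \<open>a \<otimes> a'\<close> that equalizes them factors uniquely (\<open>factor\<close>). Both iterated products embed
  into the threefold product of \<open>A\<close>, where the associator and the symmetry of \<open>A\<close> respect the three
  half-braidings; so they restrict, and pentagon, hexagon and naturality are inherited from \<open>A\<close>.

  The object \<open>L = \<Oplus> i \<otimes> i\<^sup>*\<close> of the unit carries a natural arrow \<open>x \<rightarrow> L \<otimes> x\<close>, defined by
  coevaluation on simple \<open>x\<close>, and its half-braiding is determined by compatibility with this arrow
  (\<open>ubh_dlh\<close>). The half-braiding of \<open>z\<close> gives an action \<open>a \<otimes> L \<rightarrow> a\<close>. On the equalizer
  the action is inverted by inserting the arrow \<open>\<I> \<rightarrow> L\<close> (\<open>avg_uV_act\<close>, \<open>act_uV\<close>); this is the right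
  unitor, and the left unitor is its composite with the symmetry.\<close>

text \<open>Compact notation, since the terms are long: \<open>$\<close> multiplies objects, \<open>b |> f\<close> and \<open>f <| w\<close> are the two
  whiskerings, and \<open>\<b>\<close> is the inverse associator.\<close>

no_notation (ASCII) comp (infixl \<open>o\<close> 55)
no_notation (ASCII) rtrancl (\<open>(\<open>notation=\<open>postfix *\<close>\<close>_^*)\<close> [1000] 999)
no_notation fps_nth (infixl \<open>$\<close> 75)
notation Ident (\<open>\<i>\<index>\<close>)
notation Comp (\<open>_ o\<index> _\<close> [56, 55] 55)
notation tensor_obj (infixr \<open>$\<index>\<close> 70)
notation dual_obj (\<open>_^*\<index>\<close> [1000] 1000)
notation arr_zero (\<open>\<z>\<index>\<close>)
notation simple_object (\<open>simple\<index>\<close>)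

abbreviation is_obj (\<open>obj\<index> _\<close> [1000] 50) where "obj\<^bsub>C\<^esub> x \<equiv> x \<in> Obj C"
abbreviation is_arr (\<open>arr\<index> _\<close> [1000] 50) where "arr\<^bsub>C\<^esub> f \<equiv> f \<in> Arr C"
abbreviation typed (\<open>_ :::\<index> _ ~> _\<close> [51, 51, 51] 50)
  where "f :::\<^bsub>C\<^esub> x ~> y \<equiv> f \<in> Arr C \<and> Dom C f = x \<and> Cod C f = y"
abbreviation inverse_associator (\<open>\<b>\<index>\<close>) where "\<b>\<^bsub>C\<^esub> x y z \<equiv> inv_arr C (associator C x y z)"
abbreviation left_whisker (infixr \<open>|>\<index>\<close> 70) where "x |>\<^bsub>C\<^esub> f \<equiv> tensor_arr C (Ident C x) f"
abbreviation right_whisker (infixr \<open><|\<index>\<close> 70) where "f <|\<^bsub>C\<^esub> x \<equiv> tensor_arr C f (Ident C x)"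

section \<open>Composites and whiskering\<close>

context category
begin

lemma hom_iff:"f : Hom x y \<longleftrightarrow> arr f \<and> Dom C f = x \<and> Cod C f = y" by (auto simp: hom_set_def)

lemma homD:"f : Hom x y ==> arr f" "f : Hom x y ==> Dom C f = x" "f : Hom x y ==> Cod C f = y" by (simp_all add: hom_iff)

lemma homI:"arr f ==> Dom C f = x ==> Cod C f = y ==> f : Hom x y" by (simp add: hom_iff)

lemma hom_obj:"f : Hom x y ==> obj x" "f : Hom x y ==> obj y" using dom_in cod_in by (auto simp: hom_iff)

lemmas obj_typ [simp] = dom_in cod_in

lemma ident_typ [simp]:
 assumes "obj x"
 shows "\<i> x ::: x ~> x" using ident_in[OF assms] by (auto simp: hom_iff)

lemma comp_typ [simp]:
 assumes "arr f" "arr g" "Dom C g = Cod C f"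
 shows "g o f \<in> Arr C" "Dom C (g o f) = Dom C f" "Cod C (g o f) = Cod C g"
 using comp_in[of f "Dom C f" "Cod C f" g "Cod C g"] assms by (auto simp: hom_iff)

lemma comp_ident_right [simp]:"arr f ==> Dom C f = x ==> f o \<i> x = f"
 and comp_ident_left [simp]:"arr f ==> Cod C f = x ==> \<i> x o f = f" by (auto intro: comp_ident ident_comp simp: hom_iff)

lemma comp_assoc_right [simp]:
 "[|arr f; arr g; arr h; Dom C g = Cod C f; Dom C h = Cod C g|]
  ==> (h o g) o f = h o (g o f)" by (rule comp_assoc) (auto simp: hom_iff)

text \<open>Composites are kept associated to the right; this extends an equation between two-step composites to
  one inside a longer composite.\<close>
lemma tail:
 assumes "b o a = c" "arr a" "arr b" "Dom C b = Cod C a" "arr r" "Dom C a = Cod C r"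
 shows "b o (a o r) = c o r" using comp_assoc_right[of r a b] assms by simp

lemma tail3:
 assumes "c o (b o a) = d" "arr a" "arr b" "arr c" "Dom C b = Cod C a" "Dom C c = Cod C b"
  "arr r" "Dom C a = Cod C r"
 shows "c o (b o (a o r)) = d o r"
proof -
 have "c o (b o (a o r))=(c o (b o a)) o r" using assms(2-) by simp
 then show ?thesis using assms(1) by simp
qed

lemma inverse_arrows_unique:
 assumes "inverse_arrows C f g" "inverse_arrows C f h"
 shows "g = h"
proof -
 have g:"arr g" "Dom C g=Cod C f" "Cod C g=Dom C f" "arr f"
  "g o f = \<i> (Dom C f)" using assms(1) by (auto simp: inverse_arrows_def hom_iff)
 have h:"arr h" "Dom C h=Cod C f" "Cod C h=Dom C f" "f o h=\<i> (Cod C f)"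
  using assms(2) by (auto simp: inverse_arrows_def hom_iff)
 have "g=g o (f o h)" unfolding h(4) using g h by simp
 also have "...=(g o f) o h" using comp_assoc_right[of h f g] g h by simp
 also have "...=h" unfolding g(5) using g h by simp
 finally show ?thesis .
qed

lemma inv_arrI:
 assumes "arr f" "arr g" "Dom C g = Cod C f" "Cod C g = Dom C f"
  "g o f = \<i> (Dom C f)" "f o g = \<i> (Cod C f)"
 shows "iso_arr C f" (is ?P1) "Inv f = g"
proof -
 have *:"inverse_arrows C f g" using assms by (simp add: inverse_arrows_def hom_iff)
 then show ?P1 by (auto simp: iso_arr_def)
 show "Inv f=g" unfolding inv_arr_def using * inverse_arrows_unique by (blast intro: the_equality)
qed

lemma inverse_arrows_inv:"iso_arr C f ==> inverse_arrows C f (Inv f)"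
 unfolding iso_arr_def inv_arr_def using inverse_arrows_unique by (blast intro: theI2)

lemma inv_typ [simp]:
 assumes "iso_arr C f"
 shows "Inv f ::: Cod C f ~> Dom C f"
 using inverse_arrows_inv[OF assms] by (auto simp: inverse_arrows_def hom_iff)

lemma iso_arr_in [simp]:"iso_arr C f ==> arr f" by (auto simp: iso_arr_def inverse_arrows_def)

lemma inv_comp [simp]:
 assumes "iso_arr C f"
 shows "Inv f o f = \<i> (Dom C f)" "f o Inv f = \<i> (Cod C f)"
 using inverse_arrows_inv[OF assms] by (auto simp: inverse_arrows_def hom_iff)

lemma inv_comp_tail [simp]:
 assumes "iso_arr C f" "arr r"
 shows "Cod C r = Dom C f ==> Inv f o (f o r) = r" "Cod C r = Cod C f ==> f o (Inv f o r) = r"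
 using tail[OF inv_comp(1)[OF assms(1)], of r] tail[OF inv_comp(2)[OF assms(1)], of r] assms by simp_all

lemma iso_cancel_left:
 assumes "iso_arr C f" "arr g" "arr h" "Cod C g = Dom C f" "Cod C h = Dom C f" "f o g = f o h"
 shows "g = h"
proof -
 have "Inv f o f o g=Inv f o f o h" using assms by simp
 then show ?thesis using assms(1-5) by simp
qed

lemma iso_cancel_right:
 assumes "iso_arr C f" "arr g" "arr h" "Dom C g = Cod C f" "Dom C h = Cod C f" "g o f = h o f"
 shows "g = h"
proof -
 have "(g o f) o Inv f=(h o f) o Inv f" using assms by simp
 then show ?thesis using assms(1-5) by simp
qed

lemma inv_inv [simp]:"iso_arr C f ==> Inv (Inv f) = f" "iso_arr C f ==> iso_arr C (Inv f)" using inv_arrI[of "Inv f" f] by auto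

lemma comp_iso:
 assumes "iso_arr C f" "iso_arr C g" "Dom C g = Cod C f"
 shows "iso_arr C (g o f)" "Inv (g o f) = Inv f o Inv g" using inv_arrI[of "g o f" "Inv f o Inv g"] assms by auto

end

context monoidal_category
begin

lemma tensor_obj_typ [simp]:"obj x ==> obj y ==> x$y \<in> Obj C" by (rule tensor_obj_in)

lemmas unit_typ [simp] = unit_in

lemma tensor_typ [simp]:
 assumes "arr f" "arr g"
 shows "f \<boxdot> g ::: Dom C f$Dom C g ~> Cod C f$Cod C g"
 using tensor_arr_in[of f "Dom C f" "Cod C f" g "Dom C g" "Cod C g"] assms by (auto simp: hom_iff)

lemmas tensor_ident' [simp] = tensor_ident

lemma tensor_comp':
 "[|arr f; arr f'; arr g; arr g'; Dom C f' = Cod C f; Dom C g' = Cod C g|]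
  ==> (f' o f) \<boxdot> (g' o g) = f' \<boxdot> g' o f \<boxdot> g" by (rule tensor_comp) (auto simp: hom_iff)

lemma whisker_comp [simp]:
 assumes "arr f" "arr g" "Dom C g = Cod C f" "obj x"
 shows "x|>(g o f) = x|>g o x|>f" "(g o f)<|x = g<|x o f<|x"
 using tensor_comp'[of "\<i> x" "\<i> x" f g] tensor_comp'[of f g "\<i> x" "\<i> x"] assms by auto

lemma tensor_split:
 assumes "arr f" "arr g"
 shows "f \<boxdot> g = f<|(Cod C g) o (Dom C f)|>g" using tensor_comp'[of "\<i> (Dom C f)" f g "\<i> (Cod C g)"] assms by simp

lemma interchange:
 assumes "arr f" "arr g" "Dom C f = x" "Cod C f = y" "Dom C g = w" "Cod C g = v"
 shows "f<|v o x|>g = y|>g o f<|w"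
proof -
 have "obj x" "obj y" "obj w" "obj v" using assms by auto
 then show ?thesis using tensor_comp'[of "\<i> x" f g "\<i> v"] tensor_comp'[of f "\<i> y" "\<i> w" g] assms by simp
qed

lemma iso_tensor:
 assumes "iso_arr C f" "iso_arr C g"
 shows "iso_arr C (f \<boxdot> g)" "Inv (f \<boxdot> g) = Inv f \<boxdot> Inv g"
 using inv_arrI[of "f \<boxdot> g" "Inv f \<boxdot> Inv g"] assms by (simp_all add: tensor_comp'[symmetric])

lemma iso_ident [simp]:"obj x ==> iso_arr C (\<i> x)" "obj x ==> Inv (\<i> x) = \<i> x"
 using inv_arrI[of "\<i> x" "\<i> x"] by auto

lemma whisker_inv [simp]:
 assumes "iso_arr C f" "obj x"
 shows "iso_arr C (x|>f)" "iso_arr C (f<|x)"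
  "Inv (x|>f) = x|>Inv f" "Inv (f<|x) = Inv f<|x" using iso_tensor[of "\<i> x" f] iso_tensor[of f "\<i> x"] assms by auto

lemma whisker_inv_comp [simp]:
 assumes "iso_arr C f" "obj x"
 shows "x|>f o x|>Inv f = \<i> (x$Cod C f)"
  "x|>Inv f o x|>f = \<i> (x$Dom C f)"
  "f<|x o Inv f<|x = \<i> (Cod C f$x)"
  "Inv f<|x o f<|x = \<i> (Dom C f$x)" using inv_comp[of "x|>f"] inv_comp[of "f<|x"] assms by (simp_all del: inv_comp)

lemma whisker_inv_tail [simp]:
 assumes "iso_arr C f" "obj x" "arr r"
 shows "Cod C r = x$Cod C f ==> (x|>f) o x|>Inv f o r = r"
  "Cod C r = x$Dom C f ==> (x|>Inv f) o x|>f o r = r"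
  "Cod C r = Cod C f$x ==> (f<|x) o Inv f<|x o r = r"
  "Cod C r = Dom C f$x ==> (Inv f<|x) o f<|x o r = r" using inv_comp_tail[of "x|>f" r] inv_comp_tail[of "f<|x" r] assms
 by (simp_all del: inv_comp_tail)

lemma whisker2_inv [simp]:
 assumes "iso_arr C f" "obj x" "obj y"
 shows "x|>y|>f o x|>y|>Inv f = \<i> (x$y$Cod C f)"
  "x|>y|>Inv f o x|>y|>f = \<i> (x$y$Dom C f)"
  "x|>f<|y o x|>Inv f<|y = \<i> (x$Cod C f$y)"
  "x|>Inv f<|y o x|>f<|y = \<i> (x$Dom C f$y)" using whisker_inv_comp(1,2)[of "y|>f" x] whisker_inv_comp(1,2)[of "f<|y" x] assms
 by (simp_all del: whisker_inv_comp)

lemmas whisker2_inv_tail [simp] = whisker2_inv[THEN tail]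

lemma associator_typ [simp]:
 assumes "obj x" "obj y" "obj z"
 shows "\<a> x y z ::: (x$y)$z ~> x$y$z"
  "iso_arr C (\<a> x y z)" using associator_in[OF assms] associator_iso[OF assms] by (auto simp: hom_iff)

lemma left_unitor_typ [simp]:
 assumes "obj x"
 shows "\<l> x ::: \<I>$x ~> x" "iso_arr C (\<l> x)"
 using left_unitor_in[OF assms] left_unitor_iso[OF assms] by (auto simp: hom_iff)

lemma right_unitor_typ [simp]:
 assumes "obj x"
 shows "\<r> x ::: x$\<I> ~> x" "iso_arr C (\<r> x)"
 using right_unitor_in[OF assms] right_unitor_iso[OF assms] by (auto simp: hom_iff)

lemma associator_natural':
 "[|arr f; arr g; arr h; Dom C f = x; Cod C f = x'; Dom C g = y; Cod C g = y'; Dom C h = z; Cod C h = z'|]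
  ==> \<a> x' y' z' o (f \<boxdot> g) \<boxdot> h = f \<boxdot> (g \<boxdot> h) o \<a> x y z"
 by (rule associator_natural) (auto simp: hom_iff)

lemma left_unitor_natural':
 "[|arr f; Dom C f = x; Cod C f = y|] ==> \<l> y o \<I>|>f = f o \<l> x" by (rule left_unitor_natural) (auto simp: hom_iff)

lemma right_unitor_natural':
 "[|arr f; Dom C f = x; Cod C f = y|] ==> \<r> y o f<|\<I> = f o \<r> x" by (rule right_unitor_natural) (auto simp: hom_iff)

lemma assoc_conj:
 assumes "arr f" "arr g" "arr h"
 shows "(f \<boxdot> g) \<boxdot> h =
  \<b> (Cod C f) (Cod C g) (Cod C h) o f \<boxdot> (g \<boxdot> h) o \<a> (Dom C f) (Dom C g) (Dom C h)"
 using associator_natural'[OF assms refl refl refl refl refl refl, symmetric] assms by simp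

lemma assoc_conj_ident:
 assumes "arr f" "obj x" "obj y"
 shows "(x$y)|>f = \<b> x y (Cod C f) o x|>y|>f o \<a> x y (Dom C f)"
 using assoc_conj[of "\<i> x" "\<i> y" f] assms by simp

lemma unit_whisker:
 assumes "arr f"
 shows "\<I>|>f = Inv (\<l> (Cod C f)) o f o \<l> (Dom C f)" using left_unitor_natural'[OF assms refl refl, symmetric] assms by simp

lemma unit_whisker_cancel:
 assumes "\<I>|>f = \<I>|>g" "f : Hom x y" "g : Hom x y"
 shows "f = g"
proof -
 have "\<l> y o \<I>|>f=\<l> y o \<I>|>g" using assms by simp
 then have "f o \<l> x=g o \<l> x" using left_unitor_natural[OF assms(2)] left_unitor_natural[OF assms(3)] by simp
 then show ?thesis using iso_cancel_right[of "\<l> x" f g] assms hom_obj[OF assms(2)] by (simp add: hom_iff)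
qed

lemma right_unitor_whisker:"obj x ==> obj w ==> \<r> x<|w = x|>\<l> w o \<a> x \<I> w" using triangle by simp

text \<open>These rules pull an arrow tensored with an object past the brackets, so that simplification ends in
  right-nested form.\<close>
lemma associator_whisker:
 assumes "obj x" "obj y" "obj z" "obj w"
 shows "\<a> x y z<|w
  = \<b> x (y$z) w o x|>\<b> y z w o \<a> x y (z$w) o \<a> (x$y) z w" using pentagon[OF assms, symmetric] assms by simp

lemma left_unitor_whisker:
 assumes "obj x" "obj w"
 shows "\<l> x<|w = \<l> (x$w) o \<a> \<I> x w"
proof -
 have 1:"\<r> \<I><|x=\<I>|>\<l> x o \<a> \<I> \<I> x" using triangle[of \<I> x] assms by simp
 have "\<I>|>(\<l> (x$w) o \<a> \<I> x w) o \<a> \<I> (\<I>$x) w o \<a> \<I> \<I> x<|w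
   = (\<I>|>\<l> (x$w) o \<a> \<I> \<I> (x$w)) o \<a> (\<I>$\<I>) x w" using pentagon[of \<I> \<I> x w] assms by simp
 also have "...=\<r> \<I><|(x$w) o \<a> (\<I>$\<I>) x w" using triangle[of \<I> "x$w"] assms by simp
 also have "...=\<a> \<I> x w o (\<r> \<I><|x)<|w" using associator_natural'[of "\<r> \<I>" "\<i> x" "\<i> w"] assms by simp
 also have "...=(\<a> \<I> x w o (\<I>|>\<l> x)<|w) o \<a> \<I> \<I> x<|w" unfolding 1 using assms by simp
 also have "...=\<I>|>\<l> x<|w o \<a> \<I> (\<I>$x) w o \<a> \<I> \<I> x<|w"
  using associator_natural'[of "\<i> \<I>" "\<l> x" "\<i> w"] assms by simp
 finally have 2:"\<I>|>(\<l> (x$w) o \<a> \<I> x w) o (\<a> \<I> (\<I>$x) w o \<a> \<I> \<I> x<|w)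
  = \<I>|>\<l> x<|w o (\<a> \<I> (\<I>$x) w o \<a> \<I> \<I> x<|w)" .
 have "\<I>|>(\<l> (x$w) o \<a> \<I> x w)=\<I>|>\<l> x<|w"
  by (rule iso_cancel_right[OF _ _ _ _ _ 2]) (use assms in \<open>simp_all add: comp_iso\<close>)
 from unit_whisker_cancel[OF this, of "(\<I>$x)$w" "x$w"] show ?thesis using assms by (simp add: hom_iff)
qed

lemma inv_whisker:
 assumes "obj x" "obj w"
 shows "Inv (\<l> x)<|w = \<b> \<I> x w o Inv (\<l> (x$w))" (is ?P1)
  "Inv (\<r> x)<|w = \<b> x \<I> w o x|>Inv (\<l> w)" (is ?P2)
proof -
 have "Inv (\<l> x)<|w=Inv (\<l> x<|w)" "Inv (\<r> x)<|w=Inv (\<r> x<|w)" using assms by simp_all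
 then show ?P1
  ?P2 unfolding left_unitor_whisker[OF assms] right_unitor_whisker[OF assms]
  using assms by (simp_all add: comp_iso)
qed

lemma inv_associator_whisker:
 assumes "obj x" "obj y" "obj z" "obj w"
 shows "\<b> x y z<|w
  = \<b> (x$y) z w o \<b> x y (z$w) o x|>\<a> y z w o \<a> x (y$z) w"
proof -
 have "\<b> x y z<|w=Inv (\<a> x y z<|w)" using assms by simp
 then show ?thesis unfolding associator_whisker[OF assms] using assms by (simp add: comp_iso)
qed

lemmas spread = assoc_conj assoc_conj_ident unit_whisker right_unitor_whisker left_unitor_whisker
 associator_whisker inv_associator_whisker inv_whisker

text \<open>Tensoring with the unit object is an equivalence, so the tail \<open>\<I>\<close> already suffices;
  the universal form matches what right-nested calculations deliver.\<close>
lemma eq_by_tail: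
 assumes "f : Hom x y" "g : Hom x y" "!!w. w \<in> Obj C ==> f<|w = g<|w"
 shows "f = g"
proof -
 have "\<r> y o f<|\<I>=\<r> y o g<|\<I>" using assms by simp
 then have "f o \<r> x=g o \<r> x" using right_unitor_natural[OF assms(1)] right_unitor_natural[OF assms(2)] by simp
 then show ?thesis using iso_cancel_right[of "\<r> x" f g] assms hom_obj[OF assms(1)] by (simp add: hom_iff)
qed

text \<open>Right-nested form of an arrow \<open>x \<otimes> y \<rightarrow> x' \<otimes> y'\<close> acting in
  front of a tail.\<close>
definition hat ::"'o => 'o => 'o => 'o => 'm => 'o => 'm" where
 "hat x y x' y' f w = \<a> x' y' w o f<|w o \<b> x y w"

lemma hat_typ [simp]:
 assumes "f : Hom (x$y) (x'$y')" "obj x" "obj y" "obj x'" "obj y'" "obj w"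
 shows "hat x y x' y' f w ::: x$y$w ~> x'$y'$w" using assms unfolding hat_def hom_iff by auto

lemma hat_natural:
 assumes f:"f : Hom (x$y) (x'$y')" and o:"obj x" "obj y" "obj x'" "obj y'"
  and g:"arr g" "Dom C g = w" "Cod C g = v"
 shows "hat x y x' y' f v o x|>y|>g = x'|>y'|>g o hat x y x' y' f w"
proof -
 have wv:"obj w" "obj v" using g by auto
 have f':"f ::: x$y ~> x'$y'" using f by (auto simp: hom_iff)
 have "hat x y x' y' f v o x|>y|>g=\<a> x' y' v o (f<|v o (x$y)|>g) o \<b> x y w"
  using f' o g wv by (simp add: hat_def assoc_conj_ident)
 also have "...=\<a> x' y' v o ((x'$y')|>g o f<|w) o \<b> x y w" using f' g interchange[of f g] by simp
 also have "...=x'|>y'|>g o hat x y x' y' f w" using f' o g wv by (simp add: hat_def assoc_conj_ident)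
 finally show ?thesis .
qed

lemma hat_comp:
 assumes "f : Hom (x$y) (x'$y')" "g : Hom (x'$y') (x''$y'')"
  "obj x" "obj y" "obj x'" "obj y'" "obj x''" "obj y''" "obj w"
 shows "hat x' y' x'' y'' g w o hat x y x' y' f w = hat x y x'' y'' (g o f) w" using assms by (simp add: hat_def hom_iff)

lemma hat_ident:"obj x ==> obj y ==> obj w ==> hat x y x y (\<i> (x$y)) w = \<i> (x$y$w)" by (simp add: hat_def)

lemma hat_unfold:
 assumes "f : Hom (x$y) (x'$y')" "obj x" "obj y" "obj x'" "obj y'" "obj w"
 shows "f<|w = \<b> x' y' w o hat x y x' y' f w o \<a> x y w" using assms by (simp add: hat_def hom_iff)

end

section \<open>Half-braidings in right-nested form\<close>

context symmetric_monoidal_category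
begin

lemma symmetry_typ [simp]:
 assumes "obj x" "obj y"
 shows "\<s> x y \<in> Arr C" (is ?P1) "Dom C (\<s> x y) = x$y" (is ?P2) "Cod C (\<s> x y) = y$x" (is ?P3)
  "iso_arr C (\<s> x y)" (is ?P4) "Inv (\<s> x y) = \<s> y x" (is ?P5)
proof -
 show 1: ?P1 ?P2 ?P3 using symmetry_in[OF assms] by (auto simp: hom_iff)
 have 2:"\<s> y x \<in> Arr C" "Dom C (\<s> y x)=y$x" "Cod C (\<s> y x)=x$y" using symmetry_in[OF assms(2,1)] by (auto simp: hom_iff)
 show ?P4 ?P5
  using inv_arrI[of "\<s> x y" "\<s> y x"] symmetry_involutive[OF assms] symmetry_involutive[OF assms(2,1)] 1 2 by simp_all
qed

lemma symmetry_natural':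
 "[|arr f; arr g; Dom C f = x; Cod C f = x'; Dom C g = y; Cod C g = y'|]
  ==> \<s> x' y' o f \<boxdot> g = g \<boxdot> f o \<s> x y" by (rule symmetry_natural) (auto simp: hom_iff)

definition sw ::"'o => 'o => 'o => 'm" where
 "sw x y w = hat x y y x (\<s> x y) w"

lemma sw_typ [simp]:
 assumes "obj x" "obj y" "obj w"
 shows "sw x y w ::: x$y$w ~> y$x$w" using assms symmetry_in by (simp_all add: sw_def)

lemma sw_natural:
 assumes "obj x" "obj y" "arr g" "Dom C g = w" "Cod C g = v"
 shows "sw x y v o x|>y|>g = y|>x|>g o sw x y w" unfolding sw_def using hat_natural symmetry_in assms by simp

lemma sw_sw [simp]:
 assumes "obj x" "obj y" "obj w"
 shows "sw y x w o sw x y w = \<i> (x$y$w)" unfolding sw_def using hat_comp[OF symmetry_in symmetry_in] symmetry_involutive assms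
 by (simp add: hat_ident)

lemmas sw_sw_tail [simp] = sw_sw[THEN tail]

lemma sw_sw_whisker [simp]:
 assumes "obj x" "obj y" "obj w" "obj v"
 shows "v|>sw y x w o v|>sw x y w = \<i> (v$x$y$w)"
 using whisker_comp(1)[of "sw x y w" "sw y x w" v, symmetric] assms by (simp del: whisker_comp)

lemmas sw_sw_whisker_tail [simp] = sw_sw_whisker[THEN tail]

lemma sw_sw_whisker2 [simp]:
 assumes "obj x" "obj y" "obj w" "obj v" "obj u"
 shows "u|>v|>sw y x w o u|>v|>sw x y w = \<i> (u$v$x$y$w)"
 using whisker_comp(1)[of "v|>sw x y w" "v|>sw y x w" u, symmetric] assms by (simp del: whisker_comp)

lemmas sw_sw_whisker2_tail [simp] = sw_sw_whisker2[THEN tail]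

lemma sw_iso [simp]:
 assumes "obj x" "obj y" "obj w"
 shows "iso_arr C (sw x y w)" "Inv (sw x y w) = sw y x w" using inv_arrI[of "sw x y w" "sw y x w"] assms by simp_all

lemma sw_natural_left:
 assumes "obj y" "obj w" "arr f" "Dom C f = x" "Cod C f = x'"
 shows "sw x' y w o f<|(y$w) = y|>f<|w o sw x y w"
proof -
 have o:"obj x" "obj x'" using assms by auto
 have "\<a> y x' w o (\<s> x' y o f<|y)<|w o \<b> x y w
  = \<a> y x' w o (y|>f o \<s> x y)<|w o \<b> x y w" using symmetry_natural'[of f "\<i> y"] assms by simp
 then show ?thesis using assms o by (simp add: sw_def hat_def assoc_conj)
qed

lemma sw_natural_right:
 assumes "obj x" "obj w" "arr g" "Dom C g = y" "Cod C g = y'"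
 shows "sw x y' w o x|>g<|w = g<|(x$w) o sw x y w"
proof -
 have o:"obj y" "obj y'" using assms by auto
 have "\<a> y' x w o (\<s> x y' o x|>g)<|w o \<b> x y w
  = \<a> y' x w o (g<|x o \<s> x y)<|w o \<b> x y w" using symmetry_natural'[of "\<i> x" g] assms by simp
 then show ?thesis using assms o by (simp add: sw_def hat_def assoc_conj)
qed

lemma sw_tensor_right:
 assumes "obj x" "obj y" "obj z" "obj w"
 shows "sw x (y$z) w
  = \<b> y z (x$w) o y|>sw x z w o sw x y (z$w) o x|>\<a> y z w"
proof -
 have "(\<a> y z x o \<s> x (y$z) o \<a> x y z)<|w
   = (y|>\<s> x z o \<a> y x z o \<s> x y<|z)<|w" using hexagon assms by simp
 then have "\<b> y z (x$w) o y|>\<a> z x w o \<a> y (z$x) w o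
   ((\<a> y z x o \<s> x (y$z) o \<a> x y z)<|w) o \<b> (x$y) z w o \<b> x y (z$w)
   o x|>\<a> y z w
  = \<b> y z (x$w) o y|>\<a> z x w o \<a> y (z$x) w o
   ((y|>\<s> x z o \<a> y x z o \<s> x y<|z)<|w) o \<b> (x$y) z w
   o \<b> x y (z$w) o x|>\<a> y z w" by simp
 then show ?thesis using assms by (simp add: sw_def hat_def spread)
qed

lemma sw_tensor_left:
 assumes "obj x" "obj y" "obj z" "obj w"
 shows "sw (x$y) z w
  = z|>\<b> x y w o sw x z (y$w) o x|>sw y z w o \<a> x y (z$w)"
proof -
 have "sw (x$y) z w=Inv (sw z (x$y) w)" using assms by simp
 then show ?thesis unfolding sw_tensor_right[OF assms(3,1,2,4)] using assms by (simp add: comp_iso)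
qed

end

lemma (in rigid_symmetric_category) dual_typ [simp]:
 assumes "obj x"
 shows "x^* : Obj A" "ev A x ::: x$x^* ~> \<I>"
  "coev A x ::: \<I> ~> x^*$x" using dual_in ev_in coev_in assms by (auto simp: hom_iff)

context rigid_symmetric_category
begin

definition hb ::"'o => ('o => 'm) => bool" where
 "hb a H \<longleftrightarrow> obj a \<and> half_braiding A a H"

definition br ::"('o => 'm) => 'o => 'o => 'o => 'm" where
 "br H a b w = hat b a a b (H b) w"

definition rb ::"('o => 'm) => 'o => 'o => 'o => 'm" where
 "rb H a b w = hat a b b a (Inv (H b)) w"

lemma hb_obj:"hb a H ==> obj a" by (simp add: hb_def)

lemma hb_typ [simp]:
 assumes "hb a H" "obj b"
 shows "H b ::: b$a ~> a$b" "iso_arr A (H b)"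
 using assms unfolding hb_def half_braiding_def by (auto simp: hom_iff)

lemma hb_natural:
 assumes "hb a H" "arr f" "Dom A f = b" "Cod A f = b'"
 shows "H b' o f<|a = a|>f o H b" using assms unfolding hb_def half_braiding_def by auto

lemma hb_tensor:
 assumes "hb a H" "obj b" "obj b'"
 shows "H (b$b') = \<a> a b b' o H b<|b' o \<b> b a b' o b|>H b' o \<a> b b' a"
 using assms unfolding hb_def half_braiding_def by auto

lemma br_typ [simp]:
 assumes "hb a H" "obj b" "obj w"
 shows "br H a b w ::: b$a$w ~> a$b$w"
  "rb H a b w ::: a$b$w ~> b$a$w"
 using assms hb_obj[OF assms(1)] by (simp_all add: br_def rb_def hom_iff)

lemma br_rb [simp]:
 assumes "hb a H" "obj b" "obj w"
 shows "br H a b w o rb H a b w = \<i> (a$b$w)" "rb H a b w o br H a b w = \<i> (b$a$w)"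
 using assms hb_obj[OF assms(1)] by (simp_all add: br_def rb_def hat_comp hat_ident hom_iff)

lemmas br_rb_tail [simp] = br_rb[THEN tail]

lemma br_iso [simp]:
 assumes "hb a H" "obj b" "obj w"
 shows "iso_arr A (br H a b w)" "Inv (br H a b w) = rb H a b w"
  "iso_arr A (rb H a b w)" "Inv (rb H a b w) = br H a b w"
 using inv_arrI[of "br H a b w" "rb H a b w"] inv_arrI[of "rb H a b w" "br H a b w"] assms by simp_all

lemma br_rb_whisker [simp]:
 assumes "hb a H" "obj b" "obj w" "obj v"
 shows "v|>br H a b w o v|>rb H a b w = \<i> (v$a$b$w)"
  "v|>rb H a b w o v|>br H a b w = \<i> (v$b$a$w)" using whisker_inv_comp(1,2)[of "br H a b w" v] assms by simp_all

lemmas br_rb_whisker_tail [simp] = br_rb_whisker[THEN tail]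

lemma br_rb_whisker2 [simp]:
 assumes "hb a H" "obj b" "obj w" "obj v" "obj u"
 shows "u|>v|>br H a b w o u|>v|>rb H a b w = \<i> (u$v$a$b$w)"
  "u|>v|>rb H a b w o u|>v|>br H a b w = \<i> (u$v$b$a$w)" using whisker2_inv(1,2)[of "br H a b w" u v] assms by simp_all

lemmas br_rb_whisker2_tail [simp] = br_rb_whisker2[THEN tail]

lemma br_natural:
 assumes "hb a H" "obj b" "arr g" "Dom A g = w" "Cod A g = v"
 shows "br H a b v o b|>a|>g = a|>b|>g o br H a b w"
  "rb H a b v o a|>b|>g = b|>a|>g o rb H a b w"
 unfolding br_def rb_def using hat_natural assms hb_obj[OF assms(1)] by (simp_all add: hom_iff)

lemma br_natural_left:
 assumes "hb a H" "obj w" "arr f" "Dom A f = b" "Cod A f = b'"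
 shows "br H a b' w o f<|(a$w) = a|>f<|w o br H a b w"
proof -
 have o:"obj a" "obj b" "obj b'" using assms hb_obj by auto
 have "\<a> a b' w o (H b' o f<|a)<|w o \<b> b a w
  = \<a> a b' w o (a|>f o H b)<|w o \<b> b a w" using hb_natural[OF assms(1,3-5)] by simp
 then show ?thesis using assms o by (simp add: br_def hat_def assoc_conj)
qed

lemma br_tensor:
 assumes "hb a H" "obj b" "obj b'" "obj w"
 shows "br H a (b$b') w
  = a|>\<b> b b' w o br H a b (b'$w) o b|>br H a b' w o \<a> b b' (a$w)"
proof -
 have o:"obj a" using assms hb_obj by auto
 show ?thesis using assms o by (simp add: br_def hat_def hb_tensor spread)
qed

text \<open>The tensor law at \<open>b = b' = \<I>\<close> makes the component at the unit idempotent up to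
  unitors; being invertible, it is trivial.\<close>
lemma br_unit:
 assumes h:"hb a H" and w:"obj w"
 shows "a|>\<l> w o br H a \<I> w = \<l> (a$w)"
proof -
 have a:"obj a" using h hb_obj by auto
 have u:"\<I>|>\<l> y=\<l> (\<I>$y)" if "obj y" for y using that by (simp add: unit_whisker)
 have "a|>\<l> \<I><|w o br H a (\<I>$\<I>) w=br H a \<I> w o \<l> \<I><|(a$w)" using br_natural_left[OF h w, of "\<l> \<I>"] by simp
 then have "a|>\<l> (\<I>$w) o br H a \<I> (\<I>$w) o \<I>|>br H a \<I> w o \<a> \<I> \<I> (a$w)
   = br H a \<I> w o \<l> (\<I>$(a$w)) o \<a> \<I> \<I> (a$w)" using h w a by (simp add: left_unitor_whisker br_tensor)
 then have "(a|>\<l> (\<I>$w) o br H a \<I> (\<I>$w) o \<I>|>br H a \<I> w) o \<a> \<I> \<I> (a$w)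
   = (br H a \<I> w o \<l> (\<I>$(a$w))) o \<a> \<I> \<I> (a$w)" using h w a by simp
 from iso_cancel_right[OF _ _ _ _ _ this]
 have "a|>\<l> (\<I>$w) o br H a \<I> (\<I>$w) o \<I>|>br H a \<I> w
   = br H a \<I> w o \<l> (\<I>$(a$w))" using h w a by simp
 moreover have "br H a \<I> w o \<I>|>a|>\<l> w=a|>\<l> (\<I>$w) o br H a \<I> (\<I>$w)"
  using br_natural(1)[OF h, of \<I> "\<l> w"] w u[OF w] by simp
 note this[THEN tail]
 ultimately have "br H a \<I> w o \<I>|>(a|>\<l> w o br H a \<I> w)=br H a \<I> w o \<I>|>\<l> (a$w)" using h w a u by simp
 from iso_cancel_left[OF _ _ _ _ _ this]
 have "\<I>|>(a|>\<l> w o br H a \<I> w)=\<I>|>\<l> (a$w)" using h w a by simp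
 from unit_whisker_cancel[OF this, of "\<I>$a$w" "a$w"] show ?thesis using h w a by (simp add: hom_iff)
qed

text \<open>A half-braiding can be recognized on right-nested arrows, by cancelling the tail.\<close>
lemma hbI:
 assumes a:"obj a" and ext:"H \<in> extensional (Obj A)"
  and ty:"!!b. b : Obj A ==> H b : Hom (b$a) (a$b)"
  and iso:"!!b. b : Obj A ==> iso_arr A (H b)"
  and nat:"!!f w. f : Arr A ==> obj w ==>
   br H a (Cod A f) w o f<|(a$w) = a|>f<|w o br H a (Dom A f) w"
  and ten:"!!b b' w. b : Obj A ==> obj b' ==> obj w ==>
   (a|>\<a> b b' w) o br H a (b$b') w = br H a b (b'$w) o b|>br H a b' w o \<a> b b' (a$w)"
 shows "hb a H" unfolding hb_def half_braiding_def
proof (intro conjI ballI a ext)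
 have t:"H b ::: b$a ~> a$b" if "obj b" for b using ty[OF that] by (auto simp: hom_iff)
 show "H b : Hom (b$a) (a$b)" "iso_arr A (H b)" if "obj b" for b using ty iso that by auto
 show "H (Cod A f) o f<|a=a|>f o H (Dom A f)" if f:"arr f" for f
 proof (rule eq_by_tail)
  show "H (Cod A f) o (f<|a) : Hom (Dom A f$a) (a$Cod A f)"
   "a|>f o H (Dom A f) : Hom (Dom A f$a) (a$Cod A f)" using t f a by (simp_all add: hom_iff)
  fix w assume w:"obj w"
  have "\<b> a (Cod A f) w o (br H a (Cod A f) w o f<|(a$w)) o \<a> (Dom A f) a w
   = \<b> a (Cod A f) w o (a|>f<|w o br H a (Dom A f) w) o \<a> (Dom A f) a w" using nat[OF f w] by simp
  then show "(H (Cod A f) o f<|a)<|w=(a|>f o H (Dom A f))<|w" using t f a w by (simp add: br_def hat_def assoc_conj)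
 qed
 show "H (b$b')=\<a> a b b' o H b<|b' o \<b> b a b' o b|>H b' o \<a> b b' a"
  if b:"obj b" "obj b'" for b b'
 proof (rule eq_by_tail)
  show "H (b$b') : Hom ((b$b')$a) (a$b$b')" using ty b by simp
  show "\<a> a b b' o H b<|b' o \<b> b a b' o b|>H b' o \<a> b b' a : Hom ((b$b')$a) (a$b$b')"
   using t b a by (simp add: hom_iff)
  fix w assume w:"obj w"
  have "\<b> a (b$b') w o a|>\<b> b b' w o (a|>\<a> b b' w o br H a (b$b') w) o \<a> (b$b') a w
   = \<b> a (b$b') w o a|>\<b> b b' w o (br H a b (b'$w) o b|>br H a b' w o \<a> b b' (a$w)) o \<a> (b$b') a w"
   using ten[OF b w] by simp
  then show "H (b$b')<|w
   = (\<a> a b b' o H b<|b' o \<b> b a b' o b|>H b' o \<a> b b' a)<|w" using t b a w by (simp add: br_def hat_def spread)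
 qed
qed

definition trs ::"'o => 'o => 'm" where
 "trs a = (\<lambda>b \<in> Obj A. \<s> b a)"

lemma br_trs [simp]:"obj b ==> obj a ==> br (trs a) a b w = sw b a w"
 "obj b ==> obj a ==> rb (trs a) a b w = sw a b w" by (simp_all add: br_def rb_def sw_def trs_def)

lemma hb_trs [simp]:"obj a ==> hb a (trs a)"
proof (rule hbI)
 assume a:"obj a"
 show "trs a \<in> extensional (Obj A)" by (simp add: trs_def)
 show "trs a b : Hom (b$a) (a$b)" "iso_arr A (trs a b)" if "obj b" for b using that a by (simp_all add: trs_def hom_iff)
 show "br (trs a) a (Cod A f) w o f<|(a$w)=a|>f<|w o br (trs a) a (Dom A f) w"
  if "arr f" "obj w" for f w using sw_natural_left[of a w f] that a by simp
 show "a|>\<a> b b' w o br (trs a) a (b$b') w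
  = br (trs a) a b (b'$w) o b|>br (trs a) a b' w o \<a> b b' (a$w)"
  if "obj b" "obj b'" "obj w" for b b' w using that a by (simp add: sw_tensor_left)
qed

text \<open>The laws of a half-braiding with the unit law in place of invertibility. For the symmetric unit only
  these can be verified directly; rigidity then supplies the inverse.\<close>
definition lax ::"'o => ('o => 'm) => bool" where
 "lax a H \<longleftrightarrow> obj a \<and> (\<forall>b \<in> Obj A. H b : Hom (b$a) (a$b)) \<and>
   (\<forall>f \<in> Arr A. \<forall>w \<in> Obj A.
   br H a (Cod A f) w o f<|(a$w) = a|>f<|w o br H a (Dom A f) w) \<and>
   (\<forall>b \<in> Obj A. \<forall>b' \<in> Obj A. \<forall>w \<in> Obj A. (a|>\<a> b b' w) o br H a (b$b') w
   = br H a b (b'$w) o b|>br H a b' w o \<a> b b' (a$w)) \<and>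
   (\<forall>w \<in> Obj A. (a|>\<l> w) o br H a \<I> w = \<l> (a$w))"

lemma lax_obj:"lax a H ==> obj a" by (simp add: lax_def)

lemma hb_lax [simp]:"hb a H ==> lax a H" unfolding lax_def using br_natural_left br_unit hb_obj by (auto simp: hom_iff br_tensor)

lemma lax_typ [simp]:
 assumes "lax a H" "obj b" "obj w"
 shows "br H a b w ::: b$a$w ~> a$b$w" using assms by (simp_all add: br_def lax_def)

lemma lax_natural:
 assumes "lax a H" "obj b" "arr g" "Dom A g = w" "Cod A g = v"
 shows "br H a b v o b|>a|>g = a|>b|>g o br H a b w" unfolding br_def using hat_natural assms by (simp add: lax_def)

lemma lax_natural_left:
 assumes "lax a H" "obj w" "arr f" "Dom A f = b" "Cod A f = b'"
 shows "br H a b' w o f<|(a$w) = a|>f<|w o br H a b w" using assms by (auto simp: lax_def)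

lemma lax_tensor:
 assumes "lax a H" "obj b" "obj b'" "obj w"
 shows "br H a (b$b') w
  = a|>\<b> b b' w o br H a b (b'$w) o b|>br H a b' w o \<a> b b' (a$w)"
proof -
 have a:"obj a" using assms lax_obj by auto
 have "a|>\<b> b b' w o (a|>\<a> b b' w o br H a (b$b') w)
  = a|>\<b> b b' w o br H a b (b'$w) o b|>br H a b' w o \<a> b b' (a$w)" using assms by (simp add: lax_def)
 then show ?thesis using assms a by simp
qed

lemma lax_unit:
 assumes "lax a H" "obj w"
 shows "a|>\<l> w o br H a \<I> w = \<l> (a$w)" using assms by (simp add: lax_def)

lemmas lax_unit_tail = lax_unit[THEN tail]

text \<open>Naturality of a half-braiding in its parameter, applied to the symmetry.\<close>
lemma br_yang_baxter:
 assumes h:"lax a H" and o:"obj x" "obj y" "obj w"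
 shows "a|>sw x y w o br H a x (y$w) o x|>br H a y w
  = br H a y (x$w) o y|>br H a x w o sw x y (a$w)"
proof -
 have a:"obj a" using h lax_obj by auto
 have "a|>\<a> y x w o (br H a (y$x) w o \<s> x y<|(a$w)) o \<b> x y (a$w)
   = a|>\<a> y x w o (a|>\<s> x y<|w o br H a (x$y) w) o \<b> x y (a$w)" using lax_natural_left[OF h o(3), of "\<s> x y"] o by simp
 then show ?thesis using h o a by (simp add: lax_tensor sw_def hat_def)
qed

text \<open>Naturality of the symmetry against the components of a half-braiding.\<close>
lemma sw_yang_baxter:
 assumes "obj x" "obj y" "obj z" "obj w"
 shows "z|>sw x y w o sw x z (y$w) o x|>sw y z w
  = sw y z (x$w) o y|>sw x z w o sw x y (z$w)" using br_yang_baxter[of z "trs z" x y w] assms by simp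

definition cap ::"'o => 'o => 'm" where
 "cap x w = \<l> w o ev A x<|w o \<b> x x^* w"

definition cup ::"'o => 'o => 'm" where
 "cup x w = \<a> x^* x w o coev A x<|w o Inv (\<l> w)"

definition cap' ::"'o => 'o => 'm" where
 "cap' x w = cap x w o sw x^* x w"

definition cup' ::"'o => 'o => 'm" where
 "cup' x w = sw x^* x w o cup x w"

lemma cap_typ [simp]:
 assumes "obj x" "obj w"
 shows "cap x w ::: x$x^*$w ~> w"
  "cup x w ::: w ~> x^*$x$w"
  "cap' x w ::: x^*$x$w ~> w"
  "cup' x w ::: w ~> x$x^*$w"
 using assms by (simp_all add: cap_def cup_def cap'_def cup'_def)

lemma cap_natural:
 assumes x:"obj x" and g:"arr g" "Dom A g = w" "Cod A g = v"
 shows "cap x v o x|>x^*|>g = g o cap x w"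
proof -
 have o:"obj w" "obj v" using g by auto
 have "cap x v o x|>x^*|>g
  = \<l> v o (ev A x<|v o (x$x^*)|>g) o \<b> x x^* w" using x g o by (simp add: cap_def assoc_conj_ident)
 also have "...=\<l> v o (\<I>|>g o ev A x<|w) o \<b> x x^* w" using x g interchange[of "ev A x" g] by simp
 also have "...=g o cap x w" using x g o by (simp add: cap_def unit_whisker)
 finally show ?thesis .
qed

lemma cup_natural:
 assumes x:"obj x" and g:"arr g" "Dom A g = w" "Cod A g = v"
 shows "x^*|>x|>g o cup x w = cup x v o g"
proof -
 have o:"obj w" "obj v" using g by auto
 have "x^*|>x|>g o cup x w
  = \<a> x^* x v o ((x^*$x)|>g o coev A x<|w) o Inv (\<l> w)" using x g o by (simp add: cup_def assoc_conj_ident)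
 also have "...=\<a> x^* x v o (coev A x<|v o \<I>|>g) o Inv (\<l> w)" using x g interchange[of "coev A x" g] by simp
 also have "...=cup x v o g" using x g o by (simp add: cup_def unit_whisker)
 finally show ?thesis .
qed

lemma cap'_natural:
 assumes x:"obj x" and g:"arr g" "Dom A g = w" "Cod A g = v"
 shows "cap' x v o x^*|>x|>g = g o cap' x w"
proof -
 have o:"obj w" "obj v" using g by auto
 show ?thesis using x g o cap_natural[OF x g, THEN tail] by (simp add: cap'_def sw_natural)
qed

lemma cup'_natural:
 assumes x:"obj x" and g:"arr g" "Dom A g = w" "Cod A g = v"
 shows "x|>x^*|>g o cup' x w = cup' x v o g"
proof -
 have o:"obj w" "obj v" using g by auto
 show ?thesis using x g o cup_natural[OF x g] sw_natural[of "x^*" x g, symmetric, THEN tail] by (simp add: cup'_def)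
qed

text \<open>Tensor law followed by naturality at the evaluation: a cap slides off the strand
  \<open>a\<close>.\<close>
lemma br_cap:
 assumes h:"lax a H" and o:"obj x" "obj w"
 shows "a|>cap x w o br H a x (x^*$w) o x|>br H a x^* w = cap x (a$w)"
proof -
 have a:"obj a" using h lax_obj by auto
 have "a|>\<l> w o (br H a \<I> w o ev A x<|(a$w)) o \<b> x x^* (a$w)
  = a|>\<l> w o (a|>ev A x<|w o br H a (x$x^*) w) o \<b> x x^* (a$w)" using lax_natural_left[OF h o(2), of "ev A x"] o by simp
 then show ?thesis using h o a by (simp add: lax_tensor cap_def lax_unit_tail)
qed

lemma br_cup:
 assumes h:"lax a H" and o:"obj x" "obj w"
 shows "br H a x^* (x$w) o x^*|>br H a x w o cup x (a$w) = a|>cup x w"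
proof -
 have a:"obj a" using h lax_obj by auto
 have u:"br H a \<I> w o Inv (\<l> (a$w))=a|>Inv (\<l> w)"
 proof -
  have "br H a \<I> w=a|>Inv (\<l> w) o (a|>\<l> w o br H a \<I> w)" using h o a by simp
  then show ?thesis unfolding lax_unit[OF h o(2)] using h o a by simp
 qed
 have "a|>\<a> x^* x w o (a|>coev A x<|w o br H a \<I> w) o Inv (\<l> (a$w))
   = a|>\<a> x^* x w o (br H a (x^*$x) w o coev A x<|(a$w)) o Inv (\<l> (a$w))"
  using lax_natural_left[OF h o(2), of "coev A x"] o by simp
 then show ?thesis using h o a by (simp add: lax_tensor cup_def u)
qed

lemma br_cap':
 assumes h:"lax a H" and o:"obj x" "obj w"
 shows "a|>cap' x w o br H a x^* (x$w) o x^*|>br H a x w = cap' x (a$w)"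
proof -
 have a:"obj a" using h lax_obj by auto
 show ?thesis using h o a br_cap[OF h o, THEN tail] by (simp add: cap'_def br_yang_baxter)
qed

lemma br_cup':
 assumes h:"lax a H" and o:"obj x" "obj w"
 shows "br H a x (x^*$w) o x|>br H a x^* w o cup' x (a$w) = a|>cup' x w"
proof -
 have a:"obj a" using h lax_obj by auto
 have "(br H a x (x^*$w) o x|>br H a x^* w o sw x^* x (a$w)) o cup x (a$w)
  = a|>cup' x w" using h o a br_cup[OF h o] by (simp add: cup'_def br_yang_baxter[symmetric])
 then show ?thesis using h o a by (simp add: cup'_def)
qed

lemma snake:
 assumes "obj x" "obj w"
 shows "cap x (x$w) o x|>cup x w = \<i> (x$w)" (is ?P1)
  "x^*|>cap x w o cup x (x^*$w) = \<i> (x^*$w)" (is ?P2)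
proof -
 have "(\<l> x o ev A x<|x o \<b> x x^* x o x|>coev A x o Inv (\<r> x))<|w=x|>\<i> w" using snake_obj assms by simp
 then show ?P1 using assms by (simp add: spread cap_def cup_def)
 have "(\<r> x^* o x^*|>ev A x o \<a> x^* x x^*
   o coev A x<|x^* o Inv (\<l> x^*))<|w = x^*|>\<i> w" using snake_dual assms by simp
 then show ?P2 using assms by (simp add: spread cap_def cup_def)
qed

end

section \<open>Invertibility, morphisms and tensor products of half-braidings\<close>

context rigid_symmetric_category
begin

lemma snake':
 assumes "obj x" "obj w"
 shows "cap' x (x^*$w) o x^*|>cup' x w = \<i> (x^*$w)"
  "x|>cap' x w o cup' x (x$w) = \<i> (x$w)" (is ?P1)
proof -
 let ?d = "x^*"
 have c:"cap x (?d$w)=?d|>cap x w o sw x ?d (?d$w) o x|>sw ?d ?d w" using br_cap[of ?d "trs ?d" x w] assms by simp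
 have "cap' x (?d$w) o ?d|>cup' x w
  = ?d|>cap x w o sw x ?d (?d$w) o
   (x|>sw ?d ?d w o sw ?d x (?d$w) o ?d|>sw ?d x w) o ?d|>cup x w" using assms by (simp add: cap'_def cup'_def c)
 also have "...=?d|>cap x w o ?d|>sw ?d x w o sw ?d ?d (x$w) o ?d|>cup x w" using sw_yang_baxter[of ?d ?d x w, THEN tail3] assms by simp
 also have "...=?d|>cap x w o cup x (?d$w)"
 proof -
  have "sw ?d ?d (x$w) o ?d|>sw x ?d w o cup x (?d$w)=?d|>cup x w" using br_cup[of ?d "trs ?d" x w] assms by simp
  from this[symmetric] show ?thesis using assms by simp
 qed
 finally show "cap' x (?d$w) o ?d|>cup' x w=\<i> (?d$w)" using snake assms by simp
 have d:"cup x (x$w)=?d|>sw x x w o sw x ?d (x$w) o x|>cup x w"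
 proof -
  have "sw ?d x (x$w) o ?d|>sw x x w o cup x (x$w)=x|>cup x w" using br_cup[of x "trs x" x w] assms by simp
  from this[symmetric] show ?thesis using assms by simp
 qed
 have "x|>cap' x w o cup' x (x$w)
  = x|>cap x w o (x|>sw ?d x w o sw ?d x (x$w) o ?d|>sw x x w) o sw x ?d (x$w) o x|>cup x w"
  using assms by (simp add: cap'_def cup'_def d)
 also have "...=x|>cap x w o sw x x (?d$w) o x|>sw ?d x w o x|>cup x w" using sw_yang_baxter[of ?d x x w, THEN tail3] assms by simp
 also have "...=cap x (x$w) o x|>cup x w"
 proof -
  have "x|>cap x w o sw x x (?d$w) o x|>sw ?d x w=cap x (x$w)" using br_cap[of x "trs x" x w] assms by simp
  note this[THEN tail3]
  then show ?thesis using assms by simp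
 qed
 finally show ?P1 using snake assms by simp
qed

lemmas snake_tail = snake[THEN tail] and snake'_tail = snake'[THEN tail]

text \<open>The inverse at \<open>b\<close> is the component at the dual of \<open>b\<close>, bent around by a
  cup and a cap; the snake identities and the sliding of caps and cups make both composites trivial.\<close>
lemma lax_invertible:
 assumes h:"lax a H" and b:"obj b"
 shows "iso_arr A (H b)"
proof -
 let ?d = "b^*"
 have a:"obj a" using h lax_obj by auto
 have t:"H b ::: b$a ~> a$b" using h b by (auto simp: lax_def hom_iff)
 define T where "T w = b|>a|>cap' b w o b|>br H a ?d (b$w) o cup' b (a$b$w)" for w
 have T:"T w ::: a$b$w ~> b$a$w" if "obj w" for w using that h a b by (simp_all add: T_def)
 have 1:"T w o br H a b w=\<i> (b$a$w)" if w:"obj w" for w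
 proof -
  have "T w o br H a b w=b|>(a|>cap' b w o br H a ?d (b$w) o ?d|>br H a b w) o cup' b (b$a$w)"
   using h a b w cup'_natural[of b "br H a b w", symmetric] by (simp add: T_def)
  also have "...=\<i> (b$a$w)" unfolding br_cap'[OF h b w] using snake' a b w by simp
  finally show ?thesis .
 qed
 have 2:"br H a b w o T w=\<i> (a$b$w)" if w:"obj w" for w
 proof -
  have "br H a b w o T w=a|>b|>cap' b w o (br H a b (?d$b$w) o b|>br H a ?d (b$w) o cup' b (a$b$w))"
   using h a b w lax_natural[OF h b, of "cap' b w", THEN tail] by (simp add: T_def)
  also have "...=a|>(b|>cap' b w o cup' b (b$w))" unfolding br_cup'[of a H b "b$w", OF h b tensor_obj_typ[OF b w]] using a b w by simp
  also have "...=\<i> (a$b$w)" using snake' a b w by simp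
  finally show ?thesis .
 qed
 have "iso_arr A (br H a b \<I>)" using inv_arrI[of "br H a b \<I>" "T \<I>"] h a b 1 2 T by simp
 then have "iso_arr A (H b<|\<I>)" using a b t hat_unfold[of "H b" b a a b \<I>] by (simp add: br_def[symmetric] hom_iff comp_iso h)
 then have "iso_arr A (\<r> (a$b) o H b<|\<I> o Inv (\<r> (b$a)))" using a b t by (simp add: comp_iso)
 moreover have "\<r> (a$b) o H b<|\<I> o Inv (\<r> (b$a))=H b" using right_unitor_natural'[of "H b", THEN tail] a b t by simp
 ultimately show ?thesis by simp
qed

definition hbm ::"'o => ('o => 'm) => 'o => ('o => 'm) => 'm => bool" where
 "hbm a H a' H' f \<longleftrightarrow> f : Hom a a' \<and> (\<forall>b \<in> Obj A. (f<|b) o H b = H' b o b|>f)"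

lemma hbm_typ:"hbm a H a' H' f ==> arr f" "hbm a H a' H' f ==> Dom A f = a"
 "hbm a H a' H' f ==> Cod A f = a'" by (auto simp: hbm_def hom_iff)

lemma hbm_br:
 assumes m:"hbm a H a' H' f" and h:"hb a H" "hb a' H'" and o:"obj b" "obj w"
 shows "br H' a' b w o b|>f<|w = f<|(b$w) o br H a b w" (is ?P1)
  "rb H' a' b w o f<|(b$w) = b|>f<|w o rb H a b w" (is ?P2)
proof -
 have o':"obj a" "obj a'" using h hb_obj by auto
 note t = hbm_typ[OF m]
 have "\<a> a' b w o (H' b o b|>f)<|w o \<b> b a w
  = \<a> a' b w o (f<|b o H b)<|w o \<b> b a w" using m o by (simp add: hbm_def)
 then show 1: ?P1 using h o o' t by (simp add: br_def hat_def assoc_conj)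
 have "rb H' a' b w o f<|(b$w)=rb H' a' b w o (f<|(b$w) o br H a b w) o rb H a b w" using h o o' t by simp
 also have "...=b|>f<|w o rb H a b w" unfolding 1[symmetric] using h o o' t by simp
 finally show ?P2 .
qed

lemma hbmI:
 assumes t:"arr f" "Dom A f = a" "Cod A f = a'" and h:"hb a H" "hb a' H'"
  and eq:"!!b w. b : Obj A ==> obj w ==>
   br H' a' b w o b|>f<|w = f<|(b$w) o br H a b w"
 shows "hbm a H a' H' f"
proof -
 have o':"obj a" "obj a'" using h hb_obj by auto
 have "f<|b o H b=H' b o b|>f" if b:"obj b" for b
 proof (rule eq_by_tail)
  show "f<|b o H b : Hom (b$a) (a'$b)" "H' b o (b|>f) : Hom (b$a) (a'$b)" using t h b by (simp_all add: hom_iff)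
  fix w assume w:"obj w"
  have "\<b> a' b w o (f<|(b$w) o br H a b w) o \<a> b a w
   = \<b> a' b w o (br H' a' b w o b|>f<|w) o \<a> b a w" using eq[OF b w] by simp
  then show "(f<|b o H b)<|w=(H' b o b|>f)<|w" using t h b w o' by (simp add: br_def hat_def assoc_conj)
 qed
 then show ?thesis using t by (simp add: hbm_def hom_iff)
qed

lemma hbm_comp:
 assumes "hbm a H a' H' f" "hbm a' H' a'' H'' g" "hb a H" "hb a' H'" "hb a'' H''"
 shows "hbm a H a'' H'' (g o f)" using hbm_typ[OF assms(1)] hbm_typ[OF assms(2)] assms hbm_br(1)[OF assms(1,3,4)] hbm_br(1)[OF assms(2,4,5)]
  hbm_br(1)[OF assms(2,4,5), THEN tail] by (intro hbmI) simp_all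

lemma hbm_inv:
 assumes m:"hbm a H a' H' f" and h:"hb a H" "hb a' H'" and i:"iso_arr A f"
 shows "hbm a' H' a H (Inv f)"
proof -
 note t = hbm_typ[OF m]
 show ?thesis
 proof (rule hbmI)
  fix b w assume o:"obj b" "obj w"
  have "br H a b w o b|>Inv f<|w
   = Inv f<|(b$w) o (f<|(b$w) o br H a b w) o b|>Inv f<|w" using t h o i by simp
  also have "...=Inv f<|(b$w) o br H' a' b w" unfolding hbm_br(1)[OF m h o, symmetric] using t h o i hb_obj[OF h(2)] by simp
  finally show "br H a b w o b|>Inv f<|w=Inv f<|(b$w) o br H' a' b w" .
 qed (use t h i in simp_all)
qed

lemma hbm_ident:"hb a H ==> hbm a H a H (\<i> a)" using hb_obj by (intro hbmI) simp_all

lemma hbm_trs:"arr f ==> Dom A f = x ==> Cod A f = y ==> hbm x (trs x) y (trs y) f" by (intro hbmI) (auto simp: sw_natural_right)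

definition ctb ::"'o => ('o => 'm) => 'o => ('o => 'm) => 'o => 'm" where
 "ctb a H a' H' = (\<lambda>b \<in> Obj A.
   \<b> a a' b o a|>H' b o \<a> a b a' o H b<|a' o \<b> b a a')"

lemma centre_tensor_ctb:"centre_tensor A (a, H) (a', H') = (a$a', ctb a H a' H')" by (simp add: centre_tensor_def ctb_def)

lemma br_ctb:
 assumes "hb a H" "hb a' H'" "obj b" "obj w"
 shows "br (ctb a H a' H') (a$a') b w
  = \<b> a a' (b$w) o a|>br H' a' b w o br H a b (a'$w) o b|>\<a> a a' w"
proof -
 have o:"obj a" "obj a'" using assms hb_obj by auto
 show ?thesis using assms o by (simp add: br_def hat_def ctb_def spread)
qed

lemma hb_ctb [simp]:
 assumes h:"hb a H" "hb a' H'"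
 shows "hb (a$a') (ctb a H a' H')"
proof -
 have o:"obj a" "obj a'" using assms hb_obj by auto
 show ?thesis
 proof (rule hbI)
  show "a$a' : Obj A" using o by simp
  show "ctb a H a' H' \<in> extensional (Obj A)" by (simp add: ctb_def)
  fix b assume b:"obj b"
  show "ctb a H a' H' b : Hom (b$a$a') ((a$a')$b)" "iso_arr A (ctb a H a' H' b)"
   using b o h by (simp_all add: ctb_def hom_iff comp_iso)
 next
  fix f w assume f:"arr f" and w:"obj w"
  have "(Cod A f)|>\<a> a a' w o f<|((a$a')$w)=f<|(a$a'$w) o (Dom A f)|>\<a> a a' w"
   using interchange[of f "\<a> a a' w"] f w o by simp
  moreover have "br H a (Cod A f) (a'$w) o f<|(a$a'$w)
   = a|>f<|(a'$w) o br H a (Dom A f) (a'$w)" using br_natural_left[OF h(1), of "a'$w" f] f w o by simp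
  note this[THEN tail]
  moreover have "a|>(br H' a' (Cod A f) w o f<|(a'$w))
   = a|>(a'|>f<|w o br H' a' (Dom A f) w)" using br_natural_left[OF h(2), of w f] f w o by simp
  then have "a|>br H' a' (Cod A f) w o a|>f<|(a'$w)
   = a|>a'|>f<|w o a|>br H' a' (Dom A f) w" using f w o h by simp
  note this[THEN tail]
  ultimately
  show "br (ctb a H a' H') (a$a') (Cod A f) w o f<|((a$a')$w)
   = (a$a')|>f<|w o br (ctb a H a' H') (a$a') (Dom A f) w" using f w o h by (simp add: br_ctb assoc_conj_ident)
 next
  fix b b' w assume q:"obj b" "obj b'" "obj w"
  have "br H a b (a'$b'$w) o b|>a|>br H' a' b' w
   = a|>b|>br H' a' b' w o br H a b (b'$a'$w)" using br_natural(1)[OF h(1), of b "br H' a' b' w"] q o h by simp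
  note this[THEN tail]
  then show "(a$a')|>\<a> b b' w o br (ctb a H a' H') (a$a') (b$b') w
   = br (ctb a H a' H') (a$a') b (b'$w) o b|>br (ctb a H a' H') (a$a') b' w o \<a> b b' ((a$a')$w)"
   using q o h by (simp add: br_ctb br_tensor assoc_conj_ident)
 qed
qed

lemma rb_ctb:
 assumes h:"hb a H" "hb a' H'" and w:"obj b" "obj w"
 shows "rb (ctb a H a' H') (a$a') b w
  = b|>\<b> a a' w o rb H a b (a'$w) o a|>rb H' a' b w o \<a> a a' (b$w)"
proof -
 have o:"obj a" "obj a'" using assms hb_obj by auto
 have "rb (ctb a H a' H') (a$a') b w=Inv (br (ctb a H a' H') (a$a') b w)" using h w by simp
 also have "...=b|>\<b> a a' w o rb H a b (a'$w) o a|>rb H' a' b w o \<a> a a' (b$w)"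
  unfolding br_ctb[OF assms] using assms o by (simp add: comp_iso)
 finally show ?thesis .
qed

lemma hbm_tensor:
 assumes m:"hbm a H c \<g> f" "hbm a' H' c' \<g>' g" and h:"hb a H" "hb c \<g>" "hb a' H'" "hb c' \<g>'"
 shows "hbm (a$a') (ctb a H a' H') (c$c') (ctb c \<g> c' \<g>') (f \<boxdot> g)"
proof -
 note t = hbm_typ[OF m(1)] hbm_typ[OF m(2)]
 have o:"obj a" "obj c" "obj a'" "obj c'" using h hb_obj by auto
 have 1:"hbm (a$c') (ctb a H c' \<g>') (c$c') (ctb c \<g> c' \<g>') (f<|c')"
 proof (rule hbmI)
  fix b w assume q:"obj b" "obj w"
  have "f<|(c'$b$w) o a|>br \<g>' c' b w=c|>br \<g>' c' b w o f<|(b$c'$w)"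
   using interchange[of f "br \<g>' c' b w"] t q o h by simp
  note this[THEN tail]
  moreover have "br \<g> c b (c'$w) o b|>f<|(c'$w)=f<|(b$c'$w) o br H a b (c'$w)" using hbm_br(1)[OF m(1) h(1,2)] q o by simp
  note this[THEN tail]
  ultimately show "br (ctb c \<g> c' \<g>') (c$c') b w o b|>(f<|c')<|w
   = (f<|c')<|(b$w) o br (ctb a H c' \<g>') (a$c') b w" using q o t h by (simp add: br_ctb assoc_conj)
 qed (use t o h in simp_all)
 have 2:"hbm (a$a') (ctb a H a' H') (a$c') (ctb a H c' \<g>') (a|>g)"
 proof (rule hbmI)
  fix b w assume q:"obj b" "obj w"
  have "br H a b (c'$w) o b|>a|>g<|w=a|>b|>g<|w o br H a b (a'$w)" using br_natural(1)[OF h(1), of b "g<|w"] t q o by simp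
  note this[THEN tail]
  moreover have "a|>(br \<g>' c' b w o b|>g<|w)=a|>(g<|(b$w) o br H' a' b w)" using hbm_br(1)[OF m(2) h(3,4)] q o by simp
  then have "a|>br \<g>' c' b w o a|>b|>g<|w=a|>g<|(b$w) o a|>br H' a' b w" using q o t h by simp
  note this[THEN tail]
  ultimately show "br (ctb a H c' \<g>') (a$c') b w o b|>(a|>g)<|w
   = (a|>g)<|(b$w) o br (ctb a H a' H') (a$a') b w" using q o t h by (simp add: br_ctb assoc_conj)
 qed (use t o h in simp_all)
 have "f \<boxdot> g=f<|c' o a|>g" using tensor_split[of f g] t by simp
 then show ?thesis using hbm_comp[OF 2 1] h by simp
qed

lemma hbm_associator:
 assumes h:"hb a H" "hb a' H'" "hb a'' H''"
 shows "hbm ((a$a')$a'') (ctb (a$a') (ctb a H a' H') a'' H'')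
  (a$a'$a'') (ctb a H (a'$a'') (ctb a' H' a'' H'')) (\<a> a a' a'')"
proof -
 have o:"obj a" "obj a'" "obj a''" using h hb_obj by auto
 show ?thesis
 proof (rule hbmI)
  fix b w assume q:"obj b" "obj w"
  have "br H a b ((a'$a'')$w) o b|>a|>\<b> a' a'' w
   = a|>b|>\<b> a' a'' w o br H a b (a'$a''$w)" using br_natural(1)[OF h(1), of b "\<b> a' a'' w"] q o by simp
  note this[THEN tail]
  then show "br (ctb a H (a'$a'') (ctb a' H' a'' H'')) (a$a'$a'') b w o b|>(\<a> a a' a''<|w) =
   \<a> a a' a''<|(b$w) o br (ctb (a$a') (ctb a H a' H') a'' H'') ((a$a')$a'') b w" using q o h by (simp add: br_ctb spread)
 qed (use o h in simp_all)
qed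

lemma ctb_trs:"obj x ==> obj y ==> ctb x (trs x) y (trs y) = trs (x$y)"
proof
 fix b assume o:"obj x" "obj y"
 show "ctb x (trs x) y (trs y) b=trs (x$y) b"
 proof (cases "obj b")
  case True
  have "\<b> x y b o (\<a> x y b o \<s> b (x$y) o \<a> b x y) o \<b> b x y
   = \<b> x y b o (x|>\<s> b y o \<a> x b y o \<s> b x<|y) o \<b> b x y" using hexagon[of b x y] True o by simp
  then show ?thesis using True o by (simp add: ctb_def trs_def)
 qed (simp add: ctb_def trs_def)
qed

lemma br_sw:
 assumes h:"hb a H" and o:"obj x" "obj y" "obj w"
 shows "a|>sw x y w o sw x a (y$w) o x|>br H a y w
  = br H a y (x$w) o y|>sw x a w o sw x y (a$w)"
proof -
 have a:"obj a" using h hb_obj by auto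
 have "\<a> a y (x$w) o (sw x (a$y) w o x|>H y<|w) o x|>\<b> y a w
  = \<a> a y (x$w) o (H y<|(x$w) o sw x (y$a) w) o x|>\<b> y a w" using sw_natural_right[of x w "H y"] h o by simp
 then show ?thesis using a o h by (simp add: sw_tensor_right br_def hat_def)
qed

lemma hbm_symmetry:
 assumes h:"hb a H" and x:"obj x"
 shows "hbm (a$x) (ctb a H x (trs x)) (x$a) (ctb x (trs x) a H) (\<s> a x)" (is ?P1)
  "hbm (x$a) (ctb x (trs x) a H) (a$x) (ctb a H x (trs x)) (\<s> x a)" (is ?P2)
proof -
 have a:"obj a" using h hb_obj by auto
 show 2: ?P2
 proof (rule hbmI)
  fix b w assume q:"obj b" "obj w"
  have sp:"\<s> x a<|v=\<b> a x v o sw x a v o \<a> x a v" if "obj v" for v using that a x by (simp add: sw_def hat_def)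
  have "a|>sw b x w o (a|>sw x b w o sw x a (b$w) o x|>br H a b w) o sw b x (a$w)
   = a|>sw b x w o (br H a b (x$w) o b|>sw x a w o sw x b (a$w)) o sw b x (a$w)" using br_sw[OF h x q] by simp
  then have "sw x a (b$w) o x|>br H a b w o sw b x (a$w)
   = a|>sw b x w o br H a b (x$w) o b|>sw x a w" using q a x h by simp
  note this[symmetric, THEN tail]
  then show "br (ctb a H x (trs x)) (a$x) b w o b|>(\<s> x a<|w) =
   \<s> x a<|(b$w) o br (ctb x (trs x) a H) (x$a) b w" using q a x h by (simp add: br_ctb sp)
 qed (use a x h in simp_all)
 show ?P1 using hbm_inv[OF 2] a x h by simp
qed

text \<open>Two half-braidings on \<open>c\<close> commute if sliding two objects across \<open>c\<close>, one
  by each, does not depend on the order up to the symmetry.\<close>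
definition commuting ::"'o => ('o => 'm) => ('o => 'm) => bool" where
 "commuting c H H' \<longleftrightarrow> (\<forall>x \<in> Obj A. \<forall>y \<in> Obj A. \<forall>w \<in> Obj A.
   (c|>sw x y w) o br H c x (y$w) o x|>br H' c y w
   = br H' c y (x$w) o y|>br H c x w o sw x y (c$w))"

lemma commuting_self:"hb c H ==> commuting c H H" unfolding commuting_def using br_yang_baxter by simp

lemma commuting_sym:
 assumes m:"commuting c H H'" and h:"hb c H" "hb c H'"
 shows "commuting c H' H" unfolding commuting_def
proof (intro ballI)
 fix x y w assume o:"obj x" "obj y" "obj w"
 have c:"obj c" using h hb_obj by auto
 have "c|>sw x y w o (c|>sw y x w o br H c y (x$w) o y|>br H' c x w) o sw x y (c$w)
   = c|>sw x y w o (br H' c x (y$w) o x|>br H c y w o sw y x (c$w)) o sw x y (c$w)" using m o by (simp add: commuting_def)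
 then show "c|>sw x y w o br H' c x (y$w) o x|>br H c y w
   = br H c y (x$w) o y|>br H' c x w o sw x y (c$w)" using o c h by simp
qed

text \<open>The two half-braidings use complementary factors, and elsewhere only the symmetry; so naturality of
  the symmetry is all that is needed.\<close>
lemma commuting_ctb:
 assumes h:"hb a H" "hb a' H'"
 shows "commuting (a$a') (ctb a H a' (trs a')) (ctb a (trs a) a' H')" unfolding commuting_def
proof (intro ballI)
 fix x y w assume q:"obj x" "obj y" "obj w"
 have o:"obj a" "obj a'" using h hb_obj by auto
 have 1:"br H a x (a'$y$w) o x|>a|>br H' a' y w
  = a|>x|>br H' a' y w o br H a x (y$a'$w)" using br_natural(1)[OF h(1), of x "br H' a' y w"] q o h by simp
 have "a|>(a'|>sw x y w o sw x a' (y$w) o x|>br H' a' y w)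
  = a|>(br H' a' y (x$w) o y|>sw x a' w o sw x y (a'$w))" using br_sw[OF h(2) q] by simp
 then have 2:"a|>a'|>sw x y w o a|>sw x a' (y$w) o a|>x|>br H' a' y w o r
  = a|>br H' a' y (x$w) o a|>y|>sw x a' w o a|>sw x y (a'$w) o r"
  if "arr r" "Cod A r = a$x$y$a'$w" for r using tail[of "a|>(a'|>sw x y w o sw x a' (y$w))" "a|>x|>br H' a' y w" _ r] that q o h
  by simp
 have "a|>sw x y (a'$w) o (a|>sw y x (a'$w) o sw y a (x$a'$w) o y|>br H a x (a'$w)) o sw x y (a$a'$w)
  = a|>sw x y (a'$w) o (br H a x (y$a'$w) o x|>sw y a (a'$w) o sw y x (a$a'$w)) o sw x y (a$a'$w)"
  using br_sw[OF h(1) q(2,1), of "a'$w"] q o by simp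
 then have 3:"a|>sw x y (a'$w) o br H a x (y$a'$w) o x|>sw y a (a'$w)
  = sw y a (x$a'$w) o y|>br H a x (a'$w) o sw x y (a$a'$w)" using q o h by simp
 have 4:"a|>sw x y (a'$w) o br H a x (y$a'$w) o x|>sw y a (a'$w) o r
  = sw y a (x$a'$w) o y|>br H a x (a'$w) o sw x y (a$a'$w) o r"
  if "arr r" "Cod A r = x$y$a$a'$w" for r
 proof -
  have "(a|>sw x y (a'$w) o br H a x (y$a'$w) o x|>sw y a (a'$w)) o r
   = (sw y a (x$a'$w) o y|>br H a x (a'$w) o sw x y (a$a'$w)) o r" by (simp only: 3)
  then show ?thesis using that q o h by simp
 qed
 have 5:"sw y a (a'$x$w) o y|>a|>sw x a' w=a|>y|>sw x a' w o sw y a (x$a'$w)" using sw_natural[of y a "sw x a' w"] q o by simp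
 have 6:"sw x y (a$a'$w) o x|>y|>\<a> a a' w=y|>x|>\<a> a a' w o sw x y ((a$a')$w)"
  using sw_natural[of x y "\<a> a a' w"] q o by simp
 show "(a$a')|>sw x y w o br (ctb a H a' (trs a')) (a$a') x (y$w) o x|>br (ctb a (trs a) a' H') (a$a') y w
   = br (ctb a (trs a) a' H') (a$a') y (x$w) o y|>br (ctb a H a' (trs a')) (a$a') x w o sw x y ((a$a')$w)"
  using q o h by (simp add: br_ctb assoc_conj_ident 1[THEN tail] 2 4 5[THEN tail] 6)
qed

end

section \<open>Sums and scalars\<close>

context linear_category
begin

abbreviation add_arr (infixl "+." 53) where "f +. g \<equiv> arr_add A f g"

abbreviation scale_arr (infixr "*." 75) where "c*.f \<equiv> arr_scale A c f"

abbreviation hsum ::"'o => 'o => 'k set => ('k => 'm) => 'm" where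
 "hsum x y K f \<equiv> finsum (hom_space A x y) f K"

lemma hom_space_simps [simp]:
 "carrier (hom_space A x y) = Hom x y" "zero (hom_space A x y) = \<z> x y"
 "add (hom_space A x y) = arr_add A" "module.smult (hom_space A x y) = arr_scale A" by (simp_all add: hom_space_def)

lemma ring_simps [simp]:
 "carrier (ring_of_type_algebra :: complex ring) = UNIV"
 "add (ring_of_type_algebra :: complex ring) = (+)"
 "monoid.mult (ring_of_type_algebra :: complex ring) = (*)"
 "one (ring_of_type_algebra :: complex ring) = 1"
 "zero (ring_of_type_algebra :: complex ring) = 0" by (simp_all add: ring_of_type_algebra_def)

lemma hom_abelian_group:"obj x ==> obj y ==> abelian_group (hom_space A x y)" using hom_module by (simp add: module_def)

lemma hom_abelian_monoid:"obj x ==> obj y ==> abelian_monoid (hom_space A x y)" using hom_abelian_group by (simp add: abelian_group_def)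

lemma zero_typ [simp]:
 assumes "obj x" "obj y"
 shows "\<z> x y : Arr A" (is ?P1) "Dom A (\<z> x y) = x" (is ?P2) "Cod A (\<z> x y) = y" (is ?P3)
proof -
 interpret M: module "ring_of_type_algebra :: complex ring" "hom_space A x y" using hom_module assms .
 show ?P1 ?P2 ?P3
  using M.M.zero_closed by (simp_all add: hom_iff)
qed

lemma add_typ [simp]:
 assumes "arr f" "arr g" "Dom A g = Dom A f" "Cod A g = Cod A f"
 shows "f +. g : Arr A" (is ?P1) "Dom A (f +. g) = Dom A f" (is ?P2) "Cod A (f +. g) = Cod A f" (is ?P3)
proof -
 interpret M: module "ring_of_type_algebra :: complex ring" "hom_space A (Dom A f) (Cod A f)" using hom_module assms by simp
 show ?P1 ?P2 ?P3 using M.M.a_closed[of f g] assms by (simp_all add: hom_iff)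
qed

lemma scale_typ [simp]:
 assumes "arr f"
 shows "c*.f : Arr A" (is ?P1) "Dom A (c*.f) = Dom A f" (is ?P2) "Cod A (c*.f) = Cod A f" (is ?P3)
proof -
 interpret M: module "ring_of_type_algebra :: complex ring" "hom_space A (Dom A f) (Cod A f)" using hom_module assms by simp
 show ?P1 ?P2 ?P3 using M.smult_closed[of c f] assms by (simp_all add: hom_iff)
qed

lemma hsum_typ [simp]:
 assumes "obj x" "obj y" "!!i. i : K ==> f i : Hom x y"
 shows "hsum x y K f : Arr A" (is ?P1) "Dom A (hsum x y K f) = x" (is ?P2) "Cod A (hsum x y K f) = y" (is ?P3)
proof -
 interpret M: module "ring_of_type_algebra :: complex ring" "hom_space A x y" using hom_module assms by simp
 have "hsum x y K f : Hom x y" using M.M.finsum_closed[of f K] assms by auto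
 then show ?P1 ?P2 ?P3 by (simp_all add: hom_iff)
qed

lemma hsum_in:
 assumes "obj x" "obj y" "!!i. i : K ==> f i : Hom x y"
 shows "hsum x y K f : Hom x y" using hsum_typ[of x y K f, OF assms] by (simp add: hom_iff)

lemma scale_one [simp]:"arr f ==> 1*.f = f"
 and scale_scale [simp]:"arr f ==> c*.d*.f = (c * d)*.f"
 and scale_add_left:"arr f ==> (c + d)*.f = c*.f +. d*.f"
 and scale_zero_left [simp]:"arr f ==> 0*.f = \<z> (Dom A f) (Cod A f)"
proof -
 assume f:"arr f"
 interpret M: module "ring_of_type_algebra :: complex ring" "hom_space A (Dom A f) (Cod A f)" using hom_module f by simp
 have f':"f : Hom (Dom A f) (Cod A f)" using f by (simp add: hom_iff)
 show "1*.f=f" "c*.d*.f=(c * d)*.f" "(c + d)*.f=c*.f +. d*.f"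
  "0*.f = \<z> (Dom A f) (Cod A f)"
  using M.smult_one[of f] M.smult_assoc1[of c d f] M.smult_l_distr[of c d f] M.smult_l_null[of f] f' by simp_all
qed

lemma scale_add_right:"[|arr f; arr g; Dom A g = Dom A f; Cod A g = Cod A f|]
  ==> c*.(f +. g) = c*.f +. c*.g"
 and add_zero [simp]:"[|arr f; Dom A f = x; Cod A f = y|] ==> f +. \<z> x y = f"
  "[|arr f; Dom A f = x; Cod A f = y|] ==> \<z> x y +. f = f"
 and add_assoc:"[|arr f; arr g; Dom A g = Dom A f; Cod A g = Cod A f; arr h; Dom A h = Dom A f; Cod A h = Cod A f|]
  ==> (f +. g) +. h = f +. (g +. h)"
 and add_comm:"[|arr f; arr g; Dom A g = Dom A f; Cod A g = Cod A f|] ==> f +. g = g +. f"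
 and add_cancel:"[|arr f; arr g; Dom A g = Dom A f; Cod A g = Cod A f; arr h; Dom A h = Dom A f; Cod A h = Cod A f;
  f +. g = f +. h|] ==> g = h"
proof -
 {
  assume f:"arr f"
  interpret M: module "ring_of_type_algebra :: complex ring" "hom_space A (Dom A f) (Cod A f)" using hom_module f by simp
  have f':"f : Hom (Dom A f) (Cod A f)" using f by (simp add: hom_iff)
  show "Dom A f=x ==> Cod A f=y ==> f +. \<z> x y=f"
   "Dom A f = x ==> Cod A f = y ==> \<z> x y +. f = f" using M.r_zero[of f] M.l_zero[of f] f' by simp_all
  assume g:"arr g" "Dom A g = Dom A f" "Cod A g = Cod A f"
  then have g':"g : Hom (Dom A f) (Cod A f)" by (simp add: hom_iff)
  show "c*.(f +. g)=c*.f +. c*.g" "f +. g=g +. f" using M.smult_r_distr[of c f g] M.M.a_comm[of f g] f' g' by simp_all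
  assume h:"arr h" "Dom A h = Dom A f" "Cod A h = Cod A f"
  then have h':"h : Hom (Dom A f) (Cod A f)" by (simp add: hom_iff)
  show "(f +. g) +. h=f +. (g +. h)" using M.M.a_assoc[of f g h] f' g' h' by simp
  assume "f +. g = f +. h"
  then show "g=h" using M.M.add.l_cancel[of f g h] f' g' h' by simp
 }
qed

lemma add_comp:"[|arr f; arr g; arr h; Dom A h = Dom A g; Cod A h = Cod A g; Dom A g = Cod A f|]
  ==> (g +. h) o f = (g o f) +. (h o f)" using comp_add_left[of f "Dom A f" "Cod A f" g "Cod A g" h] by (simp add: hom_iff)

lemma comp_add:"[|arr f; arr g; arr h; Dom A g = Dom A f; Cod A g = Cod A f; Dom A h = Cod A f|]
  ==> h o (f +. g) = (h o f) +. (h o g)" using comp_add_right[of f "Dom A f" "Cod A f" g h "Cod A h"] by (simp add: hom_iff)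

lemma scale_comp [simp]:"[|arr f; arr g; Dom A g = Cod A f|] ==> (c*.g) o f = c*.(g o f)"
 using comp_scale_left[of f "Dom A f" "Cod A f" g "Cod A g"] by (simp add: hom_iff)

lemma comp_scale [simp]:"[|arr f; arr g; Dom A g = Cod A f|] ==> g o (c*.f) = c*.(g o f)"
 using comp_scale_right[of f "Dom A f" "Cod A f" g "Cod A g"] by (simp add: hom_iff)

lemma comp_zero [simp]:"[|arr g; obj x; Dom A g = y|] ==> g o \<z> x y = \<z> x (Cod A g)"
 using comp_scale[of "\<z> x y" g 0] by auto

lemma zero_comp [simp]:"[|arr f; obj z; Cod A f = y|] ==> \<z> y z o f = \<z> (Dom A f) z"
 using scale_comp[of f "\<z> y z" 0] by auto

lemma scale_zero [simp]:"obj x ==> obj y ==> c*.\<z> x y = \<z> x y" using scale_scale[of "\<z> x y" c 0] by simp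

text \<open>Every interchange of a categorical operation with a finite sum below is an instance of this.\<close>
lemma additive_hsum:
 assumes o:"obj x" "obj y" "obj x'" "obj y'" and fin:"finite K"
  and f:"!!i. i : K ==> f i : Hom x y"
  and F:"!!g. g : Hom x y ==> F g : Hom x' y'"
  and add:"!!g h. g : Hom x y ==> h : Hom x y ==> F (g +. h) = F g +. F h"
 shows "F (hsum x y K f) = hsum x' y' K (%i. F (f i))"
proof -
 interpret M: abelian_group "hom_space A x y" using hom_abelian_group o by simp
 interpret N: abelian_group "hom_space A x' y'" using hom_abelian_group o by simp
 have z:"\<z> x y : Hom x y" using o by (simp add: hom_iff)
 have "F (\<z> x y) +. F (\<z> x y)=F (\<z> x y) +. \<z> x' y'" using add[OF z z] F[OF z] o by (simp add: hom_iff)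
 then have F0:"F (\<z> x y)=\<z> x' y'"
  using add_cancel[of "F (\<z> x y)" "F (\<z> x y)" "\<z> x' y'"] F[OF z] o by (simp add: hom_iff)
 show ?thesis using fin f
 proof (induction K)
  case empty
  then show ?case using F0 by simp
 next
  case (insert i K)
  then have 1:"hsum x y K f : Hom x y" using o by (simp add: hom_iff)
  have "F (hsum x y (insert i K) f)=F (f i +. hsum x y K f)" using insert M.finsum_insert[of K i f] by auto
  also have "...=F (f i) +. hsum x' y' K (%i. F (f i))" using insert 1 add by simp
  also have "...=hsum x' y' (insert i K) (%i. F (f i))" using insert N.finsum_insert[of K i "%i. F (f i)"] F by auto
  finally show ?case .
 qed
qed

lemma hsum_cong:
 assumes "obj x" "obj y" "!!i. i : K ==> f i = g i" "!!i. i : K ==> g i : Hom x y"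
 shows "hsum x y K f = hsum x y K g"
proof -
 interpret M: abelian_group "hom_space A x y" using hom_abelian_group assms by simp
 show ?thesis by (rule M.finsum_cong') (use assms in auto)
qed

lemma comp_hsum:
 assumes "finite K" "!!i. i : K ==> f i : Hom x y" "arr h" "obj x" "Dom A h = y"
 shows "h o hsum x y K f = hsum x (Cod A h) K (%i. h o f i)"
 by (rule additive_hsum) (use assms in \<open>auto simp: hom_iff comp_add\<close>)

lemma hsum_comp:
 assumes "finite K" "!!i. i : K ==> f i : Hom x y" "arr h" "obj y" "Cod A h = x"
 shows "hsum x y K f o h = hsum (Dom A h) y K (%i. f i o h)"
 by (rule additive_hsum[where F = "%g. g o h"]) (use assms in \<open>auto simp: hom_iff add_comp\<close>)

lemma scale_hsum:
 assumes "finite K" "!!i. i : K ==> f i : Hom x y" "obj x" "obj y"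
 shows "c*.hsum x y K f = hsum x y K (%i. c*.f i)" by (rule additive_hsum) (use assms in \<open>auto simp: hom_iff scale_add_right\<close>)

lemma hsum_empty [simp]:"obj x ==> obj y ==> hsum x y {} f = \<z> x y"
 using abelian_monoid.finsum_empty[OF hom_abelian_monoid] by simp

lemma hsum_insert:
 assumes "obj x" "obj y" "finite K" "i \<notin> K" "!!j. j \<in> insert i K ==> f j : Hom x y"
 shows "hsum x y (insert i K) f = f i +. hsum x y K f"
 using abelian_monoid.finsum_insert[OF hom_abelian_monoid[OF assms(1,2)] assms(3,4), of f] assms(5) by auto

lemma hsum_zero:"obj x ==> obj y ==> hsum x y K (%i. \<z> x y) = \<z> x y"
 using abelian_monoid.finsum_zero[OF hom_abelian_monoid, of x y K] by simp

lemma hsum_single: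
 assumes "obj x" "obj y" "finite K" "k : K" "f k : Hom x y" "!!i. i : K ==> i \<noteq> k ==> f i = \<z> x y"
 shows "hsum x y K f = f k"
proof -
 have *:"f j : Hom x y" if "j : K" for j using assms(1,2,5,6) that by (cases "j=k") (auto simp: hom_iff)
 have "hsum x y K f=hsum x y (insert k (K - {k})) f" using assms by (simp add: insert_absorb)
 also have "...=f k +. hsum x y (K - {k}) f" using assms * by (intro hsum_insert) auto
 also have "hsum x y (K - {k}) f=hsum x y (K - {k}) (%i. \<z> x y)" using assms by (intro hsum_cong) (auto simp: hom_iff)
 finally show ?thesis using assms by (simp add: hsum_zero hom_iff)
qed

lemma hsum_add:
 assumes "obj x" "obj y" "!!i. i : K ==> f i : Hom x y" "!!i. i : K ==> g i : Hom x y"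
 shows "hsum x y K (%i. f i +. g i) = hsum x y K f +. hsum x y K g"
 using abelian_monoid.finsum_addf[OF hom_abelian_monoid[OF assms(1,2)], of f K g] assms by auto

lemma hsum_swap:
 assumes "obj x" "obj y" "finite K" "finite L" "!!i j. i : K ==> j \<in> L ==> f i j : Hom x y"
 shows "hsum x y K (%i. hsum x y L (f i)) = hsum x y L (%j. hsum x y K (%i. f i j))" using assms(3,5)
proof (induction K)
 case empty
 then show ?case using assms by (simp add: hsum_zero)
next
 case (insert k K)
 have "hsum x y (insert k K) (%i. hsum x y L (f i))=hsum x y L (f k) +. hsum x y L (%j. hsum x y K (%i. f i j))"
  using insert assms by (subst hsum_insert) (auto simp: hom_iff)
 also have "...=hsum x y L (%j. f k j +. hsum x y K (%i. f i j))" using insert assms by (intro hsum_add[symmetric]) (auto simp: hom_iff)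
 also have "...=hsum x y L (%j. hsum x y (insert k K) (%i. f i j))"
 proof (rule hsum_cong[OF assms(1,2)])
  fix j assume j:"j \<in> L"
  show "f k j +. hsum x y K (%i. f i j)=hsum x y (insert k K) (%i. f i j)" using insert assms j by (intro hsum_insert[symmetric]) auto
  have "f i j : Hom x y" if "i \<in> insert k K" for i using insert.prems that j by blast
  then show "hsum x y (insert k K) (%i. f i j) : Hom x y" by (rule hsum_in[OF assms(1,2)])
 qed
 finally show ?case .
qed

lemma hsum_scale_const:
 assumes "arr f" "finite K"
 shows "hsum (Dom A f) (Cod A f) K (%i. c i*.f) = (\<Sum>i\<in>K. c i)*.f" using assms(2)
proof (induction K)
 case (insert k K)
 then show ?case using assms(1) by (subst hsum_insert) (auto simp: hom_iff scale_add_left)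
qed (use assms in simp)

lemma scale_cancel:
 assumes "arr f" "c*.f = d*.f" "f \<noteq> \<z> (Dom A f) (Cod A f)"
 shows "c = d"
proof (rule ccontr)
 assume "c \<noteq> d"
 have "(c - d)*.f +. d*.f=\<z> (Dom A f) (Cod A f) +. d*.f" using assms scale_add_left[of f "c - d" d] by simp
 then have "d*.f +. (c - d)*.f=d*.f +. \<z> (Dom A f) (Cod A f)" using assms add_comm[of "d*.f" "(c - d)*.f"] by simp
 then have "(c - d)*.f=\<z> (Dom A f) (Cod A f)" using assms add_cancel[of "d*.f" "(c - d)*.f"] by simp
 then have "(1 / (c - d))*.((c - d)*.f)=\<z> (Dom A f) (Cod A f)" using assms by simp
 then show False using assms \<open>c \<noteq> d\<close> by simp
qed

lemma minus_zero_eq: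
 assumes "arr f" "arr g" "Dom A g = Dom A f" "Cod A g = Cod A f"
  "f +. (-1)*.g = \<z> (Dom A f) (Cod A f)"
 shows "f = g"
proof -
 have m:"(-1)*.g +. g=\<z> (Dom A f) (Cod A f)" using scale_add_left[of g "-1" 1] assms by simp
 have "f=f +. ((-1)*.g +. g)" unfolding m using assms(1-4) by simp
 also have "...=(f +. (-1)*.g) +. g" using add_assoc[of f "(-1)*.g" g] assms(1-4) by simp
 also have "...=g" unfolding assms(5) using assms(1-4) by simp
 finally show ?thesis .
qed

section \<open>Schur's lemma\<close>

lemma zero_object_arrow:"zero_object A z ==> f : Hom x z ==> f = \<z> x z"
proof -
 assume z:"zero_object A z" and f:"f : Hom x z"
 then have "\<exists>!f. f : Hom x z" "obj z" "obj x" using hom_obj[OF f] by (auto simp: zero_object_def)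
 then show ?thesis using f by (auto simp: hom_iff)
qed

lemma zero_objectI:
 assumes x:"obj x" and z:"\<i> x = \<z> x x"
 shows "zero_object A x"
proof -
 have *:"f=\<z> y x" if "f : Hom y x" for f y
 proof -
  have "f=\<i> x o f" using that by (simp add: hom_iff)
  then show ?thesis unfolding z using that x by (simp add: hom_iff)
 qed
 have **:"f=\<z> x y" if "f : Hom x y" for f y
 proof -
  have "f=f o \<i> x" using that by (simp add: hom_iff)
  then show ?thesis unfolding z using that x by (auto simp: hom_iff)
 qed
 show ?thesis unfolding zero_object_def
 proof (intro conjI ballI x)
  fix y assume "obj y"
  then have "\<z> y x : Hom y x" "\<z> x y : Hom x y" using x by (simp_all add: hom_iff)
  then show "\<exists>!f. f : Hom y x" "\<exists>!f. f : Hom x y" using * ** by metis+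
 qed
qed

lemma simple_obj [simp]:"simple x ==> obj x" by (simp add: simple_object_def)

lemma simple_ident_nonzero:"simple x ==> \<i> x \<noteq> \<z> x x"
 unfolding simple_object_def using zero_objectI by blast

lemma kernel_mono:
 assumes "is_kernel A k f"
 shows "mono_arr A k" unfolding mono_arr_def
proof (intro conjI ballI impI)
 have k:"arr f" "arr k" "Cod A k=Dom A f" "f o k=\<z> (Dom A k) (Cod A f)" using assms by (auto simp: is_kernel_def hom_iff)
 show "arr k" by fact
 fix x g h
 assume x:"obj x" and g:"g : Hom x (Dom A k)" and h:"h : Hom x (Dom A k)" and e:"k o g = k o h"
 have "f o (k o g)=\<z> x (Cod A f)" using k g x tail[OF k(4), of g] by (simp add: hom_iff)
 moreover have "k o g : Hom x (Dom A f)" using k g by (simp add: hom_iff)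
 ultimately have "\<exists>!h. h : Hom x (Dom A k) \<and> k o h=k o g" using assms x by (auto simp: is_kernel_def)
 then show "g=h" using g h e by auto
qed

end

context abelian_linear_category
begin

text \<open>The kernel of \<open>f\<close> is a subobject of \<open>x\<close> and \<open>f\<close> is not zero,
  so \<open>f\<close> is mono; a nonzero mono into a simple object is invertible.\<close>
lemma schur_iso:
 assumes x:"simple x" and y:"simple y" and f:"f : Hom x y" and nz:"f \<noteq> \<z> x y"
 shows "iso_arr A f"
proof -
 note f' = homD[OF f(1)]
 obtain k where k:"is_kernel A k f" using kernel_exists f' by blast
 have k':"arr k" "Cod A k=x" "f o k=\<z> (Dom A k) y" using k f' by (auto simp: is_kernel_def hom_iff)
 show ?thesis
 proof (cases "zero_object A (Dom A k)")
  case True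
  have "mono_arr A f" unfolding mono_arr_def
  proof (intro conjI ballI impI)
   fix w g h
   assume w:"obj w" and g:"g : Hom w (Dom A f)" and h:"h : Hom w (Dom A f)" and e:"f o g = f o h"
   have gh:"g +. (-1)*.h : Hom w (Dom A f)" using g h by (simp add: hom_iff)
   have "f o (g +. (-1)*.h)=1*.(f o h) +. (-1)*.(f o h)" using f' g h e by (simp add: hom_iff comp_add)
   also have "...=(1 + (-1))*.(f o h)" using f' h by (intro scale_add_left[symmetric]) (simp add: hom_iff)
   finally have "f o (g +. (-1)*.h)=(1 + (-1))*.(f o h)" .
   then have "f o (g +. (-1)*.h)=\<z> w (Cod A f)" using f' h by (simp add: hom_iff)
   then obtain u where u:"u : Hom w (Dom A k)" "k o u=g +. (-1)*.h" using k w gh unfolding is_kernel_def by blast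
   have "u=\<z> w (Dom A k)" using zero_object_arrow[OF True u(1)] .
   then have "g +. (-1)*.h=\<z> w (Dom A f)" using u k' w f' by auto
   then show "g=h" using minus_zero_eq[of g h] g h by (simp add: hom_iff)
  qed (use f' in simp)
  then show ?thesis using y x f' by (auto simp: simple_object_def)
 next
  case False
  then have i:"iso_arr A k" using kernel_mono[OF k] k' x by (auto simp: simple_object_def)
  have "f=f o (k o Inv k)" using i k'(2) f' by simp
  also have "...=(f o k) o Inv k" using i k'(2) f' by (intro comp_assoc_right[symmetric]) simp_all
  also have "...=\<z> (Dom A k) y o Inv k" by (simp only: k'(3))
  also have "...=\<z> x y" using i k'(2) simple_obj[OF y] by simp
  finally show ?thesis using nz by simp
 qed
qed

lemma schur_zero:
 assumes "simple x" "simple y" "\<not> isomorphic A x y" "f : Hom x y"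
 shows "f = \<z> x y" using schur_iso[of x y f] assms unfolding isomorphic_def by blast

end

text \<open>By elimination of one coordinate at a time.\<close>
lemma linear_dependence:
 fixes v ::"'i => 'b => complex"
 assumes "finite B" "finite I" "card B < card I"
 shows "\<exists>c. (\<exists>i\<in>I. c i \<noteq> 0) \<and> (\<forall>b\<in>B. (\<Sum>i\<in>I. c i * v i b) = 0)" using assms
proof (induction B arbitrary: I v rule: finite_induct)
 case empty
 then obtain i where "i \<in> I" by fastforce
 then show ?case by (intro exI[of _ "%_. 1"]) auto
next
 case (insert b B)
 show ?case
 proof (cases "\<forall>i\<in>I. v i b = 0")
  case True
  have "card B < card I" using insert by simp
  then obtain c where "\<exists>i\<in>I. c i \<noteq> 0" "\<forall>b\<in>B. (\<Sum>i\<in>I. c i * v i b)=0"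
   using insert.IH[of I v] insert.prems by auto
  then show ?thesis using True by (intro exI[of _ c]) simp
 next
  case False
  then obtain k where k:"k \<in> I" "v k b \<noteq> 0" by auto
  define J where "J = I - {k}"
  have J:"finite J" "card B < card J" "I=insert k J" "k \<notin> J" using insert k by (auto simp: J_def card_Diff_singleton)
  obtain c where c:"\<exists>i\<in>J. c i \<noteq> 0" "\<forall>d\<in>B. (\<Sum>i\<in>J. c i * (v i d - v i b / v k b * v k d)) = 0"
   using insert.IH[of J "%i d. v i d - v i b / v k b * v k d"] J by auto
  define e where "e i = (if i = k then - (\<Sum>i\<in>J. c i * v i b) / v k b else c i)" for i
  have "(\<Sum>i\<in>I. e i * v i d)=(\<Sum>i\<in>J. c i * (v i d - v i b / v k b * v k d))" for d
  proof -
   have "(\<Sum>i\<in>J. e i * v i d)=(\<Sum>i\<in>J. c i * v i d)" by (rule sum.cong) (use J in \<open>auto simp: e_def\<close>)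
   then have "(\<Sum>i\<in>I. e i * v i d)=(\<Sum>i\<in>J. c i * v i d) - (\<Sum>i\<in>J. c i * v i b) / v k b * v k d"
   using J by (simp add: e_def)
   also have "(\<Sum>i\<in>J. c i * v i b) / v k b * v k d=(\<Sum>i\<in>J. c i * (v i b / v k b * v k d))"
   unfolding sum_divide_distrib sum_distrib_right by (rule sum.cong) simp_all
   also have "(\<Sum>i\<in>J. c i * v i d) - (\<Sum>i\<in>J. c i * (v i b / v k b * v k d))
   = (\<Sum>i\<in>J. c i * v i d - c i * (v i b / v k b * v k d))" by (rule sum_subtractf[symmetric])
   also have "...=(\<Sum>i\<in>J. c i * (v i d - v i b / v k b * v k d))" by (simp add: right_diff_distrib)
   finally show ?thesis .
  qed
  moreover have "(\<Sum>i\<in>J. c i * (v i b - v i b / v k b * v k b))=0" using k by simp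
  moreover have "\<exists>i\<in>I. e i \<noteq> 0" using c(1) J by (auto simp: e_def)
  ultimately show ?thesis using c(2) by (intro exI[of _ e]) auto
 qed
qed

context semisimple_category
begin

lemma basis_coordinates:
 assumes "hom_basis A x y B" "f : Hom x y"
 shows "\<exists>c. f = hsum x y B (%\<f>. c \<f>*.\<f>)"
proof -
 have "\<exists>!c. c \<in> extensional B \<and> f=hsum x y B (%\<f>. c \<f>*.\<f>)" using assms unfolding hom_basis_def by simp
 then show ?thesis by blast
qed

text \<open>The powers of \<open>f\<close> are linearly dependent, hence some nonzero polynomial kills
  \<open>f\<close>. Its roots lie in the complex numbers, so some factor \<open>f - c\<close> is not invertible
  and vanishes by Schur's lemma.\<close>
lemma schur_scalar:
 assumes x:"simple x" and f:"f : Hom x x"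
 shows "\<exists>c. f = c*.\<i> x" (is ?P1)
proof -
 have o:"obj x" using x by simp
 note f' = homD[OF f(1)]
 define z where "z = \<z> x x"
 have z:"z ::: x ~> x" using o by (simp_all add: z_def)
 define E ::"complex poly => 'm" where "E p = fold_coeffs (%a r. a*.\<i> x +. f o r) p z" for p
 have E0:"E 0=z" by (simp add: E_def)
 have Ep:"E (pCons a p)=a*.\<i> x +. f o E p" for a p
 proof (cases "a = 0 \<and> p = 0")
  case True
  then show ?thesis using o f' by (simp add: E_def z_def)
 next
  case False
  then show ?thesis by (cases "p=0") (auto simp: E_def)
 qed
 have Et:"E p ::: x ~> x" for p by (induction p) (use o f' z in \<open>simp_all add: E0 Ep\<close>)
 have add4:"(p +. q) +. (r +. s)=(p +. r) +. (q +. s)"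
  if "p : Hom x x" "q : Hom x x" "r : Hom x x" "s : Hom x x" for p q r s
 proof -
  have "(p +. q) +. (r +. s)=p +. ((q +. r) +. s)" using that by (simp add: hom_iff add_assoc)
  also have "q +. r=r +. q" using that by (intro add_comm) (simp_all add: hom_iff)
  also have "p +. ((r +. q) +. s)=(p +. r) +. (q +. s)" using that by (simp add: hom_iff add_assoc)
  finally show ?thesis .
 qed
 have Eadd:"E (p + q)=E p +. E q" for p q
 proof (induction p q rule: poly_induct2)
  case 0
  then show ?case using o by (simp add: E0 z_def)
 next
  case (pCons a p b q)
  have "E (pCons a p + pCons b q)=(a*.\<i> x +. b*.\<i> x) +. (f o E p +. f o E q)"
   using pCons o f' Et by (simp add: Ep scale_add_left comp_add)
  also have "...=E (pCons a p) +. E (pCons b q)" unfolding Ep using o f' Et by (intro add4) (simp_all add: hom_iff)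
  finally show ?case .
 qed
 have Esmult:"E (Polynomial.smult c p)=c*.E p" for c p
  by (induction p) (use o f' Et in \<open>simp_all add: E0 Ep z_def scale_add_right\<close>)
 have Esum:"E (\<Sum>i\<in>K. p i)=hsum x x K (%i. E (p i))" if "finite K" for K and p ::"nat => complex poly" using that
 proof (induction K)
  case empty
  then show ?case using o by (simp add: E0 z_def)
 next
  case (insert k K)
  then show ?case using o Et by (subst hsum_insert) (auto simp: Eadd hom_iff)
 qed
 obtain B where B:"hom_basis A x x B" using hom_finite_dim o by blast
 then have fB:"finite B" "!!b. b : B ==> b : Hom x x" by (auto simp: hom_basis_def)
 let ?n = "card B"
 define P where "P i = Polynomial.monom (1::complex) i" for i
 have "\<exists>c. E (P i)=hsum x x B (%b. c b*.b)" for i using basis_coordinates[OF B, of "E (P i)"] Et by (simp add: hom_iff)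
 then obtain v where v:"!!i. E (P i)=hsum x x B (%b. v i b*.b)" by metis
 obtain c where c:"\<exists>i\<in>{..?n}. c i \<noteq> 0" "\<forall>b\<in>B. (\<Sum>i\<in>{..?n}. c i * v i b) = 0"
  using linear_dependence[OF fB(1), of "{..?n}" v] by auto
 define p where "p = (\<Sum>i\<in>{..?n}. Polynomial.smult (c i) (P i))"
 have "E p=hsum x x {..?n} (%i. hsum x x B (%b. (c i * v i b)*.b))" unfolding p_def Esum[OF finite_atMost] using o fB
  by (intro hsum_cong) (auto simp: Esmult v scale_hsum hom_iff intro!: hsum_cong)
 also have "...=hsum x x B (%b. hsum x x {..?n} (%i. (c i * v i b)*.b))" using o fB by (intro hsum_swap) (auto simp: hom_iff)
 also have "...=hsum x x B (%b. \<z> x x)"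
 proof (rule hsum_cong[OF o o])
  fix b assume b:"b : B"
  then have "arr b" "Dom A b=x" "Cod A b=x" using fB(2) by (auto simp: hom_iff)
  then show "hsum x x {..?n} (%i. (c i * v i b)*.b)=\<z> x x" using hsum_scale_const[of b "{..?n}" "%i. c i * v i b"] c(2) b by simp
 qed (use o in \<open>simp add: hom_iff\<close>)
 also have "...=z" using o by (simp add: hsum_zero z_def)
 finally have Ep0:"E p=z" .
 have p0:"p \<noteq> 0"
 proof
  assume "p = 0"
  obtain k where k:"k \<le> ?n" "c k \<noteq> 0" using c(1) by auto
  have "Polynomial.coeff p k=(\<Sum>i\<in>{..?n}. if i=k then c i else 0)"
   unfolding p_def Polynomial.coeff_sum P_def by (intro sum.cong) auto
  then show False using k \<open>p = 0\<close> by simp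
 qed
 have lin:"E ([:- a, 1:] * q)=(f +. (- a)*.\<i> x) o E q" for a q
 proof -
  have "[:- a, 1:] * q=Polynomial.smult (- a) q + pCons 0 q" by simp
  then have "E ([:- a, 1:] * q)=(- a)*.E q +. f o E q" using o f' Et[of q] by (simp only: Eadd Esmult Ep) simp
  also have "...=f o E q +. (- a)*.E q" using o f' Et[of q] by (intro add_comm) simp_all
  also have "...=(f +. (- a)*.\<i> x) o E q" using o f' Et[of q] by (simp add: add_comp)
  finally show ?thesis .
 qed
 have ?P1 if "p \<noteq> 0" "E p=z" for p using that
 proof (induction "degree p" arbitrary: p rule: less_induct)
  case less
  show ?case
  proof (cases "degree p = 0")
   case True
   then obtain a where a:"p=[:a:]" using degree_eq_zeroE by blast
   then have "a*.\<i> x=0*.\<i> x" using less.prems(2) o f' by (simp add: Ep E0 z_def)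
   then have "a=0" using scale_cancel[of "\<i> x" a 0] simple_ident_nonzero[OF x] o by simp
   then show ?thesis using less.prems(1) a by simp
  next
   case False
   then have "\<not> constant (poly p)" by (simp add: constant_degree)
   then obtain a where "poly p a=0" using fundamental_theorem_of_algebra by blast
   then have "[:- a, 1:] dvd p" by (simp only: poly_eq_0_iff_dvd)
   then obtain q where q:"p=[:- a, 1:] * q" by (rule dvdE)
   then have q0:"q \<noteq> 0" using less.prems(1) by auto
   then have deg:"degree q < degree p" using q by (simp add: degree_mult_eq del: mult_pCons_left)
   have e:"(f +. (- a)*.\<i> x) o E q=z" using lin less.prems(2) q by simp
   show ?thesis
   proof (cases "f +. (- a)*.\<i> x = \<z> x x")
   case True
   then have "f=a*.\<i> x" using minus_zero_eq[of f "a*.\<i> x"] f' o by simp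
   then show ?thesis by blast
   next
   case False
   then have "iso_arr A (f +. (- a)*.\<i> x)" using schur_iso[OF x x, of "f +. (- a)*.\<i> x"] f' o by (simp add: hom_iff)
   then have "E q=z" using iso_cancel_left[of "f +. (- a)*.\<i> x" "E q" z] e Et[of q] z f' o by (simp add: z_def)
   then show ?thesis using less.hyps[OF deg q0] by simp
   qed
  qed
 qed
 then show ?thesis using p0 Ep0 by blast
qed

section \<open>Bases of spaces of arrows to a simple object\<close>

lemma isomorphicI:"iso_arr A f ==> f : Hom x y ==> isomorphic A x y" by (auto simp: isomorphic_def)

lemma isomorphicE:
 assumes "isomorphic A x y"
 obtains f where "iso_arr A f" "arr f" "Dom A f = x" "Cod A f = y" using assms by (auto simp: isomorphic_def hom_iff)

lemma isomorphic_sym:"isomorphic A x y ==> isomorphic A y x" by (erule isomorphicE, rule isomorphicI, erule inv_inv(2)) (simp add: hom_iff)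

lemma isomorphic_trans:
 assumes "isomorphic A x y" "isomorphic A y z"
 shows "isomorphic A x z"
proof -
 obtain f where f:"iso_arr A f" "arr f" "Dom A f = x" "Cod A f = y" by (rule isomorphicE[OF assms(1)])
 obtain g where g:"iso_arr A g" "arr g" "Dom A g = y" "Cod A g = z" by (rule isomorphicE[OF assms(2)])
 show ?thesis by (rule isomorphicI[of "g o f"]) (use f g in \<open>simp_all add: comp_iso hom_iff\<close>)
qed

lemma separated_into_simple:
 assumes k:"simple k" and t:"t : Hom k x" "t' : Hom k x"
  and eq:"!!h. h : Hom x k ==> h o t = h o t'"
 shows "t = t'"
proof -
 have o:"obj k" "obj x" using hom_obj[OF t(1)] by auto
 obtain n Y u v where s:"!!l. l < n ==> simple (Y l)" "direct_sum A {..<n::nat} Y x u v" using semisimple[OF o(2)] by blast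
 have uv:"u l : Hom (Y l) x" "v l : Hom x (Y l)" if "l < n" for l using s(2) that by (auto simp: direct_sum_def)
 have c:"hsum x x {..<n} (%l. u l o v l)=\<i> x" using s(2) by (simp add: direct_sum_def)
 have vt:"v l o t=v l o t'" if l:"l < n" for l
 proof (cases "isomorphic A (Y l) k")
  case False
  then have "\<not> isomorphic A k (Y l)" using isomorphic_sym by blast
  then show ?thesis using schur_zero[OF k s(1)[OF l], of "v l o t"] schur_zero[OF k s(1)[OF l], of "v l o t'"]
   uv[OF l] t by (simp add: hom_iff)
 next
  case True
  then obtain g where g:"g : Hom (Y l) k" "iso_arr A g" by (auto simp: isomorphic_def)
  have "g o (v l o t)=g o (v l o t')" using eq[of "g o v l"] g uv[OF l] t by (simp add: hom_iff)
  then show ?thesis using iso_cancel_left[of g "v l o t" "v l o t'"] g uv[OF l] t by (simp add: hom_iff)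
 qed
 have "hsum x x {..<n} (%l. u l o v l) o t=hsum k x {..<n} (%l. u l o (v l o t))"
  using t uv o by (subst hsum_comp) (auto simp: hom_iff intro!: hsum_cong)
 also have "...=hsum k x {..<n} (%l. u l o (v l o t'))" using t uv o vt by (intro hsum_cong) (auto simp: hom_iff)
 also have "...=hsum x x {..<n} (%l. u l o v l) o t'" using t uv o by (subst hsum_comp) (auto simp: hom_iff intro!: hsum_cong)
 finally show ?thesis unfolding c using t by (simp add: hom_iff)
qed

text \<open>A decomposition of \<open>x\<close> into simple objects shows that composition is a perfect pairing
  between arrows into and out of \<open>x\<close>.\<close>
lemma functional_represented:
 assumes k:"simple k" and x:"obj x"
  and add:"!!g h. g : Hom x k ==> h : Hom x k ==> G (g +. h) = G g + G h"
  and sc:"!!c h. h : Hom x k ==> G (c*.h) = c * (G h :: complex)"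
 shows "\<exists>t \<in> Hom k x. \<forall>\<psi> \<in> Hom x k. \<psi> o t = G \<psi>*.\<i> k"
proof -
 have lin:"G (hsum x k {..<n} (%l. c l*.h l))=(\<Sum>l<n. c l * G (h l))"
  if "!!l. l < n ==> h l : Hom x k" for n :: nat and c h using that
 proof (induction n)
  case 0
  have "G (\<z> x k)=0" using sc[of "\<z> x k" 0] x k by (simp add: hom_iff)
  then show ?case using x k by simp
 next
  case (Suc n)
  have "hsum x k {..<Suc n} (%l. c l*.h l)=c n*.h n +. hsum x k {..<n} (%l. c l*.h l)"
   unfolding lessThan_Suc using Suc.prems x k by (intro hsum_insert) (auto simp: hom_iff less_Suc_eq)
  moreover have hl:"c l*.h l : Hom x k" if "l < Suc n" for l using Suc.prems[OF that] by (simp add: hom_iff)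
  moreover have "hsum x k {..<n} (%l. c l*.h l) : Hom x k" using x k hl by (intro hsum_in) auto
  ultimately show ?case using Suc add sc by simp
 qed
 have o:"obj k" using k by simp
 obtain n Y u v where s:"!!l. l < n ==> simple (Y l)" "direct_sum A {..<n::nat} Y x u v" using semisimple[OF x] by blast
 have uv:"u l : Hom (Y l) x" "v l : Hom x (Y l)" if "l < n" for l using s(2) that by (auto simp: direct_sum_def)
 have c:"hsum x x {..<n} (%l. u l o v l)=\<i> x" using s(2) by (simp add: direct_sum_def)
 define g where "g l = (if isomorphic A (Y l) k then (SOME g. g : Hom (Y l) k \<and> iso_arr A g) else \<z> (Y l) k)" for l
 define g' where "g' l = (if isomorphic A (Y l) k then Inv (g l) else \<z> k (Y l))" for l
 have gi:"g l : Hom (Y l) k" "iso_arr A (g l)" if "isomorphic A (Y l) k" for l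
 proof -
  have "\<exists>g. g : Hom (Y l) k \<and> iso_arr A g" using that by (auto simp: isomorphic_def)
  from someI_ex[OF this] show "g l : Hom (Y l) k" "iso_arr A (g l)" using that by (auto simp: g_def)
 qed
 have gt:"g l : Hom (Y l) k" "g' l : Hom k (Y l)" if "l < n" for l
  using gi[of l] s(1)[OF that] o by (cases "isomorphic A (Y l) k"; auto simp: g_def g'_def hom_iff)+
 define t where "t = hsum k x {..<n} (%l. G (g l o v l)*.(u l o g' l))"
 have ug:"u l o g' l : Hom k x" "g l o v l : Hom x k" if "l < n" for l using gt[OF that] uv[OF that] by (simp_all add: hom_iff)
 then have t:"t : Hom k x" unfolding t_def using o x by (intro hsum_in) (auto simp: hom_iff)
 have "\<psi> o t=G \<psi>*.\<i> k" if \<psi>:"\<psi> : Hom x k" for \<psi>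
 proof -
  have "\<exists>a. \<psi> o (u l o g' l)=a*.\<i> k" if "l < n" for l using schur_scalar[OF k comp_in[OF ug(1)[OF that] \<psi>]] .
  then obtain a where a:"!!l. l < n ==> \<psi> o (u l o g' l)=a l*.\<i> k" by metis
  have e:"\<psi> o u l=a l*.g l" if l:"l < n" for l
  proof (cases "isomorphic A (Y l) k")
   case True
   then have g':"g' l=Inv (g l)" by (simp add: g'_def)
   have "(\<psi> o u l)=(\<psi> o (u l o g' l)) o g l" using gi[OF True] uv[OF l] \<psi> by (simp add: g' hom_iff)
   then show ?thesis unfolding a[OF l] using gi[OF True] o by (simp add: hom_iff)
  next
   case False
   then show ?thesis using schur_zero[OF s(1)[OF l] k False, of "\<psi> o u l"] uv[OF l] \<psi> s(1)[OF l] o by (simp add: g_def hom_iff)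
  qed
  have "\<psi>=\<psi> o hsum x x {..<n} (%l. u l o v l)" unfolding c using \<psi> by (simp add: hom_iff)
  also have "...=hsum x k {..<n} (%l. (\<psi> o u l) o v l)" using \<psi> uv x by (subst comp_hsum) (auto simp: hom_iff intro!: hsum_cong)
  also have "...=hsum x k {..<n} (%l. a l*.(g l o v l))" using gt uv x o by (intro hsum_cong) (auto simp: e hom_iff)
  finally have 1:"\<psi>=hsum x k {..<n} (%l. a l*.(g l o v l))" .
  have 2:"G \<psi>=(\<Sum>l<n. a l * G (g l o v l))" using gt uv by (subst 1, subst lin) (auto simp: hom_iff)
  have "\<psi> o t=hsum k k {..<n} (%l. \<psi> o (G (g l o v l)*.(u l o g' l)))"
   unfolding t_def using \<psi> gt uv o by (subst comp_hsum) (auto simp: hom_iff)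
  also have "...=hsum k k {..<n} (%l. (a l * G (g l o v l))*.\<i> k)"
  proof (rule hsum_cong[OF o o])
   fix l assume "l \<in> {..<n}"
   then have l:"l < n" by simp
   have "\<psi> o (G (g l o v l)*.(u l o g' l))=G (g l o v l)*.(\<psi> o (u l o g' l))"
   using \<psi> gt[OF l] uv[OF l] by (simp add: hom_iff)
   then show "\<psi> o (G (g l o v l)*.(u l o g' l))=(a l * G (g l o v l))*.\<i> k"
   unfolding a[OF l] using o by (simp add: mult.commute)
  qed (use o in \<open>simp add: hom_iff\<close>)
  also have "...=G \<psi>*.\<i> k" using hsum_scale_const[of "\<i> k" "{..<n}" "%l. a l * G (g l o v l)"] o 2 by simp
  finally show ?thesis .
 qed
 then show ?thesis using t by blast
qed

end

context semisimple_category
begin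

lemma basis_in:"hom_basis A x y B ==> \<f> : B ==> \<f> : Hom x y"
 and basis_finite:"hom_basis A x y B ==> finite B" by (auto simp: hom_basis_def)

lemma basis_typ:
 assumes "hom_basis A x y B" "\<f> : B"
 shows "\<f> ::: x ~> y" using basis_in[OF assms] by (simp_all add: hom_iff)

lemma basis_unique:
 assumes B:"hom_basis A x y B" and o:"obj x" "obj y"
  and eq:"hsum x y B (%\<f>. c \<f>*.\<f>) = hsum x y B (%\<f>. d \<f>*.\<f>)" and \<f>:"\<f> : B"
 shows "c \<f> = d \<f>"
proof -
 have r:"hsum x y B (%\<f>. restrict e B \<f>*.\<f>)=hsum x y B (%\<f>. e \<f>*.\<f>)" for e ::"'m => complex"
  using o basis_typ[OF B] by (intro hsum_cong) (simp_all add: hom_iff)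
 have "hsum x y B (%\<f>. c \<f>*.\<f>) : Hom x y" using o basis_typ[OF B] by (intro hsum_in) (simp_all add: hom_iff)
 then have "\<exists>!e. e \<in> extensional B \<and> hsum x y B (%\<f>. c \<f>*.\<f>)=hsum x y B (%\<f>. e \<f>*.\<f>)"
  using B unfolding hom_basis_def by simp
 moreover have "restrict c B \<in> extensional B \<and> hsum x y B (%\<f>. c \<f>*.\<f>)=hsum x y B (%\<f>. restrict c B \<f>*.\<f>)"
  by (simp only: r) simp
 moreover have "restrict d B \<in> extensional B \<and> hsum x y B (%\<f>. c \<f>*.\<f>)=hsum x y B (%\<f>. restrict d B \<f>*.\<f>)"
  by (simp only: r eq) simp
 ultimately have "restrict c B=restrict d B" by blast
 then show ?thesis using \<f> by (metis restrict_apply')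
qed

lemma basis_single:
 assumes "hom_basis A x y B" "obj x" "obj y" "\<psi> : B"
 shows "hsum x y B (%\<f>. (if \<f> = \<psi> then 1 else 0)*.\<f>) = \<psi>"
 using basis_typ[OF assms(1)] basis_finite[OF assms(1)] assms(2-) by (subst hsum_single[where k = \<psi>]) (auto simp: hom_iff)

lemma additive_on_basis:
 assumes B:"hom_basis A x k B" and o:"obj x" "obj k"
  and h:"h : Hom x k" and t:"t : Hom y x" "t' : Hom y x" and eq:"!!\<psi>. \<psi> : B ==> \<psi> o t = \<psi> o t'"
 shows "h o t = h o t'"
proof -
 obtain c where c:"h = hsum x k B (%\<f>. c \<f>*.\<f>)" using basis_coordinates[OF B h] by blast
 have "obj y" using hom_obj t by blast
 have "hsum x k B (%\<f>. c \<f>*.\<f>) o t=hsum y k B (%\<f>. c \<f>*.(\<f> o t))" if t:"t : Hom y x" for t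
  using basis_typ[OF B] basis_finite[OF B] t o hom_obj[OF t] by (subst hsum_comp) (auto simp: hom_iff intro!: hsum_cong)
 moreover have "hsum y k B (%\<f>. c \<f>*.(\<f> o t))=hsum y k B (%\<f>. c \<f>*.(\<f> o t'))"
  using basis_typ[OF B] t eq o \<open>y \<in> Obj A\<close> by (intro hsum_cong) (auto simp: hom_iff)
 ultimately show ?thesis using c t by simp
qed

lemma dual_vector:
 assumes k:"simple k" and x:"obj x" and B:"hom_basis A x k B" and \<f>:"\<f> : B"
 shows "dual_vector A x k B \<f> : Hom k x" (is ?P1)
  "!!\<psi>. \<psi> : B ==> \<psi> o dual_vector A x k B \<f> = (if \<psi> = \<f> then \<i> k else \<z> k k)"
proof -
 have o:"obj k" using k by simp
 obtain co where co:"!!h. h : Hom x k ==> h = hsum x k B (%\<f>. co h \<f>*.\<f>)" using basis_coordinates[OF B] by metis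
 have u:"co h \<f>=c \<f>" if "h : Hom x k" "h=hsum x k B (%\<f>. c \<f>*.\<f>)" for h c
  using basis_unique[OF B x o _ \<f>, of "co h" c] co[OF that(1)] that(2) by simp
 have "\<exists>t\<in>Hom k x. \<forall>\<psi>\<in>Hom x k. \<psi> o t=co \<psi> \<f>*.\<i> k"
 proof (rule functional_represented[OF k x])
  fix g h c assume g:"g : Hom x k" and h:"h : Hom x k"
  have "hsum x k B (%\<f>. (co g \<f> + co h \<f>)*.\<f>)=hsum x k B (%\<f>. co g \<f>*.\<f> +. co h \<f>*.\<f>)"
   using basis_typ[OF B] x o by (intro hsum_cong) (auto simp: hom_iff scale_add_left)
  also have "...=hsum x k B (%\<f>. co g \<f>*.\<f>) +. hsum x k B (%\<f>. co h \<f>*.\<f>)"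
   using basis_typ[OF B] x o by (intro hsum_add) (auto simp: hom_iff)
  also have "...=g +. h" using co[OF g] co[OF h] by simp
  finally have "g +. h=hsum x k B (%\<f>. (co g \<f> + co h \<f>)*.\<f>)" by simp
  moreover have "g +. h : Hom x k" using g h by (simp add: hom_iff)
  ultimately show "co (g +. h) \<f>=co g \<f> + co h \<f>" using u[of "g +. h" "%\<f>. co g \<f> + co h \<f>"] by blast
 next
  fix c h assume h:"h : Hom x k"
  have "c*.h=c*.hsum x k B (%\<f>. co h \<f>*.\<f>)" using co[OF h] by simp
  also have "...=hsum x k B (%\<f>. (c * co h \<f>)*.\<f>)"
   using basis_typ[OF B] basis_finite[OF B] x o by (subst scale_hsum) (auto simp: hom_iff intro!: hsum_cong)
  finally have "c*.h=hsum x k B (%\<f>. (c * co h \<f>)*.\<f>)" .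
  moreover have "c*.h : Hom x k" using h by (simp add: hom_iff)
  ultimately show "co (c*.h) \<f>=c * co h \<f>" using u[of "c*.h" "%\<f>. c * co h \<f>"] by blast
 qed
 then obtain t where t:"t : Hom k x" "!!\<psi>. \<psi> : Hom x k ==> \<psi> o t=co \<psi> \<f>*.\<i> k" by blast
 have "\<psi> o t=(if \<psi>=\<f> then \<i> k else \<z> k k)" if \<psi>:"\<psi> : B" for \<psi>
  using t(2)[OF basis_in[OF B \<psi>]] u[OF basis_in[OF B \<psi>] basis_single[OF B x o \<psi>, symmetric]] o by (auto split: if_splits)
 with t(1) have ex:"t : Hom k x \<and> (\<forall>\<psi>\<in>B. \<psi> o t = (if \<psi> = \<f> then \<i> k else \<z> k k))" by blast
 moreover have "t'=t" if "t' : Hom k x \<and> (\<forall>\<psi>\<in>B. \<psi> o t'=(if \<psi>=\<f> then \<i> k else \<z> k k))" for t'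
 proof (rule separated_into_simple[OF k])
  show "t' : Hom k x" "t : Hom k x" using that t by auto
  fix h assume h:"h : Hom x k"
  show "h o t'=h o t" by (rule additive_on_basis[OF B x o h]) (use that ex in auto)
 qed
 ultimately have "dual_vector A x k B \<f>=t" unfolding dual_vector_def by (rule the_equality)
 then show ?P1
  "!!\<psi>. \<psi> : B ==> \<psi> o dual_vector A x k B \<f> = (if \<psi> = \<f> then \<i> k else \<z> k k)"
  using ex by auto
qed

lemma dual_vector_typ:
 assumes "simple k" "obj x" "hom_basis A x k B" "\<f> : B"
 shows "dual_vector A x k B \<f> ::: k ~> x"
 using dual_vector(1)[OF assms] by (simp_all add: hom_iff)

lemma expand_in_basis:
 assumes k:"simple k" and x:"obj x" and B:"hom_basis A x k B" and h:"h : Hom x k"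
 shows "hsum x k B (%\<f>. (h o dual_vector A x k B \<f>) o \<f>) = h"
proof -
 have o:"obj k" using k by simp
 obtain c where c:"h = hsum x k B (%\<f>. c \<f>*.\<f>)" using basis_coordinates[OF B h] by blast
 have "(h o dual_vector A x k B \<f>)=c \<f>*.\<i> k" if \<f>:"\<f> : B" for \<f>
 proof -
  note t = dual_vector_typ[OF k x B \<f>]
  have "h o dual_vector A x k B \<f>=hsum k k B (%\<psi>. c \<psi>*.(\<psi> o dual_vector A x k B \<f>))"
   unfolding c using basis_typ[OF B] basis_finite[OF B] o t by (subst hsum_comp) (auto simp: hom_iff intro!: hsum_cong)
  also have "...=c \<f>*.(\<f> o dual_vector A x k B \<f>)"
   by (rule hsum_single) (use o basis_finite[OF B] \<f> dual_vector(2)[OF k x B \<f>] in \<open>auto simp: hom_iff\<close>)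
  also have "...=c \<f>*.\<i> k" using dual_vector(2)[OF k x B \<f> \<f>] by simp
  finally show ?thesis .
 qed
 then have "hsum x k B (%\<f>. (h o dual_vector A x k B \<f>) o \<f>)=hsum x k B (%\<f>. c \<f>*.\<f>)"
  using basis_typ[OF B] o x by (intro hsum_cong) (auto simp: hom_iff)
 then show ?thesis using c by simp
qed

lemma expand_in_dual_basis:
 assumes k:"simple k" and x:"obj x" and B:"hom_basis A x k B" and t:"t : Hom k x"
 shows "hsum k x B (%\<f>. dual_vector A x k B \<f> o (\<f> o t)) = t"
proof -
 have o:"obj k" using k by simp
 note bt = basis_typ[OF B] and dt = dual_vector_typ[OF k x B]
 note t' = homD[OF t(1)]
 let ?s = "hsum k x B (%\<f>. dual_vector A x k B \<f> o (\<f> o t))"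
 have s:"?s : Hom k x" using o x bt dt t' by (intro hsum_in) (auto simp: hom_iff)
 have "\<psi> o ?s=\<psi> o t" if \<psi>:"\<psi> : B" for \<psi>
 proof -
  have "\<psi> o ?s=hsum k k B (%\<f>. (\<psi> o dual_vector A x k B \<f>) o (\<f> o t))"
   using basis_finite[OF B] o x bt dt t' \<psi> by (subst comp_hsum) (auto simp: hom_iff intro!: hsum_cong)
  also have "...=(\<psi> o dual_vector A x k B \<psi>) o (\<psi> o t)"
   by (rule hsum_single) (use o basis_finite[OF B] \<psi> dual_vector(2)[OF k x B] bt t' in \<open>auto simp: hom_iff\<close>)
  also have "...=\<psi> o t" using dual_vector(2)[OF k x B \<psi> \<psi>] bt[OF \<psi>] t' by simp
  finally show ?thesis .
 qed
 then have "h o ?s=h o t" if "h : Hom x k" for h using additive_on_basis[OF B x o that s t] by blast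
 then show ?thesis by (rule separated_into_simple[OF k s t])
qed

text \<open>The projections of a decomposition into simple objects, corrected by isomorphisms to
  representatives, are jointly monic.\<close>
lemma joint_mono:
 assumes R:"!!y. simple y ==> \<exists>k\<in>R. simple k \<and> isomorphic A y k"
  and f:"f : Hom w x" "g : Hom w x"
  and eq:"!!k h. k : R ==> simple k ==> h : Hom x k ==> h o f = h o g"
 shows "f = g"
proof -
 have o:"obj w" "obj x" using hom_obj[OF f(1)] by auto
 obtain n S u v where s:"!!l. l < n ==> simple (S l)" "direct_sum A {..<n::nat} S x u v" using semisimple[OF o(2)] by blast
 have uv:"u l : Hom (S l) x" "v l : Hom x (S l)" if "l < n" for l using s(2) that by (auto simp: direct_sum_def)
 have c:"hsum x x {..<n} (%l. u l o v l)=\<i> x" using s(2) by (simp add: direct_sum_def)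
 have vf:"v l o f=v l o g" if l:"l < n" for l
 proof -
  obtain k where k:"k : R" "simple k" "isomorphic A (S l) k" using R[OF s(1)[OF l]] by blast
  obtain q where q:"iso_arr A q" "arr q" "Dom A q = S l" "Cod A q = k" by (rule isomorphicE[OF k(3)])
  have "q o (v l o f)=q o (v l o g)" using eq[OF k(1,2), of "q o v l"] q uv[OF l] f by (simp add: hom_iff)
  then show ?thesis using iso_cancel_left[of q "v l o f" "v l o g"] q uv[OF l] f by (simp add: hom_iff)
 qed
 have *:"hsum x x {..<n} (%l. u l o v l) o f=hsum w x {..<n} (%l. u l o (v l o f))" if "f : Hom w x" for f
  using that uv o by (subst hsum_comp) (auto simp: hom_iff intro!: hsum_cong)
 have "hsum w x {..<n} (%l. u l o (v l o f))=hsum w x {..<n} (%l. u l o (v l o g))"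
  using f uv o vf by (intro hsum_cong) (auto simp: hom_iff)
 then show ?thesis using *[OF f(1)] *[OF f(2)] f unfolding c by (simp add: hom_iff)
qed

lemma representatives:
 assumes "simple_representatives A R"
 shows "!!k. k : R ==> simple k"
  "!!y. simple y ==> \<exists>k\<in>R. simple k \<and> isomorphic A y k"
  "!!i k. i : R ==> k : R ==> isomorphic A i k ==> i = k"
proof -
 show 1:"!!k. k : R ==> simple k" using assms by (simp add: simple_representatives_def)
 show "!!y. simple y ==> \<exists>k\<in>R. simple k \<and> isomorphic A y k"
  using assms 1 unfolding simple_representatives_def by blast
 fix i k assume ik:"i : R" "k : R" "isomorphic A i k"
 have "isomorphic A i i" using 1[OF ik(1)] by (intro isomorphicI[of "\<i> i"] inv_arrI(1)[of "\<i> i" "\<i> i"]) (simp_all add: hom_iff)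
 moreover have "\<exists>!j. j : R \<and> isomorphic A i j" using assms 1[OF ik(1)] by (simp add: simple_representatives_def)
 ultimately show "i=k" using ik by blast
qed

text \<open>By \<open>joint_mono\<close> it suffices to compose with arrows to representatives, where only the
  summand of the same representative survives, by Schur's lemma.\<close>
lemma completeness:
 assumes R:"simple_representatives A R" and fR:"finite R" and x:"obj x"
  and B:"!!k. k : R ==> hom_basis A x k (B k)"
 shows "hsum x x R (%k. hsum x x (B k) (%\<f>. dual_vector A x k (B k) \<f> o \<f>)) = \<i> x"
proof -
 note s = representatives[OF R]
 note bt = basis_typ[OF B] and dt = dual_vector_typ[OF s(1) x B]
 let ?S = "%k. hsum x x (B k) (%\<f>. dual_vector A x k (B k) \<f> o \<f>)"
 have S:"?S k : Hom x x" if "k : R" for k using x bt[OF that] dt[OF that that] by (intro hsum_in) (auto simp: hom_iff)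
 have T:"hsum x x R ?S : Hom x x" by (rule hsum_in[OF x x S])
 show ?thesis
 proof (rule joint_mono[OF s(2) T])
  show "\<i> x : Hom x x" using x by (simp add: hom_iff)
  fix k h assume k:"k : R" and h:"h : Hom x k"
  have ko:"obj k" using s(1)[OF k] by simp
  note h' = homD[OF h(1)]
  have hS:"h o ?S j=hsum x k (B j) (%\<f>. (h o dual_vector A x j (B j) \<f>) o \<f>)" if j:"j : R" for j
   using basis_finite[OF B[OF j]] x ko bt[OF j] dt[OF j j] h' by (subst comp_hsum) (auto simp: hom_iff intro!: hsum_cong)
  have "h o hsum x x R ?S=hsum x k R (%j. h o ?S j)" using comp_hsum[OF fR S h'(1) x] h' by simp
  also have "...=h o ?S k"
  proof (rule hsum_single[OF x ko fR k])
   show "h o ?S k : Hom x k" using S[OF k] h' by (simp add: hom_iff)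
   fix j assume j:"j : R" "j \<noteq> k"
   have jo:"obj j" using s(1)[OF j(1)] by simp
   have "h o dual_vector A x j (B j) \<f>=\<z> j k" if \<f>:"\<f> : B j" for \<f>
   using s(3)[OF j(1) k] j(2) dt[OF j(1,1) \<f>] h' by (intro schur_zero[OF s(1)[OF j(1)] s(1)[OF k]]) (auto simp: hom_iff)
   then have "hsum x k (B j) (%\<f>. (h o dual_vector A x j (B j) \<f>) o \<f>)=hsum x k (B j) (%\<f>. \<z> x k)"
   using bt[OF j(1)] x ko by (intro hsum_cong) (simp_all add: hom_iff)
   then show "h o ?S j=\<z> x k" using hS[OF j(1)] x ko by (simp add: hsum_zero)
  qed
  also have "...=h" using hS[OF k] expand_in_basis[OF s(1)[OF k] x B[OF k] h] by simp
  finally show "h o hsum x x R ?S=h o \<i> x" using h' by simp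
 qed
qed

text \<open>If the target had fewer basis vectors, the coordinates of the images would be linearly dependent,
  contradicting injectivity.\<close>
lemma card_basis_le:
 assumes B:"hom_basis A x y B" and B':"hom_basis A x' y' B'"
  and o:"obj x" "obj y" "obj x'" "obj y'"
  and F:"!!g. g : Hom x y ==> F g : Hom x' y'"
  and add:"!!g h. g : Hom x y ==> h : Hom x y ==> F (g +. h) = F g +. F h"
  and sc:"!!c g. g : Hom x y ==> F (c*.g) = c*.F g"
  and inj:"!!g. g : Hom x y ==> F g = \<z> x' y' ==> g = \<z> x y"
 shows "card B \<le> card B'"
proof (rule ccontr)
 assume "\<not> card B \<le> card B'"
 then have lt:"card B' < card B" by simp
 note bt = basis_typ[OF B] and bt' = basis_typ[OF B']
 have "\<exists>c. F \<f>=hsum x' y' B' (%\<psi>. c \<psi>*.\<psi>)" if "\<f> : B" for \<f>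
  using basis_coordinates[OF B' F[OF basis_in[OF B that]]] .
 then obtain v where v:"!!\<f>. \<f> : B ==> F \<f>=hsum x' y' B' (%\<psi>. v \<f> \<psi>*.\<psi>)" by metis
 obtain c where c:"\<exists>\<f>\<in>B. c \<f> \<noteq> 0" "\<forall>\<psi>\<in>B'. (\<Sum>\<f>\<in>B. c \<f> * v \<f> \<psi>) = 0"
  using linear_dependence[OF basis_finite[OF B'] basis_finite[OF B] lt, of v] by blast
 have s:"hsum x y B (%\<f>. c \<f>*.\<f>) : Hom x y" using o bt by (intro hsum_in) (auto simp: hom_iff)
 have "F (hsum x y B (%\<f>. c \<f>*.\<f>))=hsum x' y' B (%\<f>. F (c \<f>*.\<f>))"
  using o basis_finite[OF B] bt F add by (intro additive_hsum) (auto simp: hom_iff)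
 also have "...=hsum x' y' B (%\<f>. hsum x' y' B' (%\<psi>. (c \<f> * v \<f> \<psi>)*.\<psi>))"
 proof (rule hsum_cong[OF o(3,4)])
  fix \<f> assume \<f>:"\<f> : B"
  have "F (c \<f>*.\<f>)=c \<f>*.hsum x' y' B' (%\<psi>. v \<f> \<psi>*.\<psi>)" using sc[OF basis_in[OF B \<f>]] v[OF \<f>] by simp
  also have "...=hsum x' y' B' (%\<psi>. (c \<f> * v \<f> \<psi>)*.\<psi>)"
   using o bt' basis_finite[OF B'] by (subst scale_hsum) (auto simp: hom_iff intro!: hsum_cong)
  finally show "F (c \<f>*.\<f>)=hsum x' y' B' (%\<psi>. (c \<f> * v \<f> \<psi>)*.\<psi>)" .
  show "hsum x' y' B' (%\<psi>. (c \<f> * v \<f> \<psi>)*.\<psi>) : Hom x' y'" using o bt' by (intro hsum_in) (auto simp: hom_iff)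
 qed
 also have "...=hsum x' y' B' (%\<psi>. hsum x' y' B (%\<f>. (c \<f> * v \<f> \<psi>)*.\<psi>))"
  using o bt' basis_finite[OF B] basis_finite[OF B'] by (intro hsum_swap) (auto simp: hom_iff)
 also have "...=hsum x' y' B' (%\<psi>. \<z> x' y')"
 proof (rule hsum_cong[OF o(3,4)])
  fix \<psi> assume \<psi>:"\<psi> : B'"
  show "hsum x' y' B (%\<f>. (c \<f> * v \<f> \<psi>)*.\<psi>)=\<z> x' y'"
   using hsum_scale_const[of \<psi> B "%\<f>. c \<f> * v \<f> \<psi>"] bt'[OF \<psi>] c(2) \<psi> basis_finite[OF B] by simp
  show "\<z> x' y' : Hom x' y'" using o by (simp add: hom_iff)
 qed
 finally have "F (hsum x y B (%\<f>. c \<f>*.\<f>))=\<z> x' y'" using o by (simp add: hsum_zero)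
 then have "hsum x y B (%\<f>. c \<f>*.\<f>)=\<z> x y" using inj[OF s] by simp
 also have "...=hsum x y B (%\<f>. 0*.\<f>)"
  using o bt hsum_zero[OF o(1,2), of B] by (subst hsum_cong[of _ _ _ "%\<f>. 0*.\<f>" "%\<f>. \<z> x y"]) (auto simp: hom_iff)
 finally have "c \<f>=0" if "\<f> : B" for \<f> using basis_unique[OF B o(1,2) _ that, of c "%_. 0"] by simp
 then show False using c(1) by blast
qed

end

section \<open>Dual pairs and traces\<close>

context rigid_symmetric_category
begin

lemma cap_whisker:
 assumes "obj x" "obj y" "obj w"
 shows "cap x y<|w = cap x (y$w) o x|>\<a> x^* y w o \<a> x (x^*$y) w"
  "cup x y<|w = \<b> x^* (x$y) w o x^*|>\<b> x y w o cup x (y$w)" using assms by (simp_all add: cap_def cup_def spread)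

lemma sw_whisker:
 assumes "obj x" "obj y" "obj z" "obj w"
 shows "sw x y z<|w = \<b> y (x$z) w o y|>\<b> x z w o sw x y (z$w)
   o x|>\<a> y z w o \<a> x (y$z) w" using assms by (simp add: sw_def hat_def spread)

lemma cap'_whisker:
 assumes "obj x" "obj y" "obj w"
 shows "cap' x y<|w = cap' x (y$w) o x^*|>\<a> x y w o \<a> x^* (x$y) w" using assms by (simp add: cap'_def sw_whisker cap_whisker)

lemma symmetry_whisker:
 assumes "obj x" "obj y" "obj w"
 shows "\<s> x y<|w = \<b> y x w o sw x y w o \<a> x y w" using assms by (simp add: sw_def hat_def)

definition pair_cap ::"'o => 'o => 'm => 'o => 'm" where
 "pair_cap x y e w = \<l> w o e<|w o \<b> x y w"

definition pair_cup ::"'o => 'o => 'm => 'o => 'm" where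
 "pair_cup y x h w = \<a> y x w o h<|w o Inv (\<l> w)"

text \<open>Duality data for a pair of objects with its snake identities in right-nested form. It treats chosen
  duals, opposite duals and duals of tensor products alike.\<close>
definition dual_pair ::"'o => 'o => 'm => 'm => bool" where
 "dual_pair x y e h \<longleftrightarrow> obj x \<and> obj y \<and> e : Hom (x$y) \<I> \<and> h : Hom \<I> (y$x) \<and>
   (\<forall>w \<in> Obj A. pair_cap x y e (x$w) o x|>pair_cup y x h w = \<i> (x$w)) \<and>
   (\<forall>w \<in> Obj A. (y|>pair_cap x y e w) o pair_cup y x h (y$w) = \<i> (y$w))"

lemma pair_typ [simp]:
 assumes "obj x" "obj y" "obj w"
 shows "e : Hom (x$y) \<I> ==> pair_cap x y e w ::: x$y$w ~> w"
  "h : Hom \<I> (y$x) ==> pair_cup y x h w ::: w ~> y$x$w" using assms by (simp_all add: pair_cap_def pair_cup_def hom_iff)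

lemma pair_cap_natural:
 assumes x:"obj x" "obj y" "e : Hom (x$y) \<I>" and g:"arr g" "Dom A g = w" "Cod A g = v"
 shows "pair_cap x y e v o x|>y|>g = g o pair_cap x y e w"
proof -
 have o:"obj w" "obj v" using g by auto
 have e:"e ::: x$y ~> \<I>" using x by (auto simp: hom_iff)
 have "pair_cap x y e v o x|>y|>g
  = \<l> v o (e<|v o (x$y)|>g) o \<b> x y w" using x g o e by (simp add: pair_cap_def assoc_conj_ident)
 also have "...=\<l> v o (\<I>|>g o e<|w) o \<b> x y w" using x g e interchange[of e g] by simp
 also have "...=g o pair_cap x y e w" using x g o e by (simp add: pair_cap_def unit_whisker)
 finally show ?thesis .
qed

lemma pair_cup_natural:
 assumes x:"obj x" "obj y" "h : Hom \<I> (y$x)" and g:"arr g" "Dom A g = w" "Cod A g = v"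
 shows "y|>x|>g o pair_cup y x h w = pair_cup y x h v o g"
proof -
 have o:"obj w" "obj v" using g by auto
 have h:"h ::: \<I> ~> y$x" using x by (auto simp: hom_iff)
 have "y|>x|>g o pair_cup y x h w
  = \<a> y x v o ((y$x)|>g o h<|w) o Inv (\<l> w)" using x g o h by (simp add: pair_cup_def assoc_conj_ident)
 also have "...=\<a> y x v o (h<|v o \<I>|>g) o Inv (\<l> w)" using x g h interchange[of h g] by simp
 also have "...=pair_cup y x h v o g" using x g o h by (simp add: pair_cup_def unit_whisker)
 finally show ?thesis .
qed

lemma dual_pair_dual:"obj x ==> dual_pair x x^* (ev A x) (coev A x)"
 unfolding dual_pair_def pair_cap_def pair_cup_def cap_def[symmetric] cup_def[symmetric] using snake by (simp add: hom_iff)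

lemma dual_pair_opposite:
 "obj x ==> dual_pair x^* x (ev A x o \<s> x^* x) (\<s> x^* x o coev A x)"
proof -
 assume x:"obj x"
 have "pair_cap x^* x (ev A x o \<s> x^* x) w=cap' x w"
  "pair_cup x x^* (\<s> x^* x o coev A x) w = cup' x w" if "obj w" for w
  using x that by (simp_all add: pair_cap_def pair_cup_def cap'_def cup'_def cap_def cup_def sw_def hat_def)
 then show ?thesis unfolding dual_pair_def using x snake' by (simp add: hom_iff)
qed

definition pair_trace ::"'o => 'o => 'm => 'm => 'm => 'm" where
 "pair_trace x y e h f = e o \<s> y x o y|>f o h"

text \<open>The trace is computed with two unrelated pairs of dual objects; hence it does not depend on the
  chosen duality, and isomorphic objects have equal dimension.\<close>
lemma pair_trace_cyclic:
 assumes p:"dual_pair x x' e h" "dual_pair y y' d k" and f:"f : Hom x y" "g : Hom y x"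
 shows "pair_trace x x' e h (g o f) = pair_trace y y' d k (f o g)"
proof -
 have o:"obj x" "obj x'" "obj y" "obj y'" using p by (auto simp: dual_pair_def)
 have h:"e : Hom (x$x') \<I>" "h : Hom \<I> (x'$x)" "d : Hom (y$y') \<I>" "k : Hom \<I> (y'$y)"
  using p by (auto simp: dual_pair_def)
 have t:"e ::: x$x' ~> \<I>" "h ::: \<I> ~> x'$x"
  "d ::: y$y' ~> \<I>" "k ::: \<I> ~> y'$y"
  "f ::: x ~> y" "g ::: y ~> x" using h f by (auto simp: hom_iff)
 define u where "u = \<r> x' o x'|>(d o f<|y') o \<a> x' x y' o h<|y' o Inv (\<l> y')"
 have u:"u ::: y' ~> x'" using o t by (simp_all add: u_def)
 have uw:"u<|w=x'|>pair_cap y y' d w o x'|>f<|(y'$w) o pair_cup x' x h (y'$w)"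
  if "obj w" for w using that o t by (simp add: u_def pair_cap_def pair_cup_def spread)
 have 1:"e o x|>u=d o f<|y'"
 proof (rule eq_by_tail)
  show "e o (x|>u) : Hom (x$y') \<I>" "d o (f<|y') : Hom (x$y') \<I>" using o t u by (simp_all add: hom_iff)
  fix w assume w:"obj w"
  have "pair_cap x x' e w o (x|>u<|w) =
   pair_cap x x' e w o x|>x'|>(pair_cap y y' d w o f<|(y'$w)) o x|>pair_cup x' x h (y'$w)" using o t w h by (simp add: uw)
  also have "...=(pair_cap y y' d w o f<|(y'$w)) o (pair_cap x x' e (x$y'$w) o x|>pair_cup x' x h (y'$w))"
   using o t w h pair_cap_natural[OF o(1,2) h(1), of "pair_cap y y' d w" "y$y'$w" w, THEN tail]
   pair_cap_natural[OF o(1,2) h(1), of "f<|(y'$w)" "x$y'$w" "y$y'$w", THEN tail] by simp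
  also have "pair_cap x x' e (x$y'$w) o x|>pair_cup x' x h (y'$w)=\<i> (x$y'$w)" using p(1) o w by (simp add: dual_pair_def)
  finally have "pair_cap x x' e w o x|>u<|w=pair_cap y y' d w o f<|(y'$w)" using o t w h by simp
  then have "Inv (\<l> w) o (pair_cap x x' e w o x|>u<|w) o \<a> x y' w
   = Inv (\<l> w) o (pair_cap y y' d w o f<|(y'$w)) o \<a> x y' w" by simp
  then show "(e o x|>u)<|w=(d o f<|y')<|w" using o t w u by (simp add: pair_cap_def assoc_conj)
 qed
 have 2:"u<|y o k=x'|>f o h"
 proof (rule eq_by_tail)
  show "u<|y o k : Hom \<I> (x'$y)" "x'|>f o h : Hom \<I> (x'$y)" using o t u by (simp_all add: hom_iff)
  fix w assume w:"obj w"
  have "u<|(y$w) o pair_cup y' y k w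
   = x'|>pair_cap y y' d (y$w) o x'|>f<|(y'$y$w) o x'|>x|>pair_cup y' y k w o pair_cup x' x h w"
   using o t w h pair_cup_natural[OF o(1,2) h(2), of "pair_cup y' y k w"] by (simp add: uw)
  also have "...=x'|>(pair_cap y y' d (y$w) o (f<|(y'$y$w) o x|>pair_cup y' y k w)) o pair_cup x' x h w" using o t w h by simp
  also have "f<|(y'$y$w) o x|>pair_cup y' y k w=y|>pair_cup y' y k w o f<|w" using o t w h by (intro interchange) simp_all
  also have "pair_cap y y' d (y$w) o y|>pair_cup y' y k w o f<|w=f<|w"
  proof -
   have "pair_cap y y' d (y$w) o y|>pair_cup y' y k w=\<i> (y$w)" using p(2) w by (simp add: dual_pair_def)
   from this[THEN tail, of "f<|w"] show ?thesis using o t w h by simp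
  qed
  finally have "\<b> x' y w o (u<|(y$w) o pair_cup y' y k w) o \<l> w
   = \<b> x' y w o (x'|>f<|w o pair_cup x' x h w) o \<l> w" by simp
  then show "(u<|y o k)<|w=(x'|>f o h)<|w" using o t w u by (simp add: pair_cup_def assoc_conj)
 qed
 have "pair_trace x x' e h (g o f)=e o \<s> x' x o x'|>g o (x'|>f o h)" using o t by (simp add: pair_trace_def)
 also have "...=e o \<s> x' x o (x'|>g o u<|y) o k" unfolding 2[symmetric] using o t u by simp
 also have "x'|>g o u<|y=u<|x o y'|>g" using interchange[of u g] u t by simp
 also have "e o \<s> x' x o (u<|x o y'|>g) o k=e o (\<s> x' x o u<|x) o y'|>g o k" using o t u by simp
 also have "\<s> x' x o u<|x=x|>u o \<s> y' x" using symmetry_natural'[of u "\<i> x"] o u by simp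
 also have "e o (x|>u o \<s> y' x) o y'|>g o k=(e o x|>u) o \<s> y' x o y'|>g o k" using o t u by simp
 also have "...=d o (f<|y' o \<s> y' x) o y'|>g o k" unfolding 1 using o t by simp
 also have "f<|y' o \<s> y' x=\<s> y' y o y'|>f" using symmetry_natural'[of "\<i> y'" f] o t by simp
 also have "d o (\<s> y' y o y'|>f) o y'|>g o k=pair_trace y y' d k (f o g)" using o t by (simp add: pair_trace_def)
 finally show ?thesis .
qed

definition nested_ev ::"'o => 'o => 'm" where
 "nested_ev b i = ev A b o b|>cap i b^* o \<a> b i (i^*$b^*)"

definition nested_coev ::"'o => 'o => 'm" where
 "nested_coev b i = \<b> i^* b^* (b$i) o i^*|>cup b i o coev A i"

lemma nested_hat:
 assumes "obj b" "obj i" "obj w"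
 shows "pair_cap (b$i) (i^*$b^*) (nested_ev b i) w
   = cap b w o b|>cap i (b^*$w) o b|>i|>\<a> i^* b^* w
   o \<a> b i ((i^*$b^*)$w)" (is ?P1)
  "pair_cup (i^*$b^*) (b$i) (nested_coev b i) w
   = \<b> i^* b^* ((b$i)$w) o i^*|>b^*|>\<b> b i w
   o i^*|>cup b (i$w) o cup i w" (is ?P2)
proof -
 show ?P1 using assms by (simp add: pair_cap_def nested_ev_def spread cap_whisker) (simp add: cap_def)
 show ?P2 using assms by (simp add: pair_cup_def nested_coev_def spread cap_whisker) (simp add: cup_def)
qed

lemma dual_pair_nested:
 assumes "obj b" "obj i"
 shows "dual_pair (b$i) (i^*$b^*) (nested_ev b i) (nested_coev b i)" unfolding dual_pair_def
proof (intro conjI ballI)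
 let ?i = "i^*" and ?b = "b^*"
 show "b$i : Obj A" "?i$?b : Obj A" using assms by simp_all
 show "nested_ev b i : Hom ((b$i)$?i$?b) \<I>" "nested_coev b i : Hom \<I> ((?i$?b)$b$i)"
  using assms by (simp_all add: nested_ev_def nested_coev_def hom_iff)
 fix w assume w:"obj w"
 have "cap i (?b$b$i$w) o i|>?i|>cup b (i$w)=cup b (i$w) o cap i (i$w)" using cap_natural[of i "cup b (i$w)"] assms w by simp
 then have "b|>cap i (?b$b$i$w) o b|>i|>?i|>cup b (i$w)=b|>(cup b (i$w) o cap i (i$w))"
  using assms w by (simp add: whisker_comp(1)[symmetric] del: whisker_comp(1))
 note 1 = this[THEN tail]
 have 2:"b|>cap i (i$w) o b|>i|>cup i w=\<i> (b$i$w)"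
  using snake(1)[of i w] assms w by (simp add: whisker_comp(1)[symmetric] del: whisker_comp(1))
 have 0:"cap b ((b$i)$w) o b|>?b|>\<b> b i w=\<b> b i w o cap b (b$i$w)"
  using cap_natural[of b "\<b> b i w"] assms w by simp
 have 3:"cap i (?b$(b$i)$w) o i|>?i|>?b|>\<b> b i w=?b|>\<b> b i w o cap i (?b$b$i$w)"
  using cap_natural[of i "?b|>\<b> b i w"] assms w by simp
 then have "b|>cap i (?b$(b$i)$w) o b|>i|>?i|>?b|>\<b> b i w
   = b|>(?b|>\<b> b i w o cap i (?b$b$i$w))" using assms w by (simp add: whisker_comp(1)[symmetric] del: whisker_comp(1))
 note 4 = this[THEN tail]
 show "pair_cap (b$i) (?i$?b) (nested_ev b i) ((b$i)$w)
   o (b$i)|>pair_cup (?i$?b) (b$i) (nested_coev b i) w = \<i> ((b$i)$w)"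
  using assms w by (simp add: nested_hat assoc_conj_ident 0[THEN tail] 1 2[THEN tail] 4 snake_tail)
 have 5:"?b|>b|>cap i (?b$w) o cup b (i$?i$?b$w)=cup b (?b$w) o cap i (?b$w)"
  using cup_natural[of b "cap i (?b$w)"] assms w by simp
 then have "?i|>?b|>b|>cap i (?b$w) o ?i|>cup b (i$?i$?b$w)=?i|>(cup b (?b$w) o cap i (?b$w))"
  using assms w by (simp add: whisker_comp(1)[symmetric] del: whisker_comp(1))
 note 5 = this[THEN tail]
 have 6:"?i|>?b|>cap b w o ?i|>cup b (?b$w)=\<i> (?i$?b$w)"
  using snake(2)[of b w] assms w by (simp add: whisker_comp(1)[symmetric] del: whisker_comp(1))
 have 7:"?b|>b|>i|>\<a> ?i ?b w o cup b (i$(?i$?b)$w)=cup b (i$?i$?b$w) o i|>\<a> ?i ?b w"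
  using cup_natural[of b "i|>\<a> ?i ?b w"] assms w by simp
 then have "?i|>?b|>b|>i|>\<a> ?i ?b w o ?i|>cup b (i$(?i$?b)$w)
  = ?i|>(cup b (i$?i$?b$w) o i|>\<a> ?i ?b w)" using assms w by (simp add: whisker_comp(1)[symmetric] del: whisker_comp(1))
 note 7 = this[THEN tail]
 have 8:"?i|>i|>\<a> ?i ?b w o cup i ((?i$?b)$w)=cup i (?i$?b$w) o \<a> ?i ?b w"
  using cup_natural[of i "\<a> ?i ?b w"] assms w by simp
 show "(?i$?b)|>pair_cap (b$i) (?i$?b) (nested_ev b i) w
   o pair_cup (?i$?b) (b$i) (nested_coev b i) ((?i$?b)$w) = \<i> ((?i$?b)$w)"
  using assms w by (simp add: nested_hat assoc_conj_ident 5 6[THEN tail] 7 8 snake_tail)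
qed

text \<open>The inner loop closes to a scalar and leaves the outer loop.\<close>
lemma nested_loop:
 assumes "obj b" "obj i" "obj w"
 shows "pair_cap (b$i) (i^*$b^*) (nested_ev b i) w
   o sw (i^*$b^*) (b$i) w
   o pair_cup (i^*$b^*) (b$i) (nested_coev b i) w
  = (cap b w o cup' b w) o (cap' i w o cup i w)"
proof -
 let ?i = "i^*" and ?b = "b^*"
 note o = assms
 have c1:"?i|>cup' b (i$w)=sw b ?i (?b$i$w) o b|>sw ?b ?i (i$w) o cup' b (?i$i$w)" using br_cup'[of ?i "trs ?i" b "i$w"] o by simp
 have c2:"cap' i (?b$w) o ?i|>sw ?b i w o sw ?b ?i (i$w)=?b|>cap' i w"
 proof -
  have "?b|>cap' i w o sw ?i ?b (i$w) o ?i|>sw i ?b w=cap' i (?b$w)" using br_cap'[of ?b "trs ?b" i w] o by simp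
  from this[symmetric] show ?thesis using o by simp
 qed
 have "pair_cap (b$i) (?i$?b) (nested_ev b i) w o sw (?i$?b) (b$i) w
   o pair_cup (?i$?b) (b$i) (nested_coev b i) w
  = cap b w o b|>(cap i (?b$w) o sw ?i i (?b$w)) o b|>(?i|>sw ?b i w) o
   sw ?i b (?b$i$w) o ?i|>(sw ?b b (i$w) o cup b (i$w)) o cup i w"
 proof -
  have n1:"sw ?i b (?b$i$w) o ?i|>b|>\<a> ?b i w=b|>?i|>\<a> ?b i w o sw ?i b ((?b$i)$w)"
   using sw_natural[of ?i b "\<a> ?b i w"] o by simp
  show ?thesis using o sw_natural[of ?b b "\<a> ?b i w", THEN tail]
   by (simp add: nested_hat sw_tensor_right sw_tensor_left assoc_conj_ident)
 qed
 also have "...=cap b w o b|>cap' i (?b$w) o b|>(?i|>sw ?b i w) o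
   sw ?i b (?b$i$w) o ?i|>cup' b (i$w) o cup i w" unfolding cap'_def cup'_def ..
 also have "...=cap b w o b|>(cap' i (?b$w) o ?i|>sw ?b i w o sw ?b ?i (i$w)) o cup' b (?i$i$w) o cup i w"
  unfolding c1 using o by simp
 also have "...=cap b w o (b|>?b|>cap' i w o cup' b (?i$i$w)) o cup i w" unfolding c2 using o by simp
 also have "...=(cap b w o cup' b w) o (cap' i w o cup i w)" using cup'_natural[of b "cap' i w"] o by simp
 finally show ?thesis .
qed

end

section \<open>Dimensions\<close>

context symmetric_ribbon_fusion_category
begin

lemma tensor_linear [simp]:
 assumes "arr f" "obj z"
 shows "z|>(c*.f) = c*.(z|>f)" "(c*.f)<|z = c*.(f<|z)" using tensor_scale_right[of "\<i> z" z z f "Dom A f" "Cod A f" c]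
  tensor_scale_left[of f "Dom A f" "Cod A f" "\<i> z" z z c] assms by (simp_all add: hom_iff)

lemma tensor_add:
 assumes "arr f" "arr g" "Dom A g = Dom A f" "Cod A g = Cod A f" "obj z"
 shows "z|>(f +. g) = z|>f +. z|>g" "(f +. g)<|z = f<|z +. g<|z" using tensor_add_right[of "\<i> z" z z f "Dom A f" "Cod A f" g]
  tensor_add_left[of f "Dom A f" "Cod A f" g "\<i> z" z z] assms by (simp_all add: hom_iff)

lemma tensor_zero [simp]:
 assumes "obj x" "obj y" "obj z"
 shows "z|>\<z> x y = \<z> (z$x) (z$y)" "\<z> x y<|z = \<z> (x$z) (y$z)"
 using tensor_linear[of "\<z> x y" z 0] assms by simp_all

lemma tensor_hsum:
 assumes "finite K" "!!i. i : K ==> f i : Hom x y" "obj x" "obj y" "obj z"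
 shows "z|>hsum x y K f = hsum (z$x) (z$y) K (%i. z|>f i)"
  "hsum x y K f<|z = hsum (x$z) (y$z) K (%i. f i<|z)"
 using assms by (auto simp: hom_iff tensor_add intro!: additive_hsum additive_hsum[where F = "%g. g<|z"])

lemma hom_unit_scalar:"f : Hom \<I> \<I> ==> \<exists>c. f = c*.\<i> \<I>" using schur_scalar[OF unit_simple] .

lemma unit_scalar_cancel:"c*.\<i> \<I> = d*.\<i> \<I> ==> c = d"
 using scale_cancel[of "\<i> \<I>" c d] simple_ident_nonzero[OF unit_simple] by simp

text \<open>The dimension computed with the symmetry as closing arrow. It differs from the quantum dimension by
  the sign through which the twist acts, and is multiplicative without reference to the twist.\<close>
definition dimn ::"'o => complex" where
 "dimn x = (SOME c. ev A x o \<s> x^* x o coev A x = c*.\<i> \<I>)"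

lemma dimn:
 assumes "obj x"
 shows "ev A x o \<s> x^* x o coev A x = dimn x*.\<i> \<I>"
proof -
 have "\<exists>c. ev A x o \<s> x^* x o coev A x=c*.\<i> \<I>" using assms by (intro hom_unit_scalar) (simp add: hom_iff)
 then show ?thesis unfolding dimn_def by (rule someI_ex)
qed

lemma pair_trace_ident:
 assumes x:"obj x" and p:"dual_pair x x' e h"
 shows "pair_trace x x' e h (\<i> x) = dimn x*.\<i> \<I>"
proof -
 have "pair_trace x x' e h (\<i> x o \<i> x)=pair_trace x x^* (ev A x) (coev A x) (\<i> x o \<i> x)"
  by (rule pair_trace_cyclic[OF p dual_pair_dual[OF x]]) (use x in \<open>simp_all add: hom_iff\<close>)
 then show ?thesis using dimn[OF x] x by (simp add: pair_trace_def)
qed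

lemma dimn_dual:"obj x ==> dimn x^* = dimn x"
proof (rule unit_scalar_cancel)
 assume x:"obj x"
 have "dimn x^* *.\<i> \<I>
  = pair_trace x^* x (ev A x o \<s> x^* x) (\<s> x^* x o coev A x) (\<i> x^*)"
  using pair_trace_ident[OF _ dual_pair_opposite[OF x]] x by simp
 also have "...=ev A x o \<s> x^* x o coev A x" using x symmetry_involutive[of "x^*" x, THEN tail] by (simp add: pair_trace_def)
 finally show "dimn x^* *.\<i> \<I>=dimn x*.\<i> \<I>" using dimn[OF x] by simp
qed

lemma loop_value:
 assumes "obj x" "obj w"
 shows "cap x w o cup' x w = dimn x*.\<i> w" (is ?P1) "cap' x w o cup x w = dimn x*.\<i> w" (is ?P2)
proof -
 have "\<l> w o (ev A x o \<s> x^* x o coev A x)<|w o Inv (\<l> w)=dimn x*.\<i> w" unfolding dimn[OF assms(1)] using assms by simp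
 then show ?P1 ?P2
  using assms by (simp_all add: cap_def cup_def cap'_def cup'_def sw_def hat_def)
qed

lemma scalar_by_tail:
 assumes x:"obj x" and f:"f : Hom x x" "f<|\<I> = c*.\<i> (x$\<I>)"
 shows "f = c*.\<i> x"
proof -
 note t = homD[OF f(1)]
 have "f o \<r> x=\<r> x o f<|\<I>" using right_unitor_natural'[of f] t by simp
 also have "...=(c*.\<i> x) o \<r> x" unfolding f(2) using x by simp
 finally show ?thesis using iso_cancel_right[of "\<r> x" f "c*.\<i> x"] x t by simp
qed

lemma unit_conj_scalar:
 assumes "obj x" "q : Hom (\<I>$x) (\<I>$x)" "\<l> x o q o Inv (\<l> x) = c*.\<i> x"
 shows "q = c*.\<i> (\<I>$x)"
proof -
 have t:"q ::: \<I>$x ~> \<I>$x" using assms(2) by (auto simp: hom_iff)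
 have "q=Inv (\<l> x) o (\<l> x o q o Inv (\<l> x)) o \<l> x" using t assms(1) by simp
 also have "...=c*.\<i> (\<I>$x)" unfolding assms(3) using assms(1) by simp
 finally show ?thesis .
qed

text \<open>The nested duality of the product gives the product of the two loops; by independence of the trace
  from the duality this is the dimension.\<close>
lemma dimn_tensor:
 assumes o:"obj b" "obj i"
 shows "dimn (b$i) = dimn b * dimn i"
proof (rule unit_scalar_cancel)
 let ?x = "b$i" and ?y = "i^*$b^*"
 note p = dual_pair_nested[OF o]
 have e:"nested_ev b i : Hom (?x$?y) \<I>" "nested_coev b i : Hom \<I> (?y$?x)" using p by (auto simp: dual_pair_def)
 then have t:"nested_ev b i ::: ?x$?y ~> \<I>"
  "nested_coev b i ::: \<I> ~> ?y$?x" by (auto simp: hom_iff)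
 let ?f = "nested_ev b i o \<s> ?y ?x o nested_coev b i"
 have f:"?f : Hom \<I> \<I>" using o t by (simp add: hom_iff)
 have "?f<|\<I>=(dimn b * dimn i)*.\<i> (\<I>$\<I>)"
 proof (rule unit_conj_scalar[OF unit_typ])
  show "?f<|\<I> : Hom (\<I>$\<I>) (\<I>$\<I>)" using f by (simp add: hom_iff)
  show "\<l> \<I> o ?f<|\<I> o Inv (\<l> \<I>)=(dimn b * dimn i)*.\<i> \<I>" using nested_loop[OF o unit_typ] loop_value o t
   by (simp add: pair_cap_def pair_cup_def sw_def hat_def mult.commute)
 qed
 then have 1:"?f=(dimn b * dimn i)*.\<i> \<I>" by (rule scalar_by_tail[OF unit_typ f])
 have 2:"?f=dimn ?x*.\<i> \<I>" using pair_trace_ident[OF _ p] o t by (simp add: pair_trace_def)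
 show "dimn (b$i)*.\<i> \<I>=(dimn b * dimn i)*.\<i> \<I>" by (rule trans[OF 2[symmetric] 1])
qed

section \<open>Duals of simple objects\<close>

definition transpose_arr ::"'o => 'o => 'm => 'm" where
 "transpose_arr i k f = \<l> i o ev A k<|i o \<b> k k^* i o k|>f<|i
   o k|>coev A i o Inv (\<r> k)"

lemma transpose_hat:
 assumes "obj i" "obj k" "f : Hom i^* k^*" "obj w"
 shows "transpose_arr i k f : Hom k i"
  "transpose_arr i k f<|w = cap k (i$w) o k|>f<|(i$w) o k|>cup i w"
 using assms by (simp_all add: transpose_arr_def hom_iff spread cap_def cup_def)

lemma transpose_inverse:
 assumes o:"obj i" "obj k" "obj w" and f:"f : Hom i^* k^*"
 shows "f<|w = k^*|>cap i w o k^*|>transpose_arr i k f<|(i^*$w)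
  o cup k (i^*$w)"
proof -
 let ?i = "i^*" and ?k = "k^*"
 note t = homD[OF f(1)]
 have "?k|>cap i w o ?k|>transpose_arr i k f<|(?i$w) o cup k (?i$w)
  = ?k|>cap i w o ?k|>cap k (i$?i$w) o ?k|>k|>f<|(i$?i$w)
   o ?k|>k|>cup i (?i$w) o cup k (?i$w)" using o t f by (simp add: transpose_hat)
 also have "?k|>k|>cup i (?i$w) o cup k (?i$w)=cup k (?i$i$?i$w) o cup i (?i$w)" using cup_natural[of k "cup i (?i$w)"] o by simp
 also have "?k|>k|>f<|(i$?i$w) o cup k (?i$i$?i$w) o cup i (?i$w)
  = cup k (?k$i$?i$w) o f<|(i$?i$w) o cup i (?i$w)" using cup_natural[of k "f<|(i$?i$w)", THEN tail] o t by simp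
 also have "?k|>cap i w o ?k|>cap k (i$?i$w) o cup k (?k$i$?i$w) o f<|(i$?i$w) o cup i (?i$w)
  = (?k|>cap i w o f<|(i$?i$w)) o cup i (?i$w)" using o t by (simp add: snake_tail)
 also have "?k|>cap i w o f<|(i$?i$w)=f<|w o ?i|>cap i w" using interchange[of f "cap i w"] t o by simp
 also have "(f<|w o ?i|>cap i w) o cup i (?i$w)=f<|w" using o t snake(2)[of i w] by simp
 finally show ?thesis by simp
qed

lemma transpose_inj:
 assumes o:"obj i" "obj k" and f:"f : Hom i^* k^*" "g : Hom i^* k^*"
  and eq:"transpose_arr i k f = transpose_arr i k g"
 shows "f = g" by (rule eq_by_tail[OF f]) (simp only: transpose_inverse[OF o _ f(1)] transpose_inverse[OF o _ f(2)] eq)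

lemma transpose_linear:
 assumes o:"obj i" "obj k" and f:"f : Hom i^* k^*"
 shows "transpose_arr i k (c*.f) = c*.transpose_arr i k f" using o f by (simp add: transpose_arr_def hom_iff)

lemma transpose_ident:"obj i ==> transpose_arr i i (\<i> i^*) = \<i> i" using snake_obj[of i] by (simp add: transpose_arr_def)

lemma transpose_zero_iff:
 assumes o:"obj i" "obj k" and f:"f : Hom i^* k^*"
  and z:"transpose_arr i k f = \<z> k i"
 shows "f = \<z> i^* k^*"
proof (rule transpose_inj[OF o f])
 show "\<z> i^* k^* : Hom i^* k^*" using o by (simp add: hom_iff)
 have "transpose_arr i k (0*.f)=0*.transpose_arr i k f" by (rule transpose_linear[OF o f])
 then show "transpose_arr i k f=transpose_arr i k (\<z> i^* k^*)" using z f o by (simp add: hom_iff)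
qed

lemma simple_if_isomorphic:
 assumes y:"simple y" and f:"iso_arr A f" "f : Hom x y"
 shows "simple x"
proof -
 have t:"f ::: x ~> y" using f by (auto simp: hom_iff)
 have o:"obj x" "obj y" using t by auto
 have "\<not> zero_object A x"
 proof
  assume z:"zero_object A x"
  have "\<i> x=\<z> x x" using zero_object_arrow[OF z, of "\<i> x"] o by (simp add: hom_iff)
  then have "f o \<i> x o Inv f=f o \<z> x x o Inv f" by simp
  then have "\<i> y=\<z> y y" using t f o by simp
  then show False using simple_ident_nonzero[OF y] by simp
 qed
 moreover have "zero_object A (Dom A g) \<or> iso_arr A g" if g:"mono_arr A g" "Cod A g=x" for g
 proof -
  have g':"arr g" using g by (simp add: mono_arr_def)
  have "mono_arr A (f o g)" unfolding mono_arr_def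
  proof (intro conjI ballI impI)
   fix w h h' assume w:"obj w" and h:"h : Hom w (Dom A (f o g))" "h' : Hom w (Dom A (f o g))"
   and e:"(f o g) o h = (f o g) o h'"
   have h':"h : Hom w (Dom A g)" "h' : Hom w (Dom A g)" using h g g' t by simp_all
   then have "f o (g o h)=f o (g o h')" using e g g' t by (simp add: hom_iff)
   then have "g o h=g o h'" using iso_cancel_left[of f "g o h" "g o h'"] f g g' t h' by (simp add: hom_iff)
   then show "h=h'" using g(1) w h' unfolding mono_arr_def by blast
  qed (use g g' t in simp)
  then have "zero_object A (Dom A (f o g)) \<or> iso_arr A (f o g)" using y g g' t comp_typ(3)[of g f] unfolding simple_object_def by metis
  then show ?thesis
  proof
   assume "zero_object A (Dom A (f o g))" then show ?thesis using g g' t by simp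
  next
   assume i:"iso_arr A (f o g)"
   have "Inv f o (f o g)=g" using f g g' t by simp
   moreover have "iso_arr A (Inv f o (f o g))" using g g' t f(1) by (intro comp_iso(1)[OF i inv_inv(2)[OF f(1)]]) simp
   ultimately show ?thesis by simp
  qed
 qed
 ultimately show ?thesis using o unfolding simple_object_def by blast
qed

lemma simple_if_scalar:
 assumes x:"obj x" and nz:"\<i> x \<noteq> \<z> x x" and sc:"!!f. f : Hom x x ==> \<exists>c. f = c*.\<i> x"
 shows "simple x"
proof -
 obtain n S u v where s:"!!l. l < n ==> simple (S l)" "direct_sum A {..<n::nat} S x u v" using semisimple[OF x] by blast
 have "hsum x x {..<n} (%l. u l o v l)=\<i> x" using s(2) by (simp add: direct_sum_def)
 then have n:"0 < n" using nz x by (cases n) simp_all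
 have "u 0 : Hom (S 0) x" "v 0 : Hom x (S 0)" and vu:"v 0 o u 0=\<i> (S 0)" using s(2) n by (auto simp: direct_sum_def)
 then have t:"u 0 ::: S 0 ~> x" "v 0 ::: x ~> S 0"
  by (auto simp: hom_iff)
 have So:"S 0 : Obj A" using s(1)[OF n] by simp
 obtain c where c:"u 0 o v 0 = c*.\<i> x" using sc[of "u 0 o v 0"] t by (auto simp: hom_iff)
 have "c*.\<i> (S 0)=v 0 o (c*.\<i> x) o u 0" using t vu x So by simp
 also have "...=(v 0 o u 0) o (v 0 o u 0)" unfolding c[symmetric] using t by simp
 also have "...=1*.\<i> (S 0)" unfolding vu using So by simp
 finally have "c=1" using scale_cancel[of "\<i> (S 0)" c 1] simple_ident_nonzero[OF s(1)[OF n]] So by simp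
 then have "u 0 o v 0=\<i> x" using c x by simp
 then have "iso_arr A (v 0)" using inv_arrI[of "v 0" "u 0"] t vu by simp
 then show ?thesis using simple_if_isomorphic[OF s(1)[OF n], of "v 0"] t by (simp add: hom_iff)
qed

text \<open>Transposition identifies the endomorphisms of the dual with those of \<open>i\<close>, hence they
  are scalars, and an object of a semisimple category with only scalar endomorphisms is simple.\<close>
lemma simple_dual [simp]:
 assumes i:"simple i"
 shows "simple i^*"
proof -
 have o:"obj i" "i^* : Obj A" using i by simp_all
 have one:"\<i> i^* : Hom i^* i^*" using o by (simp add: hom_iff)
 show ?thesis
 proof (rule simple_if_scalar[OF o(2)])
  show "\<i> i^* \<noteq> \<z> i^* i^*"
  proof
   assume z:"\<i> i^* = \<z> i^* i^*"
   have "transpose_arr i i (0*.\<i> i^*)=0*.transpose_arr i i (\<i> i^*)" by (rule transpose_linear[OF o(1,1) one])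
   then have "\<i> i=\<z> i i" using z o transpose_ident[OF o(1)] by simp
   then show False using simple_ident_nonzero[OF i] by simp
  qed
  fix f assume f:"f : Hom i^* i^*"
  obtain c where c:"transpose_arr i i f = c*.\<i> i" using schur_scalar[OF i transpose_hat(1)[OF o(1,1) f unit_typ]] by blast
  have "f=c*.\<i> i^*"
   by (rule transpose_inj[OF o(1,1) f]) (use one o c transpose_ident[OF o(1)] transpose_linear[OF o(1,1) one] in \<open>simp_all add: hom_iff\<close>)
  then show "\<exists>c. f=c*.\<i> i^*" by blast
 qed
qed

lemma isomorphic_dual:
 assumes i:"simple i" "simple k" and iso:"isomorphic A i^* k^*"
 shows "isomorphic A k i"
proof -
 obtain f where f:"iso_arr A f" "arr f" "Dom A f = i^*" "Cod A f = k^*" by (rule isomorphicE[OF iso])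
 have o:"obj i" "obj k" "i^* : Obj A" "k^* : Obj A" using i by simp_all
 have fh:"f : Hom i^* k^*" using f by (simp add: hom_iff)
 have "f \<noteq> \<z> i^* k^*"
 proof
  assume z:"f = \<z> i^* k^*"
  obtain g where g:"arr g" "Dom A g = k^*" "Cod A g = i^*" "f o g = \<i> k^*" using f inv_typ[OF f(1)] inv_comp[OF f(1)] by metis
  have "f o g=\<z> k^* k^*" unfolding z using g(1-3) o by simp
  then show False using g(4) simple_ident_nonzero[OF simple_dual[OF i(2)]] by simp
 qed
 then have "transpose_arr i k f \<noteq> \<z> k i" using transpose_zero_iff[OF o(1,2) fh] by blast
 then show ?thesis using schur_iso[OF i(2,1) transpose_hat(1)[OF o(1,2) fh unit_typ]]
  transpose_hat(1)[OF o(1,2) fh unit_typ] by (blast intro: isomorphicI)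
qed

text \<open>A snake identity would make the identity of \<open>i\<close> zero.\<close>
lemma coev_nonzero:
 assumes i:"simple i"
 shows "coev A i \<noteq> \<z> \<I> (i^*$i)" (is ?P1) "ev A i \<noteq> \<z> (i$i^*) \<I>" (is ?P2)
proof -
 have o:"obj i" using i by simp
 show ?P1
 proof
  assume "coev A i = \<z> \<I> (i^*$i)"
  then have "\<i> i=\<z> i i" using snake_obj[OF o] o by simp
  then show False using simple_ident_nonzero[OF i] by simp
 qed
 show ?P2
 proof
  assume "ev A i = \<z> (i$i^*) \<I>"
  then have "\<i> i=\<z> i i" using snake_obj[OF o] o by simp
  then show False using simple_ident_nonzero[OF i] by simp
 qed
qed

lemma pairing_scalar:
 assumes i:"simple i" and h:"h : Hom (i$i^*) \<I>"
 shows "\<exists>c. h = c*.ev A i"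
proof -
 let ?i = "i^*"
 have o:"obj i" using i by simp
 note t = homD[OF h(1)]
 define f where "f = \<l> i o h<|i o \<b> i ?i i o i|>coev A i o Inv (\<r> i)"
 have f:"f : Hom i i" using o t by (simp add: f_def hom_iff)
 obtain c where c:"f = c*.\<i> i" using schur_scalar[OF i f] by blast
 have fw:"f<|w=pair_cap i ?i h (i$w) o i|>cup i w" if "obj w" for w using that o t by (simp add: f_def pair_cap_def cup_def spread)
 have "h=c*.ev A i"
 proof (rule eq_by_tail[OF h])
  show "c*.ev A i : Hom (i$?i) \<I>" using o by (simp add: hom_iff)
  fix w assume w:"obj w"
  have "cap i w o f<|(?i$w)=(cap i w o pair_cap i ?i h (i$?i$w)) o i|>cup i (?i$w)" using fw[of "?i$w"] o w h by simp
  also have "cap i w o pair_cap i ?i h (i$?i$w)=pair_cap i ?i h w o i|>?i|>cap i w"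
   using pair_cap_natural[of i ?i h "cap i w"] o h w by simp
  also have "(pair_cap i ?i h w o i|>?i|>cap i w) o i|>cup i (?i$w)
   = pair_cap i ?i h w o i|>(?i|>cap i w o cup i (?i$w))" using o h w by simp
  also have "...=pair_cap i ?i h w" unfolding snake(2)[OF o w] using o h w by simp
  finally have "pair_cap i ?i h w=c*.cap i w" unfolding c using o w by simp
  then have "Inv (\<l> w) o pair_cap i ?i h w o \<a> i ?i w=Inv (\<l> w) o (c*.cap i w) o \<a> i ?i w" by simp
  then show "h<|w=(c*.ev A i)<|w" using o t w by (simp add: pair_cap_def cap_def)
 qed
 then show ?thesis by blast
qed

text \<open>Arrows between \<open>i \<otimes> i\<^sup>*\<close> and the unit form lines by transposition, and
  composition pairs them perfectly; coevaluation and evaluation are nonzero, so their pairing is too.\<close>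
lemma dimn_nonzero:
 assumes i:"simple i"
 shows "dimn i \<noteq> 0"
proof
 assume z:"dimn i = 0"
 let ?i = "i^*" and ?q = "\<s> i^* i o coev A i"
 have o:"obj i" using i by simp
 have q:"?q : Hom \<I> (i$?i)" using o by (simp add: hom_iff)
 have "?q=\<z> \<I> (i$?i)"
 proof (rule separated_into_simple[OF unit_simple q])
  show "\<z> \<I> (i$?i) : Hom \<I> (i$?i)" using o by (simp add: hom_iff)
  fix h assume h:"h : Hom (i$?i) \<I>"
  then obtain c where "h=c*.ev A i" using pairing_scalar[OF i] by blast
  then show "h o ?q=h o \<z> \<I> (i$?i)" using dimn[OF o] z o by simp
 qed
 then have "\<s> i ?i o ?q=\<s> i ?i o \<z> \<I> (i$?i)" by simp
 then have "coev A i=\<z> \<I> (?i$i)" using symmetry_involutive[of ?i i, THEN tail] o by simp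
 then show False using coev_nonzero(1)[OF i] by simp
qed

section \<open>The pivotal structure on simple objects\<close>

lemma twist_unit:"twist A \<I> = \<i> \<I>"
proof -
 have t:"twist A \<I> : Arr A" "Dom A (twist A \<I>)=\<I>" "Cod A (twist A \<I>)=\<I>" "iso_arr A (twist A \<I>)"
  using twist_in[of \<I>] twist_iso[of \<I>] by (auto simp: hom_iff)
 obtain c where c:"twist A \<I> = c*.\<i> \<I>" using hom_unit_scalar[OF twist_in[OF unit_typ]] by blast
 have "twist A (\<I>$\<I>)=\<s> \<I> \<I> o \<s> \<I> \<I> o twist A \<I> \<boxdot> twist A \<I>" using twist_tensor by simp
 also have "...=twist A \<I> \<boxdot> twist A \<I>" using symmetry_involutive[of \<I> \<I>, THEN tail] t by simp
 also have "...=(c * c)*.\<i> (\<I>$\<I>)" using tensor_split[OF t(1,1)] t unfolding c by simp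
 finally have "twist A (\<I>$\<I>)=(c * c)*.\<i> (\<I>$\<I>)" .
 moreover have "twist A \<I> o \<l> \<I>=\<l> \<I> o twist A (\<I>$\<I>)" using twist_natural[of "\<l> \<I>" "\<I>$\<I>" \<I>] by (simp add: hom_iff)
 ultimately have e:"c*.\<l> \<I>=(c * c)*.\<l> \<I>" unfolding c by simp
 have "c*.\<l> \<I> o Inv (\<l> \<I>)=(c * c)*.\<l> \<I> o Inv (\<l> \<I>)" unfolding e ..
 then have "c*.\<i> \<I>=(c * c)*.\<i> \<I>" by simp
 then have "c=c * c" by (rule unit_scalar_cancel)
 moreover have "c \<noteq> 0"
 proof
  assume "c = 0"
  then have "twist A \<I>=\<z> \<I> \<I>" using c by simp
  moreover obtain g where g:"arr g" "Dom A g=\<I>" "Cod A g=\<I>" "twist A \<I> o g=\<i> \<I>"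
   using t(2,3) inv_typ[OF t(4)] inv_comp[OF t(4)] by metis
  ultimately show False using simple_ident_nonzero[OF unit_simple] by simp
 qed
 ultimately show ?thesis using c by simp
qed

text \<open>On a simple object the twist is a scalar \<open>t\<close>. The balancing law on \<open>i \<otimes>
  i\<^sup>*\<close>, the self-duality of the twist and its triviality on the unit give \<open>t\<^sup>2 =
  1\<close>.\<close>
lemma twist_simple:
 assumes i:"simple i"
 shows "\<exists>t. t * t = 1 \<and> twist A i = t*.\<i> i"
proof -
 let ?i = "i^*"
 have o:"obj i" "obj ?i" using i by simp_all
 have ty:"twist A i : Arr A" "Dom A (twist A i)=i" "Cod A (twist A i)=i"
  "twist A ?i : Arr A" "Dom A (twist A ?i) = ?i" "Cod A (twist A ?i) = ?i"
  using twist_in[OF o(1)] twist_in[OF o(2)] by (auto simp: hom_iff)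
 obtain t where t:"twist A i = t*.\<i> i" using schur_scalar[OF i twist_in[OF o(1)]] by blast
 have "twist A ?i=t*.dual_arr A (\<i> i)" unfolding twist_dual[OF o(1)] t using o by (simp add: dual_arr_def Let_def)
 also have "dual_arr A (\<i> i)=\<i> ?i" using snake_dual[OF o(1)] o by (simp add: dual_arr_def Let_def)
 finally have td:"twist A ?i=t*.\<i> ?i" .
 have "twist A (i$?i)=twist A i \<boxdot> twist A ?i" using twist_tensor[OF o] symmetry_involutive[OF o, THEN tail] ty o by simp
 also have "...=(t * t)*.\<i> (i$?i)" using tensor_split[OF ty(1,4)] ty o unfolding t td by simp
 finally have "twist A (i$?i)=(t * t)*.\<i> (i$?i)" .
 then have "1*.ev A i=(t * t)*.ev A i" using twist_natural[of "ev A i" "i$?i" \<I>] o twist_unit by (simp add: hom_iff)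
 then have "1=t * t" using scale_cancel[of "ev A i"] coev_nonzero(2)[OF i] o by simp
 then show ?thesis using t by metis
qed

text \<open>The Drinfeld isomorphism is bent so that one snake identity straightens it.\<close>
lemma drinfeld_coev:
 assumes o:"obj x"
 shows "drinfeld_iso A x<|x^* o (\<s> x^* x o coev A x) = coev A x^*"
  "drinfeld_iso A x : Hom x x^*^*"
proof -
 let ?d = "x^*" and ?dd = "x^*^*"
 have od:"obj ?d" "obj ?dd" using o by simp_all
 have t:"drinfeld_iso A x ::: x ~> ?dd"
  using o od by (simp_all add: drinfeld_iso_def Let_def)
 then show "drinfeld_iso A x : Hom x ?dd" by (simp add: hom_iff)
 have uw:"drinfeld_iso A x<|w=?dd|>cap' x w o cup ?d (x$w)" if "obj w" for w
  using that o od by (simp add: drinfeld_iso_def Let_def spread cap'_def cap_def cup_def symmetry_whisker)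
 show "drinfeld_iso A x<|?d o (\<s> ?d x o coev A x)=coev A ?d"
 proof (rule eq_by_tail)
  show "drinfeld_iso A x<|?d o (\<s> ?d x o coev A x) : Hom \<I> (?dd$?d)" "coev A ?d : Hom \<I> (?dd$?d)"
   using o od t by (simp_all add: hom_iff)
  fix w assume w:"obj w"
  have "drinfeld_iso A x<|(?d$w) o cup' x w
   = ?dd|>cap' x (?d$w) o (cup ?d (x$?d$w) o cup' x w)" using uw[of "?d$w"] o od w by simp
  also have "cup ?d (x$?d$w) o cup' x w=?dd|>?d|>cup' x w o cup ?d w" using cup_natural[of ?d "cup' x w"] o od w by simp
  also have "?dd|>cap' x (?d$w) o ?dd|>?d|>cup' x w o cup ?d w
   = ?dd|>(cap' x (?d$w) o ?d|>cup' x w) o cup ?d w" using o od w by simp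
  also have "...=cup ?d w" unfolding snake'(1)[OF o w] using o od w by simp
  finally have "\<b> ?dd ?d w o (drinfeld_iso A x<|(?d$w) o cup' x w) o \<l> w=\<b> ?dd ?d w o cup ?d w o \<l> w" by simp
  then show "(drinfeld_iso A x<|?d o (\<s> ?d x o coev A x))<|w=coev A ?d<|w"
   using o od t w by (simp add: assoc_conj cup'_def cup_def sw_def hat_def)
 qed
qed

lemma drinfeld_invertible:
 assumes i:"simple i"
 shows "iso_arr A (drinfeld_iso A i)"
proof (rule schur_iso[OF i _ drinfeld_coev(2)])
 let ?d = "i^*"
 have o:"obj i" "obj ?d" using i by simp_all
 show "simple ?d^*" using i by simp
 show "drinfeld_iso A i \<noteq> \<z> i ?d^*"
 proof
  assume "drinfeld_iso A i = \<z> i ?d^*"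
  then have "coev A ?d=\<z> \<I> (?d^*$?d)" using drinfeld_coev(1)[OF o(1)] o by simp
  then show False using coev_nonzero(1)[OF simple_dual[OF i]] by simp
 qed
qed (use i in simp)

text \<open>The sign occurs in the quantum dimension and again in the coevaluation, so it cancels from the
  idempotent \<open>\<Pi>\<close>.\<close>
lemma coev_tilde_simple:
 assumes i:"simple i"
 shows "\<exists>t. t * t = 1 \<and> coev_tilde A i = t*.(\<s> i^* i o coev A i) \<and> qdim A i = t * dimn i"
proof -
 let ?d = "i^*" and ?u = "drinfeld_iso A i"
 have o:"obj i" "obj ?d" "?d^* : Obj A" using i by simp_all
 obtain t where t:"t * t = 1" "twist A i = t*.\<i> i" using twist_simple[OF i] by blast
 have u:"?u ::: i ~> ?d^*" using drinfeld_coev(2)[OF o(1)] by (auto simp: hom_iff)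
 note iu = drinfeld_invertible[OF i]
 have p:"pivotal A i=t*.?u" using t u o by (simp add: pivotal_def)
 have "Inv (pivotal A i)=t*.Inv ?u" unfolding p by (rule inv_arrI) (use iu u t o in simp_all)
 then have "coev_tilde A i=t*.(Inv ?u<|?d o coev A ?d)" using iu u o by (simp add: coev_tilde_def)
 also have "Inv ?u<|?d o coev A ?d=\<s> ?d i o coev A i"
  unfolding drinfeld_coev(1)[OF o(1), symmetric] using iu u o whisker_inv_tail(4)[OF iu o(2)] by simp
 finally have c:"coev_tilde A i=t*.(\<s> ?d i o coev A i)" .
 have e:"ev A i o coev_tilde A i=(t * dimn i)*.\<i> \<I>" using c dimn[OF o(1)] o by simp
 have "qdim A i=t * dimn i" unfolding qdim_def by (rule the_equality) (use e unit_scalar_cancel in auto)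
 then show ?thesis using t c by blast
qed

end

context rigid_symmetric_category
begin

lemma cup'_whisker:
 assumes "obj x" "obj y" "obj w"
 shows "cup' x y<|w = \<b> x (x^*$y) w o x|>\<b> x^* y w o cup' x (y$w)"
 using assms by (simp add: cup'_def sw_whisker cap_whisker)

section \<open>Mates\<close>

text \<open>Mates turn an arrow between \<open>j\<close> and \<open>b \<otimes> i\<close> around, to one between
  the dual of \<open>i\<close> and \<open>j\<^sup>* \<otimes> b\<close>.\<close>
definition mate_a ::"'o => 'o => 'o => 'm => 'm" where
 "mate_a b i j t = j^*|>(\<r> b o b|>ev A i o \<a> b i i^* o t<|i^*)
   o \<a> j^* j i^* o coev A j<|i^* o Inv (\<l> i^*)"

definition mate_b ::"'o => 'o => 'o => 'm => 'm" where
 "mate_b b i j f = cap' j i^* o j^*|>(f<|i^* o \<b> b i i^* o b|>(\<s> i^* i o coev A i) o Inv (\<r> b))"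

definition mate_c ::"'o => 'o => 'o => 'm => 'm" where
 "mate_c b k j h = \<r> j o j|>((ev A k o \<s> k^* k) o h<|k o \<b> j^* b k)
   o cup' j (b$k)"

lemma mate_a_hat:
 assumes "obj b" "obj i" "obj j" "obj w" "t : Hom j (b$i)"
 shows "mate_a b i j t : Hom i^* (j^*$b)"
  "mate_a b i j t<|w = \<b> j^* b w o j^*|>b|>cap i w
   o j^*|>\<a> b i (i^*$w) o j^*|>t<|(i^*$w)
   o cup j (i^*$w)" using assms by (simp_all add: mate_a_def hom_iff spread cap_def cup_def)

lemma mate_b_hat:
 assumes o:"obj b" "obj i" "obj j" "obj w" and f:"f : Hom (b$i) j"
 shows "mate_b b i j f : Hom (j^*$b) i^*"
  "mate_b b i j f<|w = cap' j (i^*$w) o j^*|>f<|(i^*$w)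
   o j^*|>\<b> b i (i^*$w)
   o j^*|>b|>cup' i w o \<a> j^* b w"
proof -
 let ?i = "i^*" and ?j = "j^*"
 have od:"obj ?i" "obj ?j" using o by simp_all
 note t = homD[OF f(1)]
 define n where "n = f<|?i o \<b> b i ?i o b|>(\<s> ?i i o coev A i) o Inv (\<r> b)"
 have n:"n ::: b ~> j$?i" using o od t by (simp_all add: n_def)
 have q:"(\<s> ?i i o coev A i)<|w=\<b> i ?i w o cup' i w o \<l> w" using o od by (simp add: cup'_def cup_def sw_def hat_def)
 have nw:"n<|w=\<b> j ?i w o f<|(?i$w) o \<b> b i (?i$w) o b|>cup' i w"
 proof -
  have "n<|w=(f<|?i)<|w o \<b> b i ?i<|w
   o (b|>(\<s> ?i i o coev A i))<|w o Inv (\<r> b)<|w" using o od t by (simp add: n_def)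
  also have "(b|>(\<s> ?i i o coev A i))<|w
   = \<b> b (i$?i) w o b|>(\<b> i ?i w o cup' i w o \<l> w) o \<a> b \<I> w"
   using assoc_conj[of "\<i> b" "\<s> ?i i o coev A i" "\<i> w"] o od by (simp del: whisker_comp add: q)
  finally show ?thesis using o od t by (simp add: spread)
 qed
 have m:"mate_b b i j f=cap' j ?i o ?j|>n" by (simp add: mate_b_def n_def)
 show "mate_b b i j f : Hom (?j$b) ?i" using o od n by (simp add: m hom_iff)
 show "mate_b b i j f<|w=cap' j (?i$w) o ?j|>f<|(?i$w)
   o ?j|>\<b> b i (?i$w) o ?j|>b|>cup' i w o \<a> ?j b w" using o od n t by (simp add: m cap'_whisker assoc_conj nw)
qed

lemma mate_c_hat:
 assumes o:"obj b" "obj k" "obj j" "obj w" and h:"h : Hom (j^*$b) k^*"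
 shows "mate_c b k j h : Hom (b$k) j" (is ?P1)
  "mate_c b k j h<|w = j|>cap' k w o j|>h<|(k$w) o j|>\<b> j^* b (k$w)
   o cup' j (b$k$w) o \<a> b k w"
proof -
 let ?k = "k^*" and ?j = "j^*"
 have od:"obj ?k" "obj ?j" using o by simp_all
 note t = homD[OF h(1)]
 define p where "p = (ev A k o \<s> ?k k) o h<|k o \<b> ?j b k"
 have p:"p ::: ?j$b$k ~> \<I>" using o od t by (simp_all add: p_def)
 have q:"(ev A k o \<s> ?k k)<|w=Inv (\<l> w) o cap' k w o \<a> ?k k w" using o od by (simp add: cap'_def cap_def sw_def hat_def)
 have "p<|w=(ev A k o \<s> ?k k)<|w o (h<|k)<|w o \<b> ?j b k<|w" using o od t by (simp add: p_def)
 then have pw:"p<|w=Inv (\<l> w) o cap' k w o h<|(k$w) o \<b> ?j b (k$w) o ?j|>\<a> b k w o \<a> ?j (b$k) w"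
  unfolding q using o od t by (simp add: spread)
 have m:"mate_c b k j h=\<r> j o j|>p o cup' j (b$k)" by (simp add: mate_c_def p_def)
 show ?P1 using o od p by (simp add: m hom_iff)
 have "mate_c b k j h<|w=j|>\<l> w o j|>p<|w o j|>\<b> ?j (b$k) w o cup' j ((b$k)$w)"
  using o od p by (simp add: m assoc_conj cup'_whisker right_unitor_whisker)
 also have "...=j|>cap' k w o j|>h<|(k$w) o j|>\<b> ?j b (k$w)
   o j|>?j|>\<a> b k w o cup' j ((b$k)$w)" unfolding pw using o od t by simp
 also have "j|>?j|>\<a> b k w o cup' j ((b$k)$w)=cup' j (b$k$w) o \<a> b k w" using cup'_natural[of j "\<a> b k w"] o by simp
 finally show "mate_c b k j h<|w=j|>cap' k w o j|>h<|(k$w) o j|>\<b> ?j b (k$w)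
   o cup' j (b$k$w) o \<a> b k w" .
qed

lemma mate_b_c:
 assumes o:"obj b" "obj k" "obj j" and h:"h : Hom (j^*$b) k^*"
 shows "mate_b b k j (mate_c b k j h) = h"
proof (rule eq_by_tail[OF _ h])
 let ?k = "k^*" and ?j = "j^*"
 note t = homD[OF h(1)]
 have od:"obj ?k" "obj ?j" using o by simp_all
 note c = mate_c_hat[OF o _ h]
 show "mate_b b k j (mate_c b k j h) : Hom (?j$b) ?k" using mate_b_hat(1)[OF o unit_typ c(1)[OF unit_typ]] .
 fix w assume w:"obj w"
 have 1:"cap' j (?k$w) o ?j|>j|>cap' k (?k$w)=cap' k (?k$w) o cap' j (?k$k$?k$w)"
  using cap'_natural[of j "cap' k (?k$w)"] o od w by simp
 have 2:"cap' j (?k$k$?k$w) o ?j|>j|>h<|(k$?k$w)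
  = h<|(k$?k$w) o cap' j ((?j$b)$k$?k$w)" using cap'_natural[of j "h<|(k$?k$w)"] o od w t by simp
 have 3:"cap' j ((?j$b)$k$?k$w) o ?j|>j|>\<b> ?j b (k$?k$w)
  = \<b> ?j b (k$?k$w) o cap' j (?j$b$k$?k$w)" using cap'_natural[of j "\<b> ?j b (k$?k$w)"] o od w by simp
 have 4:"h<|(k$?k$w) o (?j$b)|>cup' k w=?k|>cup' k w o h<|w" using interchange[of h "cup' k w"] t o w by simp
 have 5:"\<b> ?j b (k$?k$w) o ?j|>b|>cup' k w=(?j$b)|>cup' k w o \<b> ?j b w" using o od w by (simp add: assoc_conj_ident)
 have "mate_b b k j (mate_c b k j h)<|w=cap' k (?k$w) o h<|(k$?k$w) o
   (\<b> ?j b (k$?k$w) o ?j|>b|>cup' k w) o \<a> ?j b w"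
  using o od w t h by (simp add: mate_b_hat[OF o w c(1)[OF unit_typ]] c 1[THEN tail] 2[THEN tail] 3[THEN tail] snake'_tail)
 also have "...=cap' k (?k$w) o (h<|(k$?k$w) o (?j$b)|>cup' k w)" unfolding 5 using o od w t by simp
 also have "...=h<|w" unfolding 4 using o od w t by (simp add: snake'_tail)
 finally show "mate_b b k j (mate_c b k j h)<|w=h<|w" .
qed

definition rot_a ::"'o => 'o => 'm => 'o => 'm" where
 "rot_a b i t w = b|>cap i w o \<a> b i (i^*$w) o t<|(i^*$w)"

definition rot_b ::"'o => 'o => 'm => 'o => 'm" where
 "rot_b b i f w = f<|(i^*$w) o \<b> b i (i^*$w) o b|>cup' i w"

lemma rot_typ [simp]:
 assumes "obj b" "obj i" "obj j" "obj w"
 shows "t : Hom j (b$i) ==> rot_a b i t w ::: j$i^*$w ~> b$w"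
  "f : Hom (b$i) j ==> rot_b b i f w ::: b$w ~> j$i^*$w" using assms by (simp_all add: rot_a_def rot_b_def hom_iff)

lemma mate_rot:
 assumes o:"obj b" "obj i" "obj j" "obj w"
 shows "t : Hom j (b$i) ==> mate_a b i j t<|w
   = \<b> j^* b w o j^*|>rot_a b i t w o cup j (i^*$w)"
  "f : Hom (b$i) j ==> mate_b b i j f<|w
   = cap' j (i^*$w) o j^*|>rot_b b i f w o \<a> j^* b w" using o by (simp_all add: rot_a_def rot_b_def mate_a_hat mate_b_hat hom_iff)

lemma rot_straighten:
 assumes o:"obj b" "obj i" "obj j" "obj w"
 shows "t : Hom j (b$i) ==> rot_a b i t (i$w) o j|>cup i w = \<a> b i w o t<|w"
  "f : Hom (b$i) j ==> (j|>cap' i w) o rot_b b i f (i$w) = f<|w o \<b> b i w"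
proof -
 let ?i = "i^*"
 {
  assume t:"t : Hom j (b$i)"
  then have t':"t ::: j ~> b$i" by (auto simp: hom_iff)
  have A2:"t<|(?i$i$w) o j|>cup i w=(b$i)|>cup i w o t<|w" using interchange[of t "cup i w"] t' o by simp
  have "rot_a b i t (i$w) o j|>cup i w=b|>cap i (i$w) o \<a> b i (?i$i$w) o (b$i)|>cup i w o t<|w"
   using o t' A2 by (simp add: rot_a_def)
  also have "...=b|>(cap i (i$w) o i|>cup i w) o \<a> b i w o t<|w" using o t' by (simp add: assoc_conj_ident)
  also have "...=\<a> b i w o t<|w" unfolding snake(1)[OF o(2,4)] using o t' by simp
  finally show "rot_a b i t (i$w) o j|>cup i w=\<a> b i w o t<|w" .
 }
 {
  assume f:"f : Hom (b$i) j"
  then have f':"f ::: b$i ~> j" by (auto simp: hom_iff)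
  have B2:"j|>cap' i w o f<|(?i$i$w)=f<|w o (b$i)|>cap' i w" using interchange[of f "cap' i w"] f' o by simp
  have "j|>cap' i w o rot_b b i f (i$w)
   = (j|>cap' i w o f<|(?i$i$w)) o \<b> b i (?i$i$w) o b|>cup' i (i$w)" using o f' by (simp add: rot_b_def)
  also have "...=f<|w o \<b> b i w o b|>(i|>cap' i w o cup' i (i$w))" unfolding B2 using o f' by (simp add: assoc_conj_ident)
  also have "...=f<|w o \<b> b i w" unfolding snake'(2)[OF o(2,4)] using o f' by simp
  finally show "j|>cap' i w o rot_b b i f (i$w)=f<|w o \<b> b i w" .
 }
qed

lemma mate_c_b:
 assumes o:"obj b" "obj k" "obj j" and f:"f : Hom (b$k) j"
 shows "mate_c b k j (mate_b b k j f) = f"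
proof (rule eq_by_tail[OF _ f])
 let ?k = "k^*" and ?j = "j^*"
 note t = homD[OF f(1)]
 have od:"obj ?k" "obj ?j" using o by simp_all
 note m = mate_b_hat(1)[OF o unit_typ f]
 show "mate_c b k j (mate_b b k j f) : Hom (b$k) j" using mate_c_hat(1)[OF o unit_typ m] .
 fix w assume w:"obj w"
 let ?y = "rot_b b k f (k$w)"
 have y:"?y ::: b$k$w ~> j$?k$k$w" using o w f by simp_all
 have n:"j|>?j|>?y o cup' j (b$k$w)=cup' j (j$?k$k$w) o ?y" using cup'_natural[of j ?y] o y by simp
 have "mate_c b k j (mate_b b k j f)<|w=(j|>cap' k w o ?y) o \<a> b k w"
  using o od w y f by (simp add: mate_c_hat[OF o w m] mate_rot n[THEN tail] snake'_tail)
 then show "mate_c b k j (mate_b b k j f)<|w=f<|w" unfolding rot_straighten(2)[OF o w f] using o w t by simp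
qed

text \<open>The loop around the composite of two mates is the loop around the original composite: this is the
  source of the dimension quotient in \<open>mate_pairing\<close>.\<close>
lemma mate_loop:
 assumes o:"obj b" "obj i" "obj j" "obj w" and f:"f : Hom (b$i) j" and t:"t : Hom j (b$i)"
 shows "cap' i w o (mate_b b i j f o mate_a b i j t)<|(i$w) o cup i w
  = cap' j w o j^*|>(f o t)<|w o cup j w"
proof -
 let ?i = "i^*" and ?j = "j^*"
 have od:"obj ?i" "obj ?j" using o by simp_all
 note f' = homD[OF f(1)]
 note t' = homD[OF t(1)]
 have ma:"mate_a b i j t ::: ?i ~> ?j$b"
  using mate_a_hat(1)[OF o t] by (auto simp: hom_iff)
 have mb:"mate_b b i j f ::: ?j$b ~> ?i"
  using mate_b_hat(1)[OF o f] by (auto simp: hom_iff)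
 have A1:"cup j (?i$i$w) o cup i w=?j|>j|>cup i w o cup j w" using cup_natural[of j "cup i w"] o by simp
 have "mate_a b i j t<|(i$w) o cup i w
  = \<b> ?j b (i$w) o ?j|>(rot_a b i t (i$w) o j|>cup i w) o cup j w" using o od t by (simp add: mate_rot A1)
 then have MA:"mate_a b i j t<|(i$w) o cup i w=\<b> ?j b (i$w) o ?j|>(\<a> b i w o t<|w) o cup j w"
  unfolding rot_straighten(1)[OF o t] .
 have B1:"cap' i w o cap' j (?i$i$w)=cap' j w o ?j|>j|>cap' i w" using cap'_natural[of j "cap' i w"] o by simp
 have "cap' i w o mate_b b i j f<|(i$w)=cap' j w o
  ?j|>(j|>cap' i w o rot_b b i f (i$w)) o \<a> ?j b (i$w)" using o od f by (simp add: mate_rot B1[THEN tail])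
 then have MB:"cap' i w o mate_b b i j f<|(i$w)=cap' j w o ?j|>(f<|w o \<b> b i w) o \<a> ?j b (i$w)"
  unfolding rot_straighten(2)[OF o f] .
 have "cap' i w o (mate_b b i j f o mate_a b i j t)<|(i$w) o cup i w
  = (cap' i w o mate_b b i j f<|(i$w)) o (mate_a b i j t<|(i$w) o cup i w)" using o od ma mb by simp
 also have "...=cap' j w o ?j|>(f o t)<|w o cup j w" unfolding MA MB using o od f' t' by simp
 finally show ?thesis .
qed

text \<open>A cap or a cup absorbs a mate and releases the original arrow, rotated to the other strand.\<close>
lemma mate_absorb:
 assumes o:"obj b" "obj i" "obj j" "obj w"
 shows "t : Hom j (b$i) ==> cap j (b$w) o j|>(\<a> j^* b w o mate_a b i j t<|w) = rot_a b i t w"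
  "f : Hom (b$i) j ==> (j|>(mate_b b i j f<|w o \<b> j^* b w)) o cup' j (b$w) = rot_b b i f w"
proof -
 let ?i = "i^*" and ?j = "j^*"
 have od:"obj ?i" "obj ?j" using o by simp_all
 {
  assume t:"t : Hom j (b$i)"
  have 1:"cap j (b$w) o j|>?j|>rot_a b i t w=rot_a b i t w o cap j (j$?i$w)" using cap_natural[of j "rot_a b i t w"] o t by simp
  show "cap j (b$w) o j|>(\<a> ?j b w o mate_a b i j t<|w)=rot_a b i t w" using o od t by (simp add: mate_rot 1[THEN tail] snake)
 }
 {
  assume f:"f : Hom (b$i) j"
  have 1:"j|>?j|>rot_b b i f w o cup' j (b$w)=cup' j (j$?i$w) o rot_b b i f w" using cup'_natural[of j "rot_b b i f w"] o f by simp
  show "j|>(mate_b b i j f<|w o \<b> ?j b w) o cup' j (b$w)=rot_b b i f w" using o od f by (simp add: mate_rot 1 snake'_tail)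
 }
qed

end

section \<open>The global dimension and the handle slide\<close>

context symmetric_ribbon_fusion_category
begin

lemma representatives_finite:
 assumes R:"simple_representatives A R"
 shows "finite R"
proof -
 obtain S where S:"finite S" "!!x. simple x ==> \<exists>i\<in>S. isomorphic A x i" using finitely_many_simples by blast
 have "\<forall>i. \<exists>s. i : R \<longrightarrow> s : S \<and> isomorphic A i s" using S(2) representatives(1)[OF R] by blast
 then obtain g where g:"!!i. i : R ==> g i : S" "!!i. i : R ==> isomorphic A i (g i)" by metis
 have "inj_on g R"
 proof (rule inj_onI)
  fix i k assume i:"i : R" and k:"k : R" and eq:"g i = g k"
  have "isomorphic A i k" using isomorphic_trans[OF g(2)[OF i, unfolded eq] isomorphic_sym[OF g(2)[OF k]]] .
  then show "i=k" by (rule representatives(3)[OF R i k])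
 qed
 moreover have "finite (g ` R)" using g(1) S(1) by (blast intro: finite_subset)
 ultimately show ?thesis by (rule finite_imageD[rotated])
qed

lemma isomorphic_double_dual:
 assumes "simple i"
 shows "isomorphic A i i^*^*" using isomorphicI[OF drinfeld_invertible drinfeld_coev(2)] assms by simp

lemma dual_injective:
 assumes R:"simple_representatives A R" and i:"i : R" and k:"k : R"
  and iso:"isomorphic A i^* k^*"
 shows "i = k" using representatives(3)[OF R k i isomorphic_dual[OF representatives(1)[OF R i] representatives(1)[OF R k] iso]] by simp

lemma dual_representatives:
 assumes R:"simple_representatives A R"
 shows "simple_representatives A (dual_obj  A ` R)" unfolding simple_representatives_def
proof (intro conjI ballI allI impI)
 fix i assume "i \<in> dual_obj  A ` R"
 then show "simple i" using representatives(1)[OF R] simple_dual by blast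
next
 fix y assume y:"simple y"
 obtain k where k:"k : R" "simple k" "isomorphic A y^* k" using representatives(2)[OF R simple_dual[OF y]] by blast
 have "isomorphic A y^* k^*^*" using isomorphic_trans[OF k(3) isomorphic_double_dual[OF k(2)]] .
 then have yk:"isomorphic A y k^*" using isomorphic_sym[OF isomorphic_dual[OF y simple_dual[OF k(2)]]] by blast
 show "\<exists>!i. i \<in> dual_obj  A ` R \<and> isomorphic A y i"
 proof (rule ex1I[of _ "k^*"])
  show "k^* \<in> dual_obj  A ` R \<and> isomorphic A y (dual_obj  A k)" using k yk by blast
  fix i assume i:"i \<in> dual_obj  A ` R \<and> isomorphic A y i"
  then obtain l where l:"l : R" "i=l^*" by blast
  have "isomorphic A l^* k^*" using isomorphic_trans[OF isomorphic_sym[of y i] yk] i unfolding l(2) by blast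
  then show "i=k^*" using dual_injective[OF R l(1) k(1)] l by simp
 qed
qed

lemma dimension_count:
 assumes R:"simple_representatives A R" and x:"obj x"
  and B:"!!k. k : R ==> hom_basis A x k (B k)"
 shows "(\<Sum>k\<in>R. of_nat (card (B k)) * dimn k) = dimn x"
proof (rule unit_scalar_cancel)
 note fR = representatives_finite[OF R]
 define tr where "tr z f = pair_trace z z^* (ev A z) (coev A z) f" for z f
 have tt:"tr z f : Hom \<I> \<I>" if "obj z" "f : Hom z z" for z f using that by (simp add: tr_def pair_trace_def hom_iff)
 have tadd:"tr z (f +. g)=tr z f +. tr z g" if "obj z" "f : Hom z z" "g : Hom z z" for z f g
  using that by (simp add: tr_def pair_trace_def hom_iff tensor_add add_comp comp_add)
 have tid:"tr z (\<i> z)=dimn z*.\<i> \<I>" if "obj z" for z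
  using pair_trace_ident[OF that dual_pair_dual[OF that]] by (simp add: tr_def)
 have trm:"tr x (dual_vector A x k (B k) \<f> o \<f>)=dimn k*.\<i> \<I>" if k:"k : R" and \<f>:"\<f> : B k" for k \<f>
 proof -
  have ks:"simple k" using representatives(1)[OF R k] .
  note dv = dual_vector[OF ks x B[OF k] \<f>]
  have "tr x (dual_vector A x k (B k) \<f> o \<f>)=tr k (\<f> o dual_vector A x k (B k) \<f>)"
   unfolding tr_def using dual_pair_dual[OF x] dual_pair_dual[OF simple_obj[OF ks]] basis_in[OF B[OF k] \<f>] dv(1)
   by (rule pair_trace_cyclic)
  then show ?thesis using dv(2)[OF \<f>] tid ks by simp
 qed
 have din:"dual_vector A x k (B k) \<f> o \<f> : Hom x x" if k:"k : R" and \<f>:"\<f> : B k" for k \<f>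
  using comp_in[OF basis_in[OF B[OF k] \<f>] dual_vector(1)[OF representatives(1)[OF R k] x B[OF k] \<f>]] .
 have inner:"tr x (hsum x x (B k) (%\<f>. dual_vector A x k (B k) \<f> o \<f>))=(of_nat (card (B k)) * dimn k)*.\<i> \<I>" if k:"k : R" for k
 proof -
  have "tr x (hsum x x (B k) (%\<f>. dual_vector A x k (B k) \<f> o \<f>))=hsum \<I> \<I> (B k) (%\<f>. tr x (dual_vector A x k (B k) \<f> o \<f>))"
   by (rule additive_hsum[OF x x unit_typ unit_typ basis_finite[OF B[OF k]] din[OF k] tt[OF x] tadd[OF x]])
  also have "...=hsum \<I> \<I> (B k) (%\<f>. dimn k*.\<i> \<I>)" using trm[OF k] by (intro hsum_cong) (simp_all add: hom_iff)
  also have "...=(\<Sum>\<f>\<in>B k. dimn k)*.\<i> \<I>"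
   using hsum_scale_const[of "\<i> \<I>" "B k" "%_. dimn k"] basis_finite[OF B[OF k]] by simp
  finally show ?thesis by simp
 qed
 have "dimn x*.\<i> \<I>=tr x (hsum x x R (%k. hsum x x (B k) (%\<f>. dual_vector A x k (B k) \<f> o \<f>)))"
  using completeness[OF R fR x B] tid[OF x] by simp
 also have "...=hsum \<I> \<I> R (%k. tr x (hsum x x (B k) (%\<f>. dual_vector A x k (B k) \<f> o \<f>)))"
  by (rule additive_hsum[OF x x unit_typ unit_typ fR hsum_in[OF x x din] tt[OF x] tadd[OF x]])
 also have "...=hsum \<I> \<I> R (%k. (of_nat (card (B k)) * dimn k)*.\<i> \<I>)"
  using inner by (intro hsum_cong) (simp_all add: hom_iff)
 also have "...=(\<Sum>k\<in>R. of_nat (card (B k)) * dimn k)*.\<i> \<I>" using hsum_scale_const[of "\<i> \<I>" R] fR by simp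
 finally show "(\<Sum>k\<in>R. of_nat (card (B k)) * dimn k)*.\<i> \<I>=dimn x*.\<i> \<I>" by simp
qed

lemma mate_linear:
 assumes o:"obj b" "obj i" "obj j"
 shows "[|f : Hom (b$i) j; g : Hom (b$i) j|] ==> mate_b b i j (f +. g) = mate_b b i j f +. mate_b b i j g"
  "f : Hom (b$i) j ==> mate_b b i j (c*.f) = c*.mate_b b i j f"
  "[|h : Hom (j^*$b) i^*; k : Hom (j^*$b) i^*|]
   ==> mate_c b i j (h +. k) = mate_c b i j h +. mate_c b i j k"
  "h : Hom (j^*$b) i^* ==> mate_c b i j (c*.h) = c*.mate_c b i j h"
proof -
 let ?i = "i^*" and ?j = "j^*"
 define q where "q = \<b> b i ?i o b|>(\<s> ?i i o coev A i) o Inv (\<r> b)"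
 have q:"q ::: b ~> (b$i)$?i" using o by (simp_all add: q_def)
 have mb:"mate_b b i j f=cap' j ?i o ?j|>(f<|?i o q)" for f by (simp add: mate_b_def q_def)
 define e where "e = ev A i o \<s> ?i i"
 have e:"e ::: ?i$i ~> \<I>" using o by (simp_all add: e_def)
 have mc:"mate_c b i j h=\<r> j o j|>(e o h<|i o \<b> ?j b i) o cup' j (b$i)" for h by (simp add: mate_c_def e_def)
 show "[|f : Hom (b$i) j; g : Hom (b$i) j|] ==> mate_b b i j (f +. g)=mate_b b i j f +. mate_b b i j g"
  using o q by (simp add: mb hom_iff tensor_add add_comp comp_add)
 show "f : Hom (b$i) j ==> mate_b b i j (c*.f)=c*.mate_b b i j f" using o q by (simp add: mb hom_iff)
 show "[|h : Hom (?j$b) ?i; k : Hom (?j$b) ?i|] ==> mate_c b i j (h +. k)=mate_c b i j h +. mate_c b i j k"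
  using o e by (simp add: mc hom_iff tensor_add add_comp comp_add)
 show "h : Hom (?j$b) ?i ==> mate_c b i j (c*.h)=c*.mate_c b i j h" using o e by (simp add: mc hom_iff)
qed

text \<open>Mates give injections between the two spaces of arrows in both directions.\<close>
lemma multiplicity_dual:
 assumes o:"obj b" "obj i" "obj j"
  and B:"hom_basis A (b$i) j B" and B':"hom_basis A (b$j^*) i^* B'"
 shows "card B = card B'"
proof (rule antisym)
 let ?i = "i^*" and ?j = "j^*"
 have od:"obj ?i" "obj ?j" using o by simp_all
 have mb:"mate_b b i j f ::: ?j$b ~> ?i" if "f : Hom (b$i) j" for f
  using mate_b_hat(1)[OF o unit_typ that] by (simp_all add: hom_iff)
 have mc:"mate_c b i j f : Hom (b$i) j" if "f : Hom (?j$b) ?i" for f using mate_c_hat(1)[OF o unit_typ that] .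
 have sh:"f o \<s> ?j b : Hom (?j$b) ?i" if "f : Hom (b$?j) ?i" for f using that o od by (simp add: hom_iff)
 have ob:"b$i : Obj A" "b$?j : Obj A" "?j$b : Obj A" using o od by simp_all
 show "card B \<le> card B'"
 proof (rule card_basis_le[OF B B' ob(1) o(3) ob(2) od(1), where F = "%f. mate_b b i j f o \<s> b ?j"])
  show "mate_b b i j f o \<s> b ?j : Hom (b$?j) ?i" if "f : Hom (b$i) j" for f using mb[OF that] o od by (simp add: hom_iff)
  show "mate_b b i j (f +. g) o \<s> b ?j=mate_b b i j f o \<s> b ?j +. mate_b b i j g o \<s> b ?j"
   if "f : Hom (b$i) j" "g : Hom (b$i) j" for f g
   using mb[OF that(1)] mb[OF that(2)] o od that by (simp add: mate_linear add_comp)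
  show "mate_b b i j (c*.f) o \<s> b ?j=c*.(mate_b b i j f o \<s> b ?j)" if "f : Hom (b$i) j" for c f
   using mb[OF that] o od that by (simp add: mate_linear)
  fix f assume f:"f : Hom (b$i) j" and z:"mate_b b i j f o \<s> b ?j = \<z> (b$?j) ?i"
  have "(mate_b b i j f o \<s> b ?j) o \<s> ?j b=\<z> (?j$b) ?i" unfolding z using o od by simp
  then have "mate_b b i j f=\<z> (?j$b) ?i" using mb[OF f] o od symmetry_involutive by simp
  also have "...=0*.\<z> (?j$b) ?i" using ob od by simp
  finally have "mate_c b i j (mate_b b i j f)=0*.mate_c b i j (\<z> (?j$b) ?i)"
   using mate_linear(4)[OF o, of "\<z> (?j$b) ?i" 0] ob od by (simp add: hom_iff)
  also have "...=\<z> (b$i) j" using mc[of "\<z> (?j$b) ?i"] ob od by (simp add: hom_iff)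
  finally show "f=\<z> (b$i) j" using mate_c_b[OF o f] by simp
 qed
 show "card B' \<le> card B"
 proof (rule card_basis_le[OF B' B ob(2) od(1) ob(1) o(3), where F = "%f. mate_c b i j (f o \<s> ?j b)"])
  show "mate_c b i j (f o \<s> ?j b) : Hom (b$i) j" if "f : Hom (b$?j) ?i" for f using mc[OF sh[OF that]] .
  show "mate_c b i j ((f +. g) o \<s> ?j b)=mate_c b i j (f o \<s> ?j b) +. mate_c b i j (g o \<s> ?j b)"
   if "f : Hom (b$?j) ?i" "g : Hom (b$?j) ?i" for f g
   using mate_linear(3)[OF o sh[OF that(1)] sh[OF that(2)]] o od that by (simp add: hom_iff add_comp)
  show "mate_c b i j ((c*.f) o \<s> ?j b)=c*.mate_c b i j (f o \<s> ?j b)" if "f : Hom (b$?j) ?i" for c f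
   using mate_linear(4)[OF o sh[OF that]] o od that by (simp add: hom_iff)
  fix f assume f:"f : Hom (b$?j) ?i" and z:"mate_c b i j (f o \<s> ?j b) = \<z> (b$i) j"
  have "f o \<s> ?j b=mate_b b i j (0*.\<z> (b$i) j)" using mate_b_c[OF o sh[OF f]] z ob o by simp
  also have "...=0*.mate_b b i j (\<z> (b$i) j)" using ob o by (intro mate_linear(2)) (simp_all add: hom_iff)
  also have "...=\<z> (?j$b) ?i" using mb[of "\<z> (b$i) j"] ob o by (simp add: hom_iff)
  finally have "(f o \<s> ?j b) o \<s> b ?j=\<z> (b$?j) ?i" using o od by simp
  then show "f=\<z> (b$?j) ?i" using f o od symmetry_involutive by (simp add: hom_iff)
 qed
qed

lemma dimn_nonzero_sum:
 assumes R:"simple_representatives A R"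
 shows "(\<Sum>i\<in>R. dimn i * cnj (dimn i)) \<noteq> 0"
proof -
 note fR = representatives_finite[OF R]
 obtain i where i:"i : R" using representatives(2)[OF R unit_simple] by blast
 have "(\<Sum>i\<in>R. dimn i * cnj (dimn i))=complex_of_real (\<Sum>i\<in>R. (cmod (dimn i))\<^sup>2)"
  by (simp add: complex_norm_square[symmetric])
 moreover have "(\<Sum>i\<in>R. (cmod (dimn i))\<^sup>2) > 0"
  using dimn_nonzero[OF representatives(1)[OF R i]] i fR by (intro sum_pos2[where i = i]) auto
 ultimately show ?thesis by (simp del: of_real_sum of_real_power)
qed

text \<open>Put \<open>v\<^sub>j = d_j\<close>. Counting dimensions in \<open>b \<otimes> i\<close> gives
  \<open>d_b v = N v\<close> with \<open>N\<close> the matrix of multiplicities, and the transpose of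
  \<open>N\<close> is up to duals the matrix of \<open>b\<close> again. Hence \<open>d_b\<close> and its
  conjugate have the same pairing with the positive number \<open>\<Sum> |v\<^sub>j|\<^sup>2\<close>.\<close>
lemma dimn_real:
 assumes R:"simple_representatives A R" and b:"obj b"
 shows "cnj (dimn b) = dimn b"
proof -
 let ?d = "dual_obj A"
 note fR = representatives_finite[OF R] and R' = dual_representatives[OF R]
 have Ro:"i : R ==> obj i" for i using representatives(1)[OF R] by simp
 define B where "B x y = (SOME B. hom_basis A x y B)" for x y
 have B:"hom_basis A x y (B x y)" if "obj x" "obj y" for x y unfolding B_def using someI_ex[OF hom_finite_dim[OF that]] .
 define M where "M i j = (of_nat (card (B (b$i) j)) :: complex)" for i j
 have M:"M i j = of_nat (card (B (b$?d j) (?d i)))" if "i : R" "j : R" for i j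
  unfolding M_def using multiplicity_dual[OF b Ro[OF that(1)] Ro[OF that(2)] B B] b Ro that by simp
 have inj:"inj_on ?d R" using dual_injective[OF R] isomorphic_trans isomorphic_sym isomorphic_double_dual simple_dual representatives(1)[OF R]
  by (intro inj_onI) metis
 have r:"(\<Sum>j\<in>R. M i j * dimn j)=dimn b * dimn i" if i:"i : R" for i
  unfolding M_def using dimension_count[OF R, of "b$i" "%k. B (b$i) k"] B b Ro i by (simp add: dimn_tensor)
 have c:"(\<Sum>i\<in>R. M i j * dimn i)=dimn b * dimn j" if j:"j : R" for j
 proof -
  have "(\<Sum>k\<in>?d ` R. of_nat (card (B (b$?d j) k)) * dimn k)=dimn (b$?d j)"
   using dimension_count[OF R', of "b$?d j" "%k. B (b$?d j) k"] B b Ro j by force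
  then have "(\<Sum>i\<in>R. of_nat (card (B (b$?d j) (?d i))) * dimn (?d i))=dimn (b$?d j)" by (simp add: sum.reindex[OF inj])
  then show ?thesis using M j b Ro by (simp add: dimn_tensor dimn_dual)
 qed
 let ?N = "\<Sum>i\<in>R. dimn i * cnj (dimn i)"
 have cM:"cnj (M i j)=M i j" for i j by (simp add: M_def)
 have "dimn b * ?N=(\<Sum>i\<in>R. (dimn b * dimn i) * cnj (dimn i))" by (simp add: sum_distrib_left mult.assoc)
 also have "...=(\<Sum>i\<in>R. \<Sum>j\<in>R. M i j * dimn j * cnj (dimn i))" by (simp add: r[symmetric] sum_distrib_right)
 also have "...=(\<Sum>j\<in>R. \<Sum>i\<in>R. M i j * dimn j * cnj (dimn i))" by (rule sum.swap)
 also have "...=(\<Sum>j\<in>R. dimn j * cnj (\<Sum>i\<in>R. M i j * dimn i))" by (simp add: cM sum_distrib_left mult_ac)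
 also have "...=(\<Sum>j\<in>R. dimn j * cnj (dimn b * dimn j))" using c by simp
 also have "...=cnj (dimn b) * ?N" by (simp add: sum_distrib_left mult_ac)
 finally show ?thesis using dimn_nonzero_sum[OF R] by simp
qed

text \<open>A sum of squares of reals, with the dimension of the unit among them.\<close>
lemma global_dimension_nonzero:
 assumes R:"simple_representatives A R"
 shows "(\<Sum>i\<in>R. (dimn i)\<^sup>2) \<noteq> 0"
proof -
 have "(\<Sum>i\<in>R. (dimn i)\<^sup>2)=(\<Sum>i\<in>R. dimn i * cnj (dimn i))"
  using dimn_real[OF R] representatives(1)[OF R] by (intro sum.cong) (simp_all add: power2_eq_square)
 then show ?thesis using dimn_nonzero_sum[OF R] by simp
qed

text \<open>By Schur's lemma the composite is a scalar; closing it to a loop determines it, which brings in the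
  quotient of dimensions.\<close>
lemma mate_pairing:
 assumes b:"obj b" and i:"simple i" and j:"simple j"
  and f:"f : Hom (b$i) j" and t:"t : Hom j (b$i)" and ft:"f o t = \<nu>*.\<i> j"
 shows "mate_b b i j f o mate_a b i j t = (\<nu> * dimn j / dimn i)*.\<i> i^*"
proof -
 note o = b simple_obj[OF i] simple_obj[OF j]
 let ?m = "mate_b b i j f o mate_a b i j t"
 have "?m : Hom i^* i^*" using comp_in[OF mate_a_hat(1)[OF o unit_typ t] mate_b_hat(1)[OF o unit_typ f]] .
 then obtain c where c:"?m=c*.\<i> i^*" using schur_scalar[OF simple_dual[OF i]] by blast
 have "(c * dimn i)*.\<i> \<I>=(\<nu> * dimn j)*.\<i> \<I>" using mate_loop[OF o unit_typ f t] o by (simp add: c ft loop_value)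
 then have "c * dimn i=\<nu> * dimn j" by (rule unit_scalar_cancel)
 then have "c=\<nu> * dimn j / dimn i" using dimn_nonzero[OF i] by (simp add: field_simps)
 then show ?thesis using c by simp
qed

text \<open>The mates of a basis and of its dual vectors are again dual to each other up to the factor
  \<open>d_j/d_i\<close>. So this is the completeness relation for \<open>j\<^sup>* \<otimes> b\<close> over the
  dual representatives.\<close>
lemma mate_completeness:
 assumes R:"simple_representatives A R" and b:"obj b" and j:"simple j"
  and B:"!!i. i : R ==> hom_basis A (b$i) j (B i)"
 defines "Y \<equiv> j^*$b"
 shows "hsum Y Y R (%i. hsum Y Y (B i) (%\<f>. dimn i*.(mate_a b i j (dual_vector A (b$i) j (B i) \<f>) o mate_b b i j \<f>)))
  = dimn j*.\<i> Y"
proof -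
 let ?d = "dual_obj A"
 define t where "t i \<f> = dual_vector A (b$i) j (B i) \<f>" for i \<f>
 define q where "q i \<f> = dimn i*.(mate_a b i j (t i \<f>) o mate_b b i j \<f>)" for i \<f>
 note fR = representatives_finite[OF R] and R' = dual_representatives[OF R]
 have Rs:"i : R ==> simple i" for i using representatives(1)[OF R] .
 have Ro:"i : R ==> obj i" for i using Rs by simp
 have jo:"obj j" and Y:"obj Y" using j b by (simp_all add: Y_def)
 have tin:"t i \<f> : Hom j (b$i)" if "i : R" "\<f> : B i" for i \<f>
  unfolding t_def using dual_vector(1)[OF j _ B] that b Ro by simp
 have ain:"mate_a b i j (t i \<f>) : Hom (?d i) Y" if "i : R" "\<f> : B i" for i \<f>
  using mate_a_hat(1)[OF b Ro jo unit_typ tin] that by (simp add: Y_def)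
 have bin:"mate_b b i j f : Hom Y (?d i)" if "i : R" "f : Hom (b$i) j" for i f
  using mate_b_hat(1)[OF b Ro jo unit_typ] that by (simp add: Y_def)
 have qin:"q i \<f> : Hom Y Y" if "i : R" "\<f> : B i" for i \<f>
  using ain[OF that] bin[OF that(1) basis_in[OF B[OF that(1)] that(2)]] by (simp add: q_def hom_iff)
 have win:"hsum Y Y (B i) (q i) : Hom Y Y" if "i : R" for i by (rule hsum_in[OF Y Y qin[OF that]])
 let ?L = "hsum Y Y R (%i. hsum Y Y (B i) (q i))"
 have Lin:"?L : Hom Y Y" using hsum_in[OF Y Y win] .
 have key:"mate_b b k j \<psi> o ?L=dimn j*.mate_b b k j \<psi>" if k:"k : R" and \<psi>:"\<psi> : Hom (b$k) j" for k \<psi>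
 proof -
  define h where "h = mate_b b k j \<psi>"
  have h:"arr h" "Dom A h=Y" "Cod A h=?d k" using bin[OF k \<psi>] by (simp_all add: h_def hom_iff)
  have bk:"b$k : Obj A" and ko:"?d k : Obj A" using b Ro k by simp_all
  have off:"h o hsum Y Y (B i) (q i)=\<z> Y (?d k)" if i:"i : R" "i \<noteq> k" for i
  proof -
   have "h o q i \<f>=\<z> Y (?d k)" if \<f>:"\<f> : B i" for \<f>
   proof -
   have ta:"mate_a b i j (t i \<f>) ::: ?d i ~> Y"
   using ain[OF i(1) \<f>] by (simp_all add: hom_iff)
   have tb:"mate_b b i j \<f> ::: Y ~> ?d i"
   using bin[OF i(1) basis_in[OF B[OF i(1)] \<f>]] by (simp_all add: hom_iff)
   have ni:"\<not> isomorphic A (?d i) (?d k)" using dual_injective[OF R i(1) k] i(2) by blast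
   have "h o mate_a b i j (t i \<f>) : Hom (?d i) (?d k)" using ta h by (simp add: hom_iff)
   then have z:"h o mate_a b i j (t i \<f>)=\<z> (?d i) (?d k)"
   by (rule schur_zero[OF simple_dual[OF Rs[OF i(1)]] simple_dual[OF Rs[OF k]] ni])
   show ?thesis using ta tb h ko Ro i Y by (simp add: q_def z[THEN tail])
   qed
   then have "hsum Y (?d k) (B i) (%\<f>. h o q i \<f>)=hsum Y (?d k) (B i) (%\<f>. \<z> Y (?d k))"
   using Y ko by (intro hsum_cong) (simp_all add: hom_iff)
   then show ?thesis using comp_hsum[OF basis_finite[OF B[OF i(1)]] qin[OF i(1)] h(1) Y h(2)] h Y ko by (simp add: hsum_zero)
  qed
  have on:"h o hsum Y Y (B k) (q k)=dimn j*.h"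
  proof -
   have "\<forall>\<f>. \<exists>c. \<f> : B k \<longrightarrow> \<psi> o t k \<f>=c*.\<i> j"
   using schur_scalar[OF j comp_in[OF tin[OF k] \<psi>]] by blast
   then obtain \<nu> where \<nu>:"!!\<f>. \<f> : B k ==> \<psi> o t k \<f>=\<nu> \<f>*.\<i> j" by metis
   have \<f>in:"\<f> : Hom (b$k) j" if "\<f> : B k" for \<f> using basis_in[OF B[OF k] that] .
   have hq:"h o q k \<f>=dimn j*.mate_b b k j (\<nu> \<f>*.\<f>)" if \<f>:"\<f> : B k" for \<f>
   proof -
   have ta:"mate_a b k j (t k \<f>) ::: ?d k ~> Y"
   using ain[OF k \<f>] by (simp_all add: hom_iff)
   have tb:"mate_b b k j \<f> ::: Y ~> ?d k"
   using bin[OF k \<f>in[OF \<f>]] by (simp_all add: hom_iff)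
   have p:"h o mate_a b k j (t k \<f>)=(\<nu> \<f> * dimn j / dimn k)*.\<i> (?d k)"
   unfolding h_def by (rule mate_pairing[OF b Rs[OF k] j \<psi> tin[OF k \<f>] \<nu>[OF \<f>]])
   have "h o q k \<f>=(dimn k * (\<nu> \<f> * dimn j / dimn k))*.mate_b b k j \<f>"
   using ta tb h ko by (simp add: q_def p[THEN tail])
   then show ?thesis using dimn_nonzero[OF Rs[OF k]] tb by (simp add: mate_linear(2)[OF b Ro[OF k] jo \<f>in[OF \<f>]] mult.commute)
   qed
   have sin:"\<nu> \<f>*.\<f> : Hom (b$k) j" if "\<f> : B k" for \<f> using \<f>in[OF that] by (simp add: hom_iff)
   have "hsum (b$k) j (B k) (%\<f>. \<nu> \<f>*.\<f>)=hsum (b$k) j (B k) (%\<f>. (\<psi> o t k \<f>) o \<f>)"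
   proof (rule hsum_cong[OF bk jo])
   fix \<f> assume \<f>:"\<f> : B k"
   show "\<nu> \<f>*.\<f>=(\<psi> o t k \<f>) o \<f>" using \<nu>[OF \<f>] \<f>in[OF \<f>] jo by (simp add: hom_iff)
   show "(\<psi> o t k \<f>) o \<f> : Hom (b$k) j" using comp_in[OF \<f>in[OF \<f>] comp_in[OF tin[OF k \<f>] \<psi>]] .
   qed
   also have "...=\<psi>" unfolding t_def by (rule expand_in_basis[OF j bk B[OF k] \<psi>])
   finally have ex:"hsum (b$k) j (B k) (%\<f>. \<nu> \<f>*.\<f>)=\<psi>" .
   have mb:"mate_b b k j (hsum (b$k) j (B k) (%\<f>. \<nu> \<f>*.\<f>))=hsum Y (?d k) (B k) (%\<f>. mate_b b k j (\<nu> \<f>*.\<f>))"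
   by (rule additive_hsum[OF bk jo Y ko basis_finite[OF B[OF k]] sin bin[OF k] mate_linear(1)[OF b Ro[OF k] jo]])
   have "h o hsum Y Y (B k) (q k)=hsum Y (?d k) (B k) (%\<f>. h o q k \<f>)"
   using comp_hsum[OF basis_finite[OF B[OF k]] qin[OF k] h(1) Y h(2)] h(3) by simp
   also have "...=hsum Y (?d k) (B k) (%\<f>. dimn j*.mate_b b k j (\<nu> \<f>*.\<f>))"
   using hq bin[OF k sin] by (intro hsum_cong[OF Y ko]) (simp_all add: hom_iff)
   also have "...=dimn j*.hsum Y (?d k) (B k) (%\<f>. mate_b b k j (\<nu> \<f>*.\<f>))"
   using scale_hsum[OF basis_finite[OF B[OF k]] bin[OF k sin] Y ko] by simp
   finally show ?thesis unfolding mb[symmetric] ex h_def .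
  qed
  have hw:"h o hsum Y Y (B i) (q i) : Hom Y (?d k)" if "i : R" for i using win[OF that] h by (simp add: hom_iff)
  have "h o ?L=hsum Y (?d k) R (%i. h o hsum Y Y (B i) (q i))" using comp_hsum[OF fR win h(1) Y h(2)] h(3) by simp
  also have "...=h o hsum Y Y (B k) (q k)" using off hw[OF k] by (intro hsum_single[OF Y ko fR k, of "%i. h o hsum Y Y (B i) (q i)"]) auto
  finally show ?thesis using on by (simp add: h_def)
 qed
 have "?L=dimn j*.\<i> Y"
 proof (rule joint_mono[OF representatives(2)[OF R'] Lin])
  show "dimn j*.\<i> Y : Hom Y Y" using Y by (simp add: hom_iff)
  fix k' h assume k':"k' \<in> ?d ` R" and h:"h : Hom Y k'"
  obtain k where k:"k : R" "k' = ?d k" using k' by blast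
  have h':"h : Hom (?d j$b) (?d k)" using h k by (simp add: Y_def)
  have e:"mate_b b k j (mate_c b k j h)=h" using mate_b_c[OF b Ro[OF k(1)] jo h'] .
  have "h o ?L=dimn j*.h" using key[OF k(1) mate_c_hat(1)[OF b Ro[OF k(1)] jo unit_typ h']] unfolding e .
  then show "h o ?L=h o (dimn j*.\<i> Y)" using h Y by (simp add: hom_iff)
 qed blast
 then show ?thesis unfolding q_def t_def .
qed

lemma sandwich_hsum:
 assumes K:"finite K" "!!i. i : K ==> f i : Hom x y" and o:"obj x" "obj y" "obj c" "obj w"
  and P:"arr P" "Dom A P = c$y$w" and Q:"arr Q" "Cod A Q = c$x$w"
 shows "P o c|>(hsum x y K f<|w) o Q = hsum (Dom A Q) (Cod A P) K (%i. P o c|>f i<|w o Q)"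
proof (rule additive_hsum[OF o(1,2) _ _ K(1)])
 show "Dom A Q : Obj A" "Cod A P : Obj A" using P Q by simp_all
 show "f i : Hom x y" if "i : K" for i using K(2)[OF that] .
 show "P o c|>g<|w o Q : Hom (Dom A Q) (Cod A P)" if "g : Hom x y" for g using that o P Q by (simp add: hom_iff)
 show "P o c|>(g +. h)<|w o Q=P o c|>g<|w o Q +. P o c|>h<|w o Q"
  if "g : Hom x y" "h : Hom x y" for g h using that o P Q by (simp add: hom_iff tensor_add add_comp comp_add)
qed

text \<open>Inserting the completeness relation for \<open>b \<otimes> i\<close> on the left, naturality of
  \<open>\<theta>\<close> moves the arrows to \<open>j\<close> past it, where they are absorbed into mates;
  their sum over \<open>i\<close> is the completeness relation of the mates.\<close>
lemma handle_slide:
 assumes R:"simple_representatives A R" and o:"obj b" "obj c" "obj w"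
  and ty:"!!x v. x : Obj A ==> obj v ==> \<theta> x v : Hom (c$x$v) (c$x$v)"
  and nat1:"!!x y f v. f : Hom x y ==> obj v ==> \<theta> y v o c|>f<|v = c|>f<|v o \<theta> x v"
  and nat2:"!!x v u g. g : Hom v u ==> obj x ==> \<theta> x u o c|>x|>g = c|>x|>g o \<theta> x v"
 defines "Y \<equiv> c$b$w"
 shows "hsum Y Y R (%i. dimn i*.(c|>b|>cap i w o c|>\<a> b i (i^*$w)
   o \<theta> (b$i) (i^*$w) o c|>\<b> b i (i^*$w) o c|>b|>cup' i w))
  = hsum Y Y R (%j. dimn j*.(c|>cap j (b$w) o \<theta> j (j^*$b$w) o c|>cup' j (b$w)))"
proof -
 let ?d = "dual_obj A"
 note fR = representatives_finite[OF R]
 have Rs:"i : R ==> simple i" for i using representatives(1)[OF R] .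
 have Ro:"i : R ==> obj i" for i using Rs by simp
 have Y:"obj Y" using o by (simp add: Y_def)
 define B where "B i j = (SOME B. hom_basis A (b$i) j B)" for i j
 have B:"hom_basis A (b$i) j (B i j)" if "i : R" "j : R" for i j
  unfolding B_def by (rule someI_ex, rule hom_finite_dim) (use o Ro that in simp_all)
 have th:"\<theta> x v ::: c$x$v ~> c$x$v" if "obj x" "obj v" for x v
  using ty[OF that] by (simp_all add: hom_iff)
 define t where "t i j \<f> = dual_vector A (b$i) j (B i j) \<f>" for i j \<f>
 have tin:"t i j \<f> : Hom j (b$i)" if "i : R" "j : R" "\<f> : B i j" for i j \<f>
  unfolding t_def using dual_vector(1)[OF Rs[OF that(2)] _ B[OF that(1,2)] that(3)] o Ro that by simp
 have \<f>in:"\<f> : Hom (b$i) j" if "i : R" "j : R" "\<f> : B i j" for i j \<f>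
  using basis_in[OF B[OF that(1,2)] that(3)] .
 define m where "m i j \<f> = mate_a b i j (t i j \<f>) o mate_b b i j \<f>" for i j \<f>
 have min:"m i j \<f> : Hom (?d j$b) (?d j$b)" if "i : R" "j : R" "\<f> : B i j" for i j \<f>
  unfolding m_def using comp_in[OF mate_b_hat(1)[OF _ _ _ _ \<f>in[OF that]] mate_a_hat(1)[OF _ _ _ _ tin[OF that]]] o Ro that by simp
 define P where "P j = c|>cap j (b$w) o \<theta> j (?d j$b$w)" for j
 define G where "G j f = P j o c|>j|>(\<a> (?d j) b w o f<|w o \<b> (?d j) b w) o c|>cup' j (b$w)" for j f
 have P:"P j ::: c$j$?d j$b$w ~> Y" if "j : R" for j
  using th[of j "?d j$b$w"] o Ro that by (simp_all add: P_def Y_def)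
 have Gin:"G j f : Hom Y Y" if "j : R" "f : Hom (?d j$b) (?d j$b)" for j f
  using P[OF that(1)] o Ro that by (simp add: G_def hom_iff Y_def)
 have Gadd:"G j (f +. g)=G j f +. G j g" if "j : R" "f : Hom (?d j$b) (?d j$b)" "g : Hom (?d j$b) (?d j$b)" for j f g
  using P[OF that(1)] o Ro that by (simp add: G_def hom_iff tensor_add add_comp comp_add)
 have Gsc:"G j (r*.f)=r*.G j f" if "j : R" "f : Hom (?d j$b) (?d j$b)" for j f r
  using P[OF that(1)] o Ro that by (simp add: G_def hom_iff)
 have G1:"G j (\<i> (?d j$b))=c|>cap j (b$w) o \<theta> j (?d j$b$w) o c|>cup' j (b$w)" if "j : R" for j
  using th[of j "?d j$b$w"] o Ro that by (simp add: G_def P_def)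
 define L where "L i = c|>b|>cap i w o c|>\<a> b i (?d i$w) o \<theta> (b$i) (?d i$w)" for i
 define Q where "Q i = c|>\<b> b i (?d i$w) o c|>b|>cup' i w" for i
 have L:"L i : Arr A" "Dom A (L i)=c$(b$i)$?d i$w" "Cod A (L i)=Y" if "i : R" for i
  using th[of "b$i" "?d i$w"] o Ro that by (simp_all add: L_def Y_def)
 have Q:"Q i : Arr A" "Cod A (Q i)=c$(b$i)$?d i$w" "Dom A (Q i)=Y" if "i : R" for i
  using o Ro that by (simp_all add: Q_def Y_def)
 have LQ:"L i o c|>(t i j \<f> o \<f>)<|(?d i$w) o Q i=G j (m i j \<f>)" if i:"i : R" and j:"j : R" and \<f>:"\<f> : B i j" for i j \<f>
 proof -
  let ?v = "?d i$w" and ?a = "mate_a b i j (t i j \<f>)" and ?b = "mate_b b i j \<f>"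
  note io = Ro[OF i] and jo = Ro[OF j] and tt = tin[OF i j \<f>] and pp = \<f>in[OF i j \<f>]
  have v:"obj ?v" using io o by simp
  have t':"t i j \<f> ::: j ~> b$i" using tt by (simp_all add: hom_iff)
  have p':"\<f> ::: b$i ~> j" using pp by (simp_all add: hom_iff)
  have a':"?a ::: ?d i ~> ?d j$b" using mate_a_hat(1)[OF o(1) io jo unit_typ tt] by (simp_all add: hom_iff)
  have b':"?b ::: ?d j$b ~> ?d i" using mate_b_hat(1)[OF o(1) io jo unit_typ pp] by (simp_all add: hom_iff)
  note thb = th[OF tensor_obj_typ[OF o(1) io] v] and thj = th[OF jo v]
  have "L i o c|>(t i j \<f> o \<f>)<|?v o Q i
   = c|>b|>cap i w o c|>\<a> b i ?v o (\<theta> (b$i) ?v o c|>t i j \<f><|?v) o c|>\<f><|?v o Q i"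
   using t' p' thb o io jo v Q[OF i] by (simp add: L_def)
  also have "...=c|>rot_a b i (t i j \<f>) w o \<theta> j ?v o c|>rot_b b i \<f> w"
   unfolding nat1[OF tt v] using t' p' thj o io jo v by (simp add: rot_a_def rot_b_def Q_def)
  also have "...=c|>cap j (b$w) o (c|>j|>(\<a> (?d j) b w o ?a<|w) o \<theta> j ?v)
   o c|>j|>(?b<|w o \<b> (?d j) b w) o c|>cup' j (b$w)"
   unfolding mate_absorb(1)[OF o(1) io jo o(3) tt, symmetric] mate_absorb(2)[OF o(1) io jo o(3) pp, symmetric]
   using a' b' thj o io jo by simp
  also have "c|>j|>(\<a> (?d j) b w o ?a<|w) o \<theta> j ?v
   = \<theta> j (?d j$b$w) o c|>j|>(\<a> (?d j) b w o ?a<|w)"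
   by (rule nat2[symmetric]) (use a' o io jo in \<open>simp_all add: hom_iff\<close>)
  finally show ?thesis using a' b' th[OF jo, of "?d j$b$w"] o jo by (simp add: G_def P_def m_def)
 qed
 have LQin:"L i o c|>f<|(?d i$w) o Q i : Hom Y Y" if "i : R" "f : Hom (b$i) (b$i)" for i f
  using L[OF that(1)] Q[OF that(1)] that Ro o by (simp add: hom_iff)
 have one:"L i o Q i=hsum Y Y R (%j. hsum Y Y (B i j) (%\<f>. G j (m i j \<f>)))" if i:"i : R" for i
 proof -
  have bi:"b$i : Obj A" and v:"?d i$w : Obj A" using o Ro i by simp_all
  have fin:"t i j \<f> o \<f> : Hom (b$i) (b$i)" if "j : R" "\<f> : B i j" for j \<f>
   using comp_in[OF \<f>in[OF i that] tin[OF i that]] .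
  let ?S = "%j. hsum (b$i) (b$i) (B i j) (%\<f>. t i j \<f> o \<f>)"
  have Sin:"?S j : Hom (b$i) (b$i)" if "j : R" for j by (rule hsum_in[OF bi bi fin[OF that]])
  have "L i o Q i=L i o c|>(b$i)|>\<i> (?d i$w) o Q i" using L[OF i] Q[OF i] o bi v by simp
  also have "\<i> (b$i)=hsum (b$i) (b$i) R ?S" unfolding t_def by (rule completeness[OF R fR bi B[OF i], symmetric])
  also have "L i o c|>(hsum (b$i) (b$i) R ?S<|(?d i$w)) o Q i
   = hsum Y Y R (%j. L i o c|>?S j<|(?d i$w) o Q i)"
   using sandwich_hsum[OF fR Sin bi bi o(2) v L(1,2)[OF i] Q(1,2)[OF i]] L(3)[OF i] Q(3)[OF i] by simp
  also have "...=hsum Y Y R (%j. hsum Y Y (B i j) (%\<f>. G j (m i j \<f>)))"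
  proof (rule hsum_cong[OF Y Y])
   fix j assume j:"j : R"
   show "hsum Y Y (B i j) (%\<f>. G j (m i j \<f>)) : Hom Y Y" by (rule hsum_in[OF Y Y Gin[OF j min[OF i j]]])
   have "L i o c|>?S j<|(?d i$w) o Q i
   = hsum Y Y (B i j) (%\<f>. L i o c|>(t i j \<f> o \<f>)<|(?d i$w) o Q i)"
   using sandwich_hsum[OF basis_finite[OF B[OF i j]] fin[OF j] bi bi o(2) v L(1,2)[OF i] Q(1,2)[OF i]] L(3)[OF i] Q(3)[OF i] by simp
   also have "...=hsum Y Y (B i j) (%\<f>. G j (m i j \<f>))" by (rule hsum_cong[OF Y Y LQ[OF i j] Gin[OF j min[OF i j]]])
   finally show "L i o c|>?S j<|(?d i$w) o Q i=hsum Y Y (B i j) (%\<f>. G j (m i j \<f>))" .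
  qed
  finally show ?thesis .
 qed
 have sG:"dimn i*.hsum Y Y (B i j) (%\<f>. G j (m i j \<f>))=G j (hsum (?d j$b) (?d j$b) (B i j) (%\<f>. dimn i*.m i j \<f>))"
  and sm:"hsum (?d j$b) (?d j$b) (B i j) (%\<f>. dimn i*.m i j \<f>) : Hom (?d j$b) (?d j$b)"
  if i:"i : R" and j:"j : R" for i j
 proof -
  have jb:"?d j$b : Obj A" using o Ro j by simp
  have smi:"dimn i*.m i j \<f> : Hom (?d j$b) (?d j$b)" if "\<f> : B i j" for \<f> using min[OF i j that] by (simp add: hom_iff)
  show "hsum (?d j$b) (?d j$b) (B i j) (%\<f>. dimn i*.m i j \<f>) : Hom (?d j$b) (?d j$b)" by (rule hsum_in[OF jb jb smi])
  have "dimn i*.hsum Y Y (B i j) (%\<f>. G j (m i j \<f>))=hsum Y Y (B i j) (%\<f>. dimn i*.G j (m i j \<f>))"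
   by (rule scale_hsum[OF basis_finite[OF B[OF i j]] Gin[OF j min[OF i j]] Y Y])
  also have "...=hsum Y Y (B i j) (%\<f>. G j (dimn i*.m i j \<f>))"
   by (rule hsum_cong[OF Y Y Gsc[OF j min[OF i j], symmetric] Gin[OF j smi]])
  also have "...=G j (hsum (?d j$b) (?d j$b) (B i j) (%\<f>. dimn i*.m i j \<f>))"
   by (rule additive_hsum[OF jb jb Y Y basis_finite[OF B[OF i j]] smi Gin[OF j] Gadd[OF j], symmetric])
  finally show "dimn i*.hsum Y Y (B i j) (%\<f>. G j (m i j \<f>))=G j (hsum (?d j$b) (?d j$b) (B i j) (%\<f>. dimn i*.m i j \<f>))" .
 qed
 let ?M = "%i j. hsum (?d j$b) (?d j$b) (B i j) (%\<f>. dimn i*.m i j \<f>)"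
 have col:"hsum Y Y R (%i. G j (?M i j))=dimn j*.G j (\<i> (?d j$b))" if j:"j : R" for j
 proof -
  have jb:"?d j$b : Obj A" using o Ro j by simp
  have "hsum Y Y R (%i. G j (?M i j))=G j (hsum (?d j$b) (?d j$b) R (%i. ?M i j))"
   by (rule additive_hsum[OF jb jb Y Y fR sm[OF _ j] Gin[OF j] Gadd[OF j], symmetric])
  also have "hsum (?d j$b) (?d j$b) R (%i. ?M i j)=dimn j*.\<i> (?d j$b)"
   unfolding m_def t_def by (rule mate_completeness[OF R o(1) Rs[OF j] B[OF _ j]])
  also have "G j (dimn j*.\<i> (?d j$b))=dimn j*.G j (\<i> (?d j$b))"
   by (rule Gsc[OF j]) (use jb in \<open>simp add: hom_iff\<close>)
  finally show ?thesis .
 qed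
 have row:"dimn i*.(L i o Q i)=hsum Y Y R (%j. G j (?M i j))" if i:"i : R" for i
 proof -
  have hin:"hsum Y Y (B i j) (%\<f>. G j (m i j \<f>)) : Hom Y Y" if j:"j : R" for j by (rule hsum_in[OF Y Y Gin[OF j min[OF i j]]])
  have "dimn i*.(L i o Q i)=hsum Y Y R (%j. dimn i*.hsum Y Y (B i j) (%\<f>. G j (m i j \<f>)))"
   unfolding one[OF i] by (rule scale_hsum[OF fR hin Y Y])
  also have "...=hsum Y Y R (%j. G j (?M i j))" by (rule hsum_cong[OF Y Y sG[OF i] Gin[OF _ sm[OF i]]])
  finally show ?thesis .
 qed
 have rin:"hsum Y Y R (%j. G j (?M i j)) : Hom Y Y" if "i : R" for i by (rule hsum_in[OF Y Y Gin[OF _ sm[OF that]]])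
 have "hsum Y Y R (%i. dimn i*.(L i o Q i))=hsum Y Y R (%i. hsum Y Y R (%j. G j (?M i j)))" by (rule hsum_cong[OF Y Y row rin])
 also have "...=hsum Y Y R (%j. hsum Y Y R (%i. G j (?M i j)))" by (rule hsum_swap[OF Y Y fR fR Gin[OF _ sm]])
 also have "...=hsum Y Y R (%j. dimn j*.G j (\<i> (?d j$b)))"
 proof (rule hsum_cong[OF Y Y col])
  fix j assume j:"j : R"
  show "dimn j*.G j (\<i> (?d j$b)) : Hom Y Y" using Gin[OF j, of "\<i> (?d j$b)"] o Ro[OF j] by (simp add: hom_iff)
 qed
 also have "...=hsum Y Y R (%j. dimn j*.(c|>cap j (b$w) o \<theta> j (?d j$b$w) o c|>cup' j (b$w)))"
 proof (rule hsum_cong[OF Y Y])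
  fix j assume j:"j : R"
  show "dimn j*.G j (\<i> (?d j$b))=dimn j*.(c|>cap j (b$w) o \<theta> j (?d j$b$w) o c|>cup' j (b$w))" unfolding G1[OF j] ..
  show "dimn j*.(c|>cap j (b$w) o \<theta> j (?d j$b$w) o c|>cup' j (b$w)) : Hom Y Y"
   unfolding G1[OF j, symmetric] using Gin[OF j, of "\<i> (?d j$b)"] o Ro[OF j] by (simp add: hom_iff)
 qed
 also have "hsum Y Y R (%i. dimn i*.(L i o Q i))
  = hsum Y Y R (%i. dimn i*.(c|>b|>cap i w o c|>\<a> b i (?d i$w)
   o \<theta> (b$i) (?d i$w) o c|>\<b> b i (?d i$w) o c|>b|>cup' i w))"
 proof (rule hsum_cong[OF Y Y])
  fix i assume i:"i : R"
  have e:"c|>b|>cap i w o c|>\<a> b i (?d i$w)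
   o \<theta> (b$i) (?d i$w) o c|>\<b> b i (?d i$w) o c|>b|>cup' i w = L i o Q i"
   using th[of "b$i" "?d i$w"] o Ro[OF i] by (simp add: L_def Q_def)
  show "dimn i*.(L i o Q i)=dimn i*.(c|>b|>cap i w o c|>\<a> b i (?d i$w)
   o \<theta> (b$i) (?d i$w) o c|>\<b> b i (?d i$w) o c|>b|>cup' i w)" unfolding e ..
  show "dimn i*.(c|>b|>cap i w o c|>\<a> b i (?d i$w)
   o \<theta> (b$i) (?d i$w) o c|>\<b> b i (?d i$w) o c|>b|>cup' i w) : Hom Y Y"
   unfolding e using L[OF i] Q[OF i] by (simp add: hom_iff)
 qed
 finally show ?thesis .
qed

end

section \<open>Haar idempotents\<close>

context rigid_symmetric_category
begin

lemma rb_tensor: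
 assumes h:"hb a H" and o:"obj b" "obj b'" "obj w"
 shows "rb H a (b$b') w
  = \<b> b b' (a$w) o b|>rb H a b' w o rb H a b (b'$w) o a|>\<a> b b' w"
proof (rule iso_cancel_left[of "br H a (b$b') w"])
 note ao = hb_obj[OF h]
 have "br H a (b$b') w o
   (\<b> b b' (a$w) o b|>rb H a b' w o rb H a b (b'$w) o a|>\<a> b b' w) = \<i> (a$(b$b')$w)"
  unfolding br_tensor[OF h o] using o h ao by simp
 then show "br H a (b$b') w o rb H a (b$b') w=br H a (b$b') w o
   (\<b> b b' (a$w) o b|>rb H a b' w o rb H a b (b'$w) o a|>\<a> b b' w)" using o h by simp
qed (use o h hb_obj[OF h] in simp_all)

definition loop_open ::"'o => 'o => 'm" where
 "loop_open c i = \<b> c i i^* o c|>(\<s> i^* i o coev A i) o Inv (\<r> c)"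

definition loop_close ::"'o => 'o => 'm" where
 "loop_close c i = \<r> c o c|>ev A i o \<a> c i i^*"

definition loop_arr ::"'o => ('o => 'm) => ('o => 'm) => 'o => 'm" where
 "loop_arr c H H' i = loop_close c i o (H i o Inv (H' i))<|i^* o loop_open c i"

lemma loop_open_typ [simp]:
 assumes "obj c" "obj i"
 shows "loop_open c i ::: c ~> (c$i)$i^*"
  "loop_close c i ::: (c$i)$i^* ~> c"
 using assms by (simp_all add: loop_open_def loop_close_def)

lemma loop_open_hat:
 assumes o:"obj c" "obj i" "obj w"
 shows "loop_open c i<|w = \<b> (c$i) i^* w o \<b> c i (i^*$w) o c|>cup' i w"
  "loop_close c i<|w = c|>cap i w o \<a> c i (i^*$w) o \<a> (c$i) i^* w"
proof -
 let ?i = "i^*"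
 have q:"(\<s> ?i i o coev A i)<|w=\<b> i ?i w o cup' i w o \<l> w" using o by (simp add: cup'_def cup_def sw_def hat_def)
 have q2:"(c|>(\<s> ?i i o coev A i))<|w
   = \<b> c (i$?i) w o c|>(\<b> i ?i w o cup' i w o \<l> w) o \<a> c \<I> w"
  using assoc_conj[of "\<i> c" "\<s> ?i i o coev A i" "\<i> w"] o by (simp del: whisker_comp add: q)
 have "loop_open c i<|w=\<b> c i ?i<|w o (c|>(\<s> ?i i o coev A i))<|w o Inv (\<r> c)<|w" using o by (simp add: loop_open_def)
 then show "loop_open c i<|w=\<b> (c$i) ?i w o \<b> c i (?i$w) o c|>cup' i w"
  unfolding q2 using o by (simp add: inv_associator_whisker inv_whisker)
 show "loop_close c i<|w=c|>cap i w o \<a> c i (?i$w) o \<a> (c$i) ?i w" using o by (simp add: loop_close_def cap_def spread)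
qed

text \<open>The object \<open>i\<close> is created, crosses \<open>c\<close> by the inverse of
  \<open>H'\<close>, crosses back by \<open>H\<close>, and is annihilated.\<close>
definition loop ::"'o => ('o => 'm) => ('o => 'm) => 'o => 'o => 'm" where
 "loop c H H' i w = c|>cap i w o br H c i (i^*$w) o rb H' c i (i^*$w) o c|>cup' i w"

lemma loop_typ [simp]:
 assumes "hb c H" "hb c H'" "obj i" "obj w"
 shows "loop c H H' i w ::: c$w ~> c$w"
 using assms hb_obj[OF assms(1)] by (simp_all add: loop_def)

lemma loop_arr_hat:
 assumes h:"hb c H" "hb c H'" and o:"obj i" "obj w"
 shows "loop_arr c H H' i<|w = loop c H H' i w"
proof -
 let ?i = "i^*"
 note c = hb_obj[OF h(1)]
 let ?m = "H i o Inv (H' i)"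
 have m:"?m : Hom (c$i) (c$i)" using h o by (simp add: hom_iff)
 then have m':"arr ?m" "Dom A ?m=c$i" "Cod A ?m=c$i" by (simp_all only: hom_iff)
 have 1:"br H c i (?i$w) o rb H' c i (?i$w)=hat c i c i ?m (?i$w)"
  unfolding br_def rb_def using h o c by (intro hat_comp) (simp_all add: hom_iff)
 have "loop_arr c H H' i<|w=loop_close c i<|w o (?m<|?i)<|w o loop_open c i<|w"
  unfolding loop_arr_def using m' o c by (simp del: comp_assoc_right)
 also have "(?m<|?i)<|w=\<b> (c$i) ?i w o (\<b> c i (?i$w) o hat c i c i ?m (?i$w) o \<a> c i (?i$w)) o \<a> (c$i) ?i w"
  using assoc_conj[OF m'(1), of "\<i> ?i" "\<i> w"] hat_unfold[OF m c o(1) c o(1), of "?i$w"] m'(2,3) c o by (simp del: whisker_comp)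
 also have "loop_close c i<|w o ... o loop_open c i<|w=c|>cap i w o hat c i c i ?m (?i$w) o c|>cup' i w"
  unfolding loop_open_hat[OF c o] using hat_typ[OF m c o(1) c o(1), of "?i$w"] c o by simp
 finally show ?thesis using 1 h o c by (simp add: loop_def tail[OF 1])
qed

lemma loop_arr_typ [simp]:
 assumes "hb c H" "hb c H'" "obj i"
 shows "loop_arr c H H' i ::: c ~> c"
 using assms hb_obj[OF assms(1)] by (simp_all add: loop_arr_def)

text \<open>Sliding the cup across \<open>c\<close> replaces the inverse crossing of \<open>i\<close> by a
  crossing of its dual. This is the form in which the loop occurs in \<open>\<Pi>\<close>.\<close>
lemma loop_rotate:
 assumes h:"hb c H" "hb c H'" and o:"obj i" "obj w"
 shows "loop c H H' i w = c|>cap i w o br H c i (i^*$w) o i|>br H' c i^* w o cup' i (c$w)"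
proof -
 note c = hb_obj[OF h(1)]
 let ?v = "i^*$w"
 have "rb H' c i ?v o c|>cup' i w=i|>br H' c i^* w o cup' i (c$w)" unfolding br_cup'[OF hb_lax[OF h(2)] o, symmetric] using h o c by simp
 then show ?thesis by (simp add: loop_def)
qed

lemma loop_natural:
 assumes m:"hbm c H e \<epsilon> f" "hbm c H' e \<epsilon>' f" and h:"hb c H" "hb c H'" "hb e \<epsilon>" "hb e \<epsilon>'" and o:"obj i" "obj w"
 shows "loop e \<epsilon> \<epsilon>' i w o f<|w = f<|w o loop c H H' i w"
proof -
 note c = hb_obj[OF h(1)] and e = hb_obj[OF h(3)] and f = hbm_typ[OF m(1)]
 let ?v = "i^*$w"
 have v:"obj ?v" using o by simp
 have 1:"e|>cup' i w o f<|w=f<|(i$?v) o c|>cup' i w" using interchange[of f "cup' i w"] f o by simp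
 have 2:"e|>cap i w o f<|(i$?v)=f<|w o c|>cap i w" using interchange[of f "cap i w"] f o by simp
 show ?thesis using f h o c e v
  by (simp add: loop_def 1 2[THEN tail] hbm_br(2)[OF m(2) h(2,4) o(1) v, THEN tail] hbm_br(1)[OF m(1) h(1,3) o(1) v, THEN tail])
qed

text \<open>A third half-braiding passes through the loop: over cup and cap by naturality, through the crossings
  by commutation.\<close>
lemma loop_commuting:
 assumes h:"hb c H" "hb c H'" "hb c \<g>" and cm:"commuting c \<g> H" "commuting c \<g> H'"
  and o:"obj i" "obj b" "obj w"
 shows "loop c H H' i (b$w) o br \<g> c b w = br \<g> c b w o b|>loop c H H' i w"
proof -
 note c = hb_obj[OF h(1)]
 let ?i = "i^*" let ?v = "i^*$w"
 have od:"obj ?i" "obj ?v" using o by simp_all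
 have 1:"cup' i (b$w)=i|>sw b ?i w o sw b i ?v o b|>cup' i w"
  using arg_cong[OF br_cup'[OF hb_lax[OF hb_trs[OF o(2)]] o(1,3)], of "%f. (i|>sw b ?i w) o sw b i ?v o f"] o od by simp
 have 2:"cap i (b$w) o i|>sw b ?i w o sw b i ?v=b|>cap i w"
  unfolding br_cap[OF hb_lax[OF hb_trs[OF o(2)]] o(1,3), symmetric] using o od by simp
 have C:"c|>sw b i ?v o br \<g> c b (i$?v) o b|>br H c i ?v=br H c i (b$?v) o i|>br \<g> c b ?v o sw b i (c$?v)"
  and C':"c|>sw b i ?v o br \<g> c b (i$?v) o b|>br H' c i ?v = br H' c i (b$?v) o i|>br \<g> c b ?v o sw b i (c$?v)"
  using cm o od unfolding commuting_def by blast+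
 define K where "K = c|>sw b i ?v o br \<g> c b (i$?v)"
 define J where "J = i|>br \<g> c b ?v o sw b i (c$?v)"
 have K:"K ::: b$c$i$?v ~> c$i$b$?v" using h c o od by (simp_all add: K_def)
 have J:"J ::: b$i$c$?v ~> i$c$b$?v" using h c o od by (simp_all add: J_def)
 have C1:"br H c i (b$?v) o J=K o b|>br H c i ?v" using C h c o od by (simp add: K_def J_def)
 have C2:"K o b|>br H' c i ?v=br H' c i (b$?v) o J" using C' h c o od by (simp add: K_def J_def)
 have "rb H' c i (b$?v) o K=rb H' c i (b$?v) o (K o b|>br H' c i ?v) o b|>rb H' c i ?v" using K h c o od by simp
 also have "...=J o b|>rb H' c i ?v" unfolding C2 using J h c o od by simp
 finally have C3:"rb H' c i (b$?v) o K=J o b|>rb H' c i ?v" .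
 have n1:"c|>b|>cup' i w o br \<g> c b w=br \<g> c b (i$?v) o b|>c|>cup' i w"
  using br_natural(1)[OF h(3) o(2), of "cup' i w"] o by simp
 have e1:"c|>cup' i (b$w) o br \<g> c b w=c|>i|>sw b ?i w o K o b|>c|>cup' i w" unfolding 1 K_def using n1 h c o od by simp
 have n2:"rb H' c i (?i$b$w) o c|>i|>sw b ?i w=i|>c|>sw b ?i w o rb H' c i (b$?v)"
  using br_natural(2)[OF h(2) o(1), of "sw b ?i w"] o od by simp
 have n3:"br H c i (?i$b$w) o i|>c|>sw b ?i w=c|>i|>sw b ?i w o br H c i (b$?v)"
  using br_natural(1)[OF h(1) o(1), of "sw b ?i w"] o od by simp
 have n4:"c|>b|>cap i w o br \<g> c b (i$?v)=br \<g> c b w o b|>c|>cap i w"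
  using br_natural(1)[OF h(3) o(2), of "cap i w"] o by simp
 have n5:"c|>cap i (b$w) o c|>i|>sw b ?i w o K=br \<g> c b w o b|>c|>cap i w"
 proof -
  have "c|>cap i (b$w) o c|>i|>sw b ?i w o K
   = c|>(cap i (b$w) o i|>sw b ?i w o sw b i ?v) o br \<g> c b (i$?v)" unfolding K_def using h c o od by simp
  then show ?thesis unfolding 2 n4 .
 qed
 have "loop c H H' i (b$w) o br \<g> c b w=c|>cap i (b$w) o br H c i (?i$b$w) o rb H' c i (?i$b$w)
  o c|>cup' i (b$w) o br \<g> c b w" unfolding loop_def using h c o od by simp
 also have "...=c|>cap i (b$w) o c|>i|>sw b ?i w o (br H c i (b$?v) o (rb H' c i (b$?v) o K)) o b|>c|>cup' i w"
  unfolding e1 using K h c o od by (simp add: n2[THEN tail] n3[THEN tail])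
 also have "br H c i (b$?v) o (rb H' c i (b$?v) o K)=K o b|>br H c i ?v o b|>rb H' c i ?v"
  unfolding C3 using J K h c o od by (simp add: C1[THEN tail])
 also have "c|>cap i (b$w) o c|>i|>sw b ?i w o (K o b|>br H c i ?v o b|>rb H' c i ?v) o b|>c|>cup' i w
  = (c|>cap i (b$w) o c|>i|>sw b ?i w o K) o b|>br H c i ?v o b|>rb H' c i ?v o b|>c|>cup' i w" using K h c o od by simp
 also have "...=br \<g> c b w o b|>loop c H H' i w" unfolding n5 loop_def using h c o od by simp
 finally show ?thesis .
qed

end

locale fusion_representatives = symmetric_ribbon_fusion_category A
 for A ::"('o, 'm, 'x) ribbon_fusion_data_scheme" (structure) +
 fixes R ::"'o set"
 assumes R:"simple_representatives A R"
begin

lemma R_finite [simp]:"finite R" using representatives_finite[OF R] .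
lemma R_simple:"i : R ==> simple i" using representatives(1)[OF R] .
lemma R_obj [simp]:"i : R ==> obj i" using R_simple by simp

definition global_dim :: complex where
 "global_dim = (\<Sum>i\<in>R. (dimn i)\<^sup>2)"

lemma global_dim_nonzero:"global_dim \<noteq> 0" using global_dimension_nonzero[OF R] by (simp add: global_dim_def)

definition haar ::"'o => ('o => 'm) => ('o => 'm) => 'm" where
 "haar c H H' = hsum c c R (%i. (dimn i / global_dim)*.loop_arr c H H' i)"

lemma haar_typ:
 assumes h:"hb c H" "hb c H'"
 shows "haar c H H' : Hom c c" unfolding haar_def using h hb_obj[OF h(1)] by (intro hsum_in) (simp_all add: hom_iff)

lemma haar_typ' [simp]:
 assumes h:"hb c H" "hb c H'"
 shows "haar c H H' : Arr A" "Dom A (haar c H H') = c" "Cod A (haar c H H') = c" using haar_typ[OF h] by (simp_all add: hom_iff)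

lemma haar_hat:
 assumes h:"hb c H" "hb c H'" and w:"obj w"
 shows "haar c H H'<|w = hsum (c$w) (c$w) R (%i. (dimn i / global_dim)*.loop c H H' i w)"
proof -
 note c = hb_obj[OF h(1)]
 have "haar c H H'<|w=hsum (c$w) (c$w) R (%i. ((dimn i / global_dim)*.loop_arr c H H' i)<|w)"
  unfolding haar_def by (rule tensor_hsum(2)) (use c w h in \<open>simp_all add: hom_iff\<close>)
 also have "...=hsum (c$w) (c$w) R (%i. (dimn i / global_dim)*.loop c H H' i w)"
  using c w h by (intro hsum_cong) (simp_all add: loop_arr_hat hom_iff)
 finally show ?thesis .
qed

lemma haar_scaled:
 assumes h:"hb c H" "hb c H'" and w:"obj w"
 shows "global_dim*.(haar c H H'<|w) = hsum (c$w) (c$w) R (%i. dimn i*.loop c H H' i w)"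
proof -
 note c = hb_obj[OF h(1)]
 have "global_dim*.(haar c H H'<|w)=hsum (c$w) (c$w) R (%i. global_dim*.(dimn i / global_dim)*.loop c H H' i w)"
  unfolding haar_hat[OF h w] by (rule scale_hsum) (use c w h in \<open>simp_all add: hom_iff\<close>)
 also have "...=hsum (c$w) (c$w) R (%i. dimn i*.loop c H H' i w)"
  using c w h global_dim_nonzero by (intro hsum_cong) (simp_all add: hom_iff)
 finally show ?thesis .
qed

lemma scale_global_dim_cancel:
 assumes "global_dim*.f = global_dim*.g" "arr f" "arr g"
 shows "f = g"
proof -
 have "(1 / global_dim)*.(global_dim*.f)=(1 / global_dim)*.(global_dim*.g)" using assms(1) by simp
 then show ?thesis using assms(2,3) global_dim_nonzero by simp
qed

text \<open>The handle slide, applied to the double crossing \<open>\<theta>\<close>: the crossing of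
  \<open>b\<close> by \<open>H'\<close> merges with the loop of \<open>i\<close> to the loop of \<open>b
  \<otimes> i\<close>, and the loop of \<open>j\<close> then leaves \<open>H\<close> behind.\<close>
lemma haar_conj:
 assumes h:"hb c H" "hb c H'" and o:"obj b" "obj w"
 shows "haar c H H'<|(b$w) o br H' c b w = br H c b w o b|>haar c H H'<|w"
proof -
 note c = hb_obj[OF h(1)]
 define \<theta> where "\<theta> x v = br H c x v o rb H' c x v" for x v
 have th:"\<theta> x v ::: c$x$v ~> c$x$v" if "obj x" "obj v" for x v
  using that h c by (simp_all add: \<theta>_def)
 let ?Y = "c$b$w"
 let ?P = "%i. (c|>b|>cap i w) o c|>\<a> b i (i^*$w)
   o \<theta> (b$i) (i^*$w) o c|>\<b> b i (i^*$w) o c|>b|>cup' i w"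
 let ?Q = "%j. (c|>cap j (b$w)) o \<theta> j (j^*$b$w) o c|>cup' j (b$w)"
 have Y:"obj ?Y" using c o by simp
 have slide:"hsum ?Y ?Y R (%i. dimn i*.?P i)=hsum ?Y ?Y R (%j. dimn j*.?Q j)"
 proof (rule handle_slide[OF R o(1) c o(2)])
  show "\<theta> x v : Hom (c$x$v) (c$x$v)" if "obj x" "obj v" for x v using th[OF that] by (simp add: hom_iff)
  show "\<theta> y v o c|>f<|v=c|>f<|v o \<theta> x v" if f:"f : Hom x y" and v:"obj v" for x y f v
  proof -
   note xy = hom_obj[OF f]
   note f' = homD[OF f(1)]
   have 1:"rb H' c y v o c|>f<|v=f<|(c$v) o rb H' c x v"
   proof -
   have "rb H' c y v o c|>f<|v=rb H' c y v o (c|>f<|v o br H' c x v) o rb H' c x v" using f' v xy h c by simp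
   then show ?thesis unfolding br_natural_left[OF h(2) v f', symmetric] using f' v xy h c by simp
   qed
   show ?thesis using f' v xy h c by (simp add: \<theta>_def 1 br_natural_left[OF h(1) v f', THEN tail])
  qed
  show "\<theta> x u o c|>x|>g=c|>x|>g o \<theta> x v" if g:"g : Hom v u" and x:"obj x" for x v u g
  proof -
   note g' = homD[OF g(1)]
   show ?thesis using g' x h c hom_obj[OF g] by (simp add: \<theta>_def br_natural(2)[OF h(2) x g'] br_natural(1)[OF h(1) x g', THEN tail])
  qed
 qed
 have Qi:"?Q i=loop c H H' i (b$w)" if i:"i : R" for i using i h c o by (simp add: loop_def \<theta>_def)
 have Pi:"?P i=br H c b w o b|>loop c H H' i w o rb H' c b w" if i:"i : R" for i
 proof -
  let ?v = "i^*$w"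
  have io:"obj i" "obj ?v" using i o by simp_all
  have n1:"rb H' c b (i$?v) o c|>b|>cup' i w=b|>c|>cup' i w o rb H' c b w" using br_natural(2)[OF h(2) o(1), of "cup' i w"] o io by simp
  have n2:"c|>b|>cap i w o br H c b (i$?v)=br H c b w o b|>c|>cap i w" using br_natural(1)[OF h(1) o(1), of "cap i w"] o io by simp
  have "c|>\<a> b i ?v o \<theta> (b$i) ?v o c|>\<b> b i ?v
   = br H c b (i$?v) o b|>br H c i ?v o b|>rb H' c i ?v o rb H' c b (i$?v)"
   unfolding \<theta>_def br_tensor[OF h(1) o(1) io] rb_tensor[OF h(2) o(1) io] using io h c o by simp
  from tail3[OF this, of "c|>b|>cup' i w"]
  have "?P i=c|>b|>cap i w o (br H c b (i$?v) o b|>br H c i ?v o b|>rb H' c i ?v o rb H' c b (i$?v)) o c|>b|>cup' i w"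
   using th[of "b$i" ?v] io h c o by simp
  also have "...=br H c b w o b|>loop c H H' i w o rb H' c b w" unfolding loop_def using io h c o by (simp add: n1 n2[THEN tail])
  finally show ?thesis .
 qed
 have lin:"loop c H H' i v : Hom (c$v) (c$v)" if "i : R" "obj v" for i v using that h by (simp add: hom_iff)
 have "global_dim*.(haar c H H'<|(b$w))=hsum ?Y ?Y R (%i. dimn i*.loop c H H' i (b$w))" using haar_scaled[OF h, of "b$w"] o by simp
 also have "...=hsum ?Y ?Y R (%j. dimn j*.?Q j)" by (rule hsum_cong[OF Y Y]) (use Qi lin o in \<open>simp_all add: hom_iff\<close>)
 also have "...=hsum ?Y ?Y R (%i. dimn i*.?P i)" by (rule slide[symmetric])
 also have "...=hsum ?Y ?Y R (%i. br H c b w o b|>(dimn i*.loop c H H' i w) o rb H' c b w)"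
 proof (rule hsum_cong[OF Y Y])
  fix i assume i:"i : R"
  show "br H c b w o b|>(dimn i*.loop c H H' i w) o rb H' c b w : Hom ?Y ?Y" using i o h c by (simp add: hom_iff)
  show "dimn i*.?P i=br H c b w o b|>(dimn i*.loop c H H' i w) o rb H' c b w" unfolding Pi[OF i] using i o h c by simp
 qed
 also have "...=br H c b w o (b|>hsum (c$w) (c$w) R (%i. dimn i*.loop c H H' i w)) o rb H' c b w"
 proof (rule additive_hsum[symmetric, where F = "%f. br H c b w o b|>f o rb H' c b w"])
  show "br H c b w o b|>f o rb H' c b w : Hom ?Y ?Y" if "f : Hom (c$w) (c$w)" for f using that o h c by (simp add: hom_iff)
  show "br H c b w o b|>(f +. g) o rb H' c b w=br H c b w o b|>f o rb H' c b w +. br H c b w o b|>g o rb H' c b w"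
   if "f : Hom (c$w) (c$w)" "g : Hom (c$w) (c$w)" for f g using that o h c by (simp add: hom_iff tensor_add add_comp comp_add)
 qed (use lin o c in \<open>simp_all add: hom_iff\<close>)
 also have "...=br H c b w o b|>(global_dim*.(haar c H H'<|w)) o rb H' c b w" unfolding haar_scaled[OF h o(2)] ..
 also have "...=global_dim*.(br H c b w o b|>haar c H H'<|w o rb H' c b w)" using o h c by simp
 finally have "haar c H H'<|(b$w)=br H c b w o b|>haar c H H'<|w o rb H' c b w" by (rule scale_global_dim_cancel) (use o h c in simp_all)
 then show ?thesis using o h c by simp
qed

lemma haar_sum_intro:
 assumes h:"hb c H" "hb c H'" "hb e \<epsilon>" "hb e \<epsilon>'" and w:"obj w" "obj v" and P:"arr P" "Dom A P = c$w" "Cod A P = e$v"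
  and eq:"!!i. i : R ==> P o loop c H H' i w = loop e \<epsilon> \<epsilon>' i v o P"
 shows "P o haar c H H'<|w = haar e \<epsilon> \<epsilon>'<|v o P"
proof -
 note c = hb_obj[OF h(1)] and e = hb_obj[OF h(3)]
 have "P o haar c H H'<|w=hsum (c$w) (e$v) R (%i. P o ((dimn i / global_dim)*.loop c H H' i w))"
  unfolding haar_hat[OF h(1,2) w(1)] using P by (subst comp_hsum) (use h c w in \<open>simp_all add: hom_iff\<close>)
 also have "...=hsum (c$w) (e$v) R (%i. ((dimn i / global_dim)*.loop e \<epsilon> \<epsilon>' i v) o P)"
  using P c e w h by (intro hsum_cong) (simp_all add: hom_iff eq)
 also have "...=haar e \<epsilon> \<epsilon>'<|v o P"
  unfolding haar_hat[OF h(3,4) w(2)] using P by (subst hsum_comp) (use h e w in \<open>simp_all add: hom_iff\<close>)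
 finally show ?thesis .
qed

lemma haar_commuting:
 assumes h:"hb c H" "hb c H'" "hb c \<g>" and cm:"commuting c \<g> H" "commuting c \<g> H'"
 shows "hbm c \<g> c \<g> (haar c H H')"
proof (rule hbmI)
 note c = hb_obj[OF h(1)]
 show "haar c H H' : Arr A" "Dom A (haar c H H')=c" "Cod A (haar c H H')=c" "hb c \<g>" "hb c \<g>" using h by simp_all
 fix b w assume o:"obj b" "obj w"
 have lin:"loop c H H' i v : Hom (c$v) (c$v)" if "i : R" "obj v" for i v using that h by (simp add: hom_iff)
 have sin:"(dimn i / global_dim)*.loop c H H' i v : Hom (c$v) (c$v)" if "i : R" "obj v" for i v using that h by (simp add: hom_iff)
 let ?D = "b$c$w" and ?E = "c$b$w"
 have DE:"obj ?D" "obj ?E" "c$w : Obj A" "b$w : Obj A" using o c by simp_all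
 have "br \<g> c b w o b|>haar c H H'<|w
  = br \<g> c b w o hsum ?D ?D R (%i. b|>((dimn i / global_dim)*.loop c H H' i w))"
  unfolding haar_hat[OF h(1,2) o(2)] using tensor_hsum(1)[OF R_finite sin DE(3,3) o(1)] o by simp
 also have "...=hsum ?D ?E R (%i. br \<g> c b w o b|>((dimn i / global_dim)*.loop c H H' i w))"
  using comp_hsum[of R "%i. b|>((dimn i / global_dim)*.loop c H H' i w)" ?D ?D "br \<g> c b w"] o h c by (simp add: hom_iff)
 also have "...=hsum ?D ?E R (%i. ((dimn i / global_dim)*.loop c H H' i (b$w)) o br \<g> c b w)"
  using loop_commuting[OF h cm _ o] o h c by (intro hsum_cong[OF DE(1,2)]) (simp_all add: hom_iff)
 also have "...=haar c H H'<|(b$w) o br \<g> c b w"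
  unfolding haar_hat[OF h(1,2) DE(4)] using hsum_comp[OF R_finite sin[OF _ DE(4)], where h = "br \<g> c b w"] o h c by simp
 finally show "br \<g> c b w o b|>haar c H H'<|w=haar c H H'<|(b$w) o br \<g> c b w" .
qed

text \<open>Where the two half-braidings agree each loop is a bare circle of value \<open>d_i\<close>, and the
  weights add up to one.\<close>
lemma haar_absorb:
 assumes h:"hb c H" "hb c H'"
 shows "[|arr f; Cod A f = c; !!b w. b : Obj A ==> obj w ==>
   br H c b w o b|>f<|w = br H' c b w o (b|>f<|w)|] ==> haar c H H' o f = f"
  "[|arr g; Dom A g = c; !!b w. b : Obj A ==> obj w ==>
   (g<|(b$w)) o br H c b w = g<|(b$w) o br H' c b w|] ==> g o haar c H H' = g"
proof -
 note c = hb_obj[OF h(1)]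
 have sum:"(\<Sum>i\<in>R. dimn i / global_dim * dimn i)=1"
  using global_dim_nonzero by (simp add: global_dim_def power2_eq_square flip: sum_divide_distrib)
 have lin:"(dimn i / global_dim)*.loop c H H' i v : Hom (c$v) (c$v)" if "i : R" "obj v" for i v using that h by (simp add: hom_iff)
 {
  assume f:"arr f" "Cod A f = c" and eq:"!!b w. b : Obj A ==> obj w ==>
   br H c b w o b|>f<|w = br H' c b w o b|>f<|w"
  define x where "x = Dom A f"
  have x:"Dom A f=x" "obj x" using f by (simp_all add: x_def)
  have step:"loop c H H' i w o f<|w=dimn i*.(f<|w)" if i:"i : R" and w:"obj w" for i w
  proof -
   let ?i = "i^*"
   have od:"obj i" "obj ?i" using i by simp_all
   have n:"cup' i (c$w) o f<|w=i|>?i|>f<|w o cup' i (x$w)" using cup'_natural[of i "f<|w"] od w f x by simp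
   have E:"i|>br H' c ?i w o i|>?i|>f<|w=i|>br H c ?i w o i|>?i|>f<|w"
   using arg_cong[OF eq[OF od(2) w], of "%q. i|>q"] od w f h c by simp
   have n2:"cap i (c$w) o i|>?i|>f<|w=f<|w o cap i (x$w)" using cap_natural[of i "f<|w"] od w f x by simp
   have "loop c H H' i w o f<|w=c|>cap i w o br H c i (?i$w) o i|>br H c ?i w o i|>?i|>f<|w o cup' i (x$w)"
   unfolding loop_rotate[OF h od(1) w] using od w f x h c by (simp add: n E[THEN tail])
   also have "...=(c|>cap i w o br H c i (?i$w) o i|>br H c ?i w) o i|>?i|>f<|w o cup' i (x$w)" using od w f x h c by simp
   also have "...=dimn i*.(f<|w)" unfolding br_cap[OF hb_lax[OF h(1)] od(1) w] using od w f x c by (simp add: n2[THEN tail] loop_value)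
   finally show ?thesis .
  qed
  show "haar c H H' o f=f"
  proof (rule eq_by_tail[of _ x c])
   show "haar c H H' o f : Hom x c" "f : Hom x c" using f x h by (simp_all add: hom_iff)
   fix w assume w:"obj w"
   have xc:"x$w : Obj A" "c$w : Obj A" using x c w by simp_all
   have "(haar c H H' o f)<|w=hsum (c$w) (c$w) R (%i. (dimn i / global_dim)*.loop c H H' i w) o f<|w"
   unfolding haar_hat[OF h w, symmetric] using f x h w by simp
   also have "...=hsum (x$w) (c$w) R (%i. ((dimn i / global_dim)*.loop c H H' i w) o f<|w)"
   using hsum_comp[OF R_finite lin[OF _ w], where h = "f<|w"] f x w c by simp
   also have "...=hsum (x$w) (c$w) R (%i. (dimn i / global_dim * dimn i)*.(f<|w))"
   using f x w h by (intro hsum_cong[OF xc]) (simp_all add: hom_iff step)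
   also have "...=f<|w" using hsum_scale_const[of "f<|w" R "%i. dimn i / global_dim * dimn i"] f x w unfolding sum by simp
   finally show "(haar c H H' o f)<|w=f<|w" .
  qed
 }
 {
  assume g:"arr g" "Dom A g = c" and eq:"!!b w. b : Obj A ==> obj w ==>
   (g<|(b$w)) o br H c b w = g<|(b$w) o br H' c b w"
  define x where "x = Cod A g"
  have x:"Cod A g=x" "obj x" using g by (simp_all add: x_def)
  have step:"g<|w o loop c H H' i w=dimn i*.(g<|w)" if i:"i : R" and w:"obj w" for i w
  proof -
   let ?v = "i^*$w"
   have od:"obj i" "obj ?v" using i w by simp_all
   have n:"g<|w o c|>cap i w=x|>cap i w o g<|(i$?v)" using interchange[of g "cap i w"] od w g x by simp
   have n2:"g<|(i$?v) o c|>cup' i w=x|>cup' i w o g<|w" using interchange[of g "cup' i w"] od w g x by simp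
   have lv:"x|>cap i w o x|>cup' i w=dimn i*.\<i> (x$w)" using arg_cong[OF loop_value(1)[OF od(1) w], of "%q. x|>q"] od w x by simp
   show ?thesis using od w g x h c by (simp add: loop_def n[THEN tail] eq[OF od, THEN tail] n2 lv[THEN tail])
  qed
  show "g o haar c H H'=g"
  proof (rule eq_by_tail[of _ c x])
   show "g o haar c H H' : Hom c x" "g : Hom c x" using g x h by (simp_all add: hom_iff)
   fix w assume w:"obj w"
   have xc:"x$w : Obj A" "c$w : Obj A" using x c w by simp_all
   have "(g o haar c H H')<|w=g<|w o hsum (c$w) (c$w) R (%i. (dimn i / global_dim)*.loop c H H' i w)"
   unfolding haar_hat[OF h w, symmetric] using g x h w by simp
   also have "...=hsum (c$w) (x$w) R (%i. (g<|w) o ((dimn i / global_dim)*.loop c H H' i w))"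
   using comp_hsum[OF R_finite lin[OF _ w], where h = "g<|w"] g x w c by simp
   also have "...=hsum (c$w) (x$w) R (%i. (dimn i / global_dim * dimn i)*.(g<|w))"
   using g x w h by (intro hsum_cong[OF xc(2,1)]) (simp_all add: hom_iff step)
   also have "...=g<|w" using hsum_scale_const[of "g<|w" R "%i. dimn i / global_dim * dimn i"] g x w unfolding sum by simp
   finally show "(g o haar c H H')<|w=g<|w" .
  qed
 }
qed

text \<open>Transport of \<open>H'\<close> to \<open>H\<close> combined with commutation with \<open>H\<close>
  itself; idempotency then follows by absorption.\<close>
lemma haar_equalizes:
 assumes h:"hb c H" "hb c H'" and cm:"commuting c H H'"
 shows "obj b ==> obj w ==>
   br H c b w o b|>haar c H H'<|w = br H' c b w o b|>haar c H H'<|w"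
  "obj b ==> obj w ==>
   (haar c H H'<|(b$w)) o br H c b w = haar c H H'<|(b$w) o br H' c b w"
  "haar c H H' o haar c H H' = haar c H H'" (is ?P1)
  "hbm c H c H (haar c H H')" (is ?P2) "hbm c H' c H' (haar c H H')" (is ?P3)
proof -
 show m: ?P2 by (rule haar_commuting[OF h h(1) commuting_self[OF h(1)] cm])
 show m': ?P3 by (rule haar_commuting[OF h h(2) commuting_sym[OF cm h] commuting_self[OF h(2)]])
 show a:"br H c b w o b|>haar c H H'<|w=br H' c b w o b|>haar c H H'<|w"
  if "obj b" "obj w" for b w unfolding haar_conj[OF h that, symmetric] hbm_br(1)[OF m' h(2,2) that] ..
 show "haar c H H'<|(b$w) o br H c b w=haar c H H'<|(b$w) o br H' c b w"
  if "obj b" "obj w" for b w unfolding haar_conj[OF h that] hbm_br(1)[OF m h(1,1) that] ..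
 show ?P1 by (rule haar_absorb(1)[OF h haar_typ'(1,3)[OF h] a])
qed

end

section \<open>The idempotent of the symmetric tensor product\<close>

context rigid_symmetric_category
begin

definition split_idem ::"'o => ('o => 'm) => 'o => 'm => 'm => bool" where
 "split_idem c B e p \<iota> \<longleftrightarrow> hb c B \<and> obj e \<and> p : Hom c e \<and> \<iota> : Hom e c \<and> p o \<iota> = \<i> e \<and> hbm c B c B (\<iota> o p)"

definition img ::"('o => 'm) => 'm => 'm => 'o => 'm" where
 "img B p \<iota> = (\<lambda>b \<in> Obj A. (p<|b) o B b o b|>\<iota>)"

text \<open>The two arrows of the splitting intertwine, so every law of the half-braiding restricts.\<close>
lemma img_half_braiding:
 assumes s:"split_idem c B e p \<iota>"
 shows "hb e (img B p \<iota>)" "hbm e (img B p \<iota>) c B \<iota>" "hbm c B e (img B p \<iota>) p"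
proof -
 have h:"hb c B" and e:"obj e" and pi:"p o \<iota>=\<i> e" and m:"hbm c B c B (\<iota> o p)" using s by (simp_all add: split_idem_def)
 have p:"arr p" "Dom A p=c" "Cod A p=e" and i:"\<iota> : Arr A" "Dom A \<iota>=e" "Cod A \<iota>=c" using s by (simp_all add: split_idem_def hom_iff)
 note c = hb_obj[OF h]
 let ?H = "img B p \<iota>"
 have pi1:"p<|x o \<iota><|x=\<i> (e$x)" and pi2:"x|>p o x|>\<iota>=\<i> (x$e)" if "obj x" for x
  using whisker_comp(2)[OF i(1) p(1) _ that] whisker_comp(1)[OF i(1) p(1) _ that] p i that e by (simp_all add: pi)
 have ty:"?H b ::: b$e ~> e$b" if "obj b" for b using that h p i c e by (simp_all add: img_def)
 have brB:"br ?H e b w=p<|(b$w) o br B c b w o b|>\<iota><|w" if "obj b" "obj w" for b w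
  using that h p i c e by (simp add: img_def br_def hat_def assoc_conj)
 have slide:"\<iota><|(b$w) o p<|(b$w) o br B c b w=br B c b w o b|>\<iota><|w o b|>p<|w" if "obj b" "obj w" for b w
  using hbm_br(1)[OF m h h that] that h p i c by simp
 have w2:"b|>p<|w o b|>\<iota><|w=\<i> (b$e$w)" if "obj b" "obj w" for b w
  using arg_cong[OF pi1[OF that(2)], of "%q. b|>q"] that p i e c by simp
 have iB:"\<iota><|(b$w) o br ?H e b w=br B c b w o b|>\<iota><|w" if "obj b" "obj w" for b w
 proof -
  have "\<iota><|(b$w) o br ?H e b w=(\<iota><|(b$w) o p<|(b$w) o br B c b w) o b|>\<iota><|w"
   unfolding brB[OF that] using that h p i c e by simp
  then show ?thesis unfolding slide[OF that] using that h p i c e by (simp add: w2)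
 qed
 have pB:"br ?H e b w o b|>p<|w=p<|(b$w) o br B c b w" if "obj b" "obj w" for b w
 proof -
  have "br ?H e b w o b|>p<|w=p<|(b$w) o (br B c b w o b|>\<iota><|w o b|>p<|w)" unfolding brB[OF that] using that h p i c e by simp
  then show ?thesis unfolding slide[OF that, symmetric] using that h p i c e by (simp add: pi1[THEN tail])
 qed
 have bt:"br ?H e b w ::: b$e$w ~> e$b$w" if "obj b" "obj w" for b w
  unfolding brB[OF that] using that h p i c e by simp_all
 have lx:"lax e ?H" unfolding lax_def
 proof (intro conjI ballI)
  fix f w assume f:"arr f" and w:"obj w"
  define x y where "x = Dom A f" and "y = Cod A f"
  have f':"Dom A f=x" "Cod A f=y" "obj x" "obj y" using f by (simp_all add: x_def y_def)
  have 1:"y|>\<iota><|w o f<|(e$w)=f<|(c$w) o x|>\<iota><|w" using interchange[of f "\<iota><|w"] f f' i w by simp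
  have 2:"p<|(y$w) o c|>f<|w=e|>f<|w o p<|(x$w)" using interchange[of p "f<|w"] f f' p w by simp
  show "br ?H e (Cod A f) w o f<|(e$w)=e|>f<|w o br ?H e (Dom A f) w"
   using f f' w h p i c e by (simp add: brB 1 br_natural_left[OF h w f f'(1,2), THEN tail] 2[THEN tail])
 next
  fix b b' w assume o:"obj b" "obj b'" "obj w"
  have 1:"p<|(b$b'$w) o c|>\<a> b b' w=e|>\<a> b b' w o p<|((b$b')$w)" using interchange[of p "\<a> b b' w"] o p by simp
  have 2:"br B c b (b'$w) o b|>br B c b' w o \<a> b b' (c$w)=c|>\<a> b b' w o br B c (b$b') w"
   unfolding br_tensor[OF h o] using o h c by simp
  have 3:"\<a> b b' (c$w) o (b$b')|>\<iota><|w=b|>b'|>\<iota><|w o \<a> b b' (e$w)" using o i c e by (simp add: assoc_conj_ident)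
  have "br ?H e b (b'$w) o b|>br ?H e b' w o \<a> b b' (e$w)
   = (br ?H e b (b'$w) o b|>p<|(b'$w)) o b|>br B c b' w o b|>b'|>\<iota><|w o \<a> b b' (e$w)"
   using bt[of b "b'$w"] o h p i c e by (simp add: brB[OF o(2,3)])
  also have "...=p<|(b$b'$w) o (br B c b (b'$w) o b|>br B c b' w o \<a> b b' (c$w)) o (b$b')|>\<iota><|w"
   using o h p i c e by (simp add: pB 3)
  also have "...=e|>\<a> b b' w o br ?H e (b$b') w" unfolding 2 using o h p i c e by (simp add: brB 1[THEN tail])
  finally show "e|>\<a> b b' w o br ?H e (b$b') w=br ?H e b (b'$w) o b|>br ?H e b' w o \<a> b b' (e$w)" by simp
 next
  fix w assume w:"obj w"
  have 1:"e|>\<l> w o p<|(\<I>$w)=p<|w o c|>\<l> w" using interchange[of p "\<l> w"] w p by simp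
  have 2:"\<l> (c$w) o \<I>|>\<iota><|w=\<iota><|w o \<l> (e$w)" using left_unitor_natural'[of "\<iota><|w"] w i by simp
  show "e|>\<l> w o br ?H e \<I> w=\<l> (e$w)"
   using w h p i c e by (simp add: brB 1[THEN tail] br_unit[OF h w, THEN tail] 2 pi1[THEN tail])
 qed (use e ty in \<open>simp_all add: hom_iff\<close>)
 show hb:"hb e ?H"
 proof (rule hbI)
  show "obj e" "?H \<in> extensional (Obj A)" using e by (simp_all add: img_def)
  show "iso_arr A (?H b)" "?H b : Hom (b$e) (e$b)" if "obj b" for b
   using lax_invertible[OF lx that] ty[OF that] by (simp_all add: hom_iff)
 qed (use lx in \<open>unfold lax_def, blast+\<close>)
 show "hbm e ?H c B \<iota>" using iB by (intro hbmI[OF i hb h]) simp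
 show "hbm c B e ?H p" using pB by (intro hbmI[OF p h hb]) simp
qed

lemma loop_whisker:
 assumes h:"hb c \<g>" "hb c \<g>'" and o:"obj a" "obj i" "obj w"
 shows "loop (a$c) (ctb a (trs a) c \<g>) (ctb a (trs a) c \<g>') i w
  = \<b> a c w o a|>loop c \<g> \<g>' i w o \<a> a c w"
proof -
 note c = hb_obj[OF h(1)]
 let ?v = "i^*$w"
 have v:"obj ?v" using o by simp
 have "br (ctb a (trs a) c \<g>) (a$c) i ?v o rb (ctb a (trs a) c \<g>') (a$c) i ?v
  = \<b> a c (i$?v) o a|>br \<g> c i ?v o a|>rb \<g>' c i ?v o \<a> a c (i$?v)" using h c o v by (simp add: br_ctb rb_ctb)
 from tail[OF this, of "(a$c)|>cup' i w"] show ?thesis unfolding loop_def using h c o v by (simp add: assoc_conj_ident)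
qed

end

context fusion_representatives
begin

lemma haar_whisker:
 assumes h:"hb c \<g>" "hb c \<g>'" and a:"obj a"
 shows "haar (a$c) (ctb a (trs a) c \<g>) (ctb a (trs a) c \<g>') = a|>haar c \<g> \<g>'"
proof (rule eq_by_tail)
 note c = hb_obj[OF h(1)]
 let ?B = "ctb a (trs a) c \<g>" and ?B' = "ctb a (trs a) c \<g>'"
 have H:"hb (a$c) ?B" "hb (a$c) ?B'" using h a by simp_all
 show "haar (a$c) ?B ?B' : Hom (a$c) (a$c)" "a|>haar c \<g> \<g>' : Hom (a$c) (a$c)"
  using H h a by (simp_all add: hom_iff)
 fix w assume w:"obj w"
 have Y:"(a$c)$w : Obj A" "c$w : Obj A" using a c w by simp_all
 let ?k = "%i. dimn i / global_dim"
 have lin:"?k i*.loop c \<g> \<g>' i w : Hom (c$w) (c$w)" if "i : R" for i using that h w by (simp add: hom_iff)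
 have "haar (a$c) ?B ?B'<|w
  = hsum ((a$c)$w) ((a$c)$w) R (%i. \<b> a c w o a|>(?k i*.loop c \<g> \<g>' i w) o \<a> a c w)"
  unfolding haar_hat[OF H w] using h c a w by (intro hsum_cong[OF Y(1,1)]) (simp_all add: loop_whisker hom_iff)
 also have "...=\<b> a c w o a|>haar c \<g> \<g>'<|w o \<a> a c w" unfolding haar_hat[OF h w]
 proof (rule additive_hsum[symmetric, where F = "%f. \<b> a c w o a|>f o \<a> a c w", OF Y(2,2,1,1) R_finite lin])
  show "\<b> a c w o a|>f o \<a> a c w : Hom ((a$c)$w) ((a$c)$w)" if "f : Hom (c$w) (c$w)" for f
   using that a c w by (simp add: hom_iff)
  show "\<b> a c w o a|>(f +. g) o \<a> a c w=\<b> a c w o a|>f o \<a> a c w +. \<b> a c w o a|>g o \<a> a c w"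
   if "f : Hom (c$w) (c$w)" "g : Hom (c$w) (c$w)" for f g using that a c w by (simp add: hom_iff tensor_add add_comp comp_add)
 qed
 also have "...=(a|>haar c \<g> \<g>')<|w" using h a c w by (simp add: assoc_conj)
 finally show "haar (a$c) ?B ?B'<|w=(a|>haar c \<g> \<g>')<|w" .
qed

lemma haar_absorb_hbm:
 assumes h:"hb c H" "hb c H'" "hb x \<xi>" and m:"hbm x \<xi> c H f" "hbm x \<xi> c H' f"
 shows "haar c H H' o f = f"
proof (rule haar_absorb(1)[OF h(1,2) hbm_typ(1,3)[OF m(1)]])
 fix b w assume o:"obj b" "obj w"
 show "br H c b w o b|>f<|w=br H' c b w o b|>f<|w" unfolding hbm_br(1)[OF m(1) h(3,1) o] hbm_br(1)[OF m(2) h(3,2) o] ..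
qed

lemma haar_absorb_right:
 assumes h:"hb c \<g>" "hb c \<g>'" "hb x \<xi>" and a:"obj a"
  and m:"hbm x \<xi> (a$c) (ctb a (trs a) c \<g>) f" "hbm x \<xi> (a$c) (ctb a (trs a) c \<g>') f"
 shows "a|>haar c \<g> \<g>' o f = f" unfolding haar_whisker[OF h(1,2) a, symmetric]
 by (rule haar_absorb_hbm[OF _ _ h(3) m]) (use h a in simp_all)

lemma haar_absorb_left:
 assumes h:"hb c \<g>" "hb c \<g>'" "hb x \<xi>" and a:"obj a"
  and m:"hbm x \<xi> (c$a) (ctb c \<g> a (trs a)) f" "hbm x \<xi> (c$a) (ctb c \<g>' a (trs a)) f"
 shows "haar c \<g> \<g>'<|a o f = f"
proof -
 note c = hb_obj[OF h(1)] and f = hbm_typ[OF m(1)]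
 have H:"hb (c$a) (ctb c \<g> a (trs a))" "hb (a$c) (ctb a (trs a) c \<g>)"
  "hb (c$a) (ctb c \<g>' a (trs a))" "hb (a$c) (ctb a (trs a) c \<g>')" using h a by simp_all
 have "a|>haar c \<g> \<g>' o (\<s> c a o f)=\<s> c a o f"
  by (rule haar_absorb_right[OF h a hbm_comp[OF m(1) hbm_symmetry(1)[OF h(1) a] h(3) H(1,2)] hbm_comp[OF m(2) hbm_symmetry(1)[OF h(2) a] h(3) H(3,4)]])
 moreover have "a|>haar c \<g> \<g>' o \<s> c a=\<s> c a o haar c \<g> \<g>'<|a"
  using symmetry_natural'[of "haar c \<g> \<g>'" "\<i> a"] h a c by simp
 ultimately have "\<s> c a o (haar c \<g> \<g>'<|a o f)=\<s> c a o f"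
  using f h a c comp_assoc_right[of f "\<s> c a" "a|>haar c \<g> \<g>'"] by simp
 then show ?thesis by (rule iso_cancel_left[rotated -1]) (use f h a c in simp_all)
qed

text \<open>A summand of \<open>\<Pi>\<close> crosses \<open>a\<close> with \<open>i\<close> and
  \<open>a'\<close> with its dual; this is the rotated loop of the two half-braidings.\<close>
lemma Pi_summand_hat:
 assumes h:"hb a H" "hb a' H'" and o:"obj i" "obj w"
 defines "N \<equiv> H i o \<s> a i" and "M \<equiv> \<s> a' i^* o H' i^*"
 shows "(loop_close a i<|a' o \<b> (a$i) i^* a' o N \<boxdot> M
   o \<a> (a$i) i^* a' o loop_open a i<|a')<|w
  = loop (a$a') (ctb a H a' (trs a')) (ctb a (trs a) a' H') i w"
proof -
 let ?i = "i^*" let ?v = "?i$w"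
 note a = hb_obj[OF h(1)] and a' = hb_obj[OF h(2)]
 have od:"obj ?i" "obj ?v" using o by simp_all
 have N:"arr N" "Dom A N=a$i" "Cod A N=a$i" using h a o by (simp_all add: N_def)
 have M:"arr M" "Dom A M=?i$a'" "Cod A M=?i$a'" using h a' o by (simp_all add: M_def)
 have NM:"N \<boxdot> M=N<|(?i$a') o (a$i)|>M" using tensor_split[OF N(1) M(1)] N M by simp
 define U where "U = loop_close a i<|a' o \<b> (a$i) ?i a'"
 define V where "V = \<a> (a$i) ?i a' o loop_open a i<|a'"
 have U:"U=a|>cap i a' o \<a> a i (?i$a')" unfolding U_def loop_open_hat(2)[OF a o(1) a'] using a a' o by simp
 have V:"V=\<b> a i (?i$a') o a|>cup' i a'" unfolding V_def loop_open_hat(1)[OF a o(1) a'] using a a' o by simp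
 have Uw:"\<a> a a' w o U<|w=a|>cap i (a'$w) o \<a> a i (?i$a'$w) o (a$i)|>\<a> ?i a' w o \<a> (a$i) (?i$a') w"
  unfolding U using a a' o by (simp add: assoc_conj assoc_conj_ident cap_whisker associator_whisker)
 have Vw:"V<|w o \<b> a a' w=\<b> (a$i) (?i$a') w o (a$i)|>\<b> ?i a' w o \<b> a i (?i$a'$w) o a|>cup' i (a'$w)"
  unfolding V using a a' o by (simp add: assoc_conj assoc_conj_ident cup'_whisker inv_associator_whisker)
 have Nw:"N<|(?i$a'$w)=\<b> a i (?i$a'$w) o br H a i (?i$a'$w) o sw a i (?i$a'$w) o \<a> a i (?i$a'$w)"
  unfolding N_def using h a a' o by (simp add: br_def sw_def hat_def)
 have Mw:"M<|w=\<b> ?i a' w o sw a' ?i w o br H' a' ?i w o \<a> ?i a' w"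
  unfolding M_def using h a a' o by (simp add: br_def sw_def hat_def)
 have NMw:"(N \<boxdot> M)<|w=\<b> (a$i) (?i$a') w o N<|((?i$a')$w) o (a$i)|>M<|w o \<a> (a$i) (?i$a') w"
  unfolding NM using N M a a' o by (simp add: assoc_conj)
 have ch:"(a$i)|>\<a> ?i a' w o N<|((?i$a')$w)=N<|(?i$a'$w) o (a$i)|>\<a> ?i a' w"
  using interchange[of N "\<a> ?i a' w"] N a a' o by simp
 define K where "K = sw a' ?i w o br H' a' ?i w"
 have K:"arr K" "Dom A K=?i$a'$w" "Cod A K=?i$a'$w" using h a' o od by (simp_all add: K_def)
 have MK:"(a$i)|>\<a> ?i a' w o (a$i)|>M<|w o (a$i)|>\<b> ?i a' w=(a$i)|>K" unfolding Mw K_def using h a a' o od by simp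
 let ?S = "loop_close a i<|a' o \<b> (a$i) ?i a' o N \<boxdot> M o \<a> (a$i) ?i a' o loop_open a i<|a'"
 have Ut:"U ::: (a$i)$?i$a' ~> a$a'" unfolding U using a a' o by simp_all
 have Vt:"V ::: a$a' ~> (a$i)$?i$a'" unfolding V using a a' o by simp_all
 have S:"?S=U o N \<boxdot> M o V" unfolding U_def V_def using N M a a' o by simp
 let ?x = "?i$a'$w"
 have "\<a> a a' w o ?S<|w o \<b> a a' w=(\<a> a a' w o U<|w) o (N \<boxdot> M)<|w o (V<|w o \<b> a a' w)"
  unfolding S using Ut Vt N M a a' o by simp
 also have "...=a|>cap i (a'$w) o \<a> a i ?x o N<|?x o ((a$i)|>\<a> ?i a' w o (a$i)|>M<|w o (a$i)|>\<b> ?i a' w)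
   o \<b> a i ?x o a|>cup' i (a'$w)" unfolding Uw Vw NMw using N M a a' o by (simp add: ch[THEN tail])
 also have "...=a|>cap i (a'$w) o br H a i ?x o sw a i ?x o a|>i|>K o a|>cup' i (a'$w)"
  unfolding MK Nw using K h a a' o by (simp add: assoc_conj_ident)
 also have "a|>cup' i (a'$w)=sw i a ?x o i|>sw ?i a (a'$w) o cup' i (a$a'$w)" using br_cup'[of a "trs a" i "a'$w"] a a' o by simp
 also have "sw a i ?x o a|>i|>K o (sw i a ?x o i|>sw ?i a (a'$w) o cup' i (a$a'$w))
  = i|>a|>K o i|>sw ?i a (a'$w) o cup' i (a$a'$w)"
  using sw_natural[OF a o(1) K, THEN tail, of "sw i a ?x o i|>sw ?i a (a'$w) o cup' i (a$a'$w)"] K a a' o by simp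
 finally have L:"\<a> a a' w o ?S<|w o \<b> a a' w
  = a|>cap i (a'$w) o br H a i ?x o i|>a|>K o i|>sw ?i a (a'$w) o cup' i (a$a'$w)" .
 have r1:"br H a i ?x o i|>a|>sw a' ?i w=a|>i|>sw a' ?i w o br H a i (a'$?v)"
  using br_natural(1)[OF h(1) o(1), of "sw a' ?i w"] a' o by simp
 have r2:"a|>cap i (a'$w) o a|>i|>sw a' ?i w=a|>a'|>cap i w o a|>sw i a' ?v"
 proof -
  have "cap i (a'$w) o i|>sw a' ?i w=a'|>cap i w o sw i a' ?v" using br_cap[of a' "trs a'" i w, symmetric] a' o by simp
  from arg_cong[OF this, of "%q. a|>q"] show ?thesis using a a' o by simp
 qed
 have H:"hb (a$a') (ctb a H a' (trs a'))" "hb (a$a') (ctb a (trs a) a' H')" using h a a' by simp_all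
 have n:"i|>?i|>\<a> a a' w o cup' i ((a$a')$w)=cup' i (a$a'$w) o \<a> a a' w" using cup'_natural[of i "\<a> a a' w"] a a' o by simp
 have "loop (a$a') (ctb a H a' (trs a')) (ctb a (trs a) a' H') i w
  = \<b> a a' w o (a|>cap i (a'$w) o br H a i ?x o i|>a|>K o i|>sw ?i a (a'$w) o cup' i (a$a'$w)) o \<a> a a' w"
  unfolding loop_rotate[OF H o] K_def using h a a' o od by (simp add: br_ctb assoc_conj_ident n r1[THEN tail] r2[THEN tail])
 also have "...=?S<|w" unfolding L[symmetric] using Ut Vt N M a a' o by (simp add: S)
 finally show ?thesis by simp
qed

text \<open>By \<open>Pi_summand_hat\<close> and the cancellation of signs in
  \<open>coev_tilde_simple\<close>.\<close>
lemma Pi_idem_haar: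
 assumes h:"hb a H" "hb a' H'"
 shows "Pi_idem A R (a, H) (a', H') = haar (a$a') (ctb a H a' (trs a')) (ctb a (trs a) a' H')"
proof -
 note a = hb_obj[OF h(1)] and a' = hb_obj[OF h(2)]
 let ?c = "a$a'" and ?B = "ctb a H a' (trs a')" and ?B' = "ctb a (trs a) a' H'"
 have c:"obj ?c" using a a' by simp
 have H:"hb ?c ?B" "hb ?c ?B'" using h a a' by simp_all
 have "\<forall>i. \<exists>t. i : R \<longrightarrow> t * t=1 \<and> coev_tilde A i=t*.(\<s> i^* i o coev A i) \<and> qdim A i=t * dimn i"
  using coev_tilde_simple R_simple by blast
 then obtain t where t:"!!i. i : R ==> t i * t i=1" "!!i. i : R ==> coev_tilde A i=t i*.(\<s> i^* i o coev A i)"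
  "!!i. i : R ==> qdim A i = t i * dimn i" by metis
 have D:"(\<Sum>j\<in>R. (qdim A j)\<^sup>2)=global_dim" unfolding global_dim_def
 proof (rule sum.cong[OF refl])
  fix j assume j:"j : R"
  have "(qdim A j)\<^sup>2=(t j * t j) * (dimn j)\<^sup>2" unfolding t(3)[OF j] by (simp add: power2_eq_square mult_ac)
  then show "(qdim A j)\<^sup>2=(dimn j)\<^sup>2" using t(1)[OF j] by simp
 qed
 have term_eq:"(qdim A i / (\<Sum>j\<in>R. (qdim A j)\<^sup>2)) *.
   (\<r> a<|a' o (a|>ev A i)<|a' o Inv (rebracket A a i i^* a')
   o (H i o \<s> a i) \<boxdot> (\<s> a' i^* o H' i^*)
   o rebracket A a i i^* a' o (a|>coev_tilde A i)<|a'
   o Inv (\<r> a)<|a') = (dimn i / global_dim)*.loop_arr ?c ?B ?B' i" if i:"i : R" for i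
 proof -
  let ?i = "i^*"
  have io:"obj i" "obj ?i" using i by simp_all
  let ?N = "H i o \<s> a i" and ?M = "\<s> a' ?i o H' ?i"
  define N where "N = ?N" define M where "M = ?M"
  have N:"N ::: a$i ~> a$i" using h a io by (simp_all add: N_def)
  have M:"M ::: ?i$a' ~> ?i$a'" using h a' io by (simp_all add: M_def)
  let ?S = "loop_close a i<|a' o \<b> (a$i) ?i a' o N \<boxdot> M o \<a> (a$i) ?i a' o loop_open a i<|a'"
  have rbk:"Inv (rebracket A a i ?i a')=\<a> a i ?i<|a' o \<b> (a$i) ?i a'"
   unfolding rebracket_def using a a' io by (simp add: comp_iso)
  have S:"?S=loop_arr ?c ?B ?B' i"
  proof (rule eq_by_tail[of _ ?c ?c])
   show "?S : Hom ?c ?c" "loop_arr ?c ?B ?B' i : Hom ?c ?c" using N M H a a' io by (simp_all add: hom_iff)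
   show "?S<|w=loop_arr ?c ?B ?B' i<|w" if "obj w" for w
   unfolding loop_arr_hat[OF H io(1) that] N_def M_def by (rule Pi_summand_hat[OF h io(1) that])
  qed
  let ?E = "\<r> a<|a' o (a|>ev A i)<|a' o Inv (rebracket A a i ?i a') o N \<boxdot> M
   o rebracket A a i ?i a'"
  have E:"?E o (a|>(\<s> ?i i o coev A i))<|a' o Inv (\<r> a)<|a'=?S"
   unfolding rbk unfolding rebracket_def loop_close_def loop_open_def using N M a a' io by simp
  have "\<r> a<|a' o (a|>ev A i)<|a' o Inv (rebracket A a i ?i a') o N \<boxdot> M
   o rebracket A a i ?i a' o (a|>coev_tilde A i)<|a' o Inv (\<r> a)<|a'
   = t i*.(?E o (a|>(\<s> ?i i o coev A i))<|a' o Inv (\<r> a)<|a')"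
   unfolding t(2)[OF i] rbk unfolding rebracket_def using N M a a' io by simp
  then have "\<r> a<|a' o (a|>ev A i)<|a' o Inv (rebracket A a i ?i a') o ?N \<boxdot> ?M
   o rebracket A a i ?i a' o (a|>coev_tilde A i)<|a' o Inv (\<r> a)<|a'
   = t i*.loop_arr ?c ?B ?B' i" unfolding E S N_def[symmetric] M_def[symmetric] .
  then have "(qdim A i / (\<Sum>j\<in>R. (qdim A j)\<^sup>2))*.(\<r> a<|a' o (a|>ev A i)<|a' o Inv (rebracket A a i ?i a') o ?N \<boxdot> ?M
   o rebracket A a i ?i a' o (a|>coev_tilde A i)<|a' o Inv (\<r> a)<|a')
   = ((t i * dimn i / global_dim) * t i)*.loop_arr ?c ?B ?B' i"
   unfolding D t(3)[OF i] using loop_arr_typ[OF H io(1)] by (simp only: scale_scale)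
  also have "(t i * dimn i / global_dim) * t i=dimn i / global_dim" using t(1)[OF i] by (simp add: field_simps)
  finally show ?thesis .
 qed
 show ?thesis unfolding Pi_idem_def haar_def prod.case hom_space_simps
  by (rule hsum_cong[OF c c term_eq]) (use H in \<open>simp_all add: hom_iff\<close>)
qed

end

locale centre_data = symmetric_ribbon_fusion_category A
 for A ::"('o, 'm, 'x) ribbon_fusion_data_scheme" (structure) +
 fixes T ::"('o, 'm) symmetric_choice"
 assumes valid:"valid_choice A T"

sublocale centre_data \<subseteq> fusion_representatives A "simples T" using valid by unfold_locales (simp add: valid_choice_def)

section \<open>The symmetric tensor product as an equalizer\<close>

context rigid_symmetric_category
begin

definition zobj ::"('o, 'm) centre_obj => bool" where
 "zobj z \<longleftrightarrow> hb (fst z) (snd z)"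

definition mor ::"('o, 'm) centre_obj => ('o, 'm) centre_obj => 'm => bool" where
 "mor z z' f \<longleftrightarrow> hbm (fst z) (snd z) (fst z') (snd z') f"

lemma zobj_fst [simp]:"zobj z ==> fst z : Obj A" by (simp add: zobj_def hb_obj)
lemma zobj_hb [simp]:"zobj z ==> hb (fst z) (snd z)" by (simp add: zobj_def)

lemma mor_typ:"mor z z' f ==> arr f" "mor z z' f ==> Dom A f = fst z" "mor z z' f ==> Cod A f = fst z'"
 using hbm_typ unfolding mor_def by blast+

lemma mor_comp:"[|mor z z' f; mor z' z'' g; zobj z; zobj z'; zobj z''|] ==> mor z z'' (g o f)"
 unfolding mor_def zobj_def by (rule hbm_comp)

lemma mor_ident:"zobj z ==> mor z z (\<i> (fst z))" unfolding mor_def zobj_def by (rule hbm_ident)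

lemma mor_inv:"[|mor z z' f; zobj z; zobj z'; iso_arr A f|] ==> mor z' z (Inv f)" unfolding mor_def zobj_def by (rule hbm_inv)

lemma centre_obj_iff:"z \<in> Obj (drinfeld_centre A) \<longleftrightarrow> zobj z"
 by (cases z) (simp add: drinfeld_centre_def Let_def zobj_def hb_def)

lemma centre_arr_iff:"(z, f, z') \<in> Arr (drinfeld_centre A) \<longleftrightarrow> zobj z \<and> zobj z' \<and> mor z z' f"
 by (cases z; cases z') (auto simp: drinfeld_centre_def Let_def zobj_def hb_def mor_def hbm_def)

definition on_left ::"('o, 'm) centre_obj => ('o, 'm) centre_obj => 'o => 'm" where
 "on_left z z' = ctb (fst z) (snd z) (fst z') (trs (fst z'))"

definition on_right ::"('o, 'm) centre_obj => ('o, 'm) centre_obj => 'o => 'm" where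
 "on_right z z' = ctb (fst z) (trs (fst z)) (fst z') (snd z')"

lemma on_hb [simp]:
 assumes "zobj z" "zobj z'"
 shows "hb (fst z$fst z') (on_left z z')" "hb (fst z$fst z') (on_right z z')" using assms by (simp_all add: on_left_def on_right_def)

lemma on_commuting:"[|zobj z; zobj z'|] ==> commuting (fst z$fst z') (on_left z z') (on_right z z')"
 unfolding on_left_def on_right_def by (rule commuting_ctb) simp_all

lemma on_tensor:
 assumes f:"mor z w f" and g:"mor z' w' g" and Z:"zobj z" "zobj z'" "zobj w" "zobj w'"
 shows "hbm (fst z$fst z') (on_left z z') (fst w$fst w') (on_left w w') (f \<boxdot> g)"
  "hbm (fst z$fst z') (on_right z z') (fst w$fst w') (on_right w w') (f \<boxdot> g)" unfolding on_left_def on_right_def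
 using hbm_tensor[OF f[unfolded mor_def] hbm_trs[OF mor_typ[OF g]]] hbm_tensor[OF hbm_trs[OF mor_typ[OF f]] g[unfolded mor_def]] Z by simp_all

lemma on_symmetry:
 assumes Z:"zobj z" "zobj z'"
 shows "hbm (fst z$fst z') (on_left z z') (fst z'$fst z) (on_right z' z) (\<s> (fst z) (fst z'))"
  "hbm (fst z$fst z') (on_right z z') (fst z'$fst z) (on_left z' z) (\<s> (fst z) (fst z'))"
 unfolding on_left_def on_right_def using hbm_symmetry(1)[of "fst z" "snd z" "fst z'"] hbm_symmetry(2)[of "fst z'" "snd z'" "fst z"] Z by simp_all

end

context centre_data
begin

abbreviation stens (infixr "<>" 70) where "z<>z' \<equiv> stensor_obj A T z z'"
abbreviation inc where "inc z z' \<equiv> Pi_incl T z z'"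
abbreviation prj where "prj z z' \<equiv> Pi_proj T z z'"

text \<open>The idempotent \<open>\<Pi>\<close> in the form in which it is used from here on.\<close>
definition avg ::"('o, 'm) centre_obj => ('o, 'm) centre_obj => 'm" where
 "avg z z' = haar (fst z$fst z') (on_left z z') (on_right z z')"

lemma stensor_props:
 assumes Z:"zobj z" "zobj z'"
 shows "prj z z' : Arr A" (is ?P1) "Dom A (prj z z') = fst z$fst z'" (is ?P2) "Cod A (prj z z') = fst (z<>z')" (is ?P3)
  "inc z z' : Arr A" (is ?P4) "Cod A (inc z z') = fst z$fst z'" (is ?P5) "Dom A (inc z z') = fst (z<>z')" (is ?P6)
  "prj z z' o inc z z' = \<i> (fst (z<>z'))" (is ?P7) "inc z z' o prj z z' = avg z z'" (is ?P8)
  "snd (z<>z') = img (on_right z z') (prj z z') (inc z z')" (is ?P9) "fst (z<>z') : Obj A" (is ?P10)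
proof -
 obtain a H a' H' where zz:"z = (a, H)" "z' = (a', H')" by (cases z; cases z') blast
 have fs:"fst (z<>z')=fst (Pi_image T z z')" unfolding zz by (simp add: stensor_obj_def Let_def)
 have ct:"fst (centre_tensor A z z')=fst z$fst z'" unfolding zz centre_tensor_ctb by simp
 have zo:"z \<in> Obj (drinfeld_centre A)" "z' \<in> Obj (drinfeld_centre A)" using Z by (simp_all add: centre_obj_iff)
 have v:"(Pi_image T z z', inc z z', centre_tensor A z z') \<in> Arr (drinfeld_centre A)"
  "(centre_tensor A z z', prj z z', Pi_image T z z') \<in> Arr (drinfeld_centre A)"
  "prj z z' o inc z z' = \<i> (fst (Pi_image T z z'))" "inc z z' o prj z z' = Pi_idem A (simples T) z z'"
  using valid zo unfolding valid_choice_def by blast+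
 have m:"mor (Pi_image T z z') (centre_tensor A z z') (inc z z')" "mor (centre_tensor A z z') (Pi_image T z z') (prj z z')" "zobj (Pi_image T z z')"
  using v(1,2) unfolding centre_arr_iff by blast+
 show t: ?P1 ?P2 ?P3
  ?P4 ?P5 ?P6
  using mor_typ[OF m(1)] mor_typ[OF m(2)] by (simp_all only: fs ct)
 show ?P7 using v(3) by (simp only: fs)
 have "Pi_idem A (simples T) z z'=avg z z'"
  using Pi_idem_haar[of a H a' H'] Z unfolding zz avg_def on_left_def on_right_def by (simp add: zobj_def)
 then show ?P8 using v(4) by simp
 show o: ?P10 unfolding fs using m(3) by simp
 show ?P9
 proof -
  have "prj z z'<|b o \<b> a a' b o a|>H' b o \<a> a b a' o \<s> b a<|a' o \<b> b a a' o b|>inc z z'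
   = prj z z'<|b o on_right z z' b o b|>inc z z'" if b:"obj b" for b
  proof -
   have h:"hb a' H'" "obj a" "obj a'" using Z zz by (simp_all add: zobj_def hb_obj)
   have fo:"Dom A (prj z z')=a$a'" "Cod A (inc z z')=a$a'" using t zz by simp_all
   show ?thesis using b h t(1,4) fo zz o by (simp add: on_right_def ctb_def trs_def)
  qed
  then show ?thesis unfolding zz by (simp add: stensor_obj_def img_def Let_def cong: restrict_cong)
 qed
qed

lemmas stensor_typ [simp] = stensor_props(1-6,10) and prj_inc [simp] = stensor_props(7) and inc_prj = stensor_props(8)
lemmas prj_inc_tail [simp] = stensor_props(7)[THEN tail] and inc_prj_tail = stensor_props(8)[THEN tail]

lemma avg_arr [simp]:
 assumes "zobj z" "zobj z'"
 shows "avg z z' ::: fst z$fst z' ~> fst z$fst z'" using assms by (simp_all add: avg_def)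

lemma avg_inc [simp]:"zobj z ==> zobj z' ==> avg z z' o inc z z' = inc z z'"
 and prj_avg [simp]:"zobj z ==> zobj z' ==> prj z z' o avg z z' = prj z z'" by (simp_all flip: inc_prj)

lemma stensor_hb:
 assumes Z:"zobj z" "zobj z'"
 shows "zobj (z<>z')" (is ?P1)
  "hbm (fst (z<>z')) (snd (z<>z')) (fst z$fst z') (on_left z z') (inc z z')"
  "hbm (fst (z<>z')) (snd (z<>z')) (fst z$fst z') (on_right z z') (inc z z')"
  "hbm (fst z$fst z') (on_left z z') (fst (z<>z')) (snd (z<>z')) (prj z z')"
  "hbm (fst z$fst z') (on_right z z') (fst (z<>z')) (snd (z<>z')) (prj z z')"
proof -
 let ?c = "fst z$fst z'" and ?L = "on_left z z'" and ?R = "on_right z z'"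
 note eq = haar_equalizes[OF on_hb[OF Z] on_commuting[OF Z]]
 have s:"split_idem ?c ?R (fst (z<>z')) (prj z z') (inc z z')"
  unfolding split_idem_def inc_prj[OF Z] using Z eq(5) by (simp add: hom_iff avg_def)
 note im = img_half_braiding[OF s, folded stensor_props(9)[OF Z]]
 show ?P1 unfolding zobj_def using im(1) .
 note S = im(1)
 show r:"hbm (fst (z<>z')) (snd (z<>z')) ?c ?R (inc z z')" "hbm ?c ?R (fst (z<>z')) (snd (z<>z')) (prj z z')" using im(2,3) .
 show "hbm (fst (z<>z')) (snd (z<>z')) ?c ?L (inc z z')"
 proof (rule hbmI[OF _ _ _ S on_hb(1)[OF Z]])
  fix b w assume o:"obj b" "obj w"
  have 1:"b|>inc z z'<|w=b|>avg z z'<|w o b|>inc z z'<|w" using arg_cong[OF avg_inc[OF Z], of "%q. b|>q<|w"] Z o by (simp del: avg_inc)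
  have 2:"br ?L ?c b w o b|>avg z z'<|w=br ?R ?c b w o b|>avg z z'<|w" using eq(1)[OF o] by (simp add: avg_def)
  have "br ?L ?c b w o b|>inc z z'<|w=(br ?L ?c b w o b|>avg z z'<|w) o b|>inc z z'<|w" by (subst 1) (use Z o in simp)
  also have "...=br ?R ?c b w o (b|>avg z z'<|w o b|>inc z z'<|w)" unfolding 2 using Z o by simp
  also have "...=inc z z'<|(b$w) o br (snd (z<>z')) (fst (z<>z')) b w"
   unfolding 1[symmetric] by (rule hbm_br(1)[OF r(1) S on_hb(2)[OF Z] o])
  finally show "br ?L ?c b w o b|>inc z z'<|w=inc z z'<|(b$w) o br (snd (z<>z')) (fst (z<>z')) b w" .
 qed (use Z in simp_all)
 show "hbm ?c ?L (fst (z<>z')) (snd (z<>z')) (prj z z')"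
 proof (rule hbmI[OF _ _ _ on_hb(1)[OF Z] S])
  fix b w assume o:"obj b" "obj w"
  have 1:"prj z z'<|(b$w)=prj z z'<|(b$w) o avg z z'<|(b$w)"
   using arg_cong[OF prj_avg[OF Z], of "%q. q<|(b$w)"] Z o by (simp del: prj_avg)
  have 2:"avg z z'<|(b$w) o br ?L ?c b w=avg z z'<|(b$w) o br ?R ?c b w" using eq(2)[OF o] by (simp add: avg_def)
  have "br (snd (z<>z')) (fst (z<>z')) b w o b|>prj z z'<|w=prj z z'<|(b$w) o br ?R ?c b w"
   by (rule hbm_br(1)[OF r(2) on_hb(2)[OF Z] S o])
  also have "...=prj z z'<|(b$w) o (avg z z'<|(b$w) o br ?R ?c b w)" by (subst 1) (use Z o in simp)
  also have "...=(prj z z'<|(b$w) o avg z z'<|(b$w)) o br ?L ?c b w" unfolding 2[symmetric] using Z o by simp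
  finally show "br (snd (z<>z')) (fst (z<>z')) b w o b|>prj z z'<|w=prj z z'<|(b$w) o br ?L ?c b w" unfolding 1[symmetric] .
 qed (use Z in simp_all)
qed

lemmas stens_zobj [simp] = stensor_hb(1)

lemma inc_mono:
 assumes Z:"zobj z" "zobj z'" and f:"arr f" "arr g" "Cod A f = fst (z<>z')" "Cod A g = fst (z<>z')"
  and eq:"inc z z' o f = inc z z' o g"
 shows "f = g"
proof -
 have "prj z z' o (inc z z' o f)=prj z z' o (inc z z' o g)" using eq by simp
 then show ?thesis using Z f by simp
qed

text \<open>The idempotent absorbs an arrow that intertwines with both half-braidings, so the arrow factors
  through the image.\<close>
lemma factor:
 assumes Z:"zobj x" "zobj z" "zobj z'"
  and m:"hbm (fst x) (snd x) (fst z$fst z') (on_left z z') f" "hbm (fst x) (snd x) (fst z$fst z') (on_right z z') f"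
 shows "mor x (z<>z') (prj z z' o f)" (is ?P1) "inc z z' o (prj z z' o f) = f" (is ?P2)
proof -
 show ?P1 unfolding mor_def by (rule hbm_comp[OF m(1) stensor_hb(4)[OF Z(2,3)]]) (use Z in simp_all)
 have "avg z z' o f=f" unfolding avg_def by (rule haar_absorb_hbm[OF _ _ _ m]) (use Z in simp_all)
 then show ?P2 using inc_prj_tail[OF Z(2,3), of f] Z hbm_typ[OF m(1)] by simp
qed

definition sten where "sten z z' w w' f g = prj w w' o f \<boxdot> g o inc z z'"

lemma sten:
 assumes f:"mor z w f" "mor z' w' g" and Z:"zobj z" "zobj z'" "zobj w" "zobj w'"
 shows "mor (z<>z') (w<>w') (sten z z' w w' f g)" (is ?P1) "inc w w' o sten z z' w w' f g = f \<boxdot> g o inc z z'" (is ?P2)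
proof -
 note m = hbm_comp[OF stensor_hb(2)[OF Z(1,2)] on_tensor(1)[OF f Z]] hbm_comp[OF stensor_hb(3)[OF Z(1,2)] on_tensor(2)[OF f Z]]
 have m':"hbm (fst (z<>z')) (snd (z<>z')) (fst w$fst w') (on_left w w') (f \<boxdot> g o inc z z')"
  "hbm (fst (z<>z')) (snd (z<>z')) (fst w$fst w') (on_right w w') (f \<boxdot> g o inc z z')" using m Z by simp_all
 show ?P1 ?P2
  unfolding sten_def using factor[OF _ Z(3,4) m'] Z by simp_all
qed

definition ssym where "ssym z z' = prj z' z o \<s> (fst z) (fst z') o inc z z'"

lemma ssym:
 assumes Z:"zobj z" "zobj z'"
 shows "mor (z<>z') (z'<>z) (ssym z z')" (is ?P1) "inc z' z o ssym z z' = \<s> (fst z) (fst z') o inc z z'" (is ?P2)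
proof -
 have m':"hbm (fst (z<>z')) (snd (z<>z')) (fst z'$fst z) (on_left z' z) (\<s> (fst z) (fst z') o inc z z')"
  "hbm (fst (z<>z')) (snd (z<>z')) (fst z'$fst z) (on_right z' z) (\<s> (fst z) (fst z') o inc z z')"
  using hbm_comp[OF stensor_hb(3)[OF Z] on_symmetry(2)[OF Z]] hbm_comp[OF stensor_hb(2)[OF Z] on_symmetry(1)[OF Z]] Z by simp_all
 show ?P1 ?P2
  unfolding ssym_def using factor[OF _ Z(2,1) m'] Z by simp_all
qed

definition embL where "embL x y z = inc x y<|(fst z) o inc (x<>y) z"
definition embR where "embR x y z = (fst x)|>inc y z o inc x (y<>z)"
definition sass where
 "sass x y z = prj x (y<>z) o (fst x)|>prj y z o \<a> (fst x) (fst y) (fst z) o inc x y<|(fst z) o inc (x<>y) z"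
text \<open>The candidate inverse of the associator, by the same formula read backwards.\<close>
definition sass' where
 "sass' x y z = prj (x<>y) z o prj x y<|(fst z) o \<b> (fst x) (fst y) (fst z) o (fst x)|>inc y z o inc x (y<>z)"

lemma emb_typ [simp]:
 assumes "zobj x" "zobj y" "zobj z"
 shows "embL x y z : Arr A" "Dom A (embL x y z) = fst ((x<>y)<>z)" "Cod A (embL x y z) = (fst x$fst y)$fst z"
  "embR x y z : Arr A" "Dom A (embR x y z) = fst (x<>y<>z)" "Cod A (embR x y z) = fst x$fst y$fst z"
 using assms by (simp_all add: embL_def embR_def)

lemma emb_mono:
 assumes Z:"zobj x" "zobj y" "zobj z"
 shows "[|arr f; arr g; Cod A f = fst ((x<>y)<>z); Cod A g = fst ((x<>y)<>z); embL x y z o f = embL x y z o g|] ==> f = g"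
  "[|arr f; arr g; Cod A f = fst (x<>y<>z); Cod A g = fst (x<>y<>z); embR x y z o f = embR x y z o g|] ==> f = g"
proof -
 have L:"(prj (x<>y) z o prj x y<|(fst z)) o embL x y z=\<i> (fst ((x<>y)<>z))"
  unfolding embL_def using Z whisker_comp(2)[of "inc x y" "prj x y" "fst z", symmetric] tail[of "prj x y<|(fst z)" "inc x y<|(fst z)"]
  by (simp del: whisker_comp)
 have R:"(prj x (y<>z) o (fst x)|>prj y z) o embR x y z=\<i> (fst (x<>y<>z))"
  unfolding embR_def using Z whisker_comp(1)[of "inc y z" "prj y z" "fst x", symmetric] tail[of "(fst x)|>prj y z" "(fst x)|>inc y z"]
  by (simp del: whisker_comp)
 {
  assume f:"arr f" "arr g" "Cod A f = fst ((x<>y)<>z)" "Cod A g = fst ((x<>y)<>z)" and eq:"embL x y z o f = embL x y z o g"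
  have "((prj (x<>y) z o prj x y<|(fst z)) o embL x y z) o f=((prj (x<>y) z o prj x y<|(fst z)) o embL x y z) o g" using f Z eq by simp
  then show "f=g" unfolding L using f Z by simp
 }
 {
  assume f:"arr f" "arr g" "Cod A f = fst (x<>y<>z)" "Cod A g = fst (x<>y<>z)" and eq:"embR x y z o f = embR x y z o g"
  have "((prj x (y<>z) o (fst x)|>prj y z) o embR x y z) o f=((prj x (y<>z) o (fst x)|>prj y z) o embR x y z) o g" using f Z eq by simp
  then show "f=g" unfolding R using f Z by simp
 }
qed

text \<open>The three half-braidings of a triple product, one for each factor; \<open>k\<close> selects the
  factor that braids through its own half-braiding, and the default covers the last.\<close>
definition L3 where "L3 x y z k = ctb (fst x$fst y)
 (if k = (0::nat) then on_left x y else if k = 1 then on_right x y else trs (fst x$fst y)) (fst z) (if k \<le> 1 then trs (fst z) else snd z)"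
definition R3 where "R3 x y z k = ctb (fst x) (if k = (0::nat) then snd x else trs (fst x)) (fst y$fst z)
 (if k = 0 then trs (fst y$fst z) else if k = 1 then on_left y z else on_right y z)"

lemma triple_hb:
 assumes Z:"zobj x" "zobj y" "zobj z"
 shows "hb ((fst x$fst y)$fst z) (L3 x y z k)" "hb (fst x$fst y$fst z) (R3 x y z k)" using Z by (simp_all add: L3_def R3_def)

text \<open>An iterated product lies in the common equalizer of the three half-braidings.\<close>
lemma emb_hbm:
 assumes Z:"zobj x" "zobj y" "zobj z"
 shows "hbm (fst ((x<>y)<>z)) (snd ((x<>y)<>z)) ((fst x$fst y)$fst z) (L3 x y z k) (embL x y z)" (is ?P1)
  "hbm (fst (x<>y<>z)) (snd (x<>y<>z)) (fst x$fst y$fst z) (R3 x y z k) (embR x y z)" (is ?P2)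
proof -
 have S:"zobj (x<>y)" "zobj (y<>z)" "zobj ((x<>y)<>z)" "zobj (x<>y<>z)" using Z by simp_all
 note t = hbm_trs[of "inc x y" "fst (x<>y)" "fst x$fst y"] hbm_trs[of "inc y z" "fst (y<>z)" "fst y$fst z"]
 show ?P1
 proof (cases "k \<le> 1")
  case True
  have "hbm (fst (x<>y)$fst z) (on_left (x<>y) z) ((fst x$fst y)$fst z) (L3 x y z k) (inc x y<|(fst z))"
   unfolding on_left_def[of "x<>y" z] L3_def using True Z S by (auto intro!: hbm_tensor stensor_hb(2,3) hbm_ident)
  from hbm_comp[OF stensor_hb(2)[OF S(1) Z(3)] this] show ?thesis unfolding embL_def using Z S triple_hb by simp
 next
  case False
  have "hbm (fst (x<>y)$fst z) (on_right (x<>y) z) ((fst x$fst y)$fst z) (L3 x y z k) (inc x y<|(fst z))"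
   unfolding on_right_def[of "x<>y" z] L3_def using False Z S by (auto intro!: hbm_tensor hbm_trs hbm_ident)
  from hbm_comp[OF stensor_hb(3)[OF S(1) Z(3)] this] show ?thesis unfolding embL_def using Z S triple_hb by simp
 qed
 show ?P2
 proof (cases "k = 0")
  case False
  have "hbm (fst x$fst (y<>z)) (on_right x (y<>z)) (fst x$fst y$fst z) (R3 x y z k) ((fst x)|>inc y z)"
   unfolding on_right_def[of x "y<>z"] R3_def using False Z S by (auto intro!: hbm_tensor stensor_hb(2,3) hbm_ident)
  from hbm_comp[OF stensor_hb(3)[OF Z(1) S(2)] this] show ?thesis unfolding embR_def using Z S triple_hb by simp
 next
  case True
  have "hbm (fst x$fst (y<>z)) (on_left x (y<>z)) (fst x$fst y$fst z) (R3 x y z k) ((fst x)|>inc y z)"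
   unfolding on_left_def[of x "y<>z"] R3_def using True Z S by (auto intro!: hbm_tensor hbm_trs hbm_ident)
  from hbm_comp[OF stensor_hb(2)[OF Z(1) S(2)] this] show ?thesis unfolding embR_def using Z S triple_hb by simp
 qed
qed

lemma associator_triple:
 assumes Z:"zobj x" "zobj y" "zobj z"
 shows "hbm ((fst x$fst y)$fst z) (L3 x y z k) (fst x$fst y$fst z) (R3 x y z k) (\<a> (fst x) (fst y) (fst z))"
proof -
 let ?x = "fst x" and ?y = "fst y" and ?z = "fst z"
 have o:"obj ?x" "obj ?y" "obj ?z" "hb ?x (snd x)" "hb ?y (snd y)" "hb ?z (snd z)" using Z by simp_all
 consider "k = 0" | "k = 1" | "k > 1" by linarith
 then show ?thesis
 proof cases
  case 1
  then show ?thesis unfolding L3_def R3_def on_left_def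
   using hbm_associator[OF o(4) hb_trs[OF o(2)] hb_trs[OF o(3)]] ctb_trs[OF o(2,3)] by simp
 next
  case 2
  then show ?thesis unfolding L3_def R3_def on_left_def on_right_def using hbm_associator[OF hb_trs[OF o(1)] o(5) hb_trs[OF o(3)]] by simp
 next
  case 3
  then show ?thesis unfolding L3_def R3_def on_right_def
   using hbm_associator[OF hb_trs[OF o(1)] hb_trs[OF o(2)] o(6)] ctb_trs[OF o(1,2)] by simp
 qed
qed

lemma sass:
 assumes Z:"zobj x" "zobj y" "zobj z"
 shows "mor ((x<>y)<>z) (x<>y<>z) (sass x y z)" (is ?P1)
  "embR x y z o sass x y z = \<a> (fst x) (fst y) (fst z) o embL x y z"
proof -
 let ?x = "fst x" and ?y = "fst y" and ?z = "fst z" let ?a = "\<a> ?x ?y ?z" let ?F = "?a o embL x y z"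
 have S:"zobj (x<>y)" "zobj (y<>z)" "zobj ((x<>y)<>z)" "zobj (x<>y<>z)" using Z by simp_all
 have F:"hbm (fst ((x<>y)<>z)) (snd ((x<>y)<>z)) (?x$?y$?z) (R3 x y z k) ?F" for k
  by (rule hbm_comp[OF emb_hbm(1)[OF Z] associator_triple[OF Z] _ triple_hb[OF Z]]) (use S in simp)
 define F1 where "F1 = ?x|>prj y z o ?F"
 have "?x|>avg y z o ?F=?F"
  unfolding avg_def by (rule haar_absorb_right[OF on_hb[OF Z(2,3)] zobj_hb[OF S(3)]]) (use F[of 1] F[of 2] Z in \<open>simp_all add: R3_def\<close>)
 then have bk:"?x|>inc y z o F1=?F" unfolding F1_def inc_prj[OF Z(2,3), symmetric] using Z by simp
 have p0:"hbm (?x$?y$?z) (R3 x y z 0) (?x$fst (y<>z)) (on_left x (y<>z)) (?x|>prj y z)"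
  unfolding R3_def on_left_def using Z S by (auto intro!: hbm_tensor hbm_trs hbm_ident)
 have p1:"hbm (?x$?y$?z) (R3 x y z 1) (?x$fst (y<>z)) (on_right x (y<>z)) (?x|>prj y z)"
  unfolding R3_def on_right_def[of x "y<>z"] using Z S by (auto intro!: hbm_tensor hbm_ident stensor_hb(4))
 have m:"hbm (fst ((x<>y)<>z)) (snd ((x<>y)<>z)) (?x$fst (y<>z)) (on_left x (y<>z)) F1"
  "hbm (fst ((x<>y)<>z)) (snd ((x<>y)<>z)) (?x$fst (y<>z)) (on_right x (y<>z)) F1"
  unfolding F1_def using hbm_comp[OF F[of 0] p0] hbm_comp[OF F[of 1] p1] Z S triple_hb[OF Z] by simp_all
 have e:"sass x y z=prj x (y<>z) o F1" unfolding sass_def F1_def embL_def using Z S by simp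
 note f = factor[OF S(3) Z(1) S(2) m]
 show ?P1 unfolding e by (rule f(1))
 have "embR x y z o sass x y z=?x|>inc y z o (inc x (y<>z) o (prj x (y<>z) o F1))" unfolding e embR_def using Z S hbm_typ[OF m(1)] by simp
 then show "embR x y z o sass x y z=?F" unfolding f(2) bk .
qed

lemma sass':
 assumes Z:"zobj x" "zobj y" "zobj z"
 shows "mor (x<>y<>z) ((x<>y)<>z) (sass' x y z)" (is ?P1)
  "embL x y z o sass' x y z = \<b> (fst x) (fst y) (fst z) o embR x y z"
proof -
 let ?x = "fst x" and ?y = "fst y" and ?z = "fst z" let ?a = "\<b> ?x ?y ?z" let ?F = "?a o embR x y z"
 have S:"zobj (x<>y)" "zobj (y<>z)" "zobj ((x<>y)<>z)" "zobj (x<>y<>z)" using Z by simp_all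
 have ai:"hbm (?x$?y$?z) (R3 x y z k) ((?x$?y)$?z) (L3 x y z k) ?a" for k
  by (rule hbm_inv[OF associator_triple[OF Z] triple_hb[OF Z]]) (use Z in simp)
 have F:"hbm (fst (x<>y<>z)) (snd (x<>y<>z)) ((?x$?y)$?z) (L3 x y z k) ?F" for k
  by (rule hbm_comp[OF emb_hbm(2)[OF Z] ai _ triple_hb(2)[OF Z] triple_hb(1)[OF Z]]) (use S in simp)
 define F1 where "F1 = prj x y<|?z o ?F"
 have "avg x y<|?z o ?F=?F"
  unfolding avg_def by (rule haar_absorb_left[OF on_hb[OF Z(1,2)] zobj_hb[OF S(4)]]) (use F[of 0] F[of 1] Z in \<open>simp_all add: L3_def\<close>)
 then have bk:"inc x y<|?z o F1=?F" unfolding F1_def inc_prj[OF Z(1,2), symmetric] using Z by simp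
 have p0:"hbm ((?x$?y)$?z) (L3 x y z 0) (fst (x<>y)$?z) (on_left (x<>y) z) (prj x y<|?z)"
  unfolding L3_def on_left_def[of "x<>y" z] using Z S by (auto intro!: hbm_tensor stensor_hb(4) hbm_ident)
 have p1:"hbm ((?x$?y)$?z) (L3 x y z 2) (fst (x<>y)$?z) (on_right (x<>y) z) (prj x y<|?z)"
  unfolding L3_def on_right_def[of "x<>y" z] using Z S by (auto intro!: hbm_tensor hbm_ident hbm_trs)
 have m:"hbm (fst (x<>y<>z)) (snd (x<>y<>z)) (fst (x<>y)$?z) (on_left (x<>y) z) F1"
  "hbm (fst (x<>y<>z)) (snd (x<>y<>z)) (fst (x<>y)$?z) (on_right (x<>y) z) F1"
  unfolding F1_def using hbm_comp[OF F[of 0] p0] hbm_comp[OF F[of 2] p1] Z S triple_hb[OF Z] by simp_all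
 have e:"sass' x y z=prj (x<>y) z o F1" unfolding sass'_def F1_def embR_def using Z S by simp
 note f = factor[OF S(4) S(1) Z(3) m]
 show ?P1 unfolding e by (rule f(1))
 have "embL x y z o sass' x y z=inc x y<|?z o (inc (x<>y) z o (prj (x<>y) z o F1))"
  unfolding e embL_def using Z S hbm_typ[OF m(1)] by simp
 then show "embL x y z o sass' x y z=?F" unfolding f(2) bk .
qed

lemma sass_inverse:
 assumes Z:"zobj x" "zobj y" "zobj z"
 shows "sass' x y z o sass x y z = \<i> (fst ((x<>y)<>z))" (is ?P1) "sass x y z o sass' x y z = \<i> (fst (x<>y<>z))" (is ?P2)
proof -
 note s = sass[OF Z] and s' = sass'[OF Z] note t = mor_typ[OF s(1)] and t' = mor_typ[OF s'(1)]
 let ?a = "\<a> (fst x) (fst y) (fst z)"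
 have "embL x y z o (sass' x y z o sass x y z)=Inv ?a o (embR x y z o sass x y z)" using tail[OF s'(2), of "sass x y z"] t t' Z by simp
 also have "...=embL x y z o \<i> (fst ((x<>y)<>z))" unfolding s(2) using Z by simp
 finally show ?P1 by (rule emb_mono(1)[OF Z, rotated 4]) (use t t' Z in simp_all)
 have "embR x y z o (sass x y z o sass' x y z)=?a o (embL x y z o sass' x y z)" using tail[OF s(2), of "sass' x y z"] t t' Z by simp
 also have "...=embR x y z o \<i> (fst (x<>y<>z))" unfolding s'(2) using Z by simp
 finally show ?P2 by (rule emb_mono(2)[OF Z, rotated 4]) (use t t' Z in simp_all)
qed

end

section \<open>Functoriality, pentagon and hexagon\<close>

context centre_data
begin

lemma sten_typ:
 assumes "mor z w f" "mor z' w' g" "zobj z" "zobj z'" "zobj w" "zobj w'"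
 shows "sten z z' w w' f g : Arr A" "Dom A (sten z z' w w' f g) = fst (z<>z')" "Cod A (sten z z' w w' f g) = fst (w<>w')"
 using mor_typ[OF sten(1)[OF assms]] .

lemma sten_ident:"zobj z ==> zobj z' ==> sten z z' z z' (\<i> (fst z)) (\<i> (fst z')) = \<i> (fst (z<>z'))"
 by (simp add: sten_def)

lemma sten_comp:
 assumes f:"mor z w f" "mor w v f'" and g:"mor z' w' g" "mor w' v' g'" and Z:"zobj z" "zobj w" "zobj v" "zobj z'" "zobj w'" "zobj v'"
 shows "sten z z' v v' (f' o f) (g' o g) = sten w w' v v' f' g' o sten z z' w w' f g"
proof -
 note t = mor_typ[OF f(1)] mor_typ[OF f(2)] mor_typ[OF g(1)] mor_typ[OF g(2)]
 note S = sten_typ[OF f(1) g(1) Z(1,4,2,5)] sten_typ[OF f(2) g(2) Z(2,5,3,6)]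
 have "inc v v' o sten z z' v v' (f' o f) (g' o g)=(f' o f) \<boxdot> (g' o g) o inc z z'"
  by (rule sten(2)) (use mor_comp f g Z in blast)+
 also have "...=f' \<boxdot> g' o (f \<boxdot> g o inc z z')" using t Z by (simp add: tensor_comp')
 also have "...=inc v v' o (sten w w' v v' f' g' o sten z z' w w' f g)" unfolding sten(2)[OF f(1) g(1) Z(1,4,2,5), symmetric]
  using tail[OF sten(2)[OF f(2) g(2) Z(2,5,3,6)], of "sten z z' w w' f g"] S t Z by simp
 finally show ?thesis
  by (rule inc_mono[OF Z(3,6), rotated 4]) (use S Z sten_typ[OF mor_comp[OF f Z(1,2,3)] mor_comp[OF g Z(4,5,6)] Z(1,4,3,6)] in simp_all)
qed

lemma emb_natural:
 assumes f:"mor x x' f" "mor y y' g" "mor z z' h" and Z:"zobj x" "zobj y" "zobj z" "zobj x'" "zobj y'" "zobj z'"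
 shows "embL x' y' z' o sten (x<>y) z (x'<>y') z' (sten x y x' y' f g) h = (f \<boxdot> g) \<boxdot> h o embL x y z" (is ?P1)
  "embR x' y' z' o sten x (y<>z) x' (y'<>z') f (sten y z y' z' g h) = f \<boxdot> (g \<boxdot> h) o embR x y z" (is ?P2)
proof -
 note t = mor_typ[OF f(1)] mor_typ[OF f(2)] mor_typ[OF f(3)]
 have S:"zobj (x<>y)" "zobj (y<>z)" "zobj (x'<>y')" "zobj (y'<>z')" using Z by simp_all
 note s1 = sten[OF f(1,2) Z(1,2,4,5)] and s2 = sten[OF f(2,3) Z(2,3,5,6)]
 note s3 = sten[OF s1(1) f(3) S(1) Z(3) S(3) Z(6)] and s4 = sten[OF f(1) s2(1) Z(1) S(2) Z(4) S(4)]
 note ts = mor_typ[OF s1(1)] mor_typ[OF s2(1)] mor_typ[OF s3(1)] mor_typ[OF s4(1)]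
 have "inc x' y'<|(fst z') o sten x y x' y' f g \<boxdot> h=(inc x' y' o sten x y x' y' f g) \<boxdot> h"
  using t ts Z tensor_comp'[of "sten x y x' y' f g" "inc x' y'" h "\<i> (fst z')"] by simp
 also have "...=(f \<boxdot> g) \<boxdot> h o inc x y<|(fst z)"
  unfolding s1(2) using t Z tensor_comp'[of "inc x y" "f \<boxdot> g" "\<i> (fst z)" h] by simp
 finally have 1:"inc x' y'<|(fst z') o sten x y x' y' f g \<boxdot> h=(f \<boxdot> g) \<boxdot> h o inc x y<|(fst z)" .
 show ?P1
  unfolding embL_def using t ts Z S by (simp add: s3(2) 1[THEN tail])
 have "(fst x')|>inc y' z' o f \<boxdot> sten y z y' z' g h=f \<boxdot> (inc y' z' o sten y z y' z' g h)"
  using t ts Z tensor_comp'[of f "\<i> (fst x')" "sten y z y' z' g h" "inc y' z'"] by simp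
 also have "...=f \<boxdot> (g \<boxdot> h) o (fst x)|>inc y z"
  unfolding s2(2) using t Z tensor_comp'[of "\<i> (fst x)" f "inc y z" "g \<boxdot> h"] by simp
 finally have 2:"(fst x')|>inc y' z' o f \<boxdot> sten y z y' z' g h=f \<boxdot> (g \<boxdot> h) o (fst x)|>inc y z" .
 show ?P2
  unfolding embR_def using t ts Z S by (simp add: s4(2) 2[THEN tail])
qed

lemma sass_natural:
 assumes f:"mor x x' f" "mor y y' g" "mor z z' h" and Z:"zobj x" "zobj y" "zobj z" "zobj x'" "zobj y'" "zobj z'"
 shows "sass x' y' z' o sten (x<>y) z (x'<>y') z' (sten x y x' y' f g) h
  = sten x (y<>z) x' (y'<>z') f (sten y z y' z' g h) o sass x y z"
proof -
 note t = mor_typ[OF f(1)] mor_typ[OF f(2)] mor_typ[OF f(3)]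
 have S:"zobj (x<>y)" "zobj (y<>z)" "zobj (x'<>y')" "zobj (y'<>z')" using Z by simp_all
 note a = sass[OF Z(1-3)] and a' = sass[OF Z(4-6)]
 note s1 = sten[OF f(1,2) Z(1,2,4,5)] and s2 = sten[OF f(2,3) Z(2,3,5,6)]
 note s3 = sten[OF s1(1) f(3) S(1) Z(3) S(3) Z(6)] and s4 = sten[OF f(1) s2(1) Z(1) S(2) Z(4) S(4)]
 note ts = mor_typ[OF s3(1)] mor_typ[OF s4(1)] mor_typ[OF a(1)] mor_typ[OF a'(1)]
 note e = emb_natural[OF f Z]
 let ?l = "sten (x<>y) z (x'<>y') z' (sten x y x' y' f g) h" and ?r = "sten x (y<>z) x' (y'<>z') f (sten y z y' z' g h)"
 have "embR x' y' z' o (sass x' y' z' o ?l)=\<a> (fst x') (fst y') (fst z') o (embL x' y' z' o ?l)"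
  using tail[OF a'(2), of ?l] ts Z by simp
 also have "...=f \<boxdot> (g \<boxdot> h) o (\<a> (fst x) (fst y) (fst z) o embL x y z)"
  unfolding e(1) using t Z associator_natural'[OF t(1,4,7,2,3,5,6,8,9), THEN tail, of "embL x y z"] by simp
 also have "...=(embR x' y' z' o ?r) o sass x y z" unfolding e(2) a(2)[symmetric] using t ts Z by simp
 also have "...=embR x' y' z' o (?r o sass x y z)" using ts Z by simp
 finally show ?thesis by (rule emb_mono(2)[OF Z(4-6), rotated 4]) (use ts Z in simp_all)
qed

lemma ssym_natural:
 assumes f:"mor x x' f" "mor y y' g" and Z:"zobj x" "zobj y" "zobj x'" "zobj y'"
 shows "ssym x' y' o sten x y x' y' f g = sten y x y' x' g f o ssym x y"
proof -
 note t = mor_typ[OF f(1)] mor_typ[OF f(2)]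
 note s = ssym[OF Z(1,2)] and s' = ssym[OF Z(3,4)] and g = sten[OF f Z] and g' = sten[OF f(2,1) Z(2,1,4,3)]
 note ts = mor_typ[OF s(1)] mor_typ[OF s'(1)] mor_typ[OF g(1)] mor_typ[OF g'(1)]
 have "inc y' x' o (ssym x' y' o sten x y x' y' f g)=\<s> (fst x') (fst y') o (inc x' y' o sten x y x' y' f g)"
  using tail[OF s'(2), of "sten x y x' y' f g"] ts Z by simp
 also have "...=g \<boxdot> f o (\<s> (fst x) (fst y) o inc x y)"
  unfolding g(2) using t Z symmetry_natural'[OF t(1,4,2,3,5,6), THEN tail, of "inc x y"] by simp
 also have "...=(inc y' x' o sten y x y' x' g f) o ssym x y" unfolding g'(2) s(2)[symmetric] using t ts Z by simp
 also have "...=inc y' x' o (sten y x y' x' g f o ssym x y)" using ts Z by simp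
 finally show ?thesis by (rule inc_mono[OF Z(4,3), rotated 4]) (use ts Z in simp_all)
qed

lemma ssym_involutive:
 assumes Z:"zobj x" "zobj y"
 shows "ssym y x o ssym x y = \<i> (fst (x<>y))"
proof -
 note s = ssym[OF Z] and s' = ssym[OF Z(2,1)]
 note ts = mor_typ[OF s(1)] mor_typ[OF s'(1)]
 have "inc x y o (ssym y x o ssym x y)=\<s> (fst y) (fst x) o (inc y x o ssym x y)" using tail[OF s'(2), of "ssym x y"] ts Z by simp
 also have "...=inc x y o \<i> (fst (x<>y))"
  unfolding s(2) using Z tail[OF symmetry_involutive, of "fst x" "fst y" "inc x y"] by simp
 finally show ?thesis by (rule inc_mono[OF Z, rotated 4]) (use ts Z in simp_all)
qed

lemma hexagon_centre:
 assumes Z:"zobj x" "zobj y" "zobj z"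
 shows "sass y z x o ssym x (y<>z) o sass x y z
  = sten y (x<>z) y (z<>x) (\<i> (fst y)) (ssym x z) o sass y x z o sten (x<>y) z (y<>x) z (ssym x y) (\<i> (fst z))"
proof -
 let ?x = "fst x" and ?y = "fst y" and ?z = "fst z"
 have S:"zobj (x<>y)" "zobj (y<>z)" "zobj (x<>z)" "zobj (y<>x)" "zobj (z<>x)" using Z by simp_all
 note a = sass[OF Z(2,3,1)] sass[OF Z] sass[OF Z(2,1,3)]
 note s = ssym[OF Z(1) S(2)] ssym[OF Z(1,3)] ssym[OF Z(1,2)]
 note f = sten[OF mor_ident[OF Z(2)] s(3) Z(2) S(3) Z(2) S(5)] sten[OF s(5) mor_ident[OF Z(3)] S(1) Z(3) S(4) Z(3)]
 note t = mor_typ[OF a(1)] mor_typ[OF a(3)] mor_typ[OF a(5)] mor_typ[OF s(1)] mor_typ[OF s(3)] mor_typ[OF s(5)] mor_typ[OF f(1)] mor_typ[OF f(3)]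
 let ?f = "sten y (x<>z) y (z<>x) (\<i> ?y) (ssym x z)" and ?g = "sten (x<>y) z (y<>x) z (ssym x y) (\<i> ?z)"
 have l1:"embL y z x o ssym x (y<>z)=\<s> ?x (?y$?z) o embR x y z"
 proof -
  have "inc y z<|?x o \<s> ?x (fst (y<>z))=\<s> ?x (?y$?z) o ?x|>inc y z" using symmetry_natural'[of "\<i> ?x" "inc y z"] Z by simp
  from tail[OF this, of "inc x (y<>z)"] show ?thesis unfolding embL_def embR_def using t Z S by (simp add: s(2))
 qed
 have r1:"embR y z x o ?f=?y|>\<s> ?x ?z o embR y x z"
 proof -
  have "?y|>inc z x o ?y|>ssym x z=?y|>\<s> ?x ?z o ?y|>inc x z" using arg_cong[OF s(4), of "%q. ?y|>q"] t Z by simp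
  from tail[OF this, of "inc y (x<>z)"] show ?thesis unfolding embR_def using t Z S by (simp add: f(2))
 qed
 have r2:"embL y x z o ?g=\<s> ?x ?y<|?z o embL x y z"
 proof -
  have "inc y x<|?z o ssym x y<|?z=\<s> ?x ?y<|?z o inc x y<|?z" using arg_cong[OF s(6), of "%q. q<|?z"] t Z by simp
  from tail[OF this, of "inc (x<>y) z"] show ?thesis unfolding embL_def using t Z S by (simp add: f(4))
 qed
 have "embR y z x o (sass y z x o ssym x (y<>z) o sass x y z)=\<a> ?y ?z ?x o \<s> ?x (?y$?z) o \<a> ?x ?y ?z o embL x y z"
  using t Z S by (simp add: a(2)[THEN tail] l1[THEN tail] a(4))
 also have "...=(\<a> ?y ?z ?x o \<s> ?x (?y$?z) o \<a> ?x ?y ?z) o embL x y z" using Z by simp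
 also have "...=(?y|>\<s> ?x ?z o \<a> ?y ?x ?z o \<s> ?x ?y<|?z) o embL x y z" using hexagon[of ?x ?y ?z] Z by simp
 also have "...=embR y z x o (?f o sass y x z o ?g)" using t Z S by (simp add: r1[THEN tail] a(6)[THEN tail] r2)
 finally show ?thesis by (rule emb_mono(2)[OF Z(2,3,1), rotated 4]) (use t Z S in simp_all)
qed

lemma pentagon_centre:
 assumes W:"zobj w" and Z:"zobj x" "zobj y" "zobj z"
 shows "sten w ((x<>y)<>z) w (x<>y<>z) (\<i> (fst w)) (sass x y z) o sass w (x<>y) z
   o sten ((w<>x)<>y) z (w<>x<>y) z (sass w x y) (\<i> (fst z))
  = sass w x (y<>z) o sass (w<>x) y z"
proof -
 let ?w = "fst w" and ?x = "fst x" and ?y = "fst y" and ?z = "fst z"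
 have S:"zobj (x<>y)" "zobj (y<>z)" "zobj (w<>x)" "zobj ((x<>y)<>z)" "zobj (x<>y<>z)" "zobj ((w<>x)<>y)" "zobj (w<>x<>y)"
  using W Z by simp_all
 note a1 = sass[OF Z] and a2 = sass[OF W S(1) Z(3)] and a3 = sass[OF W Z(1,2)] and a4 = sass[OF W Z(1) S(2)] and a5 = sass[OF S(3) Z(2,3)]
 note f = sten[OF mor_ident[OF W] a1(1) W S(4) W S(5)] and g = sten[OF a3(1) mor_ident[OF Z(3)] S(6) Z(3) S(7) Z(3)]
 note t = mor_typ[OF a1(1)] mor_typ[OF a2(1)] mor_typ[OF a3(1)] mor_typ[OF a4(1)] mor_typ[OF a5(1)] mor_typ[OF f(1)] mor_typ[OF g(1)]
 let ?f = "sten w ((x<>y)<>z) w (x<>y<>z) (\<i> ?w) (sass x y z)"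
 let ?g = "sten ((w<>x)<>y) z (w<>x<>y) z (sass w x y) (\<i> ?z)"
 define E where "E = ?w|>embR x y z o inc w (x<>y<>z)"
 have Et:"E ::: fst (w<>x<>y<>z) ~> ?w$?x$?y$?z" using W Z S by (simp_all add: E_def)
 let ?G = "embL w x y<|?z o inc ((w<>x)<>y) z"
 have Gt:"?G ::: fst (((w<>x)<>y)<>z) ~> ((?w$?x)$?y)$?z" using W Z S by simp_all
 have p1:"E o ?f=?w|>\<a> ?x ?y ?z o ?w|>inc x y<|?z o embR w (x<>y) z"
 proof -
  have "?w|>embR x y z o ?w|>sass x y z=?w|>\<a> ?x ?y ?z o ?w|>embL x y z" using arg_cong[OF a1(2), of "%q. ?w|>q"] t W Z by simp
  from tail[OF this, of "inc w ((x<>y)<>z)"]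
  have "E o ?f=?w|>\<a> ?x ?y ?z o ?w|>embL x y z o inc w ((x<>y)<>z)" unfolding E_def using t W Z S by (simp add: f(2))
  then show ?thesis unfolding embL_def embR_def using W Z S by simp
 qed
 have p2:"?w|>inc x y<|?z o embR w (x<>y) z o sass w (x<>y) z=\<a> ?w (?x$?y) ?z o embR w x y<|?z o inc (w<>x<>y) z"
 proof -
  have "?w|>inc x y<|?z o \<a> ?w (fst (x<>y)) ?z=\<a> ?w (?x$?y) ?z o (?w|>inc x y)<|?z"
   using associator_natural'[of "\<i> ?w" "inc x y" "\<i> ?z"] W Z S by simp
  then show ?thesis unfolding a2(2) embL_def embR_def[of w x y] using W Z S
   by (simp add: tail[where b = "?w|>inc x y<|?z" and a = "\<a> ?w (fst (x<>y)) ?z"])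
 qed
 have p3:"embR w x y<|?z o inc (w<>x<>y) z o ?g=\<a> ?w ?x ?y<|?z o ?G"
 proof -
  have "embR w x y<|?z o sass w x y<|?z=\<a> ?w ?x ?y<|?z o embL w x y<|?z" using arg_cong[OF a3(2), of "%q. q<|?z"] t W Z by simp
  from tail[OF this, of "inc ((w<>x)<>y) z"] show ?thesis unfolding g(2) using t W Z S by simp
 qed
 have lhs:"E o (?f o sass w (x<>y) z o ?g)=(?w|>\<a> ?x ?y ?z o \<a> ?w (?x$?y) ?z o \<a> ?w ?x ?y<|?z) o ?G"
 proof -
  have "E o (?f o sass w (x<>y) z o ?g)=?w|>\<a> ?x ?y ?z o (?w|>inc x y<|?z o embR w (x<>y) z o sass w (x<>y) z) o ?g"
   using t Et W Z S by (simp add: p1[THEN tail])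
  also have "...=?w|>\<a> ?x ?y ?z o \<a> ?w (?x$?y) ?z o (embR w x y<|?z o inc (w<>x<>y) z o ?g)" unfolding p2 using t W Z S by simp
  also have "...=(?w|>\<a> ?x ?y ?z o \<a> ?w (?x$?y) ?z o \<a> ?w ?x ?y<|?z) o ?G" unfolding p3 using W Z S by simp
  finally show ?thesis .
 qed
 have q1:"E=?w|>?x|>inc y z o embR w x (y<>z)" unfolding E_def embR_def using W Z S by simp
 have q2:"E o sass w x (y<>z)=\<a> ?w ?x (?y$?z) o inc w x<|(?y$?z) o embR (w<>x) y z"
 proof -
  have 1:"?w|>?x|>inc y z o \<a> ?w ?x (fst (y<>z))=\<a> ?w ?x (?y$?z) o (?w$?x)|>inc y z" using W Z S by (simp add: assoc_conj_ident)
  have 2:"(?w$?x)|>inc y z o inc w x<|(fst (y<>z))=inc w x<|(?y$?z) o (fst (w<>x))|>inc y z"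
   using interchange[of "inc w x" "inc y z"] W Z S by simp
  have "E o sass w x (y<>z)=?w|>?x|>inc y z o (embR w x (y<>z) o sass w x (y<>z))" unfolding q1 using t W Z S by simp
  also have "...=\<a> ?w ?x (?y$?z) o inc w x<|(?y$?z) o (fst (w<>x))|>inc y z o inc (w<>x) (y<>z)"
   unfolding a4(2) embL_def using W Z S by (simp add: 1[THEN tail] 2[THEN tail])
  finally show ?thesis unfolding embR_def .
 qed
 have q3:"inc w x<|(?y$?z) o embR (w<>x) y z o sass (w<>x) y z=\<a> (?w$?x) ?y ?z o ?G"
 proof -
  have "inc w x<|(?y$?z) o \<a> (fst (w<>x)) ?y ?z=\<a> (?w$?x) ?y ?z o (inc w x<|?y)<|?z"
   using associator_natural'[of "inc w x" "\<i> ?y" "\<i> ?z"] W Z S by simp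
  then show ?thesis unfolding a5(2) embL_def using W Z S
   by (simp add: tail[where b = "inc w x<|(?y$?z)" and a = "\<a> (fst (w<>x)) ?y ?z"])
 qed
 have rhs:"E o (sass w x (y<>z) o sass (w<>x) y z)=(\<a> ?w ?x (?y$?z) o \<a> (?w$?x) ?y ?z) o ?G"
 proof -
  have "E o (sass w x (y<>z) o sass (w<>x) y z)=\<a> ?w ?x (?y$?z) o (inc w x<|(?y$?z) o embR (w<>x) y z o sass (w<>x) y z)"
   using t Et W Z S by (simp add: q2[THEN tail])
  then show ?thesis unfolding q3 using W Z S by simp
 qed
 have eq:"E o (?f o sass w (x<>y) z o ?g)=E o (sass w x (y<>z) o sass (w<>x) y z)"
  unfolding lhs rhs using pentagon[of ?w ?x ?y ?z] W Z by simp
 let ?u = "?f o sass w (x<>y) z o ?g" and ?v = "sass w x (y<>z) o sass (w<>x) y z"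
 have ut:"arr ?u" "Cod A ?u=fst (w<>x<>y<>z)" "arr ?v" "Cod A ?v=fst (w<>x<>y<>z)" using t W Z S by simp_all
 show ?thesis
 proof (rule emb_mono(2)[OF W Z(1) S(2)])
  let ?P = "?w|>?x|>prj y z"
  have pe:"?w|>?x|>prj y z o ?w|>?x|>inc y z=\<i> (?w$?x$fst (y<>z))"
   using arg_cong[OF prj_inc[OF Z(2,3)], of "%q. ?w|>?x|>q"] W Z S by (simp del: prj_inc)
  have pE:"?P o E=embR w x (y<>z)" unfolding q1 using W Z S by (simp add: pe[THEN tail])
  have "(?P o E) o ?u=(?P o E) o ?v"
   using eq ut Et W Z comp_assoc_right[of ?u E ?P] comp_assoc_right[of ?v E ?P] by (simp del: comp_assoc_right)
  then show "embR w x (y<>z) o ?u=embR w x (y<>z) o ?v" unfolding pE .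
 qed (use ut in simp_all)
qed

end

section \<open>The unit object and its canonical arrows\<close>

context rigid_symmetric_category
begin

lemma rot_a_natural:
 assumes o:"obj b" "obj i" "obj j" and t:"t : Hom j (b$i)" and g:"arr g" "Dom A g = w" "Cod A g = v"
 shows "rot_a b i t v o j|>i^*|>g = b|>g o rot_a b i t w"
proof -
 note t' = homD[OF t(1)]
 have wv:"obj w" "obj v" using g by auto
 have 1:"t<|(i^*$v) o j|>i^*|>g=(b$i)|>i^*|>g o t<|(i^*$w)" using interchange[of t "i^*|>g"] t' g o by simp
 have 2:"b|>cap i v o b|>i|>i^*|>g=b|>g o b|>cap i w" using arg_cong[OF cap_natural[OF o(2) g], of "%q. b|>q"] o g wv by simp
 show ?thesis unfolding rot_a_def using t' g o wv by (simp add: 1 assoc_conj_ident 2[THEN tail])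
qed

text \<open>The arrow in the half-braiding of the unit is a mate, so that the calculus of mates applies to
  it.\<close>
lemma sharp_mate:
 assumes o:"obj b" "obj i" "obj j" and t:"dual_vector A (b$i) j B \<f> : Hom j (b$i)"
 shows "sharp A b i j B \<f> = mate_a b i j (dual_vector A (b$i) j B \<f>)"
proof -
 let ?i = "i^*" and ?b = "b^*" and ?j = "j^*"
 define t where "t = dual_vector A (b$i) j B \<f>"
 have t:"t : Hom j (b$i)" using assms(4) by (simp add: t_def)
 then have t':"t ::: j ~> b$i" by (simp_all add: hom_iff)
 have od:"obj ?i" "obj ?b" "obj ?j" using o by simp_all
 define m where "m = ev A b o rot_a b i t ?b"
 have m:"m ::: j$?i$?b ~> \<I>" using o od t by (simp_all add: m_def)
 have m_eq:"(ev A b o b|>\<l> ?b o b|>ev A i<|?b o b|>\<b> i ?i ?b o \<a> b i (?i$?b)) o t<|(?i$?b)=m"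
  unfolding m_def rot_a_def cap_def using o od t' by simp
 have td:"tensor_dual A b i j t=\<r> ?j o ?j|>m o cup j (?i$?b)"
  unfolding tensor_dual_def Let_def m_eq[symmetric] cup_def using o od t' by simp
 have tdt:"tensor_dual A b i j t ::: ?i$?b ~> ?j"
  unfolding td using m o od by simp_all
 have rw:"rot_a b i t ?b<|v=\<b> b ?b v o rot_a b i t (?b$v) o j|>\<a> ?i ?b v o \<a> j (?i$?b) v" if v:"obj v" for v
 proof -
  have ch:"t<|(?i$?b$v) o j|>\<a> ?i ?b v=(b$i)|>\<a> ?i ?b v o t<|((?i$?b)$v)"
   using interchange[of t "\<a> ?i ?b v"] t' o od v by simp
  show ?thesis unfolding rot_a_def using o od t' v by (simp add: assoc_conj cap_whisker associator_whisker ch[THEN tail] assoc_conj_ident)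
 qed
 have mw:"m<|v=Inv (\<l> v) o cap b v o rot_a b i t (?b$v) o j|>\<a> ?i ?b v o \<a> j (?i$?b) v" if v:"obj v" for v
 proof -
  have e:"ev A b<|v=Inv (\<l> v) o cap b v o \<a> b ?b v" unfolding cap_def using o od v by simp
  have "m<|v=ev A b<|v o rot_a b i t ?b<|v" unfolding m_def using o od t v by simp
  then show ?thesis unfolding rw[OF v] e using o od t v by simp
 qed
 have tw:"tensor_dual A b i j t<|v=?j|>(cap b v o rot_a b i t (?b$v)) o cup j (?i$?b$v) o \<a> ?i ?b v" if v:"obj v" for v
 proof -
  have n:"?j|>j|>\<a> ?i ?b v o cup j ((?i$?b)$v)=cup j (?i$?b$v) o \<a> ?i ?b v"
   using cup_natural[of j "\<a> ?i ?b v"] o od v by simp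
  have "tensor_dual A b i j t<|v=?j|>\<l> v o ?j|>m<|v o ?j|>\<b> j (?i$?b) v o cup j ((?i$?b)$v)"
   unfolding td using m o od v by (simp add: assoc_conj right_unitor_whisker cap_whisker)
  then show ?thesis unfolding mw[OF v] using o od v t by (simp add: n)
 qed
 have sh:"sharp A b i j B \<f>=tensor_dual A b i j t<|b o \<b> ?i ?b b o ?i|>coev A b o Inv (\<r> ?i)"
  by (simp add: sharp_def t_def Let_def)
 have ma:"mate_a b i j t : Hom ?i (?j$b)" by (rule mate_a_hat(1)[OF o unit_typ t])
 show ?thesis unfolding t_def[symmetric]
 proof (rule eq_by_tail[OF _ ma])
  show "sharp A b i j B \<f> : Hom ?i (?j$b)" unfolding sh using tdt o od by (simp add: hom_iff)
  fix w assume w:"obj w"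
  have c:"coev A b<|w=\<b> ?b b w o cup b w o \<l> w" unfolding cup_def using o od w by simp
  have 1:"(?i|>coev A b)<|w=\<b> ?i (?b$b) w o ?i|>(\<b> ?b b w o cup b w o \<l> w) o \<a> ?i \<I> w"
   using assoc_conj[of "\<i> ?i" "coev A b" "\<i> w"] o od w by (simp del: whisker_comp add: c)
  have n2:"cup j (?i$?b$b$w) o ?i|>cup b w=?j|>j|>?i|>cup b w o cup j (?i$w)" using cup_natural[of j "?i|>cup b w"] o od w by simp
  have n3:"(cap b (b$w) o rot_a b i t (?b$b$w)) o j|>?i|>cup b w=rot_a b i t w"
   using rot_a_natural[OF o t, of "cup b w" w "?b$b$w"] o od w t by (simp add: snake_tail)
  have "sharp A b i j B \<f><|w=(tensor_dual A b i j t<|b)<|w o \<b> ?i ?b b<|w o (?i|>coev A b)<|w o Inv (\<r> ?i)<|w"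
   unfolding sh using tdt o od w by simp
  also have "...=\<b> ?j b w o tensor_dual A b i j t<|(b$w) o \<b> ?i ?b (b$w) o ?i|>cup b w"
   unfolding 1 using tdt o od w by (simp add: assoc_conj[of "tensor_dual A b i j t"] inv_associator_whisker inv_whisker)
  also have "...=\<b> ?j b w o ?j|>(cap b (b$w) o rot_a b i t (?b$b$w)) o ?j|>j|>?i|>cup b w o cup j (?i$w)"
   using tw[of "b$w"] o od w t by (simp add: n2)
  also have "...=\<b> ?j b w o ?j|>((cap b (b$w) o rot_a b i t (?b$b$w)) o j|>?i|>cup b w) o cup j (?i$w)"
   using o od w t by simp
  finally show "sharp A b i j B \<f><|w=mate_a b i j t<|w" unfolding n3 mate_rot(1)[OF o w t] .
 qed
qed

end

context fusion_representatives
begin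

text \<open>The identity of \<open>x\<close> is a sum of arrows through representatives.\<close>
lemma completeness_ext:
 assumes o:"obj x" "obj y" "obj z"
  and F:"!!f. f : Hom x x ==> F f : Hom y z" "!!f g. f : Hom x x ==> g : Hom x x ==> F (f +. g) = F f +. F g"
  and G:"!!f. f : Hom x x ==> G f : Hom y z" "!!f g. f : Hom x x ==> g : Hom x x ==> G (f +. g) = G f +. G g"
  and eq:"!!k r s. k : R ==> r : Hom x k ==> s : Hom k x ==> F (s o r) = G (s o r)"
 shows "F (\<i> x) = G (\<i> x)"
proof -
 define B where "B k = (SOME B. hom_basis A x k B)" for k
 have B:"hom_basis A x k (B k)" if "k : R" for k unfolding B_def by (rule someI_ex, rule hom_finite_dim) (use o that in simp_all)
 let ?t = "%k \<f>. dual_vector A x k (B k) \<f>"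
 have tin:"?t k \<f> : Hom k x" if "k : R" "\<f> : B k" for k \<f> using dual_vector(1)[OF R_simple[OF that(1)] o(1) B[OF that(1)] that(2)] .
 have pin:"\<f> : Hom x k" if "k : R" "\<f> : B k" for k \<f> using basis_in[OF B[OF that(1)] that(2)] .
 have din:"?t k \<f> o \<f> : Hom x x" if "k : R" "\<f> : B k" for k \<f> using comp_in[OF pin[OF that] tin[OF that]] .
 let ?S = "%k. hsum x x (B k) (%\<f>. ?t k \<f> o \<f>)"
 have Sin:"?S k : Hom x x" if "k : R" for k by (rule hsum_in[OF o(1,1) din[OF that]])
 have H:"H (\<i> x)=hsum y z R (%k. hsum y z (B k) (%\<f>. H (?t k \<f> o \<f>)))"
  if Hin:"!!f. f : Hom x x ==> H f : Hom y z" and Hadd:"!!f g. f : Hom x x ==> g : Hom x x ==> H (f +. g) = H f +. H g" for H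
 proof -
  have "H (\<i> x)=H (hsum x x R ?S)" using completeness[OF R R_finite o(1) B] by simp
  also have "...=hsum y z R (%k. H (?S k))" by (rule additive_hsum[OF o(1,1,2,3) R_finite Sin Hin Hadd])
  also have "...=hsum y z R (%k. hsum y z (B k) (%\<f>. H (?t k \<f> o \<f>)))"
  proof (rule hsum_cong[OF o(2,3)])
   fix k assume k:"k : R"
   show "H (?S k)=hsum y z (B k) (%\<f>. H (?t k \<f> o \<f>))" by (rule additive_hsum[OF o(1,1,2,3) basis_finite[OF B[OF k]] din[OF k] Hin Hadd])
   show "hsum y z (B k) (%\<f>. H (?t k \<f> o \<f>)) : Hom y z" by (rule hsum_in[OF o(2,3) Hin[OF din[OF k]]])
  qed
  finally show ?thesis .
 qed
 have "hsum y z R (%k. hsum y z (B k) (%\<f>. F (?t k \<f> o \<f>)))=hsum y z R (%k. hsum y z (B k) (%\<f>. G (?t k \<f> o \<f>)))"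
 proof (rule hsum_cong[OF o(2,3)])
  fix k assume k:"k : R"
  show "hsum y z (B k) (%\<f>. F (?t k \<f> o \<f>))=hsum y z (B k) (%\<f>. G (?t k \<f> o \<f>))"
   by (rule hsum_cong[OF o(2,3) eq[OF k pin[OF k] tin[OF k]] G(1)[OF din[OF k]]])
  show "hsum y z (B k) (%\<f>. G (?t k \<f> o \<f>)) : Hom y z" by (rule hsum_in[OF o(2,3) G(1)[OF din[OF k]]])
 qed
 moreover have "F (\<i> x)=hsum y z R (%k. hsum y z (B k) (%\<f>. F (?t k \<f> o \<f>)))" by (rule H[OF F])
 moreover have "G (\<i> x)=hsum y z R (%k. hsum y z (B k) (%\<f>. G (?t k \<f> o \<f>)))" by (rule H[OF G])
 ultimately show ?thesis by simp
qed

lemma simples_epi: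
 assumes f:"f : Hom x y" "g : Hom x y" and eq:"!!k t. k : R ==> t : Hom k x ==> f o t = g o t"
 shows "f = g"
proof -
 note o = hom_obj[OF f(1)]
 have t:"f ::: x ~> y" "g ::: x ~> y" using f by (simp_all add: hom_iff)
 have "f o \<i> x=g o \<i> x"
 proof (rule completeness_ext[OF o(1) o, of "%h. f o h" "%h. g o h"])
  fix k r s assume k:"k : R" and rs:"r : Hom x k" "s : Hom k x"
  have "(f o s) o r=(g o s) o r" using eq[OF k rs(2)] by simp
  then show "f o (s o r)=g o (s o r)" using t rs by (simp add: hom_iff)
 qed (use t o in \<open>simp_all add: hom_iff comp_add\<close>)
 then show ?thesis using t by simp
qed

lemma simples_epi_inside:
 assumes f:"f : Hom (c$x$w) y" "g : Hom (c$x$w) y" and o:"obj c" "obj x" "obj w"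
  and eq:"!!k t. k : R ==> t : Hom k x ==> f o c|>t<|w = g o c|>t<|w"
 shows "f = g"
proof -
 have y:"obj y" "c$x$w : Obj A" using hom_obj[OF f(1)] by simp_all
 have t:"f ::: c$x$w ~> y" "g ::: c$x$w ~> y" using f by (simp_all add: hom_iff)
 have "f o c|>x|>\<i> w=g o c|>x|>\<i> w"
 proof (rule completeness_ext[OF o(2) y(2,1), of "%h. f o c|>h<|w" "%h. g o c|>h<|w"])
  fix k r s assume k:"k : R" and rs:"r : Hom x k" "s : Hom k x"
  have "(f o c|>s<|w) o c|>r<|w=(g o c|>s<|w) o c|>r<|w" using eq[OF k rs(2)] by simp
  then show "f o c|>(s o r)<|w=g o c|>(s o r)<|w" using t rs o by (simp add: hom_iff)
 qed (use t o y in \<open>simp_all add: hom_iff tensor_add comp_add\<close>)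
 then show ?thesis using t o by simp
qed

end

context centre_data
begin

abbreviation "L \<equiv> sum_obj T"
abbreviation "uin \<equiv> sum_inj T"
abbreviation "upr \<equiv> sum_prj T"
abbreviation "Rs \<equiv> simples T"

lemma unit_sum:
 shows "obj L" and "i : Rs ==> uin i : Hom (i$i^*) L" "i : Rs ==> upr i : Hom L (i$i^*)"
  and "i : Rs ==> k : Rs ==> upr i o uin k = (if i = k then \<i> (i$i^*) else \<z> (k$k^*) (i$i^*))"
  and "hsum L L Rs (%i. uin i o upr i) = \<i> L" (is ?P1)
proof -
 have d:"direct_sum A Rs (%i. i$i^*) L uin upr" using valid by (simp add: valid_choice_def)
 show "obj L" ?P1 using d unfolding direct_sum_def by blast+
 show "i : Rs ==> uin i : Hom (i$i^*) L" "i : Rs ==> upr i : Hom L (i$i^*)" using d unfolding direct_sum_def by blast+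
 show "i : Rs ==> k : Rs ==> upr i o uin k=(if i=k then \<i> (i$i^*) else \<z> (k$k^*) (i$i^*))"
  using d unfolding direct_sum_def by blast
qed

lemmas L_obj [simp] = unit_sum(1)

lemma unit_sum_typ [simp]:
 assumes "i : Rs"
 shows "uin i ::: i$i^* ~> L"
  "upr i ::: L ~> i$i^*" using unit_sum(2,3)[OF assms] by (simp_all add: hom_iff)

text \<open>The inclusion of \<open>i \<otimes> (i\<^sup>* \<otimes> w)\<close> into \<open>L \<otimes>
  w\<close>.\<close>
definition uJ ::"'o => 'o => 'm" where
 "uJ i w = uin i<|w o \<b> i i^* w"

lemma uJ_typ [simp]:
 assumes "i : Rs" "obj w"
 shows "uJ i w ::: i$i^*$w ~> L$w" using assms by (simp_all add: uJ_def)

lemma uJ_natural: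
 assumes i:"i : Rs" and g:"arr g" "Dom A g = w" "Cod A g = v"
 shows "uJ i v o i|>i^*|>g = L|>g o uJ i w"
proof -
 have wv:"obj w" "obj v" using g by auto
 have 1:"uin i<|v o (i$i^*)|>g=L|>g o uin i<|w" using interchange[of "uin i" g] i g by simp
 have "\<b> i i^* v o i|>i^*|>g=(i$i^*)|>g o \<b> i i^* w" using i g wv by (simp add: assoc_conj_ident)
 then show ?thesis unfolding uJ_def using i g wv by (simp add: 1[THEN tail])
qed

lemma unit_joint_epi:
 assumes f:"f : Hom (b$L$w) y" "g : Hom (b$L$w) y" and o:"obj b" "obj w"
  and eq:"!!i. i : Rs ==> f o b|>uJ i w = g o b|>uJ i w"
 shows "f = g"
proof -
 have y:"obj y" "b$L$w : Obj A" using hom_obj[OF f(1)] by simp_all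
 have t:"arr f" "Dom A f=b$L$w" "Cod A f=y" "arr g" "Dom A g=b$L$w" "Cod A g=y" using f by (simp_all add: hom_iff)
 have pin:"uin i o upr i : Hom L L" if "i : Rs" for i using that by (simp add: hom_iff)
 have H:"h=hsum (b$L$w) y Rs (%i. h o b|>(uin i o upr i)<|w)" if h:"arr h" "Dom A h=b$L$w" "Cod A h=y" for h
 proof -
  have "h=hsum (b$L$w) y Rs (%i. h o b|>(uin i o upr i)<|w o \<i> (b$L$w))"
   using sandwich_hsum[of Rs "%i. uin i o upr i" L L b w h "\<i> (b$L$w)"] pin h o y unfolding unit_sum(5) by simp
  also have "...=hsum (b$L$w) y Rs (%i. h o b|>(uin i o upr i)<|w)"
   by (rule hsum_cong[OF y(2,1)]) (use h o in \<open>simp_all add: hom_iff\<close>)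
  finally show ?thesis .
 qed
 have "f o b|>(uin i o upr i)<|w=g o b|>(uin i o upr i)<|w" if i:"i : Rs" for i
 proof -
  have "(f o b|>uJ i w) o b|>(\<a> i i^* w o upr i<|w)=(g o b|>uJ i w) o b|>(\<a> i i^* w o upr i<|w)" unfolding eq[OF i] ..
  then show ?thesis unfolding uJ_def using t i o by simp
 qed
 then have "hsum (b$L$w) y Rs (%i. f o b|>(uin i o upr i)<|w)=hsum (b$L$w) y Rs (%i. g o b|>(uin i o upr i)<|w)"
  using t o by (intro hsum_cong[OF y(2,1)]) (simp_all add: hom_iff)
 then show ?thesis using H[OF t(1-3)] H[OF t(4-6)] by simp
qed

text \<open>The natural arrow \<open>k \<rightarrow> L \<otimes> k\<close> on a representative.\<close>
definition dl0 ::"'o => 'm" where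
 "dl0 k = uJ k k o k|>coev A k o Inv (\<r> k)"

text \<open>The unique natural extension of \<open>dl0\<close> to all objects. The bases are arbitrary, by
  \<open>dl_expand\<close>.\<close>
definition dl ::"'o => 'm" where
 "dl x = hsum x (L$x) Rs (%k. hsum x (L$x) (SOME B. hom_basis A x k B)
   (%\<f>. (L|>dual_vector A x k (SOME B. hom_basis A x k B) \<f>) o dl0 k o \<f>))"

lemma dl0_typ [simp]:
 assumes "k : Rs"
 shows "dl0 k ::: k ~> L$k" using assms by (simp_all add: dl0_def)

lemma dl_component:
 assumes x:"obj x" and k:"k : Rs" and B:"hom_basis A x k B"
 defines "N \<equiv> hsum x (L$x) B (%\<f>. (L|>dual_vector A x k B \<f>) o dl0 k o \<f>)"
 shows "N : Hom x (L$x)" (is ?P1) "t : Hom k x ==> N o t = L|>t o dl0 k"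
  "l : Rs ==> l \<noteq> k ==> s : Hom l x ==> N o s = \<z> l (L$x)"
proof -
 note ks = R_simple[OF k] let ?t = "dual_vector A x k B"
 have dv:"?t \<f> ::: k ~> x" if "\<f> : B" for \<f> using dual_vector_typ[OF ks x B that] by simp_all
 have bt:"\<f> ::: x ~> k" if "\<f> : B" for \<f> using basis_typ[OF B that] by simp_all
 have nin:"L|>?t \<f> o dl0 k o \<f> : Hom x (L$x)" if "\<f> : B" for \<f>
  using dv[OF that] bt[OF that] k by (simp add: hom_iff)
 have Lx:"L$x : Obj A" using x by simp
 show ?P1 unfolding N_def by (rule hsum_in[OF x Lx nin])
 have Ns:"N o s=hsum (Dom A s) (L$x) B (%\<f>. (L|>?t \<f> o dl0 k o \<f>) o s)" if "arr s" "Cod A s=x" for s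
  unfolding N_def by (rule hsum_comp[OF basis_finite[OF B] nin that(1) Lx that(2)])
 {
  assume t:"t : Hom k x"
  then have t':"arr t" "Dom A t=k" "Cod A t=x" by (simp_all add: hom_iff)
  have sc:"dl0 k o f=L|>f o dl0 k" if f:"f : Hom k k" for f
  proof -
   obtain c where "f = c*.\<i> k" using schur_scalar[OF ks f] by blast
   then show ?thesis using k by simp
  qed
  have "N o t=hsum k (L$x) B (%\<f>. (L|>?t \<f> o dl0 k o \<f>) o t)" using Ns[OF t'(1,3)] t' by simp
  also have "...=hsum k (L$x) B (%\<f>. (L|>(?t \<f> o (\<f> o t))) o dl0 k)"
  proof (rule hsum_cong[OF _ Lx])
   show "obj k" using k by simp
   fix \<f> assume p:"\<f> : B"
   note d = dv[OF p] bt[OF p]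
   have "(L|>?t \<f> o dl0 k o \<f>) o t=L|>?t \<f> o (dl0 k o (\<f> o t))" using d t' k by simp
   also have "dl0 k o (\<f> o t)=L|>(\<f> o t) o dl0 k" by (rule sc) (use d t' in \<open>simp add: hom_iff\<close>)
   finally show "(L|>?t \<f> o dl0 k o \<f>) o t=L|>(?t \<f> o (\<f> o t)) o dl0 k" using d t' k by simp
   show "L|>(?t \<f> o (\<f> o t)) o dl0 k : Hom k (L$x)" using d t' k by (simp add: hom_iff)
  qed
  also have "...=(L|>hsum k x B (%\<f>. ?t \<f> o (\<f> o t))) o dl0 k"
  proof (rule additive_hsum[symmetric, where F = "%f. (L|>f) o dl0 k", OF _ x _ Lx basis_finite[OF B]])
   show "?t \<f> o (\<f> o t) : Hom k x" if "\<f> : B" for \<f> using dv[OF that] bt[OF that] t' by (simp add: hom_iff)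
   show "L|>g o dl0 k : Hom k (L$x)" if "g : Hom k x" for g using that k by (simp add: hom_iff)
   show "L|>(g +. h) o dl0 k=L|>g o dl0 k +. (L|>h) o dl0 k" if "g : Hom k x" "h : Hom k x" for g h
   using that k by (simp add: hom_iff tensor_add add_comp)
  qed (use k in simp_all)
  also have "hsum k x B (%\<f>. ?t \<f> o (\<f> o t))=t" by (rule expand_in_dual_basis[OF ks x B t])
  finally show "N o t=L|>t o dl0 k" .
 }
 {
  assume l:"l : Rs" "l \<noteq> k" and s:"s : Hom l x"
  then have s':"arr s" "Dom A s=l" "Cod A s=x" by (simp_all add: hom_iff)
  have ni:"\<not> isomorphic A l k" using representatives(3)[OF R l(1) k] l(2) by blast
  have "(L|>?t \<f> o dl0 k o \<f>) o s=\<z> l (L$x)" if p:"\<f> : B" for \<f>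
  proof -
   have "\<f> o s=\<z> l k" by (rule schur_zero[OF R_simple[OF l(1)] ks ni]) (use bt[OF p] s' in \<open>simp add: hom_iff\<close>)
   then show ?thesis using dv[OF p] bt[OF p] s' k l x by simp
  qed
  then have "N o s=hsum l (L$x) B (%\<f>. \<z> l (L$x))"
   unfolding Ns[OF s'(1,3)] s'(2) using l Lx by (intro hsum_cong) (simp_all add: hom_iff)
  then show "N o s=\<z> l (L$x)" using l x by (simp add: hsum_zero)
 }
qed

lemma dl_on_simple:
 assumes x:"obj x" and B:"!!k. k : Rs ==> hom_basis A x k (B k)" and l:"l : Rs" and t:"t : Hom l x"
 defines "N \<equiv> %k. hsum x (L$x) (B k) (%\<f>. (L|>dual_vector A x k (B k) \<f>) o dl0 k o \<f>)"
 shows "hsum x (L$x) Rs N o t = L|>t o dl0 l"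
proof -
 note t' = homD[OF t(1)]
 have Lx:"L$x : Obj A" and lo:"obj l" using x l by simp_all
 note N = dl_component[OF x _ B, folded N_def]
 have Nin:"N k : Hom x (L$x)" if "k : Rs" for k unfolding N_def by (rule dl_component(1)[OF x that B[OF that]])
 have e:"N l o t=L|>t o dl0 l" unfolding N_def by (rule dl_component(2)[OF x l B[OF l] t])
 have z:"N k o t=\<z> l (L$x)" if "k : Rs" "k \<noteq> l" for k
  unfolding N_def using that by (intro dl_component(3)[OF x that(1) B[OF that(1)] l _ t]) simp
 have "hsum x (L$x) Rs N o t=hsum l (L$x) Rs (%k. N k o t)" using hsum_comp[OF R_finite Nin t'(1) Lx t'(3)] t'(2) by simp
 also have "...=N l o t" using z comp_in[OF t Nin[OF l]] by (intro hsum_single[OF lo Lx R_finite l, of "%k. N k o t"]) auto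
 finally show ?thesis unfolding e .
qed

lemma some_basis:"obj x ==> k : Rs ==> hom_basis A x k (SOME B. hom_basis A x k B)" by (rule someI_ex, rule hom_finite_dim) simp_all

lemma dl_in:
 assumes x:"obj x" and B:"!!k. k : Rs ==> hom_basis A x k (B k)"
 shows "hsum x (L$x) Rs (%k. hsum x (L$x) (B k) (%\<f>. (L|>dual_vector A x k (B k) \<f>) o dl0 k o \<f>)) : Hom x (L$x)"
 by (rule hsum_in) (use x dl_component(1)[OF x _ B] in simp_all)

lemma dl_typ [simp]:
 assumes "obj x"
 shows "dl x ::: x ~> L$x"
 using dl_in[OF assms some_basis[OF assms]] unfolding dl_def hom_iff by blast+

lemma dl_simple:
 assumes "obj x" "l : Rs" "t : Hom l x"
 shows "dl x o t = L|>t o dl0 l" unfolding dl_def by (rule dl_on_simple[OF assms(1) some_basis[OF assms(1)] assms(2,3)])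

lemma dl_eq_dl0:"k : Rs ==> dl k = dl0 k" using dl_simple[of k k "\<i> k"] by (simp add: hom_iff)

lemma dl_expand:
 assumes x:"obj x" and B:"!!k. k : Rs ==> hom_basis A x k (B k)"
 shows "dl x = hsum x (L$x) Rs (%k. hsum x (L$x) (B k) (%\<f>. (L|>dual_vector A x k (B k) \<f>) o dl0 k o \<f>))"
 by (rule simples_epi[OF _ dl_in[OF x B]]) (use x dl_simple[OF x] dl_on_simple[OF x B] in \<open>simp_all add: hom_iff[of "dl x"]\<close>)

text \<open>Both sides agree on arrows from representatives, by \<open>dl_component\<close>, and these are
  jointly epic.\<close>
lemma dl_natural:
 assumes f:"arr f" "Dom A f = x" "Cod A f = y"
 shows "dl y o f = L|>f o dl x"
proof (rule simples_epi)
 have o:"obj x" "obj y" using f by auto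
 show "dl y o f : Hom x (L$y)" "L|>f o dl x : Hom x (L$y)" using f o by (simp_all add: hom_iff)
 fix k t assume k:"k : Rs" and t:"t : Hom k x"
 then have t':"t ::: k ~> x" by (simp_all add: hom_iff)
 have "dl y o (f o t)=L|>(f o t) o dl0 k" by (rule dl_simple[OF o(2) k]) (use f t' in \<open>simp add: hom_iff\<close>)
 then show "(dl y o f) o t=(L|>f o dl x) o t" using f o t' k dl_simple[OF o(1) k t] by simp
qed

definition dlh ::"'o => 'o => 'm" where
 "dlh x w = \<a> L x w o dl x<|w"

lemma dlh_typ [simp]:
 assumes "obj x" "obj w"
 shows "dlh x w ::: x$w ~> L$x$w" using assms by (simp_all add: dlh_def)

lemma dlh_natural:
 assumes x:"obj x" and g:"arr g" "Dom A g = w" "Cod A g = v"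
 shows "dlh x v o x|>g = L|>x|>g o dlh x w"
proof -
 have wv:"obj w" "obj v" using g by auto
 have "dl x<|v o x|>g=(L$x)|>g o dl x<|w" using interchange[of "dl x" g] x g by simp
 then show ?thesis unfolding dlh_def using x g wv by (simp add: assoc_conj_ident)
qed

lemma dlh_natural_left:
 assumes w:"obj w" and f:"arr f" "Dom A f = x" "Cod A f = y"
 shows "dlh y w o f<|w = L|>f<|w o dlh x w"
proof -
 have o:"obj x" "obj y" using f by auto
 have 1:"dl y<|w o f<|w=(L|>f)<|w o dl x<|w" using arg_cong[OF dl_natural[OF f], of "%q. q<|w"] f w o by simp
 show ?thesis unfolding dlh_def using w f o by (simp add: 1 assoc_conj[of "\<i> L" f])
qed

lemma dlh_uJ:
 assumes i:"i : Rs" and w:"obj w"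
 shows "dlh i w = uJ i (i$w) o i|>cup i w" "uJ i w = L|>cap i w o dlh i (i^*$w)"
proof -
 let ?i = "i^*"
 have 1:"dlh i w=uJ i (i$w) o i|>cup i w" if w:"obj w" for w
 proof -
  have c:"coev A i<|w=\<b> ?i i w o cup i w o \<l> w" unfolding cup_def using i w by simp
  have q:"(i|>coev A i)<|w=\<b> i (?i$i) w o i|>(\<b> ?i i w o cup i w o \<l> w) o \<a> i \<I> w"
   using assoc_conj[of "\<i> i" "coev A i" "\<i> w"] i w by (simp del: whisker_comp add: c)
  have "dl i<|w=uJ i i<|w o (i|>coev A i)<|w o Inv (\<r> i)<|w" unfolding dl_eq_dl0[OF i] dl0_def using i w by simp
  then show ?thesis unfolding dlh_def q uJ_def using i w by (simp add: assoc_conj[of "uin i"] inv_associator_whisker inv_whisker)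
 qed
 show "dlh i w=uJ i (i$w) o i|>cup i w" by (rule 1[OF w])
 show "uJ i w=L|>cap i w o dlh i (?i$w)"
 proof -
  have n:"L|>cap i w o uJ i (i$?i$w)=uJ i w o i|>?i|>cap i w" using uJ_natural[OF i, of "cap i w"] i w by simp
  have s:"i|>?i|>cap i w o i|>cup i (?i$w)=\<i> (i$?i$w)" using arg_cong[OF snake(2)[of i w], of "%q. i|>q"] i w by simp
  have "?i$w : Obj A" using i w by simp
  from 1[OF this] show ?thesis using i w by (simp add: n[THEN tail] s)
 qed
qed

definition ubr ::"'o => 'm" where "ubr = snd (sunit A T)"

lemma sunit_eq:"sunit A T = (L, ubr)" by (simp add: ubr_def sunit_def Let_def)

text \<open>The sum over the bases in the half-braiding of the unit is the expansion of the canonical arrow at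
  \<open>b \<otimes> i\<close>.\<close>
lemma ubr_component:
 assumes b:"obj b" and i:"i : Rs"
 shows "ubr b : Hom (b$L) (L$b)"
  "ubr b o b|>uin i = L|>loop_close b i o \<a> L (b$i) i^* o dl (b$i)<|i^* o \<b> b i i^*"
proof -
 let ?d = "dual_obj A" let ?X = "b$L" and ?Y = "L$b"
 have o:"obj ?X" "obj ?Y" using b by simp_all
 have Bs:"hom_basis A (b$i) j (basis T b i j)" if "i : Rs" "j : Rs" for i j using valid b that by (simp add: valid_choice_def)
 define t where "t i j \<f> = dual_vector A (b$i) j (basis T b i j) \<f>" for i j \<f>
 define M where "M i j \<f> = uin j<|b o \<b> j (?d j) b o \<f> \<boxdot> mate_a b i j (t i j \<f>) o \<b> b i (?d i)" for i j \<f>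
 have tin:"t i j \<f> : Hom j (b$i)" if "i : Rs" "j : Rs" "\<f> : basis T b i j" for i j \<f>
  unfolding t_def by (rule dual_vector(1)[OF R_simple[OF that(2)] _ Bs[OF that(1,2)] that(3)]) (use b that in simp)
 have pin:"\<f> ::: b$i ~> j" if "i : Rs" "j : Rs" "\<f> : basis T b i j" for i j \<f>
  using basis_typ[OF Bs[OF that(1,2)] that(3)] by simp_all
 have ma:"mate_a b i j (t i j \<f>) ::: ?d i ~> ?d j$b"
  if "i : Rs" "j : Rs" "\<f> : basis T b i j" for i j \<f>
  using mate_a_hat(1)[OF b _ _ unit_typ tin[OF that]] that by (simp_all add: hom_iff)
 have Mt:"M i j \<f> ::: b$i$?d i ~> ?Y" if "i : Rs" "j : Rs" "\<f> : basis T b i j" for i j \<f>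
  using pin[OF that] ma[OF that] that b by (simp_all add: M_def)
 define S where "S i' j \<f> = M i' j \<f> o b|>upr i'" for i' j \<f>
 have Sin:"S i' j \<f> : Hom ?X ?Y" if "i' : Rs" "j : Rs" "\<f> : basis T b i' j" for i' j \<f>
  using Mt[OF that] that b by (simp add: S_def hom_iff)
 let ?S2 = "%i' j. hsum ?X ?Y (basis T b i' j) (S i' j)"
 let ?S3 = "%i'. hsum ?X ?Y Rs (?S2 i')"
 have S2:"?S2 i' j : Hom ?X ?Y" if "i' : Rs" "j : Rs" for i' j by (rule hsum_in[OF o Sin[OF that]])
 have S3:"?S3 i' : Hom ?X ?Y" if "i' : Rs" for i' by (rule hsum_in[OF o S2[OF that]])
 have ub:"ubr b=hsum ?X ?Y Rs ?S3"
 proof -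
  have "ubr b=hsum ?X ?Y Rs (%i. hsum ?X ?Y Rs (%j. hsum ?X ?Y (basis T b i j) (%\<f>.
   (uin j<|b) o \<b> j (?d j) b o \<f> \<boxdot> sharp A b i j (basis T b i j) \<f> o \<b> b i (?d i) o b|>upr i)))"
   unfolding ubr_def sunit_def Let_def using b by simp
  also have "...=hsum ?X ?Y Rs ?S3"
  proof (intro hsum_cong[OF o] S3 S2 Sin)
   fix i j \<f> assume a:"i : Rs" "j : Rs" "\<f> : basis T b i j"
   have sh:"sharp A b i j (basis T b i j) \<f>=mate_a b i j (t i j \<f>)"
   unfolding t_def by (rule sharp_mate[OF b]) (use a tin[OF a] in \<open>simp_all add: t_def\<close>)
   show "uin j<|b o \<b> j (?d j) b o \<f> \<boxdot> sharp A b i j (basis T b i j) \<f> o \<b> b i (?d i) o b|>upr i=S i j \<f>"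
   unfolding S_def M_def sh using pin[OF a] ma[OF a] a b by simp
  qed
  finally show ?thesis .
 qed
 show uin:"ubr b : Hom ?X ?Y" unfolding ub by (rule hsum_in[OF o S3])
 define V where "V = b$i$?d i"
 have V:"obj V" using b i by (simp add: V_def)
 have u:"b|>uin i : Arr A" "Dom A (b|>uin i)=V" "Cod A (b|>uin i)=?X" using b i by (simp_all add: V_def)
 have Su:"S i' j \<f> o b|>uin i=(if i'=i then M i j \<f> else \<z> V ?Y)" if a:"i' : Rs" "j : Rs" "\<f> : basis T b i' j" for i' j \<f>
 proof -
  have "b|>upr i' o b|>uin i=b|>(upr i' o uin i)" using a i b by simp
  then have e:"b|>upr i' o b|>uin i=b|>(if i'=i then \<i> (i'$?d i') else \<z> (i$?d i) (i'$?d i'))"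
   unfolding unit_sum(4)[OF a(1) i] .
  have s:"S i' j \<f> o b|>uin i=M i' j \<f> o (b|>upr i' o b|>uin i)" unfolding S_def using Mt[OF a] a i b by simp
  show ?thesis unfolding s e using Mt[OF a] a i b o by (cases "i'=i") (simp_all add: V_def)
 qed
 have comp2:"?S2 i' j o b|>uin i=hsum V ?Y (basis T b i' j) (%\<f>. S i' j \<f> o b|>uin i)" if "i' : Rs" "j : Rs" for i' j
  using hsum_comp[OF basis_finite[OF Bs[OF that]] Sin[OF that] u(1) o(2) u(3)] u(2) by simp
 have comp3:"?S3 i' o b|>uin i=hsum V ?Y Rs (%j. ?S2 i' j o b|>uin i)" if "i' : Rs" for i'
  using hsum_comp[OF R_finite S2[OF that] u(1) o(2) u(3)] u(2) by simp
 have Suin:"S i' j \<f> o (b|>uin i) : Hom V ?Y" if "i' : Rs" "j : Rs" "\<f> : basis T b i' j" for i' j \<f>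
  using Sin[OF that] u by (simp add: hom_iff)
 have off:"?S3 i' o b|>uin i=\<z> V ?Y" if i':"i' : Rs" "i' \<noteq> i" for i'
 proof -
  have "?S2 i' j o b|>uin i=\<z> V ?Y" if j:"j : Rs" for j
  proof -
   have "hsum V ?Y (basis T b i' j) (%\<f>. S i' j \<f> o b|>uin i)=hsum V ?Y (basis T b i' j) (%\<f>. \<z> V ?Y)"
   by (rule hsum_cong[OF V o(2)]) (use Su[OF i'(1) j] i' V o in \<open>simp_all add: hom_iff\<close>)
   then show ?thesis unfolding comp2[OF i'(1) j] using V o by (simp add: hsum_zero)
  qed
  then have "hsum V ?Y Rs (%j. ?S2 i' j o b|>uin i)=hsum V ?Y Rs (%j. \<z> V ?Y)"
   by (intro hsum_cong[OF V o(2)]) (use V o in \<open>simp_all add: hom_iff\<close>)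
  then show ?thesis unfolding comp3[OF i'(1)] using V o by (simp add: hsum_zero)
 qed
 have "ubr b o b|>uin i=hsum V ?Y Rs (%i'. ?S3 i' o b|>uin i)" unfolding ub using hsum_comp[OF R_finite S3 u(1) o(2) u(3)] u(2) by simp
 also have "...=?S3 i o b|>uin i" using off comp_in[OF homI[OF u] S3[OF i]]
  by (intro hsum_single[OF V o(2) R_finite i, of "%i'. ?S3 i' o b|>uin i"]) blast+
 also have "...=hsum V ?Y Rs (%j. hsum V ?Y (basis T b i j) (M i j))" unfolding comp3[OF i]
 proof (rule hsum_cong[OF V o(2)])
  fix j assume j:"j : Rs"
  have Min:"M i j \<f> : Hom V ?Y" if "\<f> : basis T b i j" for \<f> using Mt[OF i j that] by (simp add: V_def hom_iff)
  show "hsum V ?Y (basis T b i j) (M i j) : Hom V ?Y" by (rule hsum_in[OF V o(2) Min])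
  show "?S2 i j o b|>uin i=hsum V ?Y (basis T b i j) (M i j)"
   unfolding comp2[OF i j] by (rule hsum_cong[OF V o(2)]) (use Su[OF i j] Min in simp_all)
 qed
 finally have lhs:"ubr b o b|>uin i=hsum V ?Y Rs (%j. hsum V ?Y (basis T b i j) (M i j))" .
 let ?x = "b$i"
 have x:"obj ?x" and io:"obj i" "?d i : Obj A" using b i by simp_all
 define E where "E f = L|>loop_close b i o \<a> L ?x (?d i) o f<|(?d i) o \<b> b i (?d i)" for f
 have Ein:"E f : Hom V ?Y" if "f : Hom ?x (L$?x)" for f using that b io by (simp add: E_def hom_iff V_def)
 have Eadd:"E (f +. g)=E f +. E g" if "f : Hom ?x (L$?x)" "g : Hom ?x (L$?x)" for f g
  using that b io by (simp add: E_def hom_iff tensor_add add_comp comp_add)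
 let ?n = "%j \<f>. (L|>t i j \<f>) o dl0 j o \<f>"
 have nin:"?n j \<f> : Hom ?x (L$?x)" if "j : Rs" "\<f> : basis T b i j" for j \<f>
  using tin[OF i that] pin[OF i that] that by (simp add: hom_iff)
 have EM:"E (?n j \<f>)=M i j \<f>" if a:"j : Rs" "\<f> : basis T b i j" for j \<f>
 proof -
  have t':"t i j \<f> ::: j ~> ?x" using tin[OF i a] by (simp_all add: hom_iff)
  note p = pin[OF i a]
  have jo:"obj j" "?d j : Obj A" using a by simp_all
  define m where "m = loop_close b i o t i j \<f><|(?d i)"
  have m:"arr m" "Dom A m=j$?d i" "Cod A m=b" using t' b io by (simp_all add: m_def)
  have ma':"mate_a b i j (t i j \<f>)=(?d j)|>m o cup j (?d i)"
   unfolding mate_a_def m_def loop_close_def cup_def using t' b io jo by simp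
  have dh:"\<a> L j (?d i) o dl0 j<|(?d i)=uJ j (j$?d i) o j|>cup j (?d i)"
   using dlh_uJ(1)[OF a(1) io(2)] unfolding dlh_def dl_eq_dl0[OF a(1)] .
  have "E (?n j \<f>)=L|>loop_close b i o (\<a> L ?x (?d i) o (L|>t i j \<f>)<|(?d i)) o dl0 j<|(?d i) o \<f><|(?d i) o \<b> b i (?d i)"
   unfolding E_def using t' p b io a by simp
  also have "...=L|>m o (\<a> L j (?d i) o dl0 j<|(?d i)) o \<f><|(?d i) o \<b> b i (?d i)"
   unfolding m_def using t' p b io a by (simp add: assoc_conj[of "\<i> L" "t i j \<f>"])
  also have "...=(L|>m o uJ j (j$?d i)) o j|>cup j (?d i) o \<f><|(?d i) o \<b> b i (?d i)"
   unfolding dh using m p b io a jo by simp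
  also have "...=uJ j b o j|>mate_a b i j (t i j \<f>) o \<f><|(?d i) o \<b> b i (?d i)"
   unfolding uJ_natural[OF a(1) m, symmetric] ma' using m p b io a jo by simp
  also have "...=M i j \<f>"
   unfolding M_def uJ_def using ma[OF i a] p b io a jo tensor_comp'[of \<f> "\<i> j" "\<i> (?d i)" "mate_a b i j (t i j \<f>)"]
   tail[of "j|>mate_a b i j (t i j \<f>)" "\<f><|(?d i)" "\<f> \<boxdot> mate_a b i j (t i j \<f>)" "\<b> b i (?d i)"] by simp
  finally show ?thesis .
 qed
 have Lx:"L$?x : Obj A" using x by simp
 have n2:"hsum ?x (L$?x) (basis T b i j) (?n j) : Hom ?x (L$?x)" if "j : Rs" for j by (rule hsum_in[OF x Lx nin[OF that]])
 have "E (dl ?x)=E (hsum ?x (L$?x) Rs (%j. hsum ?x (L$?x) (basis T b i j) (?n j)))"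
  using dl_expand[OF x, of "basis T b i", OF Bs[OF i]] by (simp add: t_def)
 also have "...=hsum V ?Y Rs (%j. E (hsum ?x (L$?x) (basis T b i j) (?n j)))"
  by (rule additive_hsum[OF x Lx V o(2) R_finite n2 Ein Eadd])
 also have "...=hsum V ?Y Rs (%j. hsum V ?Y (basis T b i j) (M i j))"
 proof (rule hsum_cong[OF V o(2)])
  fix j assume j:"j : Rs"
  have Min:"M i j \<f> : Hom V ?Y" if "\<f> : basis T b i j" for \<f> using Mt[OF i j that] by (simp add: V_def hom_iff)
  show "hsum V ?Y (basis T b i j) (M i j) : Hom V ?Y" by (rule hsum_in[OF V o(2) Min])
  have "E (hsum ?x (L$?x) (basis T b i j) (?n j))=hsum V ?Y (basis T b i j) (%\<f>. E (?n j \<f>))"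
   by (rule additive_hsum[OF x Lx V o(2) basis_finite[OF Bs[OF i j]] nin[OF j] Ein Eadd])
  also have "...=hsum V ?Y (basis T b i j) (M i j)" by (rule hsum_cong[OF V o(2) EM[OF j] Min])
  finally show "E (hsum ?x (L$?x) (basis T b i j) (?n j))=hsum V ?Y (basis T b i j) (M i j)" .
 qed
 finally show "ubr b o b|>uin i=L|>loop_close b i o \<a> L ?x (?d i) o dl ?x<|(?d i) o \<b> b i (?d i)" unfolding lhs E_def by simp
qed

end

section \<open>The half-braiding of the unit\<close>

context fusion_representatives
begin

lemma haar_equalizes_rb:
 assumes h:"hb c H" "hb c H'" and cm:"commuting c H H'" and o:"obj b" "obj w"
 shows "b|>haar c H H'<|w o rb H c b w = b|>haar c H H'<|w o rb H' c b w"
proof (rule iso_cancel_left[of "br H c b w"])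
 note e = haar_equalizes[OF h cm] and c = hb_obj[OF h(1)]
 let ?M = "b|>haar c H H'<|w" and ?N = "haar c H H'<|(b$w)"
 have 1:"br H c b w o ?M=?N o br H c b w" by (rule hbm_br(1)[OF e(4) h(1,1) o])
 have 2:"br H c b w o ?M=?N o br H' c b w" unfolding 1 by (rule e(2)[OF o])
 have "(br H c b w o ?M) o rb H c b w=?N" unfolding 1 using h o c by simp
 moreover have "(br H c b w o ?M) o rb H' c b w=?N" unfolding 2 using h o c by simp
 ultimately show "br H c b w o (?M o rb H c b w)=br H c b w o (?M o rb H' c b w)" using h o c by simp
qed (use h o hb_obj[OF h(1)] in simp_all)

end

context centre_data
begin

lemma ubr_typ [simp]:
 assumes "obj b"
 shows "ubr b : Arr A" (is ?P1) "Dom A (ubr b) = b$L" (is ?P2) "Cod A (ubr b) = L$b" (is ?P3)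
proof -
 obtain i where "i : Rs" using representatives(2)[OF R unit_simple] by blast
 from ubr_component(1)[OF assms this]
 show ?P1 ?P2 ?P3 by (simp_all add: hom_iff)
qed

abbreviation ubh where "ubh b w \<equiv> br ubr L b w"

lemma ubh_typ [simp]:
 assumes "obj b" "obj w"
 shows "ubh b w ::: b$L$w ~> L$b$w" using assms by (simp_all add: br_def hom_iff)

lemma ubh_natural:
 assumes "obj b" "arr g" "Dom A g = w" "Cod A g = v"
 shows "ubh b v o b|>L|>g = L|>b|>g o ubh b w" unfolding br_def by (rule hat_natural) (use assms in \<open>simp_all add: hom_iff\<close>)

lemma ubh_uJ:
 assumes b:"obj b" and i:"i : Rs" and w:"obj w"
 shows "ubh b w o b|>uJ i w = L|>b|>cap i w o L|>\<a> b i (i^*$w)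
  o dlh (b$i) (i^*$w) o \<b> b i (i^*$w)"
proof -
 let ?i = "i^*" let ?x = "b$i"
 have o:"obj i" "obj ?i" "obj ?x" using b i by simp_all
 have 1:"\<b> b L w o b|>uin i<|w=(b|>uin i)<|w o \<b> b (i$?i) w"
  using b i w o by (simp add: assoc_conj[of "\<i> b" "uin i"])
 have 2:"ubr b<|w o (b|>uin i)<|w=(ubr b o b|>uin i)<|w" using b i w by simp
 have 3:"(ubr b o b|>uin i)<|w=(L|>loop_close b i)<|w o \<a> L ?x ?i<|w o (dl ?x<|?i)<|w o \<b> b i ?i<|w"
  unfolding ubr_component(2)[OF b i] using b o w by simp
 have 4:"(L|>loop_close b i)<|w=\<b> L b w o L|>(b|>cap i w o \<a> b i (?i$w) o \<a> ?x ?i w) o \<a> L (?x$?i) w"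
  unfolding loop_open_hat(2)[OF b o(1) w, symmetric] using assoc_conj[of "\<i> L" "loop_close b i" "\<i> w"] b o w by simp
 have 5:"(dl ?x<|?i)<|w=\<b> (L$?x) ?i w o dl ?x<|(?i$w) o \<a> ?x ?i w"
  using assoc_conj[of "dl ?x" "\<i> ?i" "\<i> w"] b o w by simp
 have "ubh b w o b|>uJ i w=\<a> L b w o ubr b<|w o (\<b> b L w o b|>uin i<|w) o b|>\<b> i ?i w"
  unfolding br_def hat_def uJ_def using b i w o by simp
 also have "...=\<a> L b w o (ubr b<|w o (b|>uin i)<|w) o \<b> b (i$?i) w o b|>\<b> i ?i w" unfolding 1 using b i w o by simp
 also have "...=L|>b|>cap i w o L|>\<a> b i (?i$w) o dlh ?x (?i$w) o \<b> b i (?i$w)"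
  unfolding 2 3 4 5 dlh_def using b w o by (simp add: associator_whisker[of L] inv_associator_whisker[of b])
 finally show ?thesis .
qed

text \<open>By naturality it suffices to treat representatives; there the coevaluation cancels the cap of
  \<open>ubh_uJ\<close>. The law characterizes the half-braiding of the unit.\<close>
lemma ubh_dlh:
 assumes o:"obj b" "obj x" "obj w"
 shows "ubh b (x$w) o b|>dlh x w = L|>\<a> b x w o dlh (b$x) w o \<b> b x w"
proof (rule simples_epi_inside[OF _ _ o])
 show "ubh b (x$w) o (b|>dlh x w) : Hom (b$x$w) (L$b$x$w)"
  "L|>\<a> b x w o dlh (b$x) w o \<b> b x w : Hom (b$x$w) (L$b$x$w)" using o by (simp_all add: hom_iff)
 fix k t assume k:"k : Rs" and t:"t : Hom k x"
 let ?k = "k^*"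
 have t':"arr t" "Dom A t=k" "Cod A t=x" and ko:"obj k" "obj ?k" using t k by (simp_all add: hom_iff)
 have base:"ubh b (k$w) o b|>dlh k w=L|>\<a> b k w o dlh (b$k) w o \<b> b k w"
 proof -
  let ?v = "?k$k$w"
  have v:"obj ?v" "k$w : Obj A" using ko o by simp_all
  have 1:"\<b> b k ?v o b|>k|>cup k w=(b$k)|>cup k w o \<b> b k w" using o ko by (simp add: assoc_conj_ident)
  have 2:"dlh (b$k) ?v o (b$k)|>cup k w=L|>(b$k)|>cup k w o dlh (b$k) w" by (rule dlh_natural) (use o ko in simp_all)
  have 3:"L|>\<a> b k ?v o L|>(b$k)|>cup k w=L|>b|>k|>cup k w o L|>\<a> b k w" using o ko by (simp add: assoc_conj_ident)
  have 4:"L|>b|>cap k (k$w) o L|>b|>k|>cup k w=\<i> (L$b$k$w)"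
   using arg_cong[OF snake(1)[OF ko(1) o(3)], of "%q. L|>b|>q"] o ko by simp
  have "ubh b (k$w) o b|>dlh k w=(ubh b (k$w) o b|>uJ k (k$w)) o b|>k|>cup k w" unfolding dlh_uJ(1)[OF k o(3)] using o ko k by simp
  also have "...=L|>\<a> b k w o dlh (b$k) w o \<b> b k w"
   unfolding ubh_uJ[OF o(1) k v(2)] using o ko by (simp add: 1 2[THEN tail] 3[THEN tail] 4[THEN tail])
  finally show ?thesis .
 qed
 have n1:"dlh x w o t<|w=L|>t<|w o dlh k w" by (rule dlh_natural_left[OF o(3) t'])
 have n1':"b|>dlh x w o b|>t<|w=b|>L|>t<|w o b|>dlh k w" using arg_cong[OF n1, of "%q. b|>q"] t' o ko by simp
 have n2:"ubh b (x$w) o b|>L|>t<|w=L|>b|>t<|w o ubh b (k$w)" by (rule ubh_natural) (use t' o ko in simp_all)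
 have n3:"\<b> b x w o b|>t<|w=(b|>t)<|w o \<b> b k w" using t' o ko by (simp add: assoc_conj[of "\<i> b" t])
 have n4:"dlh (b$x) w o (b|>t)<|w=L|>(b|>t)<|w o dlh (b$k) w" by (rule dlh_natural_left) (use t' o ko in simp_all)
 have n5:"L|>\<a> b x w o L|>(b|>t)<|w=L|>b|>t<|w o L|>\<a> b k w" using t' o ko by (simp add: assoc_conj[of "\<i> b" t])
 show "(ubh b (x$w) o b|>dlh x w) o b|>t<|w=(L|>\<a> b x w o dlh (b$x) w o \<b> b x w) o b|>t<|w"
  using t' o ko by (simp add: n1' n2[THEN tail] base n3 n4[THEN tail] n5[THEN tail])
qed

lemma unit_joint_epi2:
 assumes f:"f : Hom (b$a$L$w) y" "g : Hom (b$a$L$w) y" and o:"obj b" "obj a" "obj w"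
  and eq:"!!i. i : Rs ==> f o b|>a|>uJ i w = g o b|>a|>uJ i w"
 shows "f = g"
proof -
 have t:"f ::: b$a$L$w ~> y" "g ::: b$a$L$w ~> y" using f by (simp_all add: hom_iff)
 have "f o \<a> b a (L$w)=g o \<a> b a (L$w)"
 proof (rule unit_joint_epi[of _ "b$a" w y])
  show "f o \<a> b a (L$w) : Hom ((b$a)$L$w) y" "g o \<a> b a (L$w) : Hom ((b$a)$L$w) y"
   using t o by (simp_all add: hom_iff)
  fix i assume i:"i : Rs"
  have "(f o b|>a|>uJ i w) o \<a> b a (i$i^*$w)=(g o b|>a|>uJ i w) o \<a> b a (i$i^*$w)" using eq[OF i] by simp
  then show "(f o \<a> b a (L$w)) o (b$a)|>uJ i w=(g o \<a> b a (L$w)) o (b$a)|>uJ i w" using t o i by (simp add: assoc_conj_ident)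
 qed (use o in simp_all)
 then show ?thesis by (rule iso_cancel_right[rotated -1]) (use t o in simp_all)
qed

lemma unit_joint_epi0:
 assumes f:"f : Hom (L$w) y" "g : Hom (L$w) y" and o:"obj w"
  and eq:"!!i. i : Rs ==> f o uJ i w = g o uJ i w"
 shows "f = g"
proof -
 have t:"f ::: L$w ~> y" "g ::: L$w ~> y" using f by (simp_all add: hom_iff)
 have "f o \<l> (L$w)=g o \<l> (L$w)"
 proof (rule unit_joint_epi[of _ "\<I>" w y])
  show "f o \<l> (L$w) : Hom (\<I>$L$w) y" "g o \<l> (L$w) : Hom (\<I>$L$w) y" using t o by (simp_all add: hom_iff)
  fix i assume i:"i : Rs"
  have "(f o uJ i w) o \<l> (i$i^*$w)=(g o uJ i w) o \<l> (i$i^*$w)" using eq[OF i] by simp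
  then show "(f o \<l> (L$w)) o \<I>|>uJ i w=(g o \<l> (L$w)) o \<I>|>uJ i w" using t o i by (simp add: unit_whisker)
 qed (use o in simp_all)
 then show ?thesis by (rule iso_cancel_right[rotated -1]) (use t o in simp_all)
qed

text \<open>Each law is checked on the summands of \<open>L\<close>, where it follows from naturality of the
  canonical arrows. Invertibility comes from \<open>lax_invertible\<close>.\<close>
lemma ubr_lax:"lax L ubr" unfolding lax_def
proof (intro conjI ballI)
 fix f w assume f:"arr f" and w:"obj w"
 define x y where "x = Dom A f" and "y = Cod A f"
 have f':"arr f" "Dom A f=x" "Cod A f=y" "obj x" "obj y" using f by (simp_all add: x_def y_def)
 show "ubh (Cod A f) w o f<|(L$w)=L|>f<|w o ubh (Dom A f) w" unfolding f'(2,3)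
 proof (rule unit_joint_epi[of _ x w "L$y$w"])
  show "ubh y w o (f<|(L$w)) : Hom (x$L$w) (L$y$w)" "L|>f<|w o ubh x w : Hom (x$L$w) (L$y$w)"
   using f' w by (simp_all add: hom_iff)
  fix i assume i:"i : Rs"
  let ?v = "i^*$w"
  have io:"obj i" "obj ?v" using i w by simp_all
  have 1:"f<|(L$w) o x|>uJ i w=y|>uJ i w o f<|(i$?v)" by (rule interchange) (use f' i w in simp_all)
  have 2:"\<b> y i ?v o f<|(i$?v)=(f<|i)<|?v o \<b> x i ?v" using f' io by (simp add: assoc_conj[of f "\<i> i"])
  have 3:"dlh (y$i) ?v o (f<|i)<|?v=L|>(f<|i)<|?v o dlh (x$i) ?v" by (rule dlh_natural_left) (use f' io in simp_all)
  have 4:"L|>\<a> y i ?v o L|>(f<|i)<|?v=L|>f<|(i$?v) o L|>\<a> x i ?v" using f' io by (simp add: assoc_conj[of f "\<i> i"])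
  have 5:"L|>y|>cap i w o L|>f<|(i$?v)=L|>f<|w o L|>x|>cap i w"
   using arg_cong[OF interchange[of f "cap i w" x y "i$?v" w], of "%q. L|>q"] f' io w by simp
  show "(ubh y w o f<|(L$w)) o x|>uJ i w=(L|>f<|w o ubh x w) o x|>uJ i w"
   using f' i io w by (simp add: 1 ubh_uJ ubh_uJ[THEN tail] 2 3[THEN tail] 4[THEN tail] 5[THEN tail])
 qed (use f' w in simp_all)
next
 fix b b' w assume o:"obj b" "obj b'" "obj w"
 show "L|>\<a> b b' w o ubh (b$b') w=ubh b (b'$w) o b|>ubh b' w o \<a> b b' (L$w)"
 proof (rule unit_joint_epi[of _ "b$b'" w "L$b$b'$w"])
  show "L|>\<a> b b' w o ubh (b$b') w : Hom ((b$b')$L$w) (L$b$b'$w)"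
   "ubh b (b'$w) o b|>ubh b' w o \<a> b b' (L$w) : Hom ((b$b')$L$w) (L$b$b'$w)" using o by (simp_all add: hom_iff)
  fix i assume i:"i : Rs"
  let ?v = "i^*$w"
  have io:"obj i" "obj ?v" using i o by simp_all
  have 1:"\<a> b b' (L$w) o (b$b')|>uJ i w=b|>b'|>uJ i w o \<a> b b' (i$?v)" using o i io by (simp add: assoc_conj_ident)
  have 2:"b|>ubh b' w o b|>b'|>uJ i w=b|>L|>b'|>cap i w o b|>L|>\<a> b' i ?v o b|>dlh (b'$i) ?v o b|>\<b> b' i ?v"
   using arg_cong[OF ubh_uJ[OF o(2) i o(3)], of "%q. b|>q"] o i io by simp
  have 3:"ubh b (b'$w) o b|>L|>b'|>cap i w=L|>b|>b'|>cap i w o ubh b (b'$i$?v)" by (rule ubh_natural) (use o io in simp_all)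
  have 4:"ubh b (b'$i$?v) o b|>L|>\<a> b' i ?v=L|>b|>\<a> b' i ?v o ubh b ((b'$i)$?v)" by (rule ubh_natural) (use o io in simp_all)
  have F:"ubh b ((b'$i)$?v) o b|>dlh (b'$i) ?v=L|>\<a> b (b'$i) ?v o dlh (b$b'$i) ?v o \<b> b (b'$i) ?v"
   by (rule ubh_dlh) (use o io in simp_all)
  have R:"(ubh b (b'$w) o b|>ubh b' w o \<a> b b' (L$w)) o (b$b')|>uJ i w
   = L|>b|>b'|>cap i w o L|>b|>\<a> b' i ?v o L|>\<a> b (b'$i) ?v o dlh (b$b'$i) ?v
   o \<b> b (b'$i) ?v o b|>\<b> b' i ?v o \<a> b b' (i$?v)"
   using o i io by (simp add: 1 2[THEN tail] 3[THEN tail] 4[THEN tail] F[THEN tail])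
  have N:"dlh (b$b'$i) ?v o \<a> b b' i<|?v=L|>\<a> b b' i<|?v o dlh ((b$b')$i) ?v" by (rule dlh_natural_left) (use o io in simp_all)
  have P:"\<b> b (b'$i) ?v o b|>\<b> b' i ?v o \<a> b b' (i$?v)=\<a> b b' i<|?v o \<b> (b$b') i ?v"
   using o io by (simp add: associator_whisker)
  have Q:"L|>b|>\<a> b' i ?v o L|>\<a> b (b'$i) ?v o L|>\<a> b b' i<|?v=L|>\<a> b b' (i$?v) o L|>\<a> (b$b') i ?v"
   using arg_cong[OF pentagon[OF o(1,2) io], of "%q. L|>q"] o io by simp
  have S:"L|>b|>b'|>cap i w o L|>\<a> b b' (i$?v)=L|>\<a> b b' w o L|>(b$b')|>cap i w" using o io by (simp add: assoc_conj_ident)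
  have Q':"L|>b|>\<a> b' i ?v o L|>\<a> b (b'$i) ?v o L|>\<a> b b' i<|?v o r=L|>\<a> b b' (i$?v) o L|>\<a> (b$b') i ?v o r"
   if "arr r" "Cod A r = L$((b$b')$i)$?v" for r using tail3[OF Q, of r] that o io by simp
  have e:"(ubh b (b'$w) o b|>ubh b' w o \<a> b b' (L$w)) o (b$b')|>uJ i w
   = L|>\<a> b b' w o L|>(b$b')|>cap i w o L|>\<a> (b$b') i ?v o dlh ((b$b')$i) ?v o \<b> (b$b') i ?v"
   unfolding R P using o io by (simp add: N[THEN tail] Q' S[THEN tail])
  show "(L|>\<a> b b' w o ubh (b$b') w) o (b$b')|>uJ i w=(ubh b (b'$w) o b|>ubh b' w o \<a> b b' (L$w)) o (b$b')|>uJ i w"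
   unfolding e using ubh_uJ[of "b$b'" i w] o i io by simp
 qed (use o in simp_all)
next
 fix w assume w:"obj w"
 show "L|>\<l> w o ubh \<I> w=\<l> (L$w)"
 proof (rule unit_joint_epi[of _ "\<I>" w "L$w"])
  fix i assume i:"i : Rs"
  let ?v = "i^*$w"
  have io:"obj i" "obj ?v" using i w by simp_all
  have 1:"L|>\<l> w o L|>\<I>|>cap i w=L|>cap i w o L|>\<l> (i$?v)" using io w by (simp add: unit_whisker)
  have 2:"L|>\<l> (i$?v) o L|>\<a> \<I> i ?v=L|>\<l> i<|?v" using io by (simp add: left_unitor_whisker)
  have 3:"L|>\<l> i<|?v o dlh (\<I>$i) ?v=dlh i ?v o \<l> i<|?v" by (rule dlh_natural_left[symmetric]) (use io in simp_all)
  have 4:"\<l> i<|?v o \<b> \<I> i ?v=\<l> (i$?v)" using io by (simp add: left_unitor_whisker)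
  have "(L|>\<l> w o ubh \<I> w) o \<I>|>uJ i w=(L|>cap i w o dlh i ?v) o \<l> (i$?v)"
   using i io w ubh_uJ[of "\<I>" i w] by (simp add: 1[THEN tail] 2[THEN tail] 3[THEN tail] 4)
  then show "(L|>\<l> w o ubh \<I> w) o \<I>|>uJ i w=\<l> (L$w) o \<I>|>uJ i w"
   unfolding dlh_uJ(2)[OF i w, symmetric] using i w by (simp add: unit_whisker)
 qed (use w in \<open>simp_all add: hom_iff\<close>)
qed (simp_all add: hom_iff)

lemma sunit_hb [simp]:"hb L ubr"
proof (rule hbI)
 show "ubr \<in> extensional (Obj A)" by (simp add: ubr_def sunit_def Let_def)
 show "iso_arr A (ubr b)" "ubr b : Hom (b$L) (L$b)" if "obj b" for b
  using lax_invertible[OF ubr_lax that] that by (simp_all add: hom_iff)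
qed (use ubr_lax in \<open>unfold lax_def, blast+\<close>)

lemma unit_extract:
 assumes a:"obj a" "obj y" and G:"!!i. i : Rs ==> G i : Hom (a$i$i^*) y" and k:"k : Rs"
 shows "hsum (a$L) y Rs (%i. G i o a|>upr i) : Hom (a$L) y" (is ?P1)
  "hsum (a$L) y Rs (%i. G i o a|>upr i) o a|>uin k = G k" (is ?P2)
proof -
 let ?V = "a$k$k^*"
 have t:"G i ::: a$i$i^* ~> y" if "i : Rs" for i using G[OF that] by (simp_all add: hom_iff)
 have o:"a$L : Obj A" "obj ?V" using a k by simp_all
 have sin:"G i o (a|>upr i) : Hom (a$L) y" if "i : Rs" for i using t[OF that] that a by (simp add: hom_iff)
 show ?P1 by (rule hsum_in[OF o(1) a(2) sin])
 have c:"(G i o a|>upr i) o a|>uin k=(if i=k then G k else \<z> ?V y)" if i:"i : Rs" for i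
 proof -
  have "(G i o a|>upr i) o a|>uin k=G i o a|>(upr i o uin k)" using t[OF i] i k a by simp
  then show ?thesis unfolding unit_sum(4)[OF i k] using t[OF i] i k a by (cases "i=k") simp_all
 qed
 have "hsum (a$L) y Rs (%i. G i o a|>upr i) o a|>uin k=hsum ?V y Rs (%i. (G i o a|>upr i) o a|>uin k)"
  using hsum_comp[of Rs "%i. G i o a|>upr i" "a$L" y "a|>uin k"] sin k a by simp
 also have "...=(G k o a|>upr k) o a|>uin k"
  using c G k by (intro hsum_single[OF o(2) a(2) R_finite k, of "%i. (G i o a|>upr i) o a|>uin k"]) simp_all
 finally show ?P2 using c[OF k] by simp
qed

lemma unit_extract_left:
 assumes a:"obj a" "obj y" and G:"!!i. i : Rs ==> G i : Hom ((i$i^*)$a) y" and k:"k : Rs"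
 shows "hsum (L$a) y Rs (%i. G i o upr i<|a) : Hom (L$a) y" (is ?P1)
  "hsum (L$a) y Rs (%i. G i o upr i<|a) o uin k<|a = G k" (is ?P2)
proof -
 let ?V = "(k$k^*)$a"
 have t:"G i ::: (i$i^*)$a ~> y" if "i : Rs" for i using G[OF that] by (simp_all add: hom_iff)
 have o:"L$a : Obj A" "obj ?V" using a k by simp_all
 have sin:"G i o (upr i<|a) : Hom (L$a) y" if "i : Rs" for i using t[OF that] that a by (simp add: hom_iff)
 show ?P1 by (rule hsum_in[OF o(1) a(2) sin])
 have c:"(G i o upr i<|a) o uin k<|a=(if i=k then G k else \<z> ?V y)" if i:"i : Rs" for i
 proof -
  have "(G i o upr i<|a) o uin k<|a=G i o (upr i o uin k)<|a" using t[OF i] i k a by simp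
  then show ?thesis unfolding unit_sum(4)[OF i k] using t[OF i] i k a by (cases "i=k") simp_all
 qed
 have "hsum (L$a) y Rs (%i. G i o upr i<|a) o uin k<|a=hsum ?V y Rs (%i. (G i o upr i<|a) o uin k<|a)"
  using hsum_comp[of Rs "%i. G i o upr i<|a" "L$a" y "uin k<|a"] sin k a by simp
 also have "...=(G k o upr k<|a) o uin k<|a"
  using c G k by (intro hsum_single[OF o(2) a(2) R_finite k, of "%i. (G i o upr i<|a) o uin k<|a"]) simp_all
 finally show ?P2 using c[OF k] by simp
qed

end

context centre_data
begin

abbreviation uobj where "uobj \<equiv> (L, ubr)"

lemma uobj_zobj [simp]:"zobj uobj" by (simp add: zobj_def)

section \<open>The action of the unit\<close>

text \<open>On the \<open>i\<close>-th summand, \<open>i\<close> moves across \<open>a\<close> by the symmetry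
  and back by the half-braiding, and is then annihilated with its dual.\<close>
definition act ::"('o, 'm) centre_obj => 'm" where
 "act z = hsum (fst z$L) (fst z) Rs (%i. (loop_close (fst z) i o (snd z i o \<s> (fst z) i)<|i^*
   o \<b> (fst z) i i^*) o (fst z)|>upr i)"

lemma act_uin:
 assumes Z:"zobj z" and k:"k : Rs"
 shows "act z : Hom (fst z$L) (fst z)" (is ?P1)
  "act z o (fst z)|>uin k = loop_close (fst z) k o (snd z k o \<s> (fst z) k)<|k^* o \<b> (fst z) k k^*" (is ?P2)
proof -
 have G:"loop_close (fst z) i o (snd z i o \<s> (fst z) i)<|i^* o \<b> (fst z) i i^* : Hom (fst z$i$i^*) (fst z)"
  if "i : Rs" for i
 proof -
  define a H where "a = fst z" and "H = snd z"
  have h:"hb a H" "obj a" using Z by (simp_all add: a_def H_def)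
  show ?thesis unfolding a_def[symmetric] H_def[symmetric] using h that by (simp add: hom_iff)
 qed
 show ?P1 unfolding act_def by (rule unit_extract(1)[OF _ _ G k]) (use Z in simp_all)
 show ?P2
  unfolding act_def by (rule unit_extract(2)[OF _ _ G k]) (use Z in simp_all)
qed

lemma some_simple:"\<exists>k. k : Rs" using representatives(2)[OF R unit_simple] by blast

lemma act_typ [simp]:
 assumes "zobj z"
 shows "act z : Arr A" "Dom A (act z) = fst z$L" "Cod A (act z) = fst z" using act_uin(1)[OF assms] some_simple by (auto simp: hom_iff)

definition acth ::"('o, 'm) centre_obj => 'o => 'm" where
 "acth z w = act z<|w o \<b> (fst z) L w"

lemma acth_typ [simp]:
 assumes "zobj z" "obj w"
 shows "acth z w ::: fst z$L$w ~> fst z$w" using assms by (simp_all add: acth_def)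

lemma acth_natural:
 assumes Z:"zobj z" and g:"arr g" "Dom A g = w" "Cod A g = v"
 shows "acth z v o (fst z)|>L|>g = (fst z)|>g o acth z w"
proof -
 have wv:"obj w" "obj v" using g by auto
 have 1:"act z<|v o (fst z$L)|>g=(fst z)|>g o act z<|w" by (rule interchange) (use Z g in simp_all)
 have 2:"\<b> (fst z) L v o (fst z)|>L|>g=(fst z$L)|>g o \<b> (fst z) L w" using Z g wv by (simp add: assoc_conj_ident)
 show ?thesis unfolding acth_def using Z g wv by (simp add: 2 1[THEN tail])
qed

lemma acth_uJ:
 assumes Z:"zobj z" and i:"i : Rs" and w:"obj w"
 shows "acth z w o (fst z)|>uJ i w = (fst z)|>cap i w o br (snd z) (fst z) i (i^*$w) o sw (fst z) i (i^*$w)"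
proof -
 let ?a = "fst z" and ?H = "snd z" and ?i = "i^*" let ?v = "?i$w"
 have o:"obj ?a" "obj i" "obj ?i" "obj ?v" "hb ?a ?H" using Z i w by simp_all
 define N where "N = ?H i o \<s> ?a i"
 have N0:"H i o \<s> a i : Hom (a$i) (a$i)"
  "(H i o \<s> a i)<|?v = \<b> a i ?v o br H a i ?v o sw a i ?v o \<a> a i ?v" if "hb a H" "obj a" for a H
  using that o by (simp_all add: hom_iff br_def sw_def hat_def)
 have N:"N ::: ?a$i ~> ?a$i" using N0(1)[OF o(5,1)] by (simp_all only: N_def hom_iff)
 have Nw:"N<|?v=\<b> ?a i ?v o br ?H ?a i ?v o sw ?a i ?v o \<a> ?a i ?v" unfolding N_def by (rule N0(2)[OF o(5,1)])
 have 1:"\<b> ?a L w o ?a|>uin i<|w=(?a|>uin i)<|w o \<b> ?a (i$?i) w"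
  using o i w by (simp add: assoc_conj[of "\<i> ?a" "uin i"])
 have 2:"act z<|w o (?a|>uin i)<|w=loop_close ?a i<|w o (N<|?i)<|w o \<b> ?a i ?i<|w"
  using arg_cong[OF act_uin(2)[OF Z i, folded N_def], of "%q. q<|w"] N Z o i w by simp
 have "acth z w o ?a|>uJ i w=(act z<|w o (?a|>uin i)<|w) o \<b> ?a (i$?i) w o ?a|>\<b> i ?i w"
  unfolding acth_def uJ_def using Z o i w by (simp add: 1[THEN tail])
 also have "...=?a|>cap i w o \<a> ?a i ?v o N<|?v o \<b> ?a i ?v"
  unfolding 2 loop_open_hat(2)[OF o(1,2) w] using N o w by (simp add: assoc_conj[of N] inv_associator_whisker)
 also have "...=?a|>cap i w o br ?H ?a i ?v o sw ?a i ?v" unfolding Nw using o w by simp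
 finally show ?thesis .
qed

text \<open>The action undoes the canonical arrow and leaves the double crossing of \<open>x\<close> with
  \<open>a\<close>.\<close>
lemma acth_dlh:
 assumes Z:"zobj z" and o:"obj x" "obj w"
 shows "acth z (x$w) o (fst z)|>dlh x w = br (snd z) (fst z) x w o sw (fst z) x w"
proof (rule simples_epi_inside[OF _ _ zobj_fst[OF Z] o])
 let ?a = "fst z" and ?H = "snd z"
 have a:"obj ?a" "hb ?a ?H" using Z by simp_all
 show "acth z (x$w) o (?a|>dlh x w) : Hom (?a$x$w) (?a$x$w)" "br ?H ?a x w o sw ?a x w : Hom (?a$x$w) (?a$x$w)"
  using Z a o by (simp_all add: hom_iff)
 fix k t assume k:"k : Rs" and t:"t : Hom k x"
 let ?k = "k^*" let ?v = "?k$k$w"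
 have t':"arr t" "Dom A t=k" "Cod A t=x" and ko:"obj k" "obj ?k" "obj ?v" "k$w : Obj A" using t k o by (simp_all add: hom_iff)
 have base:"acth z (k$w) o ?a|>dlh k w=br ?H ?a k w o sw ?a k w"
 proof -
  have 1:"sw ?a k ?v o ?a|>k|>cup k w=k|>?a|>cup k w o sw ?a k w" by (rule sw_natural) (use a o ko in simp_all)
  have 2:"br ?H ?a k ?v o k|>?a|>cup k w=?a|>k|>cup k w o br ?H ?a k w" by (rule br_natural(1)) (use a o ko in simp_all)
  have 3:"?a|>cap k (k$w) o ?a|>k|>cup k w=\<i> (?a$k$w)"
   using arg_cong[OF snake(1)[OF ko(1) o(2)], of "%q. ?a|>q"] a o ko by simp
  have "acth z (k$w) o ?a|>dlh k w=(acth z (k$w) o ?a|>uJ k (k$w)) o ?a|>k|>cup k w"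
   unfolding dlh_uJ(1)[OF k o(2)] using Z a o ko k by simp
  also have "...=br ?H ?a k w o sw ?a k w" unfolding acth_uJ[OF Z k ko(4)] using a o ko by (simp add: 1 2[THEN tail] 3[THEN tail])
  finally show ?thesis .
 qed
 have n1:"?a|>dlh x w o ?a|>t<|w=?a|>L|>t<|w o ?a|>dlh k w"
  using arg_cong[OF dlh_natural_left[OF o(2) t'], of "%q. ?a|>q"] t' a o ko by simp
 have n2:"acth z (x$w) o ?a|>L|>t<|w=?a|>t<|w o acth z (k$w)" by (rule acth_natural[OF Z]) (use t' o ko in simp_all)
 have n3:"sw ?a x w o ?a|>t<|w=t<|(?a$w) o sw ?a k w" by (rule sw_natural_right) (use t' a o in simp_all)
 have n4:"br ?H ?a x w o t<|(?a$w)=?a|>t<|w o br ?H ?a k w" by (rule br_natural_left[OF a(2) o(2) t'])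
 show "(acth z (x$w) o ?a|>dlh x w) o ?a|>t<|w=(br ?H ?a x w o sw ?a x w) o ?a|>t<|w"
  using t' Z a o ko by (simp add: n1 n2[THEN tail] base n3 n4[THEN tail])
qed

lemma sw_uJ:
 assumes b:"obj b" and i:"i : Rs" and w:"obj w"
 shows "sw b L w o b|>uJ i w = uJ i (b$w) o i|>sw b i^* w o sw b i (i^*$w)"
  "sw L b w o uJ i (b$w) = b|>uJ i w o sw i b (i^*$w) o i|>sw i^* b w"
proof -
 let ?i = "i^*"
 have o:"obj i" "obj ?i" using i by simp_all
 have 1:"sw b L w o b|>uin i<|w=uin i<|(b$w) o sw b (i$?i) w" by (rule sw_natural_right) (use b i w in simp_all)
 show "sw b L w o b|>uJ i w=uJ i (b$w) o i|>sw b ?i w o sw b i (?i$w)"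
  unfolding uJ_def using b i w o by (simp add: 1[THEN tail] sw_tensor_right)
 have 2:"sw L b w o uin i<|(b$w)=b|>uin i<|w o sw (i$?i) b w" by (rule sw_natural_left) (use b i w in simp_all)
 show "sw L b w o uJ i (b$w)=b|>uJ i w o sw i b (?i$w) o i|>sw ?i b w"
  unfolding uJ_def using b i w o by (simp add: 2[THEN tail] sw_tensor_left)
qed

lemma act_on_right:
 assumes Z:"zobj z" and o:"obj b" "obj w"
 shows "br (snd z) (fst z) b w o b|>acth z w = acth z (b$w) o (fst z)|>ubh b w o sw b (fst z) (L$w)"
proof (rule unit_joint_epi2[OF _ _ o(1) zobj_fst[OF Z] o(2)])
 let ?a = "fst z" and ?H = "snd z"
 have a:"obj ?a" "hb ?a ?H" using Z by simp_all
 show "br ?H ?a b w o (b|>acth z w) : Hom (b$?a$L$w) (?a$b$w)"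
  "acth z (b$w) o ?a|>ubh b w o sw b ?a (L$w) : Hom (b$?a$L$w) (?a$b$w)" using Z a o by (simp_all add: hom_iff)
 fix i assume i:"i : Rs"
 let ?v = "i^*$w"
 have io:"obj i" "obj ?v" using i o by simp_all
 have 1:"b|>acth z w o b|>?a|>uJ i w=b|>?a|>cap i w o b|>br ?H ?a i ?v o b|>sw ?a i ?v"
  using arg_cong[OF acth_uJ[OF Z i o(2)], of "%q. b|>q"] Z a o i io by simp
 have 2:"br ?H ?a b w o b|>?a|>cap i w=?a|>b|>cap i w o br ?H ?a b (i$?v)" by (rule br_natural(1)) (use a o io in simp_all)
 have l:"(br ?H ?a b w o b|>acth z w) o b|>?a|>uJ i w
  = ?a|>b|>cap i w o br ?H ?a b (i$?v) o b|>br ?H ?a i ?v o b|>sw ?a i ?v" using Z a o i io by (simp add: 1 2[THEN tail])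
 have 3:"sw b ?a (L$w) o b|>?a|>uJ i w=?a|>b|>uJ i w o sw b ?a (i$?v)" by (rule sw_natural) (use a o i io in simp_all)
 have 4:"?a|>ubh b w o ?a|>b|>uJ i w=?a|>L|>b|>cap i w o ?a|>L|>\<a> b i ?v o ?a|>dlh (b$i) ?v o ?a|>\<b> b i ?v"
  using arg_cong[OF ubh_uJ[OF o(1) i o(2)], of "%q. ?a|>q"] a o i io by simp
 have 5:"acth z (b$w) o ?a|>L|>b|>cap i w=?a|>b|>cap i w o acth z (b$i$?v)" by (rule acth_natural[OF Z]) (use o io in simp_all)
 have 6:"acth z (b$i$?v) o ?a|>L|>\<a> b i ?v=?a|>\<a> b i ?v o acth z ((b$i)$?v)" by (rule acth_natural[OF Z]) (use o io in simp_all)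
 have 7:"acth z ((b$i)$?v) o ?a|>dlh (b$i) ?v=br ?H ?a (b$i) ?v o sw ?a (b$i) ?v" by (rule acth_dlh[OF Z]) (use o io in simp_all)
 have "(acth z (b$w) o ?a|>ubh b w o sw b ?a (L$w)) o b|>?a|>uJ i w
  = ?a|>b|>cap i w o ?a|>\<a> b i ?v o (br ?H ?a (b$i) ?v o sw ?a (b$i) ?v) o ?a|>\<b> b i ?v o sw b ?a (i$?v)"
  using Z a o i io by (simp add: 3 4[THEN tail] 5[THEN tail] 6[THEN tail] 7[THEN tail])
 also have "...=?a|>b|>cap i w o br ?H ?a b (i$?v) o b|>br ?H ?a i ?v o b|>sw ?a i ?v"
  using a o io by (simp add: br_tensor sw_tensor_right)
 finally show "(br ?H ?a b w o b|>acth z w) o b|>?a|>uJ i w=(acth z (b$w) o ?a|>ubh b w o sw b ?a (L$w)) o b|>?a|>uJ i w"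
  unfolding l by simp
qed

lemma act_on_left:
 assumes Z:"zobj z" and o:"obj b" "obj w"
 shows "br (snd z) (fst z) b w o b|>acth z w = acth z (b$w) o (fst z)|>sw b L w o br (snd z) (fst z) b (L$w)"
proof (rule unit_joint_epi2[OF _ _ o(1) zobj_fst[OF Z] o(2)])
 let ?a = "fst z" and ?H = "snd z"
 have a:"obj ?a" "hb ?a ?H" using Z by simp_all
 show "br ?H ?a b w o (b|>acth z w) : Hom (b$?a$L$w) (?a$b$w)"
  "acth z (b$w) o ?a|>sw b L w o br ?H ?a b (L$w) : Hom (b$?a$L$w) (?a$b$w)" using Z a o by (simp_all add: hom_iff)
 fix i assume i:"i : Rs"
 let ?i = "i^*" let ?v = "?i$w"
 have io:"obj i" "obj ?i" "obj ?v" "b$w : Obj A" using i o by simp_all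
 have 1:"b|>acth z w o b|>?a|>uJ i w=b|>?a|>cap i w o b|>br ?H ?a i ?v o b|>sw ?a i ?v"
  using arg_cong[OF acth_uJ[OF Z i o(2)], of "%q. b|>q"] Z a o i io by simp
 have 2:"br ?H ?a b w o b|>?a|>cap i w=?a|>b|>cap i w o br ?H ?a b (i$?v)" by (rule br_natural(1)) (use a o io in simp_all)
 have l:"(br ?H ?a b w o b|>acth z w) o b|>?a|>uJ i w
  = ?a|>b|>cap i w o br ?H ?a b (i$?v) o b|>br ?H ?a i ?v o b|>sw ?a i ?v" using Z a o i io by (simp add: 1 2[THEN tail])
 have 3:"br ?H ?a b (L$w) o b|>?a|>uJ i w=?a|>b|>uJ i w o br ?H ?a b (i$?v)" by (rule br_natural(1)) (use a o i io in simp_all)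
 have 4:"?a|>sw b L w o ?a|>b|>uJ i w=?a|>uJ i (b$w) o ?a|>i|>sw b ?i w o ?a|>sw b i ?v"
  using arg_cong[OF sw_uJ(1)[OF o(1) i o(2)], of "%q. ?a|>q"] a o i io by simp
 have 5:"sw ?a i (?i$b$w) o ?a|>i|>sw b ?i w=i|>?a|>sw b ?i w o sw ?a i (b$?v)" by (rule sw_natural) (use a o io in simp_all)
 have 6:"br ?H ?a i (?i$b$w) o i|>?a|>sw b ?i w=?a|>i|>sw b ?i w o br ?H ?a i (b$?v)" by (rule br_natural(1)) (use a o io in simp_all)
 have 7:"?a|>cap i (b$w) o ?a|>i|>sw b ?i w=?a|>b|>cap i w o ?a|>sw i b ?v"
 proof -
  have "cap i (b$w) o i|>sw b ?i w=b|>cap i w o sw i b ?v" using br_cap[OF hb_lax[OF hb_trs[OF o(1)]] io(1) o(2), symmetric] o io by simp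
  from arg_cong[OF this, of "%q. ?a|>q"] show ?thesis using a o io by simp
 qed
 have 8:"sw ?a i (b$?v) o ?a|>sw b i ?v o br ?H ?a b (i$?v)=i|>br ?H ?a b ?v o sw b i (?a$?v) o b|>sw ?a i ?v"
 proof -
  have "sw ?a i (b$?v) o ?a|>sw b i ?v o (br ?H ?a b (i$?v) o b|>sw i ?a ?v o sw i b (?a$?v)) o sw b i (?a$?v) o b|>sw ?a i ?v
   = sw ?a i (b$?v) o ?a|>sw b i ?v o br ?H ?a b (i$?v)" using a o io by simp
  then show ?thesis unfolding br_sw[OF a(2) io(1) o(1) io(3), symmetric] using a o io by simp
 qed
 have 9:"?a|>sw i b ?v o br ?H ?a i (b$?v) o i|>br ?H ?a b ?v=br ?H ?a b (i$?v) o b|>br ?H ?a i ?v o sw i b (?a$?v)"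
  by (rule br_yang_baxter) (use a o io in simp_all)
 have "(acth z (b$w) o ?a|>sw b L w o br ?H ?a b (L$w)) o b|>?a|>uJ i w
  = (acth z (b$w) o ?a|>uJ i (b$w)) o ?a|>i|>sw b ?i w o ?a|>sw b i ?v o br ?H ?a b (i$?v)"
  using Z a o i io by (simp add: 3 4[THEN tail])
 also have "...=?a|>b|>cap i w o ?a|>sw i b ?v o br ?H ?a i (b$?v) o (sw ?a i (b$?v) o ?a|>sw b i ?v o br ?H ?a b (i$?v))"
  unfolding acth_uJ[OF Z i io(4)] using a o io by (simp add: 5[THEN tail] 6[THEN tail] 7[THEN tail])
 also have "...=?a|>b|>cap i w o (?a|>sw i b ?v o br ?H ?a i (b$?v) o i|>br ?H ?a b ?v) o sw b i (?a$?v) o b|>sw ?a i ?v"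
  unfolding 8 using a o io by simp
 also have "...=?a|>b|>cap i w o br ?H ?a b (i$?v) o b|>br ?H ?a i ?v o b|>sw ?a i ?v" unfolding 9 using a o io by simp
 finally show "(br ?H ?a b w o b|>acth z w) o b|>?a|>uJ i w=(acth z (b$w) o ?a|>sw b L w o br ?H ?a b (L$w)) o b|>?a|>uJ i w"
  unfolding l by simp
qed

lemma act_hbm:
 assumes Z:"zobj z"
 shows "hbm (fst z$L) (on_left z uobj) (fst z) (snd z) (act z)" "hbm (fst z$L) (on_right z uobj) (fst z) (snd z) (act z)"
proof -
 let ?a = "fst z" and ?H = "snd z"
 have a:"obj ?a" "hb ?a ?H" using Z by simp_all
 have aw:"act z<|w=acth z w o \<a> ?a L w" if "obj w" for w unfolding acth_def using Z a that by simp
 note H = on_hb[OF Z uobj_zobj, unfolded fst_conv]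
 show "hbm (?a$L) (on_left z uobj) ?a ?H (act z)"
 proof (rule hbmI[OF act_typ[OF Z] H(1) a(2)])
  fix b w assume o:"obj b" "obj w"
  have "br ?H ?a b w o b|>act z<|w=(br ?H ?a b w o b|>acth z w) o b|>\<a> ?a L w" unfolding aw[OF o(2)] using Z a o by simp
  also have "...=act z<|(b$w) o br (on_left z uobj) (?a$L) b w"
   unfolding act_on_left[OF Z o] on_left_def fst_conv using Z a o aw[of "b$w"] by (simp add: br_ctb)
  finally show "br ?H ?a b w o b|>act z<|w=act z<|(b$w) o br (on_left z uobj) (?a$L) b w" .
 qed
 show "hbm (?a$L) (on_right z uobj) ?a ?H (act z)"
 proof (rule hbmI[OF act_typ[OF Z] H(2) a(2)])
  fix b w assume o:"obj b" "obj w"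
  have "br ?H ?a b w o b|>act z<|w=(br ?H ?a b w o b|>acth z w) o b|>\<a> ?a L w" unfolding aw[OF o(2)] using Z a o by simp
  also have "...=act z<|(b$w) o br (on_right z uobj) (?a$L) b w"
   unfolding act_on_right[OF Z o] on_right_def fst_conv snd_conv using Z a o aw[of "b$w"] by (simp add: br_ctb)
  finally show "br ?H ?a b w o b|>act z<|w=act z<|(b$w) o br (on_right z uobj) (?a$L) b w" .
 qed
qed

text \<open>The action intertwines both half-braidings of \<open>a \<otimes> L\<close> with that of
  \<open>a\<close>, so it is absorbed.\<close>
lemma act_avg:
 assumes Z:"zobj z"
 shows "act z o avg z uobj = act z" unfolding avg_def fst_conv
proof (rule haar_absorb(2))
 note H = on_hb[OF Z uobj_zobj, unfolded fst_conv]
 show "hb (fst z$L) (on_left z uobj)" "hb (fst z$L) (on_right z uobj)" using H .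
 fix b w assume o:"obj b" "obj w"
 show "act z<|(b$w) o br (on_left z uobj) (fst z$L) b w=act z<|(b$w) o br (on_right z uobj) (fst z$L) b w"
  using hbm_br(1)[OF act_hbm(1)[OF Z] H(1) zobj_hb[OF Z] o] hbm_br(1)[OF act_hbm(2)[OF Z] H(2) zobj_hb[OF Z] o] by simp
qed (use Z in simp_all)

text \<open>The arrow \<open>\<I> \<rightarrow> L\<close>, which is the canonical arrow at the unit
  object.\<close>
definition uu :: 'm where "uu = \<r> L o dl \<I>"

definition uuh ::"'o => 'm" where "uuh w = L|>\<l> w o dlh \<I> w o Inv (\<l> w)"

definition uV ::"('o, 'm) centre_obj => 'm" where "uV z = (fst z)|>uu o Inv (\<r> (fst z))"

lemma uu_typ [simp]:"arr uu" "Dom A uu = \<I>" "Cod A uu = L" by (simp_all add: uu_def)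

lemma uuh_typ [simp]:"obj w ==> uuh w : Arr A" "obj w ==> Dom A (uuh w) = w" "obj w ==> Cod A (uuh w) = L$w"
 by (simp_all add: uuh_def)

lemma uV_typ [simp]:"zobj z ==> uV z : Arr A" "zobj z ==> Dom A (uV z) = fst z" "zobj z ==> Cod A (uV z) = fst z$L"
 by (simp_all add: uV_def)

lemma uuh_eq:"obj w ==> uuh w = uu<|w o Inv (\<l> w)" by (simp add: uuh_def uu_def dlh_def right_unitor_whisker)

lemma uuh_natural:
 assumes g:"arr g" "Dom A g = w" "Cod A g = v"
 shows "uuh v o g = L|>g o uuh w"
proof -
 have wv:"obj w" "obj v" using g by auto
 have 1:"Inv (\<l> v) o g=\<I>|>g o Inv (\<l> w)" using g wv by (simp add: unit_whisker)
 have 2:"uu<|v o \<I>|>g=L|>g o uu<|w" by (rule interchange) (use g in simp_all)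
 show ?thesis unfolding uuh_eq[OF wv(1)] uuh_eq[OF wv(2)] using g wv by (simp add: 1 2[THEN tail])
qed

lemma uV_hat:
 assumes "zobj z" "obj w"
 shows "uV z<|w = \<b> (fst z) L w o (fst z)|>uuh w"
 unfolding uV_def uuh_eq[OF assms(2)] using assms by (simp add: assoc_conj[of "\<i> (fst z)" uu] inv_whisker)

lemma sw_unit:
 assumes "obj a" "obj w"
 shows "\<l> (a$w) o sw a \<I> w = a|>\<l> w" (is ?P1) "sw a \<I> w o a|>Inv (\<l> w) = Inv (\<l> (a$w))" (is ?P2)
proof -
 have 1:"a|>\<l> w o sw \<I> a w=\<l> (a$w)" using br_unit[OF hb_trs[OF assms(1)] assms(2)] assms by simp
 show 2: ?P1 unfolding 1[symmetric] using assms by simp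
 have "\<l> (a$w) o (sw a \<I> w o a|>Inv (\<l> w))=\<l> (a$w) o Inv (\<l> (a$w))" using assms by (simp add: 2[THEN tail])
 then show ?P2 by (rule iso_cancel_left[rotated -1]) (use assms in simp_all)
qed

lemma acth_uuh:
 assumes Z:"zobj z" and w:"obj w"
 shows "acth z w o (fst z)|>uuh w = \<i> (fst z$w)"
proof -
 let ?a = "fst z" and ?H = "snd z"
 have a:"obj ?a" "hb ?a ?H" using Z by simp_all
 have 1:"acth z w o ?a|>L|>\<l> w=?a|>\<l> w o acth z (\<I>$w)" by (rule acth_natural[OF Z]) (use w in simp_all)
 have 2:"acth z (\<I>$w) o ?a|>dlh \<I> w=br ?H ?a \<I> w o sw ?a \<I> w" by (rule acth_dlh[OF Z]) (use w in simp_all)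
 show ?thesis unfolding uuh_def using Z a w by (simp add: 1[THEN tail] 2[THEN tail] sw_unit(2) br_unit[OF a(2) w, THEN tail])
qed

lemma ubh_uuh:
 assumes o:"obj j" "obj w"
 shows "ubh j w o j|>uuh w = dlh j w"
proof -
 have 1:"ubh j w o j|>L|>\<l> w=L|>j|>\<l> w o ubh j (\<I>$w)" by (rule ubh_natural) (use o in simp_all)
 have 2:"ubh j (\<I>$w) o j|>dlh \<I> w=L|>\<a> j \<I> w o dlh (j$\<I>) w o \<b> j \<I> w" by (rule ubh_dlh) (use o in simp_all)
 have 3:"L|>j|>\<l> w o L|>\<a> j \<I> w=L|>\<r> j<|w" using o by (simp add: right_unitor_whisker)
 have 4:"L|>\<r> j<|w o dlh (j$\<I>) w=dlh j w o \<r> j<|w" by (rule dlh_natural_left[symmetric]) (use o in simp_all)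
 have 5:"\<r> j<|w o \<b> j \<I> w o j|>Inv (\<l> w)=\<i> (j$w)" using o by (simp add: right_unitor_whisker)
 show ?thesis unfolding uuh_def using o by (simp add: 1[THEN tail] 2[THEN tail] 3[THEN tail] 4[THEN tail] 5)
qed

lemma sw_uuh:
 assumes o:"obj j" "obj w"
 shows "sw j L w o j|>uuh w = uuh (j$w)"
proof -
 have 1:"sw j L w o j|>uu<|w=uu<|(j$w) o sw j \<I> w" by (rule sw_natural_right) (use o in simp_all)
 have jw:"j$w : Obj A" using o by simp
 show ?thesis unfolding uuh_eq[OF o(2)] uuh_eq[OF jw] using o by (simp add: 1[THEN tail] sw_unit)
qed

end

section \<open>Unitors\<close>

context centre_data
begin

text \<open>After projection to the equalizer the half-braidings of \<open>a\<close> and of \<open>L\<close>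
  cannot be told apart.\<close>
lemma avg_slide:
 assumes Z:"zobj z" and o:"obj b" "obj w"
 shows "hat (fst z) L (fst z) L (avg z uobj) (b$w) o (fst z)|>sw b L w o br (snd z) (fst z) b (L$w)
  = hat (fst z) L (fst z) L (avg z uobj) (b$w) o (fst z)|>ubh b w o sw b (fst z) (L$w)"
proof -
 define a H where "a = fst z" and "H = snd z"
 have a:"obj a" "hb a H" using Z by (simp_all add: a_def H_def)
 define p where "p = avg z uobj"
 have p:"p ::: a$L ~> a$L" using avg_arr[OF Z uobj_zobj] by (simp_all add: p_def a_def)
 note H = on_hb[OF Z uobj_zobj]
 have bl:"br (on_left z uobj) (a$L) b w=\<b> a L (b$w) o a|>sw b L w o br H a b (L$w) o b|>\<a> a L w"
  unfolding on_left_def fst_conv a_def[symmetric] H_def[symmetric] using a o by (simp add: br_ctb)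
 have br:"br (on_right z uobj) (a$L) b w=\<b> a L (b$w) o a|>ubh b w o sw b a (L$w) o b|>\<a> a L w"
  unfolding on_right_def fst_conv snd_conv a_def[symmetric] H_def[symmetric] using a o by (simp add: br_ctb)
 have "p<|(b$w) o br (on_left z uobj) (a$L) b w=p<|(b$w) o br (on_right z uobj) (a$L) b w"
  using haar_equalizes(2)[OF H on_commuting[OF Z uobj_zobj] o] by (simp add: p_def avg_def a_def)
 then have "\<a> a L (b$w) o (p<|(b$w) o br (on_left z uobj) (a$L) b w) o b|>\<b> a L w
  = \<a> a L (b$w) o (p<|(b$w) o br (on_right z uobj) (a$L) b w) o b|>\<b> a L w" by simp
 then show ?thesis unfolding bl br a_def[symmetric] H_def[symmetric] p_def[symmetric] using a o p by (simp add: hat_def)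
qed

text \<open>On the \<open>i\<close>-th summand the loop of \<open>i\<close> around \<open>a\<close> is traded,
  by \<open>avg_slide\<close>, for one around \<open>L\<close>. There it acts on the inserted unit by
  \<open>ubh_dlh\<close> and recreates the summand.\<close>
lemma avg_uV_act:
 assumes Z:"zobj z"
 shows "avg z uobj o uV z o act z = avg z uobj"
proof (rule eq_by_tail)
 define a H where "a = fst z" and "H = snd z"
 have a:"obj a" "hb a H" using Z by (simp_all add: a_def H_def)
 define p where "p = avg z uobj"
 have p:"p ::: a$L ~> a$L" using avg_arr[OF Z uobj_zobj] by (simp_all add: p_def a_def)
 then have pin:"p : Hom (a$L) (a$L)" by (simp add: hom_iff)
 have V:"uV z ::: a ~> a$L" "act z ::: a$L ~> a" using Z by (simp_all add: a_def)
 show "avg z uobj o uV z o act z : Hom (a$L) (a$L)" "avg z uobj : Hom (a$L) (a$L)" using p V by (simp_all add: hom_iff p_def)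
 fix w assume w:"obj w"
 let ?P = "hat a L a L p"
 have Pt:"?P v ::: a$L$v ~> a$L$v" if "obj v" for v
  using hat_typ[OF pin a(1) L_obj a(1) L_obj that] by simp_all
 have At:"acth z v ::: a$L$v ~> a$v" if "obj v" for v using Z that by (simp_all add: a_def)
 have key:"?P w o a|>uuh w o acth z w=?P w"
 proof (rule unit_joint_epi[of _ a w "a$L$w"])
  show "?P w o a|>uuh w o acth z w : Hom (a$L$w) (a$L$w)" "?P w : Hom (a$L$w) (a$L$w)"
   using Pt[OF w] At[OF w] a w by (simp_all add: hom_iff)
  fix j assume j:"j : Rs"
  let ?v = "j^*$w"
  have o:"obj j" "obj ?v" "j$?v : Obj A" using j w by simp_all
  have core:"?P (j$?v) o a|>dlh j ?v=?P (j$?v) o a|>uuh (j$?v) o br H a j ?v o sw a j ?v"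
  proof -
   have s:"sw a j (L$?v) o a|>j|>uuh ?v=j|>a|>uuh ?v o sw a j ?v" by (rule sw_natural) (use a o in simp_all)
   have b:"br H a j (L$?v) o j|>a|>uuh ?v=a|>j|>uuh ?v o br H a j ?v" by (rule br_natural(1)) (use a o in simp_all)
   have u:"a|>sw j L ?v o a|>j|>uuh ?v=a|>uuh (j$?v)" using arg_cong[OF sw_uuh[OF o(1,2)], of "%q. a|>q"] a o by simp
   have "?P (j$?v) o a|>dlh j ?v=(?P (j$?v) o a|>ubh j ?v o sw j a (L$?v)) o sw a j (L$?v) o a|>j|>uuh ?v"
   unfolding ubh_uuh[OF o(1,2), symmetric] using Pt[OF o(3)] a o by simp
   also have "...=(?P (j$?v) o a|>sw j L ?v o br H a j (L$?v)) o sw a j (L$?v) o a|>j|>uuh ?v"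
   using avg_slide[OF Z o(1,2)] by (simp only: a_def H_def p_def)
   also have "...=?P (j$?v) o a|>uuh (j$?v) o br H a j ?v o sw a j ?v" using Pt[OF o(3)] a o by (simp add: s b[THEN tail] u[THEN tail])
   finally show ?thesis .
  qed
  have n1:"acth z w o a|>L|>cap j w=a|>cap j w o acth z (j$?v)" unfolding a_def by (rule acth_natural[OF Z]) (use o w in simp_all)
  have n2:"a|>uuh w o a|>cap j w=a|>L|>cap j w o a|>uuh (j$?v)"
   using arg_cong[OF uuh_natural[of "cap j w" "j$?v" w], of "%q. a|>q"] a o w by simp
  have n3:"?P w o a|>L|>cap j w=a|>L|>cap j w o ?P (j$?v)" by (rule hat_natural[OF pin]) (use a o w in simp_all)
  have n4:"acth z (j$?v) o a|>dlh j ?v=br H a j ?v o sw a j ?v" unfolding a_def H_def by (rule acth_dlh[OF Z o(1,2)])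
  have J:"a|>uJ j w=a|>L|>cap j w o a|>dlh j ?v" unfolding dlh_uJ(2)[OF j w] using a o w by simp
  have "(?P w o a|>uuh w o acth z w) o a|>uJ j w
   = a|>L|>cap j w o (?P (j$?v) o a|>uuh (j$?v) o br H a j ?v o sw a j ?v)"
   unfolding J using Pt[OF w] Pt[OF o(3)] At[OF w] At[OF o(3)] a o w by (simp add: n1[THEN tail] n2[THEN tail] n3[THEN tail] n4)
  also have "...=?P w o a|>uJ j w" unfolding core[symmetric] J using Pt[OF w] Pt[OF o(3)] a o w by (simp add: n3[THEN tail])
  finally show "(?P w o a|>uuh w o acth z w) o a|>uJ j w=?P w o a|>uJ j w" .
 qed (use a w in simp_all)
 have aw:"act z<|w=acth z w o \<a> a L w" unfolding acth_def a_def using Z w by simp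
 have Vw:"uV z<|w=\<b> a L w o a|>uuh w" unfolding a_def by (rule uV_hat[OF Z w])
 have pw:"p<|w=\<b> a L w o ?P w o \<a> a L w" by (rule hat_unfold[OF pin]) (use a w in simp_all)
 have "(p o uV z o act z)<|w=\<b> a L w o (?P w o a|>uuh w o acth z w) o \<a> a L w"
  using p V Pt[OF w] At[OF w] a w by (simp add: aw Vw pw)
 also have "...=p<|w" unfolding key pw ..
 finally show "(avg z uobj o uV z o act z)<|w=avg z uobj<|w" by (simp add: p_def)
qed

text \<open>At the unit object every crossing is trivial.\<close>
lemma act_uV:
 assumes Z:"zobj z"
 shows "act z o uV z = \<i> (fst z)"
proof (rule eq_by_tail)
 show "act z o uV z : Hom (fst z) (fst z)" "\<i> (fst z) : Hom (fst z) (fst z)" using Z by (simp_all add: hom_iff)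
 show "(act z o uV z)<|w=(fst z)|>\<i> w" if w:"obj w" for w
 proof -
  have "(act z o uV z)<|w=acth z w o (fst z)|>uuh w" using Z w by (simp add: acth_def uV_hat)
  then show ?thesis unfolding acth_uuh[OF Z w] using Z w by simp
 qed
qed

definition runit where "runit z = act z o inc z uobj"

lemma runit:
 assumes Z:"zobj z"
 shows "mor (z<>uobj) z (runit z)" (is ?P1) "iso_arr A (runit z)" (is ?P2) "mor z (z<>uobj) (Inv (runit z))" (is ?P3)
proof -
 have S:"zobj (z<>uobj)" using Z by simp
 note t = stensor_typ[OF Z uobj_zobj, unfolded fst_conv]
 show m: ?P1 unfolding runit_def mor_def
  by (rule hbm_comp[OF stensor_hb(2)[OF Z uobj_zobj, unfolded fst_conv] act_hbm(1)[OF Z] _ on_hb(1)[OF Z uobj_zobj, unfolded fst_conv]]) (use Z S in simp_all)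
 have r:"runit z : Arr A" "Dom A (runit z)=fst (z<>uobj)" "Cod A (runit z)=fst z" using mor_typ[OF m] .
 have 1:"runit z o (prj z uobj o uV z)=\<i> (fst z)"
 proof -
  have "runit z o (prj z uobj o uV z)=(act z o avg z uobj) o uV z"
   unfolding runit_def inc_prj[OF Z uobj_zobj, symmetric] using Z t by simp
  then show ?thesis unfolding act_avg[OF Z] act_uV[OF Z] .
 qed
 have 2:"(prj z uobj o uV z) o runit z=\<i> (fst (z<>uobj))"
 proof -
  have av:"avg z uobj : Arr A" "Dom A (avg z uobj)=fst z$L" "Cod A (avg z uobj)=fst z$L" using avg_arr[OF Z uobj_zobj] by simp_all
  have "(prj z uobj o uV z) o runit z=((prj z uobj o avg z uobj) o uV z) o (act z o inc z uobj)"
   unfolding runit_def prj_avg[OF Z uobj_zobj] ..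
  also have "...=prj z uobj o (avg z uobj o uV z o act z) o inc z uobj" using Z t av by (simp del: prj_avg)
  also have "...=\<i> (fst (z<>uobj))" unfolding avg_uV_act[OF Z] avg_inc[OF Z uobj_zobj] prj_inc[OF Z uobj_zobj] ..
  finally show ?thesis .
 qed
 show i: ?P2 by (rule inv_arrI(1)[of _ "prj z uobj o uV z"]) (use r t Z 1 2 in simp_all)
 show ?P3 by (rule mor_inv[OF m S Z i])
qed

lemma runit_natural:
 assumes f:"mor z z' f" and Z:"zobj z" "zobj z'"
 shows "runit z' o sten z uobj z' uobj f (\<i> L) = f o runit z"
proof -
 define a H a' H' where "a = fst z" and "H = snd z" and "a' = fst z'" and "H' = snd z'"
 have a:"obj a" "hb a H" "obj a'" "hb a' H'" using Z by (simp_all add: a_def H_def a'_def H'_def)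
 have t:"arr f" "Dom A f=a" "Cod A f=a'" using mor_typ[OF f] by (simp_all add: a_def a'_def)
 have hm:"hbm a H a' H' f" using f by (simp add: mor_def a_def H_def a'_def H'_def)
 have A1:"act z ::: a$L ~> a" "act z' ::: a'$L ~> a'"
  using Z by (simp_all add: a_def a'_def)
 have At:"acth z v ::: a$L$v ~> a$v"
  "acth z' v ::: a'$L$v ~> a'$v" if "obj v" for v using Z that by (simp_all add: a_def a'_def)
 have key:"acth z' w o f<|(L$w)=f<|w o acth z w" if w:"obj w" for w
 proof (rule unit_joint_epi[of _ a w "a'$w"])
  show "acth z' w o (f<|(L$w)) : Hom (a$L$w) (a'$w)" "f<|w o acth z w : Hom (a$L$w) (a'$w)"
   using At[OF w] t w by (simp_all add: hom_iff)
  fix i assume i:"i : Rs"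
  let ?v = "i^*$w"
  have o:"obj i" "obj ?v" using i w by simp_all
  have 1:"f<|(L$w) o a|>uJ i w=a'|>uJ i w o f<|(i$?v)" by (rule interchange) (use t i w in simp_all)
  have 2:"sw a' i ?v o f<|(i$?v)=i|>f<|?v o sw a i ?v" by (rule sw_natural_left[OF o t])
  have 3:"br H' a' i ?v o i|>f<|?v=f<|(i$?v) o br H a i ?v" by (rule hbm_br(1)[OF hm a(2,4) o])
  have 4:"a'|>cap i w o f<|(i$?v)=f<|w o a|>cap i w" by (rule interchange[symmetric]) (use t i w in simp_all)
  note u = acth_uJ[OF Z(1) i w, folded a_def H_def] acth_uJ[OF Z(2) i w, folded a'_def H'_def]
  show "(acth z' w o f<|(L$w)) o a|>uJ i w=(f<|w o acth z w) o a|>uJ i w"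
   using At[OF w] t a o i w by (simp add: 1 u u(2)[THEN tail] 2 3[THEN tail] 4[THEN tail])
 qed (use a w in simp_all)
 have nat:"act z' o f<|L=f o act z"
 proof (rule eq_by_tail)
  show "act z' o (f<|L) : Hom (a$L) a'" "f o act z : Hom (a$L) a'" using A1 t by (simp_all add: hom_iff)
  fix w assume w:"obj w"
  have aw:"act z<|w=acth z w o \<a> a L w" "act z'<|w=acth z' w o \<a> a' L w" unfolding acth_def a_def a'_def using Z w by simp_all
  show "(act z' o f<|L)<|w=(f o act z)<|w" using A1 At[OF w] t a w by (simp add: aw assoc_conj[of f "\<i> L"] key[OF w, THEN tail])
 qed
 have s:"sten z uobj z' uobj f (\<i> L) ::: fst (z<>uobj) ~> fst (z'<>uobj)"
  and s2:"inc z' uobj o sten z uobj z' uobj f (\<i> L) = f<|L o inc z uobj"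
  using sten_typ[OF f mor_ident[OF uobj_zobj] Z(1) uobj_zobj Z(2) uobj_zobj] sten(2)[OF f mor_ident[OF uobj_zobj] Z(1) uobj_zobj Z(2) uobj_zobj] by simp_all
 note T1 = stensor_typ[OF Z(1) uobj_zobj, unfolded fst_conv, folded a_def] and T2 = stensor_typ[OF Z(2) uobj_zobj, unfolded fst_conv, folded a'_def]
 have "runit z' o sten z uobj z' uobj f (\<i> L)=act z' o (inc z' uobj o sten z uobj z' uobj f (\<i> L))" unfolding runit_def using A1 T2 s by simp
 also have "...=(act z' o f<|L) o inc z uobj" unfolding s2 using A1 T1 t by simp
 also have "...=f o runit z" unfolding nat runit_def using A1 T1 t by simp
 finally show ?thesis .
qed

definition lact where
 "lact z = hsum (L$fst z) (fst z) Rs (%i. (\<l> (fst z) o ev A i<|(fst z) o \<b> i i^* (fst z)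
   o i|>(Inv (snd z i^*) o \<s> i^* (fst z))
   o \<a> i i^* (fst z)) o upr i<|(fst z))"

text \<open>The left action uses the inverse crossing of the dual of \<open>i\<close>, which is the crossing of
  \<open>i\<close> rotated.\<close>
lemma lact_eq:
 assumes Z:"zobj z"
 shows "lact z = act z o \<s> L (fst z)" (is ?P1)
  "obj w ==> i : Rs ==> acth z w o sw L (fst z) w o uJ i (fst z$w)
   = cap i (fst z$w) o i|>rb (snd z) (fst z) i^* w o i|>sw i^* (fst z) w"
proof -
 define a H where "a = fst z" and "H = snd z"
 have a:"obj a" "hb a H" using Z by (simp_all add: a_def H_def)
 have At:"acth z v ::: a$L$v ~> a$v" if "obj v" for v using Z that by (simp_all add: a_def)
 have A1:"act z ::: a$L ~> a" using Z by (simp_all add: a_def)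
 have hat_eq:"acth z w o sw L a w o uJ i (a$w)=cap i (a$w) o i|>rb H a i^* w o i|>sw i^* a w"
  if w:"obj w" and i:"i : Rs" for w i
 proof -
  let ?i = "i^*" let ?v = "?i$w"
  have o:"obj i" "obj ?i" "obj ?v" using i w by simp_all
  have c:"a|>cap i w o br H a i ?v=cap i (a$w) o i|>rb H a ?i w"
   unfolding br_cap[OF hb_lax[OF a(2)] o(1) w, symmetric] using a o w by simp
  have "acth z w o sw L a w o uJ i (a$w)=(acth z w o a|>uJ i w) o sw i a ?v o i|>sw ?i a w"
   unfolding sw_uJ(2)[OF a(1) i w] using At[OF w] a o i w by simp
  also have "...=(a|>cap i w o br H a i ?v) o i|>sw ?i a w" unfolding acth_uJ[OF Z i w, folded a_def H_def] using a o w by simp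
  finally show ?thesis unfolding c using a o w by simp
 qed
 then show "obj w ==> i : Rs ==> acth z w o sw L (fst z) w o uJ i (fst z$w)
   = cap i (fst z$w) o i|>rb (snd z) (fst z) i^* w o i|>sw i^* (fst z) w" by (simp only: a_def H_def)
 define G where "G i = \<l> a o ev A i<|a o \<b> i i^* a o i|>(Inv (H i^*) o \<s> i^* a) o \<a> i i^* a" for i
 have G:"G i : Hom ((i$i^*)$a) a" if "i : Rs" for i using that a by (simp add: G_def hom_iff)
 have le:"lact z=hsum (L$a) a Rs (%i. G i o upr i<|a)" unfolding lact_def G_def a_def H_def ..
 obtain k where k:"k : Rs" using some_simple by blast
 have lin:"lact z : Hom (L$a) a" unfolding le by (rule unit_extract_left(1)[OF a(1) a(1) G k])
 then have lt:"lact z ::: L$a ~> a" by (simp_all add: hom_iff)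
 have lu:"lact z o uin i<|a=G i" if "i : Rs" for i unfolding le by (rule unit_extract_left(2)[OF a(1) a(1) G that])
 show ?P1 unfolding a_def[symmetric]
 proof (rule eq_by_tail[OF lin])
  show "act z o \<s> L a : Hom (L$a) a" using A1 a by (simp add: hom_iff)
  fix w assume w:"obj w"
  have aw:"act z<|w=acth z w o \<a> a L w" unfolding acth_def a_def using Z w by simp
  have "lact z<|w o \<b> L a w=acth z w o sw L a w"
  proof (rule unit_joint_epi0[of _ "a$w" "a$w"])
   show "lact z<|w o \<b> L a w : Hom (L$a$w) (a$w)" "acth z w o sw L a w : Hom (L$a$w) (a$w)"
   using lt At[OF w] a w by (simp_all add: hom_iff)
   fix i assume i:"i : Rs"
   let ?i = "i^*"
   have o:"obj i" "obj ?i" using i by simp_all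
   have 1:"\<b> L a w o uin i<|(a$w)=(uin i<|a)<|w o \<b> (i$?i) a w"
   using i a w by (simp add: assoc_conj[of "uin i" "\<i> a"])
   have e:"\<l> a o ev A i<|a o \<b> i ?i a=cap i a" by (simp add: cap_def)
   define m where "m = Inv (H ?i) o \<s> ?i a"
   have m:"m ::: ?i$a ~> ?i$a" using a o by (simp_all add: m_def)
   have mw:"m<|w=\<b> ?i a w o rb H a ?i w o sw ?i a w o \<a> ?i a w" unfolding m_def using a o w by (simp add: rb_def sw_def hat_def)
   have Ge:"G i=cap i a o i|>m o \<a> i ?i a" unfolding G_def m_def[symmetric] e[symmetric] using m a o by simp
   have "(lact z<|w o \<b> L a w) o uJ i (a$w)=(lact z<|w o (uin i<|a)<|w) o \<b> (i$?i) a w o \<b> i ?i (a$w)"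
   unfolding uJ_def using lt i o a w by (simp add: 1[THEN tail])
   also have "lact z<|w o (uin i<|a)<|w=G i<|w" using arg_cong[OF lu[OF i], of "%q. q<|w"] lt i o a w by simp
   also have "G i<|w o \<b> (i$?i) a w o \<b> i ?i (a$w)=cap i (a$w) o i|>\<a> ?i a w o i|>m<|w o i|>\<b> ?i a w"
   unfolding Ge using m a o w by (simp add: cap_whisker assoc_conj[of "\<i> i" m] associator_whisker)
   also have "...=cap i (a$w) o i|>rb H a ?i w o i|>sw ?i a w" unfolding mw using a o w by simp
   also have "...=(acth z w o sw L a w) o uJ i (a$w)" unfolding hat_eq[OF w i, symmetric] using At[OF w] a i w by simp
   finally show "(lact z<|w o \<b> L a w) o uJ i (a$w)=(acth z w o sw L a w) o uJ i (a$w)" .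
  qed (use a w in simp)
  then have "(lact z<|w o \<b> L a w) o \<a> L a w=(acth z w o sw L a w) o \<a> L a w" by simp
  then show "lact z<|w=(act z o \<s> L a)<|w" using lt A1 At[OF w] a w by (simp add: aw symmetry_whisker)
 qed
qed

definition lunit where "lunit z = lact z o inc uobj z"

lemma lunit_eq:
 assumes Z:"zobj z"
 shows "lunit z = runit z o ssym uobj z"
proof -
 note s = ssym(2)[OF uobj_zobj Z, unfolded fst_conv] and st = mor_typ[OF ssym(1)[OF uobj_zobj Z]]
 note T = stensor_typ[OF Z uobj_zobj, unfolded fst_conv] stensor_typ[OF uobj_zobj Z, unfolded fst_conv]
 have "runit z o ssym uobj z=act z o (inc z uobj o ssym uobj z)" unfolding runit_def using Z st T by simp
 then show ?thesis unfolding s lunit_def lact_eq(1)[OF Z] using Z T by simp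
qed

lemma ssym_iso:
 assumes Z:"zobj x" "zobj y"
 shows "iso_arr A (ssym x y)" by (rule inv_arrI(1)[of _ "ssym y x"])
  (use mor_typ[OF ssym(1)[OF Z]] mor_typ[OF ssym(1)[OF Z(2,1)]] ssym_involutive[OF Z] ssym_involutive[OF Z(2,1)] in simp_all)

lemma lunit:
 assumes Z:"zobj z"
 shows "mor (uobj<>z) z (lunit z)" (is ?P1) "iso_arr A (lunit z)" (is ?P2) "mor z (uobj<>z) (Inv (lunit z))" (is ?P3)
proof -
 have S:"zobj (uobj<>z)" "zobj (z<>uobj)" using Z by simp_all
 note r = runit[OF Z] and s = ssym(1)[OF uobj_zobj Z]
 show m: ?P1 unfolding lunit_eq[OF Z] by (rule mor_comp[OF s r(1) S Z])
 show i: ?P2 unfolding lunit_eq[OF Z]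
  by (rule comp_iso(1)[OF ssym_iso[OF uobj_zobj Z] r(2)]) (simp add: mor_typ(3)[OF s] mor_typ(2)[OF r(1)])
 show ?P3 by (rule mor_inv[OF m S(1) Z i])
qed

lemma lunit_natural:
 assumes f:"mor z z' f" and Z:"zobj z" "zobj z'"
 shows "lunit z' o sten uobj z uobj z' (\<i> L) f = f o lunit z"
proof -
 have id:"mor uobj uobj (\<i> L)" using mor_ident[OF uobj_zobj] by simp
 note t = mor_typ[OF f] mor_typ[OF runit(1)[OF Z(1)]] mor_typ[OF runit(1)[OF Z(2)]] mor_typ[OF ssym(1)[OF uobj_zobj Z(1)]] mor_typ[OF ssym(1)[OF uobj_zobj Z(2)]]
  sten_typ[OF id f uobj_zobj Z(1) uobj_zobj Z(2)] sten_typ[OF f id Z(1) uobj_zobj Z(2) uobj_zobj]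
 have "lunit z' o sten uobj z uobj z' (\<i> L) f=runit z' o (ssym uobj z' o sten uobj z uobj z' (\<i> L) f)"
  unfolding lunit_eq[OF Z(2)] using t by simp
 also have "...=(runit z' o sten z uobj z' uobj f (\<i> L)) o ssym uobj z"
  unfolding ssym_natural[OF id f uobj_zobj Z(1) uobj_zobj Z(2)] using t by simp
 also have "...=f o lunit z" unfolding runit_natural[OF f Z] lunit_eq[OF Z(1)] using t by simp
 finally show ?thesis .
qed

text \<open>In the product of \<open>x\<close> and \<open>y\<close> the loop of \<open>i\<close> may go around
  either factor, so the action of \<open>L\<close> on the left of \<open>y\<close> equals that on the right of
  \<open>x\<close>.\<close>
lemma avg_triangle:
 assumes Z:"zobj x" "zobj y"
 shows "avg x y o (fst x)|>lact y o \<a> (fst x) L (fst y) = avg x y o act x<|(fst y)"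
proof (rule eq_by_tail)
 define a H a' H' where "a = fst x" and "H = snd x" and "a' = fst y" and "H' = snd y"
 have a:"obj a" "hb a H" "obj a'" "hb a' H'" using Z by (simp_all add: a_def H_def a'_def H'_def)
 define p where "p = avg x y"
 have p:"p ::: a$a' ~> a$a'" using avg_arr[OF Z] by (simp_all add: p_def a_def a'_def)
 then have pin:"p : Hom (a$a') (a$a')" by (simp add: hom_iff)
 have A1:"act x ::: a$L ~> a" "act y ::: a'$L ~> a'"
  using Z by (simp_all add: a_def a'_def)
 have lt:"lact y ::: L$a' ~> a'" unfolding lact_eq(1)[OF Z(2)] a'_def[symmetric] using A1 a by simp_all
 show "avg x y o (fst x)|>lact y o \<a> (fst x) L (fst y) : Hom ((a$L)$a') (a$a')"
  "avg x y o (act x<|(fst y)) : Hom ((a$L)$a') (a$a')"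
  unfolding a_def[symmetric] a'_def[symmetric] p_def[symmetric] using p A1 lt a by (simp_all add: hom_iff)
 fix w assume w:"obj w"
 have At:"acth x v ::: a$L$v ~> a$v"
  "acth y v ::: a'$L$v ~> a'$v" if "obj v" for v using Z that by (simp_all add: a_def a'_def)
 have aw:"a'$w : Obj A" using a w by simp
 let ?P = "hat a a' a a' p"
 have Pt:"?P v : Arr A" "Dom A (?P v)=a$a'$v" "Cod A (?P v)=a$a'$v" if "obj v" for v
  using hat_typ[OF pin a(1) a(3) a(1) a(3) that] by simp_all
 define lh where "lh = acth y w o sw L a' w"
 have lh:"lh ::: L$a'$w ~> a'$w" using At[OF w] a w by (simp_all add: lh_def)
 have key:"?P w o a|>lh=?P w o acth x (a'$w)"
 proof (rule unit_joint_epi[of _ a "a'$w" "a$a'$w"])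
  show "?P w o (a|>lh) : Hom (a$L$a'$w) (a$a'$w)" "?P w o acth x (a'$w) : Hom (a$L$a'$w) (a$a'$w)"
   using Pt[OF w] At[OF aw] lh a by (simp_all add: hom_iff)
  fix i assume i:"i : Rs"
  let ?i = "i^*" let ?v = "?i$a'$w"
  have o:"obj i" "obj ?i" "obj ?v" using i a w by simp_all
  have lu:"lh o uJ i (a'$w)=cap i (a'$w) o i|>rb H' a' ?i w o i|>sw ?i a' w"
   using lact_eq(2)[OF Z(2) w i, folded a'_def H'_def] At[OF w] a w i by (simp add: lh_def)
  have m1:"a|>cap i (a'$w) o br H a i ?v=cap i (a$a'$w) o i|>rb H a ?i (a'$w)"
   unfolding br_cap[OF hb_lax[OF a(2)] o(1) aw, symmetric] using a o w by simp
  have m2:"a|>cap i (a'$w)=cap i (a$a'$w) o i|>sw a ?i (a'$w) o sw a i ?v"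
   using br_cap[OF hb_lax[OF hb_trs[OF a(1)]] o(1) aw, symmetric] a o w by simp
  define rl where "rl = rb H a ?i (a'$w) o a|>sw a' ?i w"
  define rr where "rr = sw a ?i (a'$w) o a|>rb H' a' ?i w"
  have rt:"rl ::: a$a'$?i$w ~> ?i$a$a'$w" "rr ::: a$a'$?i$w ~> ?i$a$a'$w"
   using a o w by (simp_all add: rl_def rr_def)
  have slide:"?i|>?P w o rl=?i|>?P w o rr"
  proof -
   have bl:"rb (on_left x y) (a$a') ?i w=?i|>\<b> a a' w o rl o \<a> a a' (?i$w)"
   unfolding on_left_def rl_def a_def[symmetric] H_def[symmetric] a'_def[symmetric] using a o w by (simp add: rb_ctb)
   have br:"rb (on_right x y) (a$a') ?i w=?i|>\<b> a a' w o rr o \<a> a a' (?i$w)"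
   unfolding on_right_def rr_def a_def[symmetric] H'_def[symmetric] a'_def[symmetric] using a o w by (simp add: rb_ctb)
   have "?i|>p<|w o rb (on_left x y) (a$a') ?i w=?i|>p<|w o rb (on_right x y) (a$a') ?i w"
   unfolding p_def avg_def a_def a'_def by (rule haar_equalizes_rb[OF on_hb[OF Z] on_commuting[OF Z] o(2) w])
   then have "?i|>\<a> a a' w o (?i|>p<|w o rb (on_left x y) (a$a') ?i w) o \<b> a a' (?i$w)
   = ?i|>\<a> a a' w o (?i|>p<|w o rb (on_right x y) (a$a') ?i w) o \<b> a a' (?i$w)" by simp
   then show ?thesis unfolding bl br using p rt a o w by (simp add: hat_def)
  qed
  have n:"?P w o cap i (a$a'$w)=cap i (a$a'$w) o i|>?i|>?P w" using cap_natural[OF o(1) Pt[OF w]] by simp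
  define E where "E = i|>a|>sw ?i a' w o sw a i ?v"
  have E:"E ::: a$i$?v ~> i$a$a'$?i$w" using a o w by (simp_all add: E_def)
  have sn:"sw a i ?v o a|>i|>(rb H' a' ?i w o sw ?i a' w)=i|>a|>(rb H' a' ?i w o sw ?i a' w) o sw a i ?v"
   by (rule sw_natural) (use a o w in simp_all)
  have l:"a|>lh o a|>uJ i (a'$w)=cap i (a$a'$w) o i|>rr o E"
  proof -
   have "a|>lh o a|>uJ i (a'$w)=a|>cap i (a'$w) o a|>i|>(rb H' a' ?i w o sw ?i a' w)"
   using arg_cong[OF lu, of "%q. a|>q"] lh a o i w by simp
   also have "...=cap i (a$a'$w) o i|>sw a ?i (a'$w) o (sw a i ?v o a|>i|>(rb H' a' ?i w o sw ?i a' w))"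
   unfolding m2 using a o w by simp
   also have "...=cap i (a$a'$w) o i|>rr o E" unfolding sn rr_def E_def using a o w by simp
   finally show ?thesis .
  qed
  have r:"acth x (a'$w) o a|>uJ i (a'$w)=cap i (a$a'$w) o i|>rl o E"
  proof -
   have "acth x (a'$w) o a|>uJ i (a'$w)=(a|>cap i (a'$w) o br H a i ?v) o sw a i ?v"
   unfolding acth_uJ[OF Z(1) i aw, folded a_def H_def] using a o w by simp
   then show ?thesis unfolding m1 rl_def E_def using a o w by simp
  qed
  have sl:"i|>?i|>?P w o i|>rl=i|>?i|>?P w o i|>rr" using arg_cong[OF slide, of "%q. i|>q"] Pt[OF w] rt o by simp
  have L1:"(?P w o a|>lh) o a|>uJ i (a'$w)=cap i (a$a'$w) o (i|>?i|>?P w o i|>rr) o E"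
   using Pt[OF w] lh rt E a o i w by (simp add: l n[THEN tail])
  have R1:"(?P w o acth x (a'$w)) o a|>uJ i (a'$w)=cap i (a$a'$w) o (i|>?i|>?P w o i|>rl) o E"
   using Pt[OF w] At[OF aw] rt E a o i w by (simp add: r n[THEN tail])
  show "(?P w o a|>lh) o a|>uJ i (a'$w)=(?P w o acth x (a'$w)) o a|>uJ i (a'$w)" unfolding L1 R1 sl ..
 qed (use a w in simp_all)
 have pw:"p<|w=\<b> a a' w o ?P w o \<a> a a' w" by (rule hat_unfold[OF pin]) (use a w in simp_all)
 have lw:"lact y<|w=lh o \<a> L a' w"
 proof -
  have "act y<|w=acth y w o \<a> a' L w" unfolding acth_def a'_def using Z w by simp
  then show ?thesis unfolding lact_eq(1)[OF Z(2)] a'_def[symmetric] lh_def using A1 At[OF w] a w by (simp add: symmetry_whisker)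
 qed
 have xw:"act x<|(a'$w)=acth x (a'$w) o \<a> a L (a'$w)" unfolding acth_def a_def using Z aw by simp
 have "(p o a|>lact y o \<a> a L a')<|w=\<b> a a' w o (?P w o a|>lh) o \<a> a L (a'$w) o \<a> (a$L) a' w"
  using p lt Pt[OF w] lh a w by (simp add: pw assoc_conj[of "\<i> a" "lact y"] lw associator_whisker)
 also have "...=(p o act x<|a')<|w"
  unfolding key using p A1 Pt[OF w] At[OF aw] a w by (simp add: pw assoc_conj[of "act x" "\<i> a'"] xw)
 finally show "(avg x y o (fst x)|>lact y o \<a> (fst x) L (fst y))<|w=(avg x y o act x<|(fst y))<|w" by (simp only: a_def a'_def p_def)
qed

lemma triangle_centre:
 assumes Z:"zobj x" "zobj y"
 shows "sten x (uobj<>y) x y (\<i> (fst x)) (lunit y) o sass x uobj y = sten (x<>uobj) y x y (runit x) (\<i> (fst y))"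
proof -
 let ?x = "fst x" and ?y = "fst y"
 have S:"zobj (uobj<>y)" "zobj (x<>uobj)" using Z by simp_all
 note U = uobj_zobj
 note f = sten[OF mor_ident[OF Z(1)] lunit(1)[OF Z(2)] Z(1) S(1) Z] and g = sten[OF runit(1)[OF Z(1)] mor_ident[OF Z(2)] S(2) Z(2) Z]
 note a = sass[OF Z(1) U Z(2)]
 note t = mor_typ[OF f(1)] mor_typ[OF g(1)] mor_typ[OF a(1)] mor_typ[OF lunit(1)[OF Z(2)]] mor_typ[OF runit(1)[OF Z(1)]]
 note T = stensor_typ[OF U Z(2), unfolded fst_conv] stensor_typ[OF Z(1) U, unfolded fst_conv] stensor_typ[OF Z(1) S(1)] stensor_typ[OF S(2) Z(2)]
 note E = emb_typ[OF Z(1) U Z(2), unfolded fst_conv]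
 have lt:"lact y ::: L$?y ~> ?y" unfolding lact_eq(1)[OF Z(2)] using Z by simp_all
 let ?F = "sten x (uobj<>y) x y (\<i> ?x) (lunit y)" and ?G = "sten (x<>uobj) y x y (runit x) (\<i> ?y)"
 have l:"inc x y o (?F o sass x uobj y)=?x|>lact y o \<a> ?x L ?y o embL x uobj y"
 proof -
  have 1:"?x|>lunit y=?x|>lact y o ?x|>inc uobj y" unfolding lunit_def using Z T lt by simp
  have "inc x y o (?F o sass x uobj y)=(?x|>lunit y o inc x (uobj<>y)) o sass x uobj y" unfolding f(2)[symmetric] using t Z by simp
  also have "...=?x|>lact y o (embR x uobj y o sass x uobj y)" unfolding 1 embR_def using t T lt Z by simp
  finally show ?thesis unfolding a(2) by simp
 qed
 have r:"inc x y o ?G=act x<|?y o embL x uobj y"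
 proof -
  have "runit x<|?y=act x<|?y o inc x uobj<|?y" unfolding runit_def using Z T by simp
  then show ?thesis unfolding g(2) embL_def using T Z by simp
 qed
 have avt:"avg x y o (inc x y o h)=inc x y o h" if "arr h" "Cod A h=fst (x<>y)" for h using tail[OF avg_inc[OF Z], of h] that Z by simp
 have "inc x y o (?F o sass x uobj y)=(avg x y o ?x|>lact y o \<a> ?x L ?y) o embL x uobj y"
  using avt[of "?F o sass x uobj y"] t lt E Z unfolding l by simp
 also have "...=avg x y o (act x<|?y o embL x uobj y)" unfolding avg_triangle[OF Z] using E Z by simp
 also have "...=inc x y o ?G" unfolding r[symmetric] by (rule avt) (use t in simp_all)
 finally show ?thesis by (rule inc_mono[OF Z, rotated 4]) (use t in simp_all)
qed

end

context centre_data
begin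

abbreviation SC where "SC \<equiv> symmetric_centre A T"

section \<open>The symmetric monoidal category and the existence of choices\<close>

lemma SC_obj:"x \<in> Obj SC \<longleftrightarrow> zobj x" by (simp add: symmetric_centre_def centre_obj_iff)

lemma SC_hom:"f \<in> hom_set SC x y \<longleftrightarrow> (\<exists>g. f = (x, g, y) \<and> zobj x \<and> zobj y \<and> mor x y g)"
proof -
 obtain x' g y' where f:"f = (x', g, y')" by (cases f) blast
 have "Dom (drinfeld_centre A) f=x'" "Cod (drinfeld_centre A) f=y'" by (simp_all add: f drinfeld_centre_def Let_def)
 then show ?thesis unfolding hom_set_def symmetric_centre_def using centre_arr_iff[of x' g y'] by (auto simp: f)
qed

lemma SC_homI:"zobj x ==> zobj y ==> mor x y g ==> (x, g, y) \<in> hom_set SC x y" by (simp add: SC_hom)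

lemma SC_simps:
 "Comp SC (y, g, y') (z, f, z') = (z, g o f, y')" "Ident SC z = (z, \<i> (fst z), z)"
 "tensor_obj SC z z' = z<>z'" "unit_obj SC = uobj"
 "tensor_arr SC (z, f, z') (y, g, y') = (z<>y, sten z y z' y' f g, z'<>y')"
 "associator SC x1 x2 x3 = ((x1<>x2)<>x3, sass x1 x2 x3, x1<>x2<>x3)"
 "symmetry SC z z' = (z<>z', ssym z z', z'<>z)"
 by (simp_all add: symmetric_centre_def drinfeld_centre_def Let_def stensor_arr_def sten_def sassociator_def sass_def
  ssymmetry_def ssym_def sunit_eq)

lemma SC_unitors:
 assumes Z:"zobj z"
 shows "left_unitor SC z = (uobj<>z, lunit z, z)" (is ?P1) "right_unitor SC z = (z<>uobj, runit z, z)" (is ?P2)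
proof -
 obtain a H where z:"z = (a, H)" by (cases z) blast
 have a:"obj a" "hb a H" using Z z by (simp_all add: zobj_def hb_obj)
 have La:"L$a : Obj A" "a$L : Obj A" using a by simp_all
 have "hsum (L$a) a Rs (%i. \<l> a o ev A i<|a o \<b> i i^* a
   o i|>(Inv (H i^*) o \<s> i^* a) o \<a> i i^* a o upr i<|a) = lact z"
  unfolding lact_def z fst_conv snd_conv by (rule hsum_cong[OF La(1) a(1)]) (use a in \<open>simp_all add: hom_iff\<close>)
 then show ?P1 unfolding symmetric_centre_def sleft_unitor_def by (simp add: z sunit_eq lunit_def)
 have "hsum (a$L) a Rs (%i. \<r> a o a|>ev A i o \<a> a i i^*
   o (H i o \<s> a i)<|i^* o \<b> a i i^* o a|>upr i) = act z"
  unfolding act_def z fst_conv snd_conv loop_close_def by (rule hsum_cong[OF La(2) a(1)]) (use a in \<open>simp_all add: hom_iff\<close>)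
 then show ?P2 unfolding symmetric_centre_def sright_unitor_def by (simp add: z sunit_eq runit_def)
qed

lemma SC_iso:
 assumes Z:"zobj x" "zobj y" and m:"mor x y g" "mor y x h" and inv:"h o g = \<i> (fst x)" "g o h = \<i> (fst y)"
 shows "iso_arr SC (x, g, y)"
proof -
 have g:"(x, g, y) \<in> hom_set SC x y" and h:"(y, h, x) \<in> hom_set SC y x" using Z m by (simp_all add: SC_homI)
 then have "Dom SC (x, g, y)=x" "Cod SC (x, g, y)=y" "(x, g, y) \<in> Arr SC" by (simp_all add: hom_set_def)
 then have "inverse_arrows SC (x, g, y) (y, h, x)" unfolding inverse_arrows_def using h inv by (simp add: SC_simps)
 then show ?thesis unfolding iso_arr_def by blast
qed

lemma symmetric_centre_category:"category SC"
proof
 show "Dom SC f \<in> Obj SC" "Cod SC f \<in> Obj SC" if "f \<in> Arr SC" for f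
 proof -
  have "f \<in> hom_set SC (Dom SC f) (Cod SC f)" using that by (simp add: hom_set_def)
  then show "Dom SC f \<in> Obj SC" "Cod SC f \<in> Obj SC" by (auto simp: SC_hom SC_obj)
 qed
 show "Ident SC x \<in> hom_set SC x x" if "x \<in> Obj SC" for x using that by (simp add: SC_obj SC_simps SC_homI mor_ident)
 show "Comp SC g f \<in> hom_set SC x z" if fg:"f \<in> hom_set SC x y" "g \<in> hom_set SC y z" for f g x y z
 proof -
  obtain f' g' where "f = (x, f', y)" "g = (y, g', z)" "zobj x" "zobj y" "zobj z" "mor x y f'" "mor y z g'" using fg unfolding SC_hom by blast
  then show ?thesis using mor_comp[of x y f' z g'] by (simp add: SC_simps SC_homI)
 qed
 show "Comp SC f (Ident SC x)=f" "Comp SC (Ident SC y) f=f" if f:"f \<in> hom_set SC x y" for f x y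
 proof -
  obtain f' where f':"f = (x, f', y)" "zobj x" "zobj y" "mor x y f'" using f unfolding SC_hom by blast
  then show "Comp SC f (Ident SC x)=f" "Comp SC (Ident SC y) f=f" using mor_typ[OF f'(4)] by (simp_all add: SC_simps)
 qed
 show "Comp SC (Comp SC h g) f=Comp SC h (Comp SC g f)" if fgh:"f \<in> hom_set SC w x" "g \<in> hom_set SC x y" "h \<in> hom_set SC y z" for f g h w x y z
 proof -
  obtain f' g' h' where e:"f = (w, f', x)" "g = (x, g', y)" "h = (y, h', z)" and m:"mor w x f'" "mor x y g'" "mor y z h'"
   using fgh unfolding SC_hom by blast
  show ?thesis using mor_typ[OF m(1)] mor_typ[OF m(2)] mor_typ[OF m(3)] by (simp add: e SC_simps)
 qed
qed

lemma symmetric_centre_symmetric_monoidal:"symmetric_monoidal_category SC"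
proof -
 interpret S: category SC by (rule symmetric_centre_category)
 have id [simp]:"mor uobj uobj (\<i> L)" using mor_ident[OF uobj_zobj] by simp
 show ?thesis
 proof
  show "tensor_obj SC x y \<in> Obj SC" if "x \<in> Obj SC" "y \<in> Obj SC" for x y using that by (simp add: SC_obj SC_simps)
  show "unit_obj SC \<in> Obj SC" by (simp add: SC_obj SC_simps)
  show "tensor_arr SC f g \<in> hom_set SC (tensor_obj SC x y) (tensor_obj SC x' y')" if fg:"f \<in> hom_set SC x x'" "g \<in> hom_set SC y y'" for f g x x' y y'
  proof -
   obtain f' g' where e:"f = (x, f', x')" "g = (y, g', y')" and m:"mor x x' f'" "mor y y' g'" and Z:"zobj x" "zobj y" "zobj x'" "zobj y'" using fg unfolding SC_hom by blast
   show ?thesis using sten(1)[OF m Z] Z by (simp add: e SC_simps SC_homI)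
  qed
  show "tensor_arr SC (Ident SC x) (Ident SC y)=Ident SC (tensor_obj SC x y)" if "x \<in> Obj SC" "y \<in> Obj SC" for x y
   using that by (simp add: SC_obj SC_simps sten_ident)
  show "tensor_arr SC (Comp SC f' f) (Comp SC g' g)=Comp SC (tensor_arr SC f' g') (tensor_arr SC f g)"
   if h:"f \<in> hom_set SC x x'" "f' \<in> hom_set SC x' x''" "g \<in> hom_set SC y y'" "g' \<in> hom_set SC y' y''" for f f' g g' x x' x'' y y' y''
  proof -
   obtain h1 h2 h3 h4 where e:"f = (x, h1, x')" "f' = (x', h2, x'')" "g = (y, h3, y')" "g' = (y', h4, y'')"
   and m:"mor x x' h1" "mor x' x'' h2" "mor y y' h3" "mor y' y'' h4" and Z:"zobj x" "zobj x'" "zobj x''" "zobj y" "zobj y'" "zobj y''"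
   using h unfolding SC_hom by blast
   show ?thesis using sten_comp[OF m Z] by (simp add: e SC_simps)
  qed
  show "associator SC x y z \<in> hom_set SC (tensor_obj SC (tensor_obj SC x y) z) (tensor_obj SC x (tensor_obj SC y z))" if "x \<in> Obj SC" "y \<in> Obj SC" "z \<in> Obj SC" for x y z
   using that sass(1)[of x y z] by (simp add: SC_obj SC_simps SC_homI)
  show "iso_arr SC (associator SC x y z)" if "x \<in> Obj SC" "y \<in> Obj SC" "z \<in> Obj SC" for x y z
  proof -
   have Z:"zobj x" "zobj y" "zobj z" using that by (simp_all add: SC_obj)
   show ?thesis unfolding SC_simps by (rule SC_iso[OF _ _ sass(1)[OF Z] sass'(1)[OF Z] sass_inverse[OF Z]]) (use Z in simp_all)
  qed
  show "Comp SC (associator SC x' y' z') (tensor_arr SC (tensor_arr SC f g) h)=Comp SC (tensor_arr SC f (tensor_arr SC g h)) (associator SC x y z)"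
   if fgh:"f \<in> hom_set SC x x'" "g \<in> hom_set SC y y'" "h \<in> hom_set SC z z'" for f g h x x' y y' z z'
  proof -
   obtain h1 h2 h3 where e:"f = (x, h1, x')" "g = (y, h2, y')" "h = (z, h3, z')" and m:"mor x x' h1" "mor y y' h2" "mor z z' h3"
   and Z:"zobj x" "zobj y" "zobj z" "zobj x'" "zobj y'" "zobj z'" using fgh unfolding SC_hom by blast
   show ?thesis using sass_natural[OF m Z] by (simp add: e SC_simps)
  qed
  show "left_unitor SC x \<in> hom_set SC (tensor_obj SC (unit_obj SC) x) x" if "x \<in> Obj SC" for x
   using that lunit(1)[of x] by (simp add: SC_obj SC_simps SC_unitors SC_homI)
  show "right_unitor SC x \<in> hom_set SC (tensor_obj SC x (unit_obj SC)) x" if "x \<in> Obj SC" for x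
   using that runit(1)[of x] by (simp add: SC_obj SC_simps SC_unitors SC_homI)
  show "iso_arr SC (left_unitor SC x)" if "x \<in> Obj SC" for x
  proof -
   have Z:"zobj x" using that by (simp add: SC_obj)
   note m = lunit[OF Z]
   show ?thesis unfolding SC_unitors[OF Z] by (rule SC_iso[OF _ Z m(1,3)]) (use Z inv_comp[OF m(2)] mor_typ[OF m(1)] in simp_all)
  qed
  show "iso_arr SC (right_unitor SC x)" if "x \<in> Obj SC" for x
  proof -
   have Z:"zobj x" using that by (simp add: SC_obj)
   note m = runit[OF Z]
   show ?thesis unfolding SC_unitors[OF Z] by (rule SC_iso[OF _ Z m(1,3)]) (use Z inv_comp[OF m(2)] mor_typ[OF m(1)] in simp_all)
  qed
  show "Comp SC (left_unitor SC y) (tensor_arr SC (Ident SC (unit_obj SC)) f)=Comp SC f (left_unitor SC x)" if f:"f \<in> hom_set SC x y" for f x y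
  proof -
   obtain f' where "f = (x, f', y)" "zobj x" "zobj y" "mor x y f'" using f unfolding SC_hom by blast
   then show ?thesis using lunit_natural[of x y f'] by (simp add: SC_simps SC_unitors)
  qed
  show "Comp SC (right_unitor SC y) (tensor_arr SC f (Ident SC (unit_obj SC)))=Comp SC f (right_unitor SC x)" if f:"f \<in> hom_set SC x y" for f x y
  proof -
   obtain f' where "f = (x, f', y)" "zobj x" "zobj y" "mor x y f'" using f unfolding SC_hom by blast
   then show ?thesis using runit_natural[of x y f'] by (simp add: SC_simps SC_unitors)
  qed
  show "Comp SC (tensor_arr SC (Ident SC w) (associator SC x y z)) (Comp SC (associator SC w (tensor_obj SC x y) z) (tensor_arr SC (associator SC w x y) (Ident SC z)))
   = Comp SC (associator SC w x (tensor_obj SC y z)) (associator SC (tensor_obj SC w x) y z)"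
   if "w \<in> Obj SC" "x \<in> Obj SC" "y \<in> Obj SC" "z \<in> Obj SC" for w x y z
   using that pentagon_centre[of w x y z] by (simp add: SC_obj SC_simps)
  show "Comp SC (tensor_arr SC (Ident SC x) (left_unitor SC y)) (associator SC x (unit_obj SC) y)=tensor_arr SC (right_unitor SC x) (Ident SC y)"
   if "x \<in> Obj SC" "y \<in> Obj SC" for x y using that triangle_centre[of x y] by (simp add: SC_obj SC_simps SC_unitors)
  show "symmetry SC x y \<in> hom_set SC (tensor_obj SC x y) (tensor_obj SC y x)" if "x \<in> Obj SC" "y \<in> Obj SC" for x y
   using that ssym(1)[of x y] by (simp add: SC_obj SC_simps SC_homI)
  show "Comp SC (symmetry SC x' y') (tensor_arr SC f g)=Comp SC (tensor_arr SC g f) (symmetry SC x y)"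
   if fg:"f \<in> hom_set SC x x'" "g \<in> hom_set SC y y'" for f g x x' y y'
  proof -
   obtain f' g' where e:"f = (x, f', x')" "g = (y, g', y')" and m:"mor x x' f'" "mor y y' g'" and Z:"zobj x" "zobj y" "zobj x'" "zobj y'" using fg unfolding SC_hom by blast
   show ?thesis using ssym_natural[OF m Z] by (simp add: e SC_simps)
  qed
  show "Comp SC (symmetry SC y x) (symmetry SC x y)=Ident SC (tensor_obj SC x y)" if "x \<in> Obj SC" "y \<in> Obj SC" for x y
   using that ssym_involutive[of x y] by (simp add: SC_obj SC_simps)
  show "Comp SC (associator SC y z x) (Comp SC (symmetry SC x (tensor_obj SC y z)) (associator SC x y z))
   = Comp SC (tensor_arr SC (Ident SC y) (symmetry SC x z)) (Comp SC (associator SC y x z) (tensor_arr SC (symmetry SC x y) (Ident SC z)))"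
   if "x \<in> Obj SC" "y \<in> Obj SC" "z \<in> Obj SC" for x y z using that hexagon_centre[of x y z] by (simp add: SC_obj SC_simps)
 qed
qed

end

context symmetric_ribbon_fusion_category
begin

text \<open>By choice among the simple objects of each isomorphism class.\<close>
lemma representatives_exist:"\<exists>R. simple_representatives A R"
proof -
 define c where "c x = (SOME y. simple y \<and> isomorphic A x y)" for x
 have refl:"isomorphic A x x" if "simple x" for x using isomorphicI[of "\<i> x" x x] that by (simp add: hom_iff)
 have c:"simple (c x)" "isomorphic A x (c x)" if "simple x" for x
  using someI[of "%y. simple y \<and> isomorphic A x y" x] that refl[OF that] unfolding c_def by blast+
 have same:"c x=c y" if "isomorphic A x y" for x y
 proof -
  have "isomorphic A x=isomorphic A y" using isomorphic_trans isomorphic_sym that by blast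
  then show ?thesis by (simp add: c_def)
 qed
 have "simple_representatives A (c ` {x. simple x})" unfolding simple_representatives_def
 proof (intro conjI ballI allI impI)
  show "simple i" if "i \<in> c ` {x. simple x}" for i using that c by blast
  fix x assume x:"simple x"
  show "\<exists>!i. i \<in> c ` {x. simple x} \<and> isomorphic A x i"
  proof (rule ex1I[of _ "c x"])
   show "c x \<in> c ` {x. simple x} \<and> isomorphic A x (c x)" using x c by blast
   fix i assume i:"i \<in> c ` {x. simple x} \<and> isomorphic A x i"
   then obtain y where y:"simple y" "i=c y" by blast
   have "isomorphic A x y" using isomorphic_trans[OF _ isomorphic_sym[OF c(2)[OF y(1)]], of x] i unfolding y(2) by blast
   then show "i=c x" using same[of x y] y(2) by simp
  qed
 qed
 then show ?thesis by blast
qed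

lemma direct_sum_exists:
 assumes "finite K" "!!k. k : K ==> Y k : Obj A"
 shows "\<exists>S u v. direct_sum A K Y S u v" using assms
proof (induction K rule: finite_induct)
 case empty
 obtain z where z:"zero_object A z" using zero_object_exists by blast
 have zo:"obj z" using z by (simp add: zero_object_def)
 have "\<i> z=\<z> z z" by (rule zero_object_arrow[OF z ident_in[OF zo]])
 then have "direct_sum A {} Y z (%k. undefined) (%k. undefined)" unfolding direct_sum_def using zo by simp
 then show ?case by blast
next
 case (insert k K)
 obtain S u v where IH:"direct_sum A K Y S u v" using insert by blast
 have S:"obj S" and uv:"!!j. j : K ==> u j : Hom (Y j) S" "!!j. j : K ==> v j : Hom S (Y j)"
  and vu:"!!j l. j : K ==> l : K ==> v j o u l = (if j = l then \<i> (Y j) else \<z> (Y l) (Y j))"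
  and sum:"hsum S S K (%j. u j o v j) = \<i> S" using IH unfolding direct_sum_def by blast+
 have yk:"Y k : Obj A" and yj:"!!j. j : K ==> Y j : Obj A" using insert by simp_all
 obtain P u' v' where B:"direct_sum A UNIV (%b::bool. if b then Y k else S) P u' v'" using binary_direct_sum_exists[OF yk S] by blast
 have P:"obj P" using B unfolding direct_sum_def by blast
 have "\<forall>b. u' b : Hom (if b then Y k else S) P \<and> v' b : Hom P (if b then Y k else S)" using B unfolding direct_sum_def by blast
 then have t:"u' True : Hom (Y k) P" "v' True : Hom P (Y k)" "u' False : Hom S P" "v' False : Hom P S"
  by (metis (full_types))+
 have "\<forall>b l. v' b o u' l=(if b=l then \<i> (if b then Y k else S) else \<z> (if l then Y k else S) (if b then Y k else S))"
  using B unfolding direct_sum_def by blast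
 then have o:"v' True o u' True=\<i> (Y k)" "v' False o u' False=\<i> S" "v' True o u' False=\<z> S (Y k)" "v' False o u' True=\<z> (Y k) S"
  by (metis (full_types))+
 have bs:"hsum P P UNIV (%b. u' b o v' b)=\<i> P" using B unfolding direct_sum_def by blast
 have t':"u' True ::: Y k ~> P" "v' True ::: P ~> Y k"
  "u' False ::: S ~> P" "v' False ::: P ~> S"
  using t by (simp_all add: hom_iff)
 have uvt:"u j ::: Y j ~> S" "v j ::: S ~> Y j" if "j : K" for j
  using uv[OF that] by (simp_all add: hom_iff)
 define p where "p b = u' b o v' b" for b
 have pt:"p b ::: P ~> P" for b using t' by (cases b; simp add: p_def)+
 have bs2:"p True +. p False=\<i> P"
 proof -
  have "hsum P P (insert True {False}) p=p True +. hsum P P {False} p" using P pt by (intro hsum_insert) (simp_all add: hom_iff)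
  moreover have "hsum P P {False} p=p False" using hsum_insert[of P P "{}" False p] P pt by (simp add: hom_iff)
  moreover have "p=(%b. u' b o v' b)" by (simp add: p_def fun_eq_iff)
  then have "hsum P P (insert True {False}) p=\<i> P" using bs by (simp add: UNIV_bool insert_commute)
  ultimately show ?thesis by simp
 qed
 define U where "U j = (if j = k then u' True else u' False o u j)" for j
 define V where "V j = (if j = k then v' True else v j o v' False)" for j
 have nk:"j \<noteq> k" if "j : K" for j using insert(2) that by blast
 have Uk:"U k=u' True" "V k=v' True" and Uj:"!!j. j : K ==> U j=u' False o u j" "!!j. j : K ==> V j=v j o v' False"
  using nk by (auto simp: U_def V_def)
 have UVin:"U j : Hom (Y j) P" "V j : Hom P (Y j)" if "j \<in> insert k K" for j
 proof -
  have "U j : Hom (Y j) P \<and> V j : Hom P (Y j)"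
  proof (cases "j = k")
   case True
   then show ?thesis using t Uk by simp
  next
   case False
   then have j:"j : K" using that by simp
   show ?thesis unfolding Uj[OF j] using comp_in[OF uv(1)[OF j] t(3)] comp_in[OF t(4) uv(2)[OF j]] by blast
  qed
  then show "U j : Hom (Y j) P" "V j : Hom P (Y j)" by blast+
 qed
 have VU:"V j o U l=(if j=l then \<i> (Y j) else \<z> (Y l) (Y j))" if j:"j \<in> insert k K" and l:"l \<in> insert k K" for j l
 proof -
  consider "j = k" "l = k" | "j = k" "l : K" | "j : K" "l = k" | "j : K" "l : K" using j l by blast
  then show ?thesis
  proof cases
   case 1
   then show ?thesis using Uk o by simp
  next
   case 2
   then show ?thesis using Uk Uj(1)[OF 2(2)] t' uvt[OF 2(2)] o(3)[THEN tail, of "u l"] nk[OF 2(2)] yk by simp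
  next
   case 3
   then show ?thesis using Uk Uj(2)[OF 3(1)] t' uvt[OF 3(1)] o(4) nk[OF 3(1)] yk by simp
  next
   case 4
   have "V j o U l=v j o (v' False o u' False) o u l" unfolding Uj(1)[OF 4(2)] Uj(2)[OF 4(1)] using t' uvt[OF 4(1)] uvt[OF 4(2)] by simp
   also have "...=v j o u l" unfolding o using uvt[OF 4(1)] uvt[OF 4(2)] S by simp
   finally show ?thesis using vu[OF 4] by simp
  qed
 qed
 have uvin:"u j o v j : Hom S S" if "j : K" for j by (rule comp_in[OF uv(2)[OF that] uv(1)[OF that]])
 have UV1:"U j o V j : Hom P P" if "j \<in> insert k K" for j by (rule comp_in[OF UVin(2)[OF that] UVin(1)[OF that]])
 have rest:"hsum P P K (%j. U j o V j)=p False"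
 proof -
  have "hsum P P K (%j. U j o V j)=hsum P P K (%j. u' False o (u j o v j) o v' False)"
  proof (rule hsum_cong[OF P P])
   fix j assume j:"j : K"
   show e:"U j o V j=u' False o (u j o v j) o v' False" unfolding Uj(1)[OF j] Uj(2)[OF j] using t' uvt[OF j] by simp
   show "u' False o (u j o v j) o v' False : Hom P P" unfolding e[symmetric] using UV1 j by simp
  qed
  also have "...=u' False o hsum S S K (%j. u j o v j) o v' False"
  proof (rule additive_hsum[symmetric, where F = "%f. u' False o f o v' False", OF S S P P insert(1) uvin])
   show "u' False o g o v' False : Hom P P" if "g : Hom S S" for g using that t' by (simp add: hom_iff)
   show "u' False o (g +. h) o v' False=u' False o g o v' False +. u' False o h o v' False" if "g : Hom S S" "h : Hom S S" for g h
   using that t' by (simp add: hom_iff add_comp comp_add)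
  qed
  finally show ?thesis unfolding sum p_def using t' S by simp
 qed
 have "hsum P P (insert k K) (%j. U j o V j)=U k o V k +. hsum P P K (%j. U j o V j)" by (rule hsum_insert[OF P P insert(1,2) UV1])
 also have "...=\<i> P" unfolding rest Uk using bs2 by (simp add: p_def)
 finally have "direct_sum A (insert k K) Y P U V"
  unfolding direct_sum_def hom_space_simps using insert(1) P UVin VU insert.prems by (intro conjI ballI) simp_all
 then show ?case by blast
qed

text \<open>The splitting is the kernel of \<open>1 - q\<close>.\<close>
lemma idempotent_splits:
 assumes h:"hb c B" and q:"hbm c B c B q" and idem:"q o q = q"
 shows "\<exists>e p \<iota>. split_idem c B e p \<iota> \<and> \<iota> o p = q"
proof -
 note c = hb_obj[OF h] and t = hbm_typ[OF q]
 define f where "f = \<i> c +. (-1)*.q"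
 have f:"arr f" "Dom A f=c" "Cod A f=c" using t c by (simp_all add: f_def)
 obtain k where k:"is_kernel A k f" using kernel_exists[OF f(1)] by blast
 define e where "e = Dom A k"
 have kin:"k : Hom e c" and fk:"f o k=\<z> e c"
  and uni:"!!x g. x : Obj A ==> g : Hom x c ==> f o g = \<z> x c ==> \<exists>!h. h : Hom x e \<and> k o h = g"
  using k f unfolding is_kernel_def e_def by simp_all
 have e:"obj e" and kt:"arr k" "Dom A k=e" "Cod A k=c" using kin hom_obj[OF kin] by (simp_all add: hom_iff)
 have fg:"f o g=g +. (-1)*.(q o g)" if "arr g" "Cod A g=c" for g unfolding f_def using that t c by (simp add: add_comp)
 have qk:"q o k=k" by (rule minus_zero_eq[symmetric]) (use fk fg[OF kt(1,3)] kt t in simp_all)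
 have self:"q +. (-1)*.q=\<z> c c" using scale_add_left[of q 1 "-1"] t by simp
 have "f o q=\<z> c c" using fg[OF t(1,3)] self by (simp add: idem)
 then obtain p where p:"p : Hom c e" "k o p=q" using uni[OF c homI[OF t]] by blast
 have pt:"p ::: c ~> e" using p(1) by (simp_all add: hom_iff)
 have "k o (p o k)=q o k" unfolding p(2)[symmetric] using pt kt by simp
 then have "k o (p o k)=k o \<i> e" using qk kt by simp
 moreover have "p o k : Hom e e" "\<i> e : Hom e e" using pt kt e by (simp_all add: hom_iff)
 moreover have "\<exists>!h. h : Hom e e \<and> k o h=k" by (rule uni[OF e kin fk])
 ultimately have "p o k=\<i> e" using kt by (metis comp_ident_right)
 then have "split_idem c B e p k" unfolding split_idem_def using h e p kin q by simp
 then show ?thesis using p(2) by blast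
qed

end

context fusion_representatives
begin

lemma Pi_image_exists:
 assumes Z:"zobj z" "zobj z'"
 shows "\<exists>e \<iota> p. (e, \<iota>, centre_tensor A z z') \<in> Arr (drinfeld_centre A) \<and> (centre_tensor A z z', p, e) \<in> Arr (drinfeld_centre A) \<and>
   p o \<iota> = \<i> (fst e) \<and> \<iota> o p = Pi_idem A R z z'"
proof -
 define a H a' H' where "a = fst z" and "H = snd z" and "a' = fst z'" and "H' = snd z'"
 have a:"hb a H" "hb a' H'" "obj a" "obj a'" using Z by (simp_all add: a_def H_def a'_def H'_def)
 have zz:"z=(a, H)" "z'=(a', H')" by (simp_all add: a_def H_def a'_def H'_def)
 define c where "c = a$a'"
 define B1 B2 B where "B1 = ctb a H a' (trs a')" and "B2 = ctb a (trs a) a' H'" and "B = ctb a H a' H'"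
 have H:"hb c B1" "hb c B2" "hb c B" and c:"obj c" using a by (simp_all add: c_def B1_def B2_def B_def)
 have cm:"commuting c B1 B2" unfolding c_def B1_def B2_def by (rule commuting_ctb[OF a(1,2)])
 define q where "q = haar c B1 B2"
 have qt:"arr q" "Dom A q=c" "Cod A q=c" using H by (simp_all add: q_def)
 note eq = haar_equalizes[OF H(1,2) cm, folded q_def]
 have q:"hbm c B c B q"
 proof (rule hbmI[OF qt H(3,3)])
  fix b w assume o:"obj b" "obj w"
  have dec:"br B c b w=br B2 c b w o rb (trs c) c b w o br B1 c b w"
   unfolding c_def B1_def B2_def B_def using a o by (simp add: br_ctb sw_tensor_left)
  note n1 = hbm_br(1)[OF eq(4) H(1,1) o] and n2 = hbm_br(1)[OF eq(5) H(2,2) o]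
   and n3 = hbm_br(2)[OF hbm_trs[OF qt] hb_trs[OF c] hb_trs[OF c] o]
  have tr:"rb (trs c) c b w ::: c$b$w ~> b$c$w"
   using br_typ[OF hb_trs[OF c] o] by simp_all
  have "br B c b w o b|>q<|w=br B2 c b w o rb (trs c) c b w o (br B1 c b w o b|>q<|w)" unfolding dec using tr qt H o by (simp del: br_trs)
  also have "...=br B2 c b w o (rb (trs c) c b w o q<|(b$w)) o br B1 c b w" unfolding n1 using tr qt H o by (simp del: br_trs)
  also have "...=(br B2 c b w o b|>q<|w) o rb (trs c) c b w o br B1 c b w" unfolding n3 using tr qt H o by (simp del: br_trs)
  also have "...=q<|(b$w) o br B c b w" unfolding n2 dec using tr qt H o by (simp del: br_trs)
  finally show "br B c b w o b|>q<|w=q<|(b$w) o br B c b w" .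
 qed
 obtain e p \<iota> where s:"split_idem c B e p \<iota>" "\<iota> o p = q" using idempotent_splits[OF H(3) q eq(3)] by blast
 note im = img_half_braiding[OF s(1)]
 have ct:"centre_tensor A z z'=(c, B)" unfolding zz centre_tensor_ctb c_def B_def ..
 have "Pi_idem A R z z'=q" unfolding zz Pi_idem_haar[OF a(1,2)] q_def c_def B1_def B2_def ..
 moreover have "((e, img B p \<iota>), \<iota>, centre_tensor A z z') \<in> Arr (drinfeld_centre A)" "(centre_tensor A z z', p, (e, img B p \<iota>)) \<in> Arr (drinfeld_centre A)"
  unfolding centre_arr_iff ct zobj_def mor_def fst_conv snd_conv using im H(3) by blast+
 moreover have "p o \<iota>=\<i> (fst (e, img B p \<iota>))" using s(1) by (simp add: split_idem_def)
 ultimately show ?thesis using s(2) by blast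
qed

end

lemma (in symmetric_ribbon_fusion_category) valid_choice_exists:"\<exists>T. valid_choice A T"
proof -
 obtain R where R:"simple_representatives A R" using representatives_exist by blast
 interpret fusion_representatives A R by unfold_locales (rule R)
 obtain S u v where S:"direct_sum A R (%i. i$i^*) S u v" using direct_sum_exists[of R "%i. i$i^*"] by auto
 have "\<forall>z z'. \<exists>e \<iota> p. zobj z \<longrightarrow> zobj z' \<longrightarrow> (e, \<iota>, centre_tensor A z z') \<in> Arr (drinfeld_centre A) \<and> (centre_tensor A z z', p, e) \<in> Arr (drinfeld_centre A) \<and>
   p o \<iota> = \<i> (fst e) \<and> \<iota> o p = Pi_idem A R z z'" using Pi_image_exists by blast
 then obtain E I P where im:"!!z z'. zobj z ==> zobj z' ==> (E z z', I z z', centre_tensor A z z') \<in> Arr (drinfeld_centre A) \<and>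
   (centre_tensor A z z', P z z', E z z') \<in> Arr (drinfeld_centre A) \<and> P z z' o I z z' = \<i> (fst (E z z')) \<and> I z z' o P z z' = Pi_idem A R z z'"
  by metis
 define Bs where "Bs b i j = (SOME B. hom_basis A (b$i) j B)" for b i j
 have Bs:"hom_basis A (b$i) j (Bs b i j)" if "obj b" "i : R" "j : R" for b i j
  unfolding Bs_def by (rule someI_ex, rule hom_finite_dim) (use that in simp_all)
 have "valid_choice A \<lparr>simples=R, basis=Bs, sum_obj=S, sum_inj=u, sum_prj=v, Pi_image=E, Pi_incl=I, Pi_proj=P\<rparr>"
  unfolding valid_choice_def Ball_def centre_obj_iff using R Bs S im by simp
 then show ?thesis by blast
qed

theorem theorem1:
 fixes A :: "('o, 'm) ribbon_fusion_data"
 assumes "symmetric_ribbon_fusion_category A"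
 shows "(\<exists>T. valid_choice A T) \<and>
   (\<forall>T. valid_choice A T \<longrightarrow> symmetric_monoidal_category (symmetric_centre A T))"
proof (intro conjI allI impI)
 interpret symmetric_ribbon_fusion_category A by fact
 show "\<exists>T. valid_choice A T" by (rule valid_choice_exists)
 fix T assume "valid_choice A T"
 then interpret centre_data A T by unfold_locales
 show "symmetric_monoidal_category (symmetric_centre A T)" by (rule symmetric_centre_symmetric_monoidal)
qed

end
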